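(* Suppose the real input sequence $\{x_i\}_{i\ge 0}$ satisfies (A1), (A2) or (A3). Let $T_n=((x_{|i-j|}))_{1\le i,j\le n}$ (symmetric Toeplitz) and $SC_n=((x_{L(i,j)}))_{1\le i,j\le n}$ with $L(i,j)=\frac n2-\left|\frac n2-|i-j|\right|$ (Symmetric Circulant), and let $\widehat{T}_n=M_n\odot T_n$ and $\widehat{SC}_n=M_n\odot SC_n$. Then the LSDs of $n^{-1/2}\widehat{T}_n$ and of $n^{-1/2}\widehat{SC}_n$ exist and are universal (each is the same for every input sequence satisfying (A1), (A2) or (A3)). Moreover, the LSD of $n^{-1/2}\widehat{T}_n$ is different from the LSD of $n^{-1/2}T_n$, and the LSD of $n^{-1/2}\widehat{SC}_n$ is different from the LSD of $n^{-1/2}SC_n$.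
   Context: Assumptions on the real input random variables: (A1) they are independent and uniformly bounded with mean $0$ and variance $1$; (A2) they are i.i.d. with mean $0$ and variance $1$; (A3) they are independent with mean $0$ and variance $1$, and with uniformly bounded moments of all orders. $M_n=((m_{ij}))_{1\le i,j\le n}$ is the symmetric matrix with $m_{ij}=1$ if $i+j<n+1$, $m_{ij}=0$ if $i+j=n+1$, and $m_{ij}=-1$ if $i+j>n+1$. The symbol $\odot$ denotes the entrywise (Schur–Hadamard) product. For a real symmetric $n\times n$ matrix $A$ with eigenvalues $\lambda_1,\dots,\lambda_n$, the empirical spectral distribution is $F^A(x)=\frac1n\#\{j:\lambda_j\le x\}$. A non-random distribution function $F$ is the limiting spectral distribution (LSD) of a sequence $A_n$ if, outside a null set, $F^{A_n}(x)\to F(x)$ as $n\to\infty$ at all continuity points $x$ of $F$. It is known that under any of (A1), (A2), (A3) the LSDs of $n^{-1/2}T_n$ and $n^{-1/2}SC_n$ exist and do not depend on the distribution of the input sequence; the latter is the standard Gaussian distribution $\mathcal{N}(0,1)$. *)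

theory Defs
  imports "HOL-Probability.Probability" "Jordan_Normal_Form.Char_Poly"
begin

section \<open>Input sequences\<close>

context prob_space
begin

text \<open>The integral of a non-integrable function is 0 by convention, so integrability is required
  explicitly. Measurability of the \<^term>\<open>x i\<close> is part of \<^term>\<open>indep_vars\<close>.\<close>

definition standardized :: "(nat \<Rightarrow> 'a \<Rightarrow> real) \<Rightarrow> bool" where
  "standardized x \<longleftrightarrow>
     (\<forall>i. integrable M (x i) \<and> integrable M (\<lambda>\<omega>. (x i \<omega>)\<^sup>2) \<and>
          expectation (x i) = 0 \<and> variance (x i) = 1)"

definition input_A1 :: "(nat \<Rightarrow> 'a \<Rightarrow> real) \<Rightarrow> bool" where
  "input_A1 x \<longleftrightarrow>
     indep_vars (\<lambda>_. borel) x UNIV \<and> standardized x \<and>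
     (\<exists>C. \<forall>i. AE \<omega> in M. \<bar>x i \<omega>\<bar> \<le> C)"

definition input_A2 :: "(nat \<Rightarrow> 'a \<Rightarrow> real) \<Rightarrow> bool" where
  "input_A2 x \<longleftrightarrow>
     indep_vars (\<lambda>_. borel) x UNIV \<and> standardized x \<and>
     (\<forall>i j. distr M borel (x i) = distr M borel (x j))"

definition input_A3 :: "(nat \<Rightarrow> 'a \<Rightarrow> real) \<Rightarrow> bool" where
  "input_A3 x \<longleftrightarrow>
     indep_vars (\<lambda>_. borel) x UNIV \<and> standardized x \<and>
     (\<forall>k. \<exists>C. \<forall>i. integrable M (\<lambda>\<omega>. \<bar>x i \<omega>\<bar> ^ k) \<and>
                    expectation (\<lambda>\<omega>. \<bar>x i \<omega>\<bar> ^ k) \<le> C)"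

definition admissible_input :: "(nat \<Rightarrow> 'a \<Rightarrow> real) \<Rightarrow> bool" where
  "admissible_input x \<longleftrightarrow> input_A1 x \<or> input_A2 x \<or> input_A3 x"

end

section \<open>The matrices\<close>

text \<open>Entries are described with row and column indices running from 1 to \<^term>\<open>n\<close>, whereas
  the matrix type counts from 0.\<close>

definition matrix1 :: "nat \<Rightarrow> (nat \<Rightarrow> nat \<Rightarrow> real) \<Rightarrow> real mat" where
  "matrix1 n a = Matrix.mat n n (\<lambda>(i, j). a (i + 1) (j + 1))"

definition M_matrix :: "nat \<Rightarrow> real mat" where
  "M_matrix n = matrix1 n
     (\<lambda>i j. if i + j < n + 1 then 1 else if i + j = n + 1 then 0 else - 1)"

definition toeplitz :: "nat \<Rightarrow> (nat \<Rightarrow> real) \<Rightarrow> real mat" where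
  "toeplitz n x = matrix1 n (\<lambda>i j. x (nat \<bar>int i - int j\<bar>))"

text \<open>For indices between 1 and \<^term>\<open>n\<close> the real number inside the floor is a natural number.\<close>

definition sc_link :: "nat \<Rightarrow> nat \<Rightarrow> nat \<Rightarrow> nat" where
  "sc_link n i j = nat \<lfloor>real n / 2 - \<bar>real n / 2 - \<bar>real i - real j\<bar>\<bar>\<rfloor>"

definition symmetric_circulant :: "nat \<Rightarrow> (nat \<Rightarrow> real) \<Rightarrow> real mat" where
  "symmetric_circulant n x = matrix1 n (\<lambda>i j. x (sc_link n i j))"

definition hadamard :: "real mat \<Rightarrow> real mat \<Rightarrow> real mat" (infixl "\<odot>" 70) where
  "A \<odot> B = Matrix.mat (dim_row A) (dim_col A) (\<lambda>(i, j). A $$ (i, j) * B $$ (i, j))"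

definition toeplitz_hat :: "nat \<Rightarrow> (nat \<Rightarrow> real) \<Rightarrow> real mat" where
  "toeplitz_hat n x = M_matrix n \<odot> toeplitz n x"

definition symmetric_circulant_hat :: "nat \<Rightarrow> (nat \<Rightarrow> real) \<Rightarrow> real mat" where
  "symmetric_circulant_hat n x = M_matrix n \<odot> symmetric_circulant n x"

section \<open>Spectral distributions\<close>

text \<open>Eigenvalues are counted with multiplicity. For a real symmetric \<^term>\<open>A\<close> the multiset of
  real roots of the characteristic polynomial has exactly \<^term>\<open>dim_row A\<close> elements.\<close>

definition esd :: "real mat \<Rightarrow> real \<Rightarrow> real" where
  "esd A t = real (size {#l \<in># proots (char_poly A). l \<le> t#}) / real (dim_row A)"

definition distribution_function :: "(real \<Rightarrow> real) \<Rightarrow> bool" where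
  "distribution_function F \<longleftrightarrow> (\<exists>\<mu>. real_distribution \<mu> \<and> F = cdf \<mu>)"

definition is_lsd :: "'a measure \<Rightarrow> (nat \<Rightarrow> 'a \<Rightarrow> real mat) \<Rightarrow> (real \<Rightarrow> real) \<Rightarrow> bool" where
  "is_lsd M A F \<longleftrightarrow>
     distribution_function F \<and> (AE \<omega> in M. weak_conv (\<lambda>n. esd (A n \<omega>)) F)"

text \<open>\<^term>\<open>F\<close> is the LSD of \<open>n\<^sup>-\<^sup>1\<^sup>/\<^sup>2 A\<^sub>n\<close> for every admissible input sequence, on every
  probability space with sample points of type \<^typ>\<open>'a\<close>. The matrix \<open>A n x\<close> is a function of
  the realization of the input. Since the logic does not quantify over types, the same \<^term>\<open>F\<close> for
  two arbitrary types of sample points expresses that \<^term>\<open>F\<close> does not depend on the type either.\<close>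

definition universal_lsd ::
    "'a itself \<Rightarrow> (nat \<Rightarrow> (nat \<Rightarrow> real) \<Rightarrow> real mat) \<Rightarrow> (real \<Rightarrow> real) \<Rightarrow> bool" where
  "universal_lsd (_ :: 'a itself) A F \<longleftrightarrow>
     (\<forall>(M :: 'a measure) x. prob_space M \<longrightarrow> prob_space.admissible_input M x \<longrightarrow>
        is_lsd M (\<lambda>n \<omega>. (real n powr (- 1 / 2)) \<cdot>\<^sub>m A n (\<lambda>i. x i \<omega>)) F)"

end

(* The index difference enters T_n and SC_n only through its distance from 0 in the cyclic group of
   order 2n and n respectively. Eigenbases u and v of two n x n matrices give the doubly stochastic
   weights w_ij = <u_i, v_j>^2, in terms of which differences of spectral averages are compared with
   the Frobenius distance of the matrices: the empirical characteristic function is Lipschitz in the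
   input and, for bounded inputs, changes by O(1/n) with one input variable. Efron-Stein, used twice,
   gives a fourth central moment of order n^-2, hence almost sure concentration.
   The expected moments are sums over closed walks on the cyclic group. Only the walks whose steps are
   matched in pairs of opposite steps survive; choosing the start and the steps by independent uniform
   variables on [0,1), dominated convergence gives the limits, which are bounded by r^m (2m)!/(2^m m!),
   so that the limiting characteristic function is an everywhere convergent power series in t^2 and
   Levy's theorem applies. Truncation reduces (A2) and (A3) to bounded inputs, with the error
   controlled by averages over dyadic blocks. Since the mask has values in [-1,1] it can only decrease
   even limit moments, and it strictly decreases the fourth: the crossing matching has sign -1 on a
   set of walks of positive proportion. *)

theory Submission
  imports Defs "Jordan_Normal_Form.Schur_Decomposition"
begin

section \<open>Spectral decomposition of real symmetric matrices\<close>

text \<open>Characteristic functions rather than moments carry the convergence, since under (A2) an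
  input may lack all moments beyond the second; \<open>ecf\<close> is bounded by 1 and stable under
  small mean-square changes of the input, so truncation passes through it. The obstacle is
  concentration: the Lipschitz bound alone lets one input move \<open>ecf\<close> by order n^(-1/2),
  and the squares of these changes add up to order 1 over the n + 1 inputs. A first-order expansion
  repairs this. The effect of input v is governed by the part of the gradient f'(A) that sits on the
  entries carrying \<open>x v\<close>, and these parts together have squared norm of order n only.
  Even then variances of order 1/n are not summable, whence the fourth moment. The limit function
  arises merely as a power series; that it belongs to a probability law is read off from one
  realization of fair coins, along which the spectral laws are tight. Masked and unmasked matrices
  are treated together, with a flag \<open>hat\<close>, because telling the limits apart requires
  both of them as moment series.\<close>

lemma nonreal_trace_eigenvalue:
  fixes C :: "complex mat"
  assumes C: "C \<in> carrier_mat n n" and tr: "(\<Sum>i<n. C $$ (i,i)) \<noteq> of_nat n * K"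
  shows "\<exists>e w. e \<noteq> K \<and> eigenvector C w e"
proof -
  obtain es where es: "char_poly C = (\<Prod>e\<leftarrow>es. [:- e, 1:])" and len: "length es = n"
    using char_poly_factorized[OF C] by auto
  obtain T P Q where sd: "schur_decomposition C es = (T, P, Q)" by (metis prod_cases3)
  from schur_decomposition[OF C es sd] have sim: "similar_mat_wit C T P Q"
    and dg: "diag_mat T = es" by auto
  from similar_mat_witD2[OF C sim] have T: "T \<in> carrier_mat n n" and P: "P \<in> carrier_mat n n"
    and Q: "Q \<in> carrier_mat n n" and PQ: "P * Q = 1\<^sub>m n" "Q * P = 1\<^sub>m n" and CT: "C = P * T * Q" by auto
  have trc: "(\<Sum>i<n. (X * Y) $$ (i,i)) = (\<Sum>i<n. (Y * X) $$ (i,i))"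
    if "X \<in> carrier_mat n n" "Y \<in> carrier_mat n n" for X Y :: "complex mat"
  proof -
    have "(\<Sum>i<n. (X * Y) $$ (i,i)) = (\<Sum>i<n. \<Sum>j<n. X $$ (i,j) * Y $$ (j,i))"
      using that by (intro sum.cong) (auto simp: scalar_prod_def atLeast0LessThan)
    also have "\<dots> = (\<Sum>j<n. \<Sum>i<n. X $$ (i,j) * Y $$ (j,i))" by (rule sum.swap)
    also have "\<dots> = (\<Sum>i<n. (Y * X) $$ (i,i))"
      using that by (intro sum.cong) (auto simp: scalar_prod_def atLeast0LessThan mult.commute)
    finally show ?thesis .
  qed
  \<comment> \<open>The trace is invariant under cyclic rotation of factors, so it equals the
    diagonal sum of the triangular factor, which lists the eigenvalues. Were all of them
    \<open>K\<close>, the trace would be \<open>n * K\<close>.\<close>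
  have "(\<Sum>i<n. C $$ (i,i)) = (\<Sum>i<n. (Q * (P * T)) $$ (i,i))"
    unfolding CT by (rule trc) (use P T Q in auto)
  also have "Q * (P * T) = T" using PQ P Q T by (simp flip: assoc_mult_mat[of Q n n P n T n])
  also have "(\<Sum>i<n. T $$ (i,i)) = sum_list es"
    unfolding dg[symmetric] diag_mat_def using T
    by (simp add: interv_sum_list_conv_sum_set_nat atLeast0LessThan)
  finally have s: "sum_list es \<noteq> of_nat n * K" using tr by simp
  have "\<exists>e\<in>set es. e \<noteq> K"
  proof (rule ccontr)
    assume "\<not> ?thesis"
    then have "es = replicate n K" using len by (metis replicate_eqI)
    with s show False by (simp add: sum_list_replicate)
  qed
  then obtain e where e: "e \<in> set es" "e \<noteq> K" by auto
  have "poly (char_poly C) e = 0" unfolding es using e(1)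
    by (simp add: poly_prod_list prod_list_zero_iff)
  then have "eigenvalue C e" using eigenvalue_root_char_poly[OF C] by simp
  with e(2) show ?thesis by (auto simp: eigenvalue_def)
qed

text \<open>The trace hypothesis yields a complex eigenvalue other than \<open>K\<close>. Symmetry
  makes the Hermitian form at its eigenvector real, hence the eigenvalue, and then the real or the
  imaginary part of the eigenvector serves. Avoiding a prescribed value is what the deflation in
  \<open>orthonormal_eigenvectors\<close> relies on.\<close>

lemma real_symmetric_eigenvector:
  fixes b :: "nat \<Rightarrow> nat \<Rightarrow> real"
  assumes sym: "\<And>i j. i < n \<Longrightarrow> j < n \<Longrightarrow> b i j = b j i"
    and tr: "(\<Sum>i<n. b i i) \<noteq> real n * K"
  shows "\<exists>\<mu> v. \<mu> \<noteq> K \<and> (\<exists>i<n. v i \<noteq> (0::real)) \<and> (\<forall>i<n. (\<Sum>j<n. b i j * v j) = \<mu> * v i)"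
proof -
  let ?C = "Matrix.mat n n (\<lambda>(i,j). complex_of_real (b i j))"
  have C: "?C \<in> carrier_mat n n" by simp
  have "(\<Sum>i<n. ?C $$ (i,i)) = complex_of_real (\<Sum>i<n. b i i)" by simp
  also have "\<dots> \<noteq> of_nat n * complex_of_real K"
    using tr by (metis of_real_mult of_real_of_nat_eq of_real_eq_iff)
  finally obtain e w where eK: "e \<noteq> complex_of_real K" and ev: "eigenvector ?C w e"
    using nonreal_trace_eigenvalue[OF C] by blast
  from ev have w: "w \<in> carrier_vec n" "w \<noteq> 0\<^sub>v n" and Cw: "?C *\<^sub>v w = e \<cdot>\<^sub>v w"
    by (auto simp: eigenvector_def)
  define z where "z i = vec_index w i" for i
  have eq: "(\<Sum>j<n. of_real (b i j) * z j) = e * z i" if "i < n" for i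
  proof -
    have "vec_index (?C *\<^sub>v w) i = (\<Sum>j<n. of_real (b i j) * z j)"
      using that w by (simp add: scalar_prod_def z_def atLeast0LessThan)
    then show ?thesis using that w by (simp add: Cw z_def)
  qed
  have nz: "\<exists>i<n. z i \<noteq> 0" using w by (auto simp: z_def vec_eq_iff)
  let ?S = "\<Sum>i<n. cnj (z i) * z i"
  have "(\<Sum>i<n. cnj (z i) * (\<Sum>j<n. of_real (b i j) * z j)) = e * ?S"
  proof -
    have "(\<Sum>i<n. cnj (z i) * (\<Sum>j<n. of_real (b i j) * z j)) = (\<Sum>i<n. e * (cnj (z i) * z i))"
      by (intro sum.cong refl, subst eq) auto
    then show ?thesis by (simp only: sum_distrib_left)
  qed
  moreover have "cnj (\<Sum>i<n. cnj (z i) * (\<Sum>j<n. of_real (b i j) * z j))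
     = (\<Sum>i<n. cnj (z i) * (\<Sum>j<n. of_real (b i j) * z j))"
  proof -
    have "cnj (\<Sum>i<n. cnj (z i) * (\<Sum>j<n. of_real (b i j) * z j))
       = (\<Sum>i<n. \<Sum>j<n. z i * of_real (b i j) * cnj (z j))"
      by (simp add: sum_distrib_left algebra_simps)
    also have "\<dots> = (\<Sum>j<n. \<Sum>i<n. z i * of_real (b i j) * cnj (z j))" by (rule sum.swap)
    also have "\<dots> = (\<Sum>i<n. cnj (z i) * (\<Sum>j<n. of_real (b i j) * z j))"
      using sym by (auto simp: sum_distrib_left algebra_simps intro!: sum.cong)
    finally show ?thesis .
  qed
  ultimately have "cnj (e * ?S) = e * ?S" by metis
  moreover have "cnj ?S = ?S" by (simp add: mult.commute)
  moreover have "?S \<noteq> 0"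
  proof -
    have "?S = of_real (\<Sum>i<n. (cmod (z i))\<^sup>2)"
      by (simp add: mult.commute complex_norm_square[symmetric] flip: of_real_power)
    moreover have "(\<Sum>i<n. (cmod (z i))\<^sup>2) \<noteq> 0"
      using nz by (subst sum_nonneg_eq_0_iff) auto
    ultimately show ?thesis by (metis of_real_eq_0_iff)
  qed
  ultimately have "cnj e = e" by simp
  then have e: "e = of_real (Re e)" by (metis Reals_cnj_iff of_real_Re)
  have R: "(\<Sum>j<n. b i j * Re (z j)) = Re e * Re (z i)" if "i < n" for i
  proof -
    have "Re (\<Sum>j<n. of_real (b i j) * z j) = Re (of_real (Re e) * z i)" using eq[OF that] e by metis
    then show ?thesis by simp
  qed
  have I: "(\<Sum>j<n. b i j * Im (z j)) = Re e * Im (z i)" if "i < n" for i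
  proof -
    have "Im (\<Sum>j<n. of_real (b i j) * z j) = Im (of_real (Re e) * z i)" using eq[OF that] e by metis
    then show ?thesis by simp
  qed
  have ne: "Re e \<noteq> K" using eK e by auto
  show ?thesis
  proof (cases "\<exists>i<n. Re (z i) \<noteq> 0")
    case True
    then show ?thesis using R ne by (intro exI[of _ "Re e"] exI[of _ "\<lambda>i. Re (z i)"]) auto
  next
    case False
    then have "\<exists>i<n. Im (z i) \<noteq> 0" using nz by (metis complex_eq_0 complex_eq_iff zero_complex.sel)
    then show ?thesis using I ne by (intro exI[of _ "Re e"] exI[of _ "\<lambda>i. Im (z i)"]) auto
  qed
qed
lemma orthonormal_rows_cols:
  fixes u :: "nat \<Rightarrow> nat \<Rightarrow> real"
  assumes "\<And>i j. i < n \<Longrightarrow> j < n \<Longrightarrow> (\<Sum>k<n. u i k * u j k) = (if i = j then 1 else 0)"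
    and "k < n" "m < n"
  shows "(\<Sum>i<n. u i k * u i m) = (if k = m then 1 else 0)"
proof -
  let ?U = "Matrix.mat n n (\<lambda>(i,j). u i j)" and ?V = "Matrix.mat n n (\<lambda>(i,j). u j i)"
  have "?U * ?V = 1\<^sub>m n"
    by (rule eq_matI) (auto simp: scalar_prod_def atLeast0LessThan assms(1))
  then have VU: "?V * ?U = 1\<^sub>m n" by (rule mat_mult_left_right_inverse[rotated 2]) auto
  have "(\<Sum>i<n. u i k * u i m) = (?V * ?U) $$ (k, m)"
    using assms(2,3) by (simp add: scalar_prod_def atLeast0LessThan)
  then show ?thesis using VU assms(2,3) by simp
qed

text \<open>Deflation replaces the restriction to an orthogonal complement: all eigenvalues found so
  far are moved to one common value \<open>K\<close>. An eigenvector of the modified matrix for a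
  value other than \<open>K\<close> is automatically orthogonal to the old vectors, and on such a
  vector the modification vanishes.\<close>

lemma orthonormal_eigenvectors:
  fixes a :: "nat \<Rightarrow> nat \<Rightarrow> real"
  assumes sym: "\<And>i j. i < n \<Longrightarrow> j < n \<Longrightarrow> a i j = a j i" and "m \<le> n"
  shows "\<exists>l u. (\<forall>i<m. \<forall>j<m. (\<Sum>k<n. u i k * u j k) = (if i = j then 1 else (0::real))) \<and>
    (\<forall>i<m. \<forall>k<n. (\<Sum>j<n. a k j * u i j) = l i * u i k)"
  using \<open>m \<le> n\<close>
proof (induction m)
  case 0
  then show ?case by auto
next
  case (Suc m)
  then have mn: "m \<le> n" by simp
  obtain l u where lu: "\<forall>i<m. \<forall>j<m. (\<Sum>k<n. u i k * u j k) = (if i = j then 1 else (0::real))"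
      "\<forall>i<m. \<forall>k<n. (\<Sum>j<n. a k j * u i j) = l i * u i k"
    using Suc.IH[OF mn] by (elim exE conjE) (rule that)
  have on: "\<And>i j. i < m \<Longrightarrow> j < m \<Longrightarrow> (\<Sum>k<n. u i k * u j k) = (if i = j then 1 else (0::real))"
    and ev: "\<And>i k. i < m \<Longrightarrow> k < n \<Longrightarrow> (\<Sum>j<n. a k j * u i j) = l i * u i k" using lu by simp_all
  \<comment> \<open>The trace of \<open>b\<close> is the trace of \<open>a\<close> minus the old
    eigenvalues plus \<open>m * K\<close>. It would equal \<open>n * K\<close> for exactly one
    \<open>K\<close>, namely the quotient without the summand 1; the 1 avoids that value.\<close>
  define K where "K = ((\<Sum>k<n. a k k) - (\<Sum>i<m. l i) + 1) / (real n - real m)"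
  define b where "b k j = a k j + (\<Sum>i<m. (K - l i) * u i k * u i j)" for k j
  have bs: "b i j = b j i" if "i < n" "j < n" for i j
    using sym that by (simp add: b_def mult_ac)
  have "(\<Sum>k<n. b k k) = (\<Sum>k<n. a k k) + (\<Sum>i<m. (K - l i) * (\<Sum>k<n. u i k * u i k))"
    unfolding b_def sum.distrib sum_distrib_left by (subst (2) sum.swap) (simp add: mult_ac)
  also have "\<dots> = (\<Sum>k<n. a k k) - (\<Sum>i<m. l i) + real m * K"
    using on by (simp add: sum_subtractf)
  also have "\<dots> \<noteq> real n * K"
    using \<open>Suc m \<le> n\<close> by (simp add: K_def field_simps)
  finally obtain \<mu> v where muK: "\<mu> \<noteq> K" and v0: "\<exists>i<n. v i \<noteq> (0::real)"
    and bv: "\<And>k. k < n \<Longrightarrow> (\<Sum>j<n. b k j * v j) = \<mu> * v k"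
    using real_symmetric_eigenvector[of n b, OF bs] by blast
  have orth: "(\<Sum>k<n. u i k * v k) = 0" if i: "i < m" for i
  proof -
    have bu: "(\<Sum>k<n. b j k * u i k) = K * u i j" if j: "j < n" for j
    proof -
      have "(\<Sum>k<n. b j k * u i k) = (\<Sum>k<n. a j k * u i k) + (\<Sum>h<m. (K - l h) * u h j * (\<Sum>k<n. u h k * u i k))"
        unfolding b_def sum.distrib distrib_right sum_distrib_left sum_distrib_right
        by (subst (2) sum.swap) (simp add: mult_ac)
      also have "\<dots> = l i * u i j + (K - l i) * u i j"
        using ev[OF i j] i by (simp add: on if_distrib sum.delta cong: if_cong)
      finally show ?thesis by (simp add: algebra_simps)
    qed
    have "\<mu> * (\<Sum>k<n. u i k * v k) = (\<Sum>k<n. u i k * (\<Sum>j<n. b k j * v j))"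
      unfolding sum_distrib_left[of \<mu>] by (intro sum.cong refl, subst bv) auto
    also have "\<dots> = (\<Sum>j<n. (\<Sum>k<n. b j k * u i k) * v j)"
      unfolding sum_distrib_left sum_distrib_right
      by (subst sum.swap) (auto intro!: sum.cong simp: bs mult_ac)
    also have "\<dots> = K * (\<Sum>k<n. u i k * v k)"
      by (simp add: bu sum_distrib_left mult_ac)
    finally show ?thesis using muK by simp
  qed
  have av: "(\<Sum>j<n. a k j * v j) = \<mu> * v k" if k: "k < n" for k
  proof -
    have "(\<Sum>j<n. b k j * v j) = (\<Sum>j<n. a k j * v j) + (\<Sum>h<m. (K - l h) * u h k * (\<Sum>j<n. u h j * v j))"
      unfolding b_def sum.distrib distrib_right sum_distrib_left sum_distrib_right
      by (subst (2) sum.swap) (simp add: mult_ac)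
    then show ?thesis using bv[OF k] orth by simp
  qed
  define s where "s = sqrt (\<Sum>k<n. (v k)\<^sup>2)"
  have s2: "s\<^sup>2 = (\<Sum>k<n. (v k)\<^sup>2)" unfolding s_def by (simp add: sum_nonneg)
  have "(\<Sum>k<n. (v k)\<^sup>2) \<noteq> 0" using v0 by (subst sum_nonneg_eq_0_iff) auto
  then have s0: "s \<noteq> 0" using s2 by auto
  let ?l = "l(m := \<mu>)" and ?u = "u(m := (\<lambda>k. v k / s))"
  have "(\<Sum>k<n. v k / s * (v k / s)) = (\<Sum>k<n. (v k)\<^sup>2) / s\<^sup>2"
    by (simp add: power2_eq_square sum_divide_distrib)
  then have "(\<Sum>k<n. v k / s * (v k / s)) = 1"
    using s0 by (simp flip: s2)
  moreover have "(\<Sum>k<n. u i k * (v k / s)) = 0" "(\<Sum>k<n. v k / s * u i k) = 0" if "i < m" for i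
    using orth[OF that] by (simp_all add: mult.commute flip: sum_divide_distrib)
  ultimately have "\<forall>i<Suc m. \<forall>j<Suc m. (\<Sum>k<n. ?u i k * ?u j k) = (if i = j then 1 else (0::real))"
    using on by (auto simp: less_Suc_eq)
  moreover have "\<forall>i<Suc m. \<forall>k<n. (\<Sum>j<n. a k j * ?u i j) = ?l i * ?u i k"
    using ev av by (auto simp: less_Suc_eq simp flip: sum_divide_distrib)
  ultimately show ?case by blast
qed

lemma proots_linear_factors:
  "proots (\<Prod>x\<leftarrow>xs. [:- x, 1:]) = mset (xs :: 'a::idom list)"
proof (induction xs)
  case (Cons x xs)
  have "(\<Prod>x\<leftarrow>xs. [:- x, 1:]) \<noteq> 0" by (auto simp: prod_list_zero_iff)
  then show ?case using Cons by (simp add: proots_mult del: mult_pCons_left)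
qed simp

text \<open>Orthonormality is recorded for rows and for columns because overlaps get summed over
  either index; the clause on \<open>proots\<close> carries the multiplicities that
  \<open>esd\<close> counts.\<close>

theorem spectral_decomposition:
  fixes a :: "nat \<Rightarrow> nat \<Rightarrow> real"
  assumes sym: "\<And>i j. i < n \<Longrightarrow> j < n \<Longrightarrow> a i j = a j i"
  obtains l u where
    "\<And>i j. i < n \<Longrightarrow> j < n \<Longrightarrow> (\<Sum>k<n. u i k * u j k) = (if i = j then 1 else (0::real))"
    "\<And>k m. k < n \<Longrightarrow> m < n \<Longrightarrow> (\<Sum>i<n. u i k * u i m) = (if k = m then 1 else (0::real))"
    "\<And>k m. k < n \<Longrightarrow> m < n \<Longrightarrow> a k m = (\<Sum>i<n. l i * u i k * u i m)"
    "proots (char_poly (Matrix.mat n n (\<lambda>(i,j). a i j))) = mset (map l [0..<n])"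
proof -
  have "\<exists>l u. (\<forall>i<n. \<forall>j<n. (\<Sum>k<n. u i k * u j k) = (if i = j then 1 else (0::real))) \<and>
    (\<forall>i<n. \<forall>k<n. (\<Sum>j<n. a k j * u i j) = l i * u i k)"
    by (rule orthonormal_eigenvectors[OF _ order_refl]) (rule sym)
  then obtain l u where lu: "\<forall>i<n. \<forall>j<n. (\<Sum>k<n. u i k * u j k) = (if i = j then 1 else (0::real))"
      "\<forall>i<n. \<forall>k<n. (\<Sum>j<n. a k j * u i j) = l i * u i k"
    by (elim exE conjE) (rule that)
  have on: "\<And>i j. i < n \<Longrightarrow> j < n \<Longrightarrow> (\<Sum>k<n. u i k * u j k) = (if i = j then 1 else (0::real))"
    and ev: "\<And>i k. i < n \<Longrightarrow> k < n \<Longrightarrow> (\<Sum>j<n. a k j * u i j) = l i * u i k" using lu by simp_all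
  have on': "(\<Sum>i<n. u i k * u i m) = (if k = m then 1 else (0::real))" if "k < n" "m < n" for k m
    using orthonormal_rows_cols[OF on that] .
  have dec: "a k m = (\<Sum>i<n. l i * u i k * u i m)" if k: "k < n" and m: "m < n" for k m
  proof -
    have "(\<Sum>i<n. l i * u i k * u i m) = (\<Sum>i<n. (\<Sum>j<n. a k j * u i j) * u i m)"
      using ev k by simp
    also have "\<dots> = (\<Sum>j<n. a k j * (\<Sum>i<n. u i j * u i m))"
      unfolding sum_distrib_left sum_distrib_right by (subst sum.swap) (simp add: mult_ac)
    also have "\<dots> = a k m" using m by (simp add: on' if_distrib cong: if_cong)
    finally show ?thesis ..
  qed
  let ?A = "Matrix.mat n n (\<lambda>(i,j). a i j)" and ?D = "Matrix.mat n n (\<lambda>(i,j). if i = j then l i else 0)"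
  let ?U = "Matrix.mat n n (\<lambda>(i,j). u i j)" and ?V = "Matrix.mat n n (\<lambda>(i,j). u j i)"
  have UV: "?U * ?V = 1\<^sub>m n"
    by (rule eq_matI) (auto simp: scalar_prod_def atLeast0LessThan on)
  have VU: "?V * ?U = 1\<^sub>m n"
    by (rule eq_matI) (auto simp: scalar_prod_def atLeast0LessThan on')
  have VD: "?V * ?D = Matrix.mat n n (\<lambda>(k,i). l i * u i k)"
    by (rule eq_matI) (auto simp: scalar_prod_def atLeast0LessThan if_distrib mult.commute cong: if_cong)
  have "?A = ?V * ?D * ?U"
    unfolding VD by (rule eq_matI) (auto simp: scalar_prod_def atLeast0LessThan dec)
  then have "similar_mat_wit ?A ?D ?V ?U"
    using UV VU by (auto simp: similar_mat_wit_def Let_def)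
  then have "char_poly ?A = char_poly ?D" by (intro char_poly_similar) (auto simp: similar_mat_def)
  also have "\<dots> = (\<Prod>x\<leftarrow>diag_mat ?D. [:- x, 1:])"
    by (rule char_poly_upper_triangular) auto
  also have "diag_mat ?D = map l [0..<n]" by (auto simp: diag_mat_def)
  finally have "proots (char_poly ?A) = mset (map l [0..<n])"
    by (simp only: proots_linear_factors)
  then show ?thesis using that on on' dec by blast
qed

section \<open>Overlaps of two eigenbases\<close>

definition eigensystem :: "nat \<Rightarrow> (nat \<Rightarrow> nat \<Rightarrow> real) \<Rightarrow> (nat \<Rightarrow> real) \<Rightarrow> (nat \<Rightarrow> nat \<Rightarrow> real) \<Rightarrow> bool" where
  "eigensystem n a l u \<longleftrightarrow>
    (\<forall>i<n. \<forall>j<n. (\<Sum>k<n. u i k * u j k) = (if i = j then 1 else 0)) \<and>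
    (\<forall>k<n. \<forall>m<n. (\<Sum>i<n. u i k * u i m) = (if k = m then 1 else 0)) \<and>
    (\<forall>k<n. \<forall>m<n. a k m = (\<Sum>i<n. l i * u i k * u i m))"

text \<open>The choice makes the eigenvalues a function of the matrix entries, so that spectral
  averages become functions of the input. Their order stays arbitrary, and only symmetric
  expressions in them occur. Both conditions are demanded of the same \<open>l\<close>, which ties
  the basis used for estimates to the roots counted by \<open>esd\<close>.\<close>

definition eigenvalues_of :: "nat \<Rightarrow> (nat \<Rightarrow> nat \<Rightarrow> real) \<Rightarrow> nat \<Rightarrow> real" where
  "eigenvalues_of n a = (SOME l. (\<exists>u. eigensystem n a l u) \<and>
     proots (char_poly (Matrix.mat n n (\<lambda>(i,j). a i j))) = mset (map l [0..<n]))"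

lemma eigenvalues_of:
  assumes "\<And>i j. i < n \<Longrightarrow> j < n \<Longrightarrow> a i j = a j i"
  shows "\<exists>u. eigensystem n a (eigenvalues_of n a) u"
    and "proots (char_poly (Matrix.mat n n (\<lambda>(i,j). a i j))) = mset (map (eigenvalues_of n a) [0..<n])"
proof -
  obtain l u where
    "\<And>i j. i < n \<Longrightarrow> j < n \<Longrightarrow> (\<Sum>k<n. u i k * u j k) = (if i = j then 1 else (0::real))"
    "\<And>k m. k < n \<Longrightarrow> m < n \<Longrightarrow> (\<Sum>i<n. u i k * u i m) = (if k = m then 1 else (0::real))"
    "\<And>k m. k < n \<Longrightarrow> m < n \<Longrightarrow> a k m = (\<Sum>i<n. l i * u i k * u i m)"
    and p: "proots (char_poly (Matrix.mat n n (\<lambda>(i,j). a i j))) = mset (map l [0..<n])"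
    by (rule spectral_decomposition[of n a]) (use assms in auto)
  then have "eigensystem n a l u" by (simp add: eigensystem_def)
  with p have "(\<exists>u. eigensystem n a l u) \<and>
     proots (char_poly (Matrix.mat n n (\<lambda>(i,j). a i j))) = mset (map l [0..<n])" by blast
  from someI[where P = "\<lambda>l. (\<exists>u. eigensystem n a l u) \<and>
     proots (char_poly (Matrix.mat n n (\<lambda>(i,j). a i j))) = mset (map l [0..<n])", OF this]
  show "\<exists>u. eigensystem n a (eigenvalues_of n a) u"
    "proots (char_poly (Matrix.mat n n (\<lambda>(i,j). a i j))) = mset (map (eigenvalues_of n a) [0..<n])"
    unfolding eigenvalues_of_def by blast+
qed

definition overlap :: "nat \<Rightarrow> (nat \<Rightarrow> nat \<Rightarrow> real) \<Rightarrow> (nat \<Rightarrow> nat \<Rightarrow> real) \<Rightarrow> nat \<Rightarrow> nat \<Rightarrow> real" where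
  "overlap n u v i j = (\<Sum>k<n. u i k * v j k)\<^sup>2"

text \<open>Both sides are the trace of the product of the matrix with spectrum \<open>f\<close> in
  the basis \<open>u\<close> and the matrix with spectrum \<open>g\<close> in the basis
  \<open>v\<close>; it suffices to expand the square and reorder sums, for arbitrary families
  \<open>u\<close> and \<open>v\<close>.\<close>

lemma sum_overlap:
  "(\<Sum>i<n. \<Sum>j<n. overlap n u v i j * (f i * g j)) =
   (\<Sum>k<n. \<Sum>k'<n. (\<Sum>i<n. f i * u i k * u i k') * (\<Sum>j<n. g j * v j k * v j k'))"
proof -
  have "(\<Sum>i<n. \<Sum>j<n. overlap n u v i j * (f i * g j)) =
      (\<Sum>i<n. \<Sum>j<n. \<Sum>k<n. \<Sum>k'<n. f i * u i k * u i k' * (g j * v j k * v j k'))"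
    unfolding overlap_def power2_eq_square sum_product
    by (simp add: sum_distrib_left sum_distrib_right mult_ac)
  also have "\<dots> = (\<Sum>i<n. \<Sum>k<n. \<Sum>k'<n. \<Sum>j<n. f i * u i k * u i k' * (g j * v j k * v j k'))"
    by (subst sum.swap, subst (2) sum.swap, simp)
  also have "\<dots> = (\<Sum>k<n. \<Sum>k'<n. \<Sum>i<n. \<Sum>j<n. f i * u i k * u i k' * (g j * v j k * v j k'))"
    by (subst sum.swap, subst (2) sum.swap, simp)
  also have "\<dots> = (\<Sum>k<n. \<Sum>k'<n. (\<Sum>i<n. f i * u i k * u i k') * (\<Sum>j<n. g j * v j k * v j k'))"
    unfolding sum_product ..
  finally show ?thesis .
qed

context
  fixes n a l u b m v
  assumes A: "eigensystem n a l u" and B: "eigensystem n b m v"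
begin

lemma sum_overlap_right:
  assumes "i < n" shows "(\<Sum>j<n. overlap n u v i j) = 1"
proof -
  \<comment> \<open>With \<open>f\<close> the indicator of \<open>i\<close> and \<open>g = 1\<close>
    the second factor becomes the identity matrix, which leaves the squared norm of
    \<open>u i\<close>.\<close>
  have "(\<Sum>i'<n. \<Sum>j<n. overlap n u v i' j * ((if i' = i then 1 else 0) * 1)) =
     (\<Sum>k<n. \<Sum>k'<n. (\<Sum>i'<n. (if i' = i then 1 else 0) * u i' k * u i' k') * (\<Sum>j<n. 1 * v j k * v j k'))"
    by (rule sum_overlap)
  also have "\<dots> = (\<Sum>k<n. \<Sum>k'<n. (u i k * u i k') * (if k = k' then 1 else 0))"
    using B assms by (intro sum.cong refl arg_cong2[where f = "(*)"])
      (auto simp: eigensystem_def if_distrib[of "\<lambda>x. x * _"] cong: if_cong)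
  also have "\<dots> = 1" using A assms by (simp add: eigensystem_def if_distrib[of "\<lambda>x. _ * x"] cong: if_cong)
  also have "(\<Sum>i'<n. \<Sum>j<n. overlap n u v i' j * ((if i' = i then 1 else 0) * 1)) =
     (\<Sum>i'<n. if i' = i then \<Sum>j<n. overlap n u v i' j else 0)"
    by (intro sum.cong) auto
  finally show ?thesis using assms by simp
qed

lemma sum_overlap_left:
  assumes "j < n" shows "(\<Sum>i<n. overlap n u v i j) = 1"
proof -
  have "(\<Sum>i<n. \<Sum>j'<n. overlap n u v i j' * (1 * (if j' = j then 1 else 0))) =
     (\<Sum>k<n. \<Sum>k'<n. (\<Sum>i<n. 1 * u i k * u i k') * (\<Sum>j'<n. (if j' = j then 1 else 0) * v j' k * v j' k'))"
    by (rule sum_overlap)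
  also have "\<dots> = (\<Sum>k<n. \<Sum>k'<n. (if k = k' then 1 else 0) * (v j k * v j k'))"
    using A assms by (intro sum.cong refl arg_cong2[where f = "(*)"])
      (auto simp: eigensystem_def if_distrib[of "\<lambda>x. x * _"] cong: if_cong)
  also have "\<dots> = 1" using B assms
    by (simp add: eigensystem_def if_distrib[of "\<lambda>x. x * _"] cong: if_cong)
  also have "(\<Sum>i<n. \<Sum>j'<n. overlap n u v i j' * (1 * (if j' = j then 1 else 0))) =
     (\<Sum>i<n. overlap n u v i j)"
    using assms by (simp add: if_distrib[of "\<lambda>x. _ * x"] cong: if_cong)
  finally show ?thesis .
qed

text \<open>This identity takes the place of the Hoffman-Wielandt inequality: the overlaps act as a
  transport plan between the two spectra whose quadratic cost is exactly the Frobenius distance, so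
  no ordering or optimal pairing of eigenvalues is required.\<close>

lemma sum_overlap_sq_diff:
  "(\<Sum>i<n. \<Sum>j<n. overlap n u v i j * (l i - m j)\<^sup>2) = (\<Sum>k<n. \<Sum>k'<n. (a k k' - b k k')\<^sup>2)"
proof -
  have a: "a k k' = (\<Sum>i<n. l i * u i k * u i k')" if "k < n" "k' < n" for k k'
    using A that by (simp add: eigensystem_def)
  have b: "b k k' = (\<Sum>i<n. m i * v i k * v i k')" if "k < n" "k' < n" for k k'
    using B that by (simp add: eigensystem_def)
  have ab: "(\<Sum>i<n. \<Sum>j<n. overlap n u v i j * (l i * m j)) = (\<Sum>k<n. \<Sum>k'<n. a k k' * b k k')"
    unfolding sum_overlap by (intro sum.cong refl) (simp add: a b)
  have sq: "(\<Sum>k<n. \<Sum>k'<n. (c k k')\<^sup>2) = (\<Sum>i<n. (p i)\<^sup>2)" if "eigensystem n c p w" for c p w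
  proof -
    have "(\<Sum>k<n. \<Sum>k'<n. (c k k')\<^sup>2) = (\<Sum>k<n. \<Sum>k'<n. (\<Sum>i<n. p i * w i k * w i k') * (\<Sum>i<n. p i * w i k * w i k'))"
      using that by (intro sum.cong refl) (simp add: eigensystem_def power2_eq_square)
    also have "\<dots> = (\<Sum>i<n. \<Sum>j<n. overlap n w w i j * (p i * p j))" by (simp only: sum_overlap)
    also have "\<dots> = (\<Sum>i<n. \<Sum>j<n. (if i = j then 1 else 0) * (p i * p j))"
      using that by (intro sum.cong refl) (simp add: eigensystem_def overlap_def)
    also have "\<dots> = (\<Sum>i<n. (p i)\<^sup>2)"
      by (simp add: if_distrib[of "\<lambda>x. x * _"] power2_eq_square cong: if_cong)
    finally show ?thesis .
  qed
  have "(\<Sum>i<n. \<Sum>j<n. overlap n u v i j * (l i - m j)\<^sup>2) =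
     (\<Sum>i<n. \<Sum>j<n. overlap n u v i j * (l i)\<^sup>2) + (\<Sum>i<n. \<Sum>j<n. overlap n u v i j * (m j)\<^sup>2)
      - 2 * (\<Sum>i<n. \<Sum>j<n. overlap n u v i j * (l i * m j))"
    by (simp add: power2_diff algebra_simps sum.distrib sum_subtractf sum_distrib_left)
  also have "(\<Sum>i<n. \<Sum>j<n. overlap n u v i j * (l i)\<^sup>2) = (\<Sum>i<n. (l i)\<^sup>2)"
    by (simp add: sum_overlap_right flip: sum_distrib_right)
  also have "(\<Sum>i<n. \<Sum>j<n. overlap n u v i j * (m j)\<^sup>2) = (\<Sum>j<n. (m j)\<^sup>2)"
    by (subst sum.swap) (simp add: sum_overlap_left flip: sum_distrib_right)
  finally show ?thesis unfolding ab sq[OF A, symmetric] sq[OF B, symmetric]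
    by (simp add: power2_diff algebra_simps sum.distrib sum_subtractf sum_distrib_left)
qed

lemma overlap_telescope:
  fixes f :: "real \<Rightarrow> 'z::real_normed_vector"
  shows "(\<Sum>i<n. f (l i)) - (\<Sum>j<n. f (m j)) = (\<Sum>i<n. \<Sum>j<n. overlap n u v i j *\<^sub>R (f (l i) - f (m j)))"
proof -
  have "(\<Sum>i<n. \<Sum>j<n. overlap n u v i j *\<^sub>R f (l i)) = (\<Sum>i<n. f (l i))"
    by (simp add: sum_overlap_right flip: scaleR_left.sum)
  moreover have "(\<Sum>i<n. \<Sum>j<n. overlap n u v i j *\<^sub>R f (m j)) = (\<Sum>j<n. f (m j))"
    by (subst sum.swap) (simp add: sum_overlap_left flip: scaleR_left.sum)
  ultimately show ?thesis by (simp add: scaleR_diff_right sum_subtractf)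
qed

text \<open>The difference of the two sums is an overlap average of differences of \<open>f\<close>;
  Cauchy-Schwarz with the overlaps as weights, of total mass \<open>n\<close>, turns the linear cost
  into the quadratic one.\<close>

lemma spectral_sum_lipschitz:
  fixes f :: "real \<Rightarrow> 'z::real_normed_vector"
  assumes L: "\<And>x y. norm (f x - f y) \<le> L * \<bar>x - y\<bar>" and "0 \<le> L"
  shows "norm ((\<Sum>i<n. f (l i)) - (\<Sum>j<n. f (m j))) \<le>
    L * sqrt (real n * (\<Sum>k<n. \<Sum>k'<n. (a k k' - b k k')\<^sup>2))"
proof -
  let ?w = "\<lambda>(i,j). overlap n u v i j" and ?d = "\<lambda>(i,j). \<bar>l i - m j\<bar>" and ?I = "{..<n} \<times> {..<n}"
  have w0: "0 \<le> ?w p" for p by (cases p) (simp add: overlap_def)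
  have "norm ((\<Sum>i<n. f (l i)) - (\<Sum>j<n. f (m j))) \<le>
      (\<Sum>i<n. \<Sum>j<n. norm (overlap n u v i j *\<^sub>R (f (l i) - f (m j))))"
    unfolding overlap_telescope by (intro order_trans[OF norm_sum] sum_mono norm_sum)
  also have "\<dots> \<le> (\<Sum>i<n. \<Sum>j<n. overlap n u v i j * (L * \<bar>l i - m j\<bar>))"
    by (intro sum_mono) (simp add: overlap_def L mult_left_mono)
  also have "\<dots> = L * (\<Sum>p\<in>?I. ?w p * ?d p)"
    unfolding sum.cartesian_product sum_distrib_left by (intro sum.cong refl) auto
  also have "\<dots> \<le> L * sqrt (real n * (\<Sum>k<n. \<Sum>k'<n. (a k k' - b k k')\<^sup>2))"
  proof (intro mult_left_mono real_le_rsqrt \<open>0 \<le> L\<close>)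
    have "(\<Sum>p\<in>?I. ?w p * ?d p)\<^sup>2 = (\<Sum>p\<in>?I. sqrt (?w p) * (sqrt (?w p) * ?d p))\<^sup>2"
      using w0 by (simp flip: mult.assoc)
    also have "\<dots> \<le> (\<Sum>p\<in>?I. (sqrt (?w p))\<^sup>2) * (\<Sum>p\<in>?I. (sqrt (?w p) * ?d p)\<^sup>2)"
      by (rule Cauchy_Schwarz_ineq_sum)
    also have "(\<Sum>p\<in>?I. (sqrt (?w p))\<^sup>2) = real n"
    proof -
      have "(\<Sum>p\<in>?I. (sqrt (?w p))\<^sup>2) = (\<Sum>i<n. \<Sum>j<n. overlap n u v i j)"
        unfolding sum.cartesian_product by (intro sum.cong refl) (auto simp: overlap_def)
      then show ?thesis by (simp add: sum_overlap_right)
    qed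
    also have "(\<Sum>p\<in>?I. (sqrt (?w p) * ?d p)\<^sup>2) = (\<Sum>i<n. \<Sum>j<n. overlap n u v i j * (l i - m j)\<^sup>2)"
      unfolding sum.cartesian_product by (intro sum.cong refl) (auto simp: power_mult_distrib overlap_def)
    finally show "(\<Sum>p\<in>?I. ?w p * ?d p)\<^sup>2 \<le> real n * (\<Sum>k<n. \<Sum>k'<n. (a k k' - b k k')\<^sup>2)"
      unfolding sum_overlap_sq_diff .
  qed
  finally show ?thesis .
qed

text \<open>\<open>G\<close> is the matrix f'(A), and the linear term is the trace of f'(A)(A - B).
  The formula for \<open>G\<close> is part of the conclusion because it does not involve
  \<open>b\<close>: one and the same gradient serves all perturbations of a single input.\<close>

lemma spectral_sum_first_order:
  fixes f f' :: "real \<Rightarrow> real"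
  assumes L: "\<And>x y. \<bar>f x - f y - f' x * (x - y)\<bar> \<le> L * (x - y)\<^sup>2" and L': "\<And>x. \<bar>f' x\<bar> \<le> L'"
  shows "\<exists>G. (\<Sum>k<n. \<Sum>k'<n. (G k k')\<^sup>2) \<le> real n * L'\<^sup>2 \<and>
     G = (\<lambda>k k'. \<Sum>i<n. f' (l i) * u i k * u i k') \<and>
    \<bar>(\<Sum>i<n. f (l i)) - (\<Sum>j<n. f (m j)) - (\<Sum>k<n. \<Sum>k'<n. G k k' * (a k k' - b k k'))\<bar> \<le>
      L * (\<Sum>k<n. \<Sum>k'<n. (a k k' - b k k')\<^sup>2)"
proof -
  define G where "G k k' = (\<Sum>i<n. f' (l i) * u i k * u i k')" for k k'
  have a: "a k k' = (\<Sum>i<n. l i * u i k * u i k')" if "k < n" "k' < n" for k k'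
    using A that by (simp add: eigensystem_def)
  have b: "b k k' = (\<Sum>i<n. m i * v i k * v i k')" if "k < n" "k' < n" for k k'
    using B that by (simp add: eigensystem_def)
  have ov: "overlap n u u i j = (if i = j then 1 else 0)" if "i < n" "j < n" for i j
    using A that by (simp add: eigensystem_def overlap_def)
  have "(\<Sum>k<n. \<Sum>k'<n. (G k k')\<^sup>2) = (\<Sum>i<n. \<Sum>j<n. overlap n u u i j * (f' (l i) * f' (l j)))"
    unfolding sum_overlap by (simp add: G_def power2_eq_square)
  also have "\<dots> = (\<Sum>i<n. (f' (l i))\<^sup>2)"
    by (simp add: ov if_distrib[of "\<lambda>x. x * _"] power2_eq_square cong: if_cong)
  also have "\<dots> \<le> (\<Sum>i<n. L'\<^sup>2)"
    using power_mono[OF L' abs_ge_zero, of _ 2] by (intro sum_mono) simp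
  finally have 1: "(\<Sum>k<n. \<Sum>k'<n. (G k k')\<^sup>2) \<le> real n * L'\<^sup>2" by simp
  have Ga: "(\<Sum>k<n. \<Sum>k'<n. G k k' * a k k') = (\<Sum>i<n. f' (l i) * l i)"
  proof -
    have "(\<Sum>k<n. \<Sum>k'<n. G k k' * a k k') = (\<Sum>i<n. \<Sum>j<n. overlap n u u i j * (f' (l i) * l j))"
      unfolding sum_overlap by (simp add: G_def a)
    then show ?thesis by (simp add: ov if_distrib[of "\<lambda>x. x * _"] cong: if_cong)
  qed
  have Gb: "(\<Sum>k<n. \<Sum>k'<n. G k k' * b k k') = (\<Sum>i<n. \<Sum>j<n. overlap n u v i j * (f' (l i) * m j))"
    unfolding sum_overlap by (simp add: G_def b)
  have "(\<Sum>k<n. \<Sum>k'<n. G k k' * (a k k' - b k k')) =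
      (\<Sum>i<n. \<Sum>j<n. overlap n u v i j * (f' (l i) * l i)) - (\<Sum>i<n. \<Sum>j<n. overlap n u v i j * (f' (l i) * m j))"
    by (simp add: right_diff_distrib sum_subtractf Ga Gb sum_overlap_right flip: sum_distrib_right)
  also have "\<dots> = (\<Sum>i<n. \<Sum>j<n. overlap n u v i j * (f' (l i) * (l i - m j)))"
    by (simp add: right_diff_distrib sum_subtractf)
  \<comment> \<open>Under the overlap average the linear term becomes
    \<open>f' (l i) * (l i - m j)\<close>, so each pair of eigenvalues contributes a one-dimensional
    Taylor remainder.\<close>
  finally have tel: "(\<Sum>i<n. f (l i)) - (\<Sum>j<n. f (m j)) - (\<Sum>k<n. \<Sum>k'<n. G k k' * (a k k' - b k k')) =
      (\<Sum>i<n. \<Sum>j<n. overlap n u v i j * (f (l i) - f (m j) - f' (l i) * (l i - m j)))"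
    unfolding overlap_telescope by (simp add: right_diff_distrib sum_subtractf)
  have "\<bar>(\<Sum>i<n. f (l i)) - (\<Sum>j<n. f (m j)) - (\<Sum>k<n. \<Sum>k'<n. G k k' * (a k k' - b k k'))\<bar> \<le> (\<Sum>i<n. \<Sum>j<n. overlap n u v i j * (L * (l i - m j)\<^sup>2))"
    unfolding tel by (intro order_trans[OF sum_abs] sum_mono)
      (simp add: abs_mult overlap_def mult_left_mono L)
  also have "\<dots> = (\<Sum>i<n. \<Sum>j<n. L * (overlap n u v i j * (l i - m j)\<^sup>2))"
    by (intro sum.cong refl) (simp only: mult.left_commute)
  also have "\<dots> = L * (\<Sum>i<n. \<Sum>j<n. overlap n u v i j * (l i - m j)\<^sup>2)"
    by (simp only: sum_distrib_left)
  also have "\<dots> = L * (\<Sum>k<n. \<Sum>k'<n. (a k k' - b k k')\<^sup>2)"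
    by (simp only: sum_overlap_sq_diff)
  finally have 2: "\<bar>(\<Sum>i<n. f (l i)) - (\<Sum>j<n. f (m j)) - (\<Sum>k<n. \<Sum>k'<n. G k k' * (a k k' - b k k'))\<bar> \<le>
      L * (\<Sum>k<n. \<Sum>k'<n. (a k k' - b k k')\<^sup>2)" .
  show ?thesis
    by (intro exI[of _ G] conjI 1 2) (intro ext, rule G_def)
qed

end

section \<open>Matrix powers and power sums of eigenvalues\<close>

fun mpow :: "nat \<Rightarrow> (nat \<Rightarrow> nat \<Rightarrow> real) \<Rightarrow> nat \<Rightarrow> nat \<Rightarrow> nat \<Rightarrow> real" where
  "mpow n a 0 i j = (if i = j then 1 else 0)"
| "mpow n a (Suc k) i j = (\<Sum>h<n. mpow n a k i h * a h j)"

lemma mpow_eigensystem: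
  assumes A: "eigensystem n a l u" and "p < n" "q < n"
  shows "mpow n a k p q = (\<Sum>i<n. l i ^ k * u i p * u i q)"
  using \<open>q < n\<close>
proof (induction k arbitrary: q)
  case 0
  then show ?case using A \<open>p < n\<close> by (simp add: eigensystem_def)
next
  case (Suc k)
  have "mpow n a (Suc k) p q = (\<Sum>h<n. (\<Sum>i<n. l i ^ k * u i p * u i h) * (\<Sum>j<n. l j * u j h * u j q))"
    using A Suc by (simp add: eigensystem_def)
  also have "\<dots> = (\<Sum>h<n. \<Sum>i<n. \<Sum>j<n. (l i ^ k * u i p * u i h) * (l j * u j h * u j q))"
    by (simp only: sum_product)
  also have "\<dots> = (\<Sum>i<n. \<Sum>h<n. \<Sum>j<n. (l i ^ k * u i p * u i h) * (l j * u j h * u j q))"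
    by (rule sum.swap)
  also have "\<dots> = (\<Sum>i<n. \<Sum>j<n. \<Sum>h<n. (l i ^ k * u i p * u i h) * (l j * u j h * u j q))"
    by (intro sum.cong refl sum.swap)
  also have "\<dots> = (\<Sum>i<n. \<Sum>j<n. l i ^ k * u i p * l j * u j q * (\<Sum>h<n. u i h * u j h))"
    by (intro sum.cong refl) (simp add: sum_distrib_left mult_ac)
  also have "\<dots> = (\<Sum>i<n. \<Sum>j<n. if i = j then l i ^ k * u i p * l j * u j q else 0)"
    using A by (intro sum.cong refl) (simp add: eigensystem_def)
  also have "\<dots> = (\<Sum>i<n. l i ^ Suc k * u i p * u i q)"
    by (simp add: mult_ac)
  finally show ?case .
qed

lemma sum_eigenvalue_power:
  assumes A: "eigensystem n a l u"
  shows "(\<Sum>i<n. l i ^ k) = (\<Sum>p<n. mpow n a k p p)"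
proof -
  have "(\<Sum>p<n. mpow n a k p p) = (\<Sum>i<n. l i ^ k * (\<Sum>p<n. u i p * u i p))"
    unfolding sum_distrib_left by (subst sum.swap) (simp add: mpow_eigensystem[OF A] mult_ac)
  also have "\<dots> = (\<Sum>i<n. l i ^ k)" using A by (simp add: eigensystem_def)
  finally show ?thesis ..
qed

section \<open>The Efron-Stein inequality\<close>

text \<open>The variance, with measure and integrand as explicit arguments: it is mostly applied to
  the law of one coordinate while the other coordinates are frozen.\<close>

definition fiber_variance :: "'b measure \<Rightarrow> ('b \<Rightarrow> real) \<Rightarrow> real" where
  "fiber_variance Q f = (\<integral>y. (f y)\<^sup>2 \<partial>Q) - (\<integral>y. f y \<partial>Q)\<^sup>2"

lemma (in prob_space) integrable_bounded:
  fixes f :: "'a \<Rightarrow> real"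
  assumes "f \<in> borel_measurable M" "\<And>x. \<bar>f x\<bar> \<le> B"
  shows "integrable M f"
  by (rule integrable_const_bound[where B = B]) (use assms in auto)

lemma (in prob_space) abs_integral_bounded:
  fixes f :: "'a \<Rightarrow> real"
  assumes "f \<in> borel_measurable M" "\<And>x. \<bar>f x\<bar> \<le> B"
  shows "\<bar>\<integral>x. f x \<partial>M\<bar> \<le> B"
proof -
  have "\<bar>\<integral>x. f x \<partial>M\<bar> \<le> (\<integral>x. \<bar>f x\<bar> \<partial>M)" by (rule integral_abs_bound)
  also have "\<dots> \<le> (\<integral>x. B \<partial>M)"
    by (rule integral_mono[OF integrable_abs[OF integrable_bounded[OF assms]]]) (use assms in auto)
  finally show ?thesis by (simp add: prob_space)
qed

lemma square_le_square_bound: "\<bar>x\<bar> \<le> B \<Longrightarrow> \<bar>(x::real)\<^sup>2\<bar> \<le> B\<^sup>2"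
  using power_mono[of "\<bar>x\<bar>" B 2] by simp

lemma (in prob_space) fiber_variance_shift:
  assumes "f \<in> borel_measurable M" "\<And>x. \<bar>f x\<bar> \<le> B"
  shows "(\<integral>x. (f x - c)\<^sup>2 \<partial>M) = fiber_variance M f + ((\<integral>x. f x \<partial>M) - c)\<^sup>2"
proof -
  have i: "integrable M f" by (rule integrable_bounded[OF assms])
  have i2: "integrable M (\<lambda>x. (f x)\<^sup>2)"
    by (rule integrable_bounded[where B = "B\<^sup>2"]) (use assms square_le_square_bound in auto)
  have "(\<integral>x. (f x - c)\<^sup>2 \<partial>M) = (\<integral>x. (f x)\<^sup>2 - 2 * c * f x + c\<^sup>2 \<partial>M)"
    by (intro Bochner_Integration.integral_cong refl) (simp add: power2_diff algebra_simps)
  also have "\<dots> = (\<integral>x. (f x)\<^sup>2 \<partial>M) - 2 * c * (\<integral>x. f x \<partial>M) + c\<^sup>2"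
    using i i2 by (simp add: prob_space)
  finally show ?thesis by (simp add: fiber_variance_def power2_diff algebra_simps)
qed

lemma (in prob_space) fiber_variance_le:
  assumes "f \<in> borel_measurable M" "\<And>x. \<bar>f x\<bar> \<le> B" "\<And>x. (f x - c)\<^sup>2 \<le> b"
  shows "fiber_variance M f \<le> b"
proof -
  have b0: "0 \<le> b" using assms(3)[of undefined] by (meson order_trans zero_le_power2)
  have "fiber_variance M f \<le> (\<integral>x. (f x - c)\<^sup>2 \<partial>M)" by (simp add: fiber_variance_shift[OF assms(1,2)])
  also have "\<dots> \<le> b"
    using abs_integral_bounded[of "\<lambda>x. (f x - c)\<^sup>2" b] assms by auto
  finally show ?thesis .
qed

lemma (in prob_space) fiber_variance_nonneg:
  assumes "f \<in> borel_measurable M" "\<And>x. \<bar>f x\<bar> \<le> B"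
  shows "0 \<le> fiber_variance M f"
proof -
  have "0 \<le> (\<integral>x. (f x - (\<integral>x. f x \<partial>M))\<^sup>2 \<partial>M)" by (rule integral_nonneg_AE) simp
  then show ?thesis using fiber_variance_shift[OF assms, of "\<integral>x. f x \<partial>M"] by simp
qed

text \<open>Variance is convex: after centring every \<open>h y\<close> separately, Jensen's
  inequality bounds the square of the average over \<open>y\<close> by the average of the squares,
  and Fubini exchanges the integrals.\<close>

lemma fiber_variance_mixture:
  fixes h :: "'b \<Rightarrow> 'c \<Rightarrow> real"
  assumes P: "prob_space P" and Q: "prob_space Q"
    and h[measurable]: "case_prod h \<in> borel_measurable (P \<Otimes>\<^sub>M Q)" and hB: "\<And>y z. \<bar>h y z\<bar> \<le> B"
  shows "fiber_variance Q (\<lambda>z. \<integral>y. h y z \<partial>P) \<le> (\<integral>y. fiber_variance Q (h y) \<partial>P)"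
proof -
  interpret P: prob_space P by fact
  interpret Q: prob_space Q by fact
  interpret PQ: pair_prob_space P Q ..
  have B0: "0 \<le> B" using hB[of undefined undefined] by linarith
  define m where "m y = (\<integral>z. h y z \<partial>Q)" for y
  define H where "H z = (\<integral>y. h y z \<partial>P)" for z
  have space_measurable: "(\<lambda>y. h y z) \<in> borel_measurable P" if "z \<in> space Q" for z
    using measurable_compose[OF measurable_Pair2'[OF that] h] by simp
  have [measurable]: "m \<in> borel_measurable P" "H \<in> borel_measurable Q"
    unfolding m_def H_def by measurable
  have hy[measurable]: "h y \<in> borel_measurable Q" if "y \<in> space P" for y
    using measurable_compose[OF measurable_Pair1'[OF that] h] by simp
  have mB: "\<bar>m y\<bar> \<le> B" if "y \<in> space P" for y
    unfolding m_def by (rule Q.abs_integral_bounded) (use hy[OF that] hB in auto)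
  have HB: "\<bar>H z\<bar> \<le> B" if "z \<in> space Q" for z
    unfolding H_def by (rule P.abs_integral_bounded) (use space_measurable[OF that] hB in auto)
  \<comment> \<open>The bound on \<open>m\<close> is available on the space of \<open>P\<close>
    only; the default value 0 elsewhere makes \<open>k\<close> bounded at every argument.\<close>
  define k where "k y z = h y z - (if y \<in> space P then m y else 0)" for y z
  have kB: "\<bar>k y z\<bar> \<le> 2 * B" for y z
    using hB[of y z] mB[of y] B0 by (auto simp: k_def)
  have k[measurable]: "case_prod k \<in> borel_measurable (P \<Otimes>\<^sub>M Q)"
    unfolding k_def split_def by measurable
  have k2i: "integrable (P \<Otimes>\<^sub>M Q) (\<lambda>(y,z). (k y z)\<^sup>2)"
  proof (rule PQ.P.integrable_bounded)
    show "\<bar>case p of (y, z) \<Rightarrow> (k y z)\<^sup>2\<bar> \<le> (2*B)\<^sup>2" for p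
      using square_le_square_bound[OF kB] by (auto split: prod.split)
  qed measurable
  have hi: "integrable (P \<Otimes>\<^sub>M Q) (\<lambda>(y,z). h y z)"
    by (rule PQ.P.integrable_bounded[where B = B]) (use hB in auto)
  have Hm: "(\<integral>z. H z \<partial>Q) = (\<integral>y. m y \<partial>P)"
    unfolding H_def m_def by (rule PQ.Fubini_integral[OF hi])
  define c where "c = (\<integral>z. H z \<partial>Q)"
  have "fiber_variance Q H = (\<integral>z. (H z - c)\<^sup>2 \<partial>Q)"
    unfolding fiber_variance_def c_def
  proof -
    have i: "integrable Q H" by (rule Q.integrable_const_bound[where B = B]) (auto simp: HB)
    have i2: "integrable Q (\<lambda>z. (H z)\<^sup>2)"
      by (rule Q.integrable_const_bound[where B = "B\<^sup>2"]) (auto intro!: AE_I2 dest: HB simp: square_le_square_bound[OF HB, simplified])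
    show "(\<integral>z. (H z)\<^sup>2 \<partial>Q) - (\<integral>z. H z \<partial>Q)\<^sup>2 = (\<integral>z. (H z - (\<integral>z. H z \<partial>Q))\<^sup>2 \<partial>Q)"
      using Q.variance_eq[OF i i2] by simp
  qed
  also have "\<dots> = (\<integral>z. (\<integral>y. k y z \<partial>P)\<^sup>2 \<partial>Q)"
  proof (intro Bochner_Integration.integral_cong refl)
    fix z assume z: "z \<in> space Q"
    have "(\<integral>y. k y z \<partial>P) = (\<integral>y. h y z - m y \<partial>P)"
      by (intro Bochner_Integration.integral_cong refl) (simp add: k_def)
    also have "\<dots> = H z - (\<integral>y. m y \<partial>P)"
      unfolding H_def
    proof (rule Bochner_Integration.integral_diff)
      show "integrable P (\<lambda>y. h y z)" by (rule P.integrable_bounded[OF space_measurable[OF z] hB])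
      show "integrable P m" by (rule P.integrable_const_bound[where B = B]) (auto simp: mB)
    qed
    finally show "(H z - c)\<^sup>2 = (\<integral>y. k y z \<partial>P)\<^sup>2" by (simp add: c_def Hm)
  qed
  also have "\<dots> \<le> (\<integral>z. (\<integral>y. (k y z)\<^sup>2 \<partial>P) \<partial>Q)"
  proof (rule integral_mono_AE)
    have km: "(\<lambda>y. k y z) \<in> borel_measurable P" if "z \<in> space Q" for z
      using measurable_compose[OF measurable_Pair2'[OF that] k] by simp
    have le: "(\<integral>y. k y z \<partial>P)\<^sup>2 \<le> (\<integral>y. (k y z)\<^sup>2 \<partial>P)" if "z \<in> space Q" for z
      using P.fiber_variance_nonneg[OF km[OF that] kB] by (simp add: fiber_variance_def)
    show "AE z in Q. (\<integral>y. k y z \<partial>P)\<^sup>2 \<le> (\<integral>y. (k y z)\<^sup>2 \<partial>P)" by (intro AE_I2 le)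
    have sq: "\<bar>\<integral>y. (k y z)\<^sup>2 \<partial>P\<bar> \<le> (2*B)\<^sup>2" if "z \<in> space Q" for z
      by (rule P.abs_integral_bounded) (use km[OF that] square_le_square_bound[OF kB] in auto)
    show "integrable Q (\<lambda>z. \<integral>y. (k y z)\<^sup>2 \<partial>P)"
      by (rule Q.integrable_const_bound[where B = "(2*B)\<^sup>2"]) (use sq in auto)
    show "integrable Q (\<lambda>z. (\<integral>y. k y z \<partial>P)\<^sup>2)"
    proof (rule Q.integrable_const_bound[where B = "(2*B)\<^sup>2"])
      show "AE z in Q. norm ((\<integral>y. k y z \<partial>P)\<^sup>2) \<le> (2 * B)\<^sup>2"
      proof (intro AE_I2)
        fix z assume "z \<in> space Q"
        with le[of z] sq[of z] show "norm ((\<integral>y. k y z \<partial>P)\<^sup>2) \<le> (2 * B)\<^sup>2" by simp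
      qed
    qed measurable
  qed
  also have "\<dots> = (\<integral>y. (\<integral>z. (k y z)\<^sup>2 \<partial>Q) \<partial>P)"
    by (rule PQ.Fubini_integral[OF k2i])
  also have "\<dots> = (\<integral>y. fiber_variance Q (h y) \<partial>P)"
  proof (intro Bochner_Integration.integral_cong refl)
    fix y assume y: "y \<in> space P"
    then show "(\<integral>z. (k y z)\<^sup>2 \<partial>Q) = fiber_variance Q (h y)"
      using Q.fiber_variance_shift[OF hy[OF y] hB, of "m y"] by (simp add: k_def m_def)
  qed
  finally show ?thesis unfolding H_def .
qed

text \<open>Induction over the coordinates by the law of total variance. Integrating out the new
  coordinate \<open>w\<close> leaves a function of the old ones whose fibre variances are, by
  convexity, at most the averages of those of \<open>F\<close>.\<close>

theorem efron_stein:
  fixes M :: "'i \<Rightarrow> 'b measure" and F :: "('i \<Rightarrow> 'b) \<Rightarrow> real"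
  assumes M: "\<And>i. prob_space (M i)" and "finite V"
    and "F \<in> borel_measurable (PiM V M)" "\<And>x. \<bar>F x\<bar> \<le> B"
  shows "fiber_variance (PiM V M) F \<le>
    (\<Sum>v\<in>V. \<integral>x. fiber_variance (M v) (\<lambda>y. F (x(v := y))) \<partial>PiM V M)"
  using assms(2-)
proof (induction V arbitrary: F rule: finite_induct)
  case empty
  interpret product_prob_space M by (intro product_prob_spaceI M)
  show ?case by (simp add: fiber_variance_def PiM_empty lebesgue_integral_count_space_finite)
next
  case (insert w V)
  interpret product_prob_space M by (intro product_prob_spaceI M)
  interpret V: prob_space "PiM V M" by (rule prob_space_PiM) (rule M)
  interpret iV: prob_space "PiM (insert w V) M" by (rule prob_space_PiM) (rule M)
  have F[measurable]: "F \<in> borel_measurable (PiM (insert w V) M)" and FB: "\<And>x. \<bar>F x\<bar> \<le> B" by fact+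
  have FB2: "\<bar>(F x)\<^sup>2\<bar> \<le> B\<^sup>2" for x by (rule square_le_square_bound[OF FB])
  have up[measurable]: "(\<lambda>p. (fst p)(w := snd p)) \<in> measurable (PiM V M \<Otimes>\<^sub>M M w) (PiM (insert w V) M)"
    by (rule measurable_fun_upd[where J = V]) (auto)
  have Fp[measurable]: "(\<lambda>p. F ((fst p)(w := snd p))) \<in> borel_measurable (PiM V M \<Otimes>\<^sub>M M w)"
    by (rule measurable_compose[OF up F])
  have Fw[measurable]: "(\<lambda>y. F (x(w := y))) \<in> borel_measurable (M w)" if "x \<in> space (PiM V M)" for x
    using measurable_compose[OF measurable_Pair1'[OF that] Fp] by simp
  define G where "G x = (\<integral>y. F (x(w := y)) \<partial>M w)" for x
  have G'[measurable]: "G \<in> borel_measurable (PiM V M)" unfolding G_def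
    using Fp by (intro M.borel_measurable_lebesgue_integral) (simp add: split_def)
  \<comment> \<open>The induction hypothesis asks for a bound at every argument, whereas
    \<open>G\<close> is controlled only on the product space; hence the value 0 outside.\<close>
  define G' where "G' x = (if x \<in> space (PiM V M) then G x else 0)" for x
  have B0: "0 \<le> B" using FB[of undefined] by linarith
  have GB: "\<bar>G' x\<bar> \<le> B" for x
    using B0 M.abs_integral_bounded[OF Fw FB] by (auto simp: G'_def G_def)
  have Gm[measurable]: "G' \<in> borel_measurable (PiM V M)" unfolding G'_def by measurable
  have int_ins: "(\<integral>x. f x \<partial>PiM (insert w V) M) = (\<integral>x. (\<integral>y. f (x(w := y)) \<partial>M w) \<partial>PiM V M)"
    if "f \<in> borel_measurable (PiM (insert w V) M)" "\<And>x. x \<in> space (PiM (insert w V) M) \<Longrightarrow> \<bar>f x\<bar> \<le> C" for C and f :: "_ \<Rightarrow> real"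
    by (rule product_integral_insert) (use insert that in \<open>auto intro!: iV.integrable_const_bound[where B=C]\<close>)
  have sp: "x(v := z) \<in> space (PiM V M)" if "x \<in> space (PiM V M)" "v \<in> V" "z \<in> space (M v)" for x v z
    using that by (auto simp: space_PiM PiE_iff extensional_def)
  have spw: "x(w := z) \<in> space (PiM (insert w V) M)" if "x \<in> space (PiM V M)" "z \<in> space (M w)" for x z
    using that by (auto simp: space_PiM PiE_iff extensional_def)
  have fv_meas[measurable]: "(\<lambda>x. fiber_variance (M v) (\<lambda>y. f (x(v := y)))) \<in> borel_measurable (PiM W M)"
    if "v \<in> W" and f: "f \<in> borel_measurable (PiM W M)" for v W and f :: "_ \<Rightarrow> real"
  proof -
    have "(\<lambda>p. (fst p)(v := snd p)) \<in> measurable (PiM W M \<Otimes>\<^sub>M M v) (PiM W M)"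
      by (rule measurable_fun_upd[where J = W]) (use that in auto)
    from measurable_compose[OF this f]
    have [measurable]: "(\<lambda>(x,y). f (x(v := y))) \<in> borel_measurable (PiM W M \<Otimes>\<^sub>M M v)" by (simp add: split_def)
    show ?thesis unfolding fiber_variance_def by measurable
  qed
  have fv_bound: "\<bar>fiber_variance (M v) (\<lambda>y. f (x(v := y)))\<bar> \<le> C\<^sup>2 + C\<^sup>2"
    if "v \<in> W" and f: "f \<in> borel_measurable (PiM W M)" "\<And>x. \<bar>f x\<bar> \<le> C" and x: "x \<in> space (PiM W M)" for v W C x and f :: "_ \<Rightarrow> real"
  proof -
    have "(\<lambda>p. (fst p)(v := snd p)) \<in> measurable (PiM W M \<Otimes>\<^sub>M M v) (PiM W M)"
      by (rule measurable_fun_upd[where J = W]) (use that in auto)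
    from measurable_compose[OF this f(1)]
    have "(\<lambda>p. f ((fst p)(v := snd p))) \<in> borel_measurable (PiM W M \<Otimes>\<^sub>M M v)" .
    from measurable_compose[OF measurable_Pair1'[OF x] this]
    have m: "(\<lambda>y. f (x(v := y))) \<in> borel_measurable (M v)" by simp
    have 1: "\<bar>\<integral>y. (f (x(v := y)))\<^sup>2 \<partial>M v\<bar> \<le> C\<^sup>2"
      by (rule M.abs_integral_bounded) (use m square_le_square_bound[OF f(2)] in auto)
    have 2: "\<bar>(\<integral>y. f (x(v := y)) \<partial>M v)\<^sup>2\<bar> \<le> C\<^sup>2"
      by (rule square_le_square_bound) (rule M.abs_integral_bounded[OF m f(2)])
    show ?thesis unfolding fiber_variance_def using 1 2 by linarith
  qed
  have fvw: "(\<integral>x. fiber_variance (M w) (\<lambda>y. F (x(w := y))) \<partial>PiM (insert w V) M) =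
      (\<integral>x. fiber_variance (M w) (\<lambda>y. F (x(w := y))) \<partial>PiM V M)"
    by (subst int_ins[of _ "B\<^sup>2 + B\<^sup>2"]) (use fv_bound[OF _ F FB] in \<open>auto simp: M.prob_space\<close>)
  have i1: "integrable (PiM V M) (\<lambda>x. \<integral>y. (F (x(w := y)))\<^sup>2 \<partial>M w)"
  proof (rule V.integrable_const_bound[where B = "B\<^sup>2"])
    show "AE x in PiM V M. norm (\<integral>y. (F (x(w := y)))\<^sup>2 \<partial>M w) \<le> B\<^sup>2"
      using M.abs_integral_bounded[OF borel_measurable_power[OF Fw] FB2] by (intro AE_I2) auto
    show "(\<lambda>x. \<integral>y. (F (x(w := y)))\<^sup>2 \<partial>M w) \<in> borel_measurable (PiM V M)"
      using Fp by (intro M.borel_measurable_lebesgue_integral) (simp add: split_def)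
  qed
  have i2: "integrable (PiM V M) (\<lambda>x. (G' x)\<^sup>2)"
    by (rule V.integrable_bounded[where B = "B\<^sup>2"]) (use square_le_square_bound[OF GB] in auto)
  have intF2: "(\<integral>x. (F x)\<^sup>2 \<partial>PiM (insert w V) M) = (\<integral>x. (\<integral>y. (F (x(w := y)))\<^sup>2 \<partial>M w) \<partial>PiM V M)"
    by (rule int_ins[of _ "B\<^sup>2"]) (use FB2 in auto)
  have intF: "(\<integral>x. F x \<partial>PiM (insert w V) M) = (\<integral>x. G' x \<partial>PiM V M)"
    by (subst int_ins[of _ B]) (use FB in \<open>auto simp: G'_def G_def intro!: Bochner_Integration.integral_cong\<close>)
  have "(\<integral>x. fiber_variance (M w) (\<lambda>y. F (x(w := y))) \<partial>PiM V M) =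
      (\<integral>x. (\<integral>y. (F (x(w := y)))\<^sup>2 \<partial>M w) - (G' x)\<^sup>2 \<partial>PiM V M)"
    by (intro Bochner_Integration.integral_cong refl) (simp add: fiber_variance_def G'_def G_def)
  also have "\<dots> = (\<integral>x. (F x)\<^sup>2 \<partial>PiM (insert w V) M) - (\<integral>x. (G' x)\<^sup>2 \<partial>PiM V M)"
    unfolding intF2 by (rule Bochner_Integration.integral_diff[OF i1 i2])
  \<comment> \<open>Total variance: the mean of the conditional variance given the coordinates in
    \<open>V\<close>, plus the variance of the conditional mean.\<close>
  finally have split: "fiber_variance (PiM (insert w V) M) F =
      (\<integral>x. fiber_variance (M w) (\<lambda>y. F (x(w := y))) \<partial>PiM (insert w V) M) + fiber_variance (PiM V M) G'"
    unfolding fvw by (simp add: fiber_variance_def intF)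
  have "fiber_variance (PiM V M) G' \<le>
    (\<Sum>v\<in>V. \<integral>x. fiber_variance (M v) (\<lambda>y. G' (x(v := y))) \<partial>PiM V M)"
    by (rule insert.IH) (use GB in auto)
  also have "\<dots> \<le> (\<Sum>v\<in>V. \<integral>x. fiber_variance (M v) (\<lambda>y. F (x(v := y))) \<partial>PiM (insert w V) M)"
  proof (rule sum_mono)
    fix v assume v: "v \<in> V"
    have vw: "v \<noteq> w" using v insert by auto
    have fb: "\<bar>fiber_variance (M v) (\<lambda>y. F (x(v := y)))\<bar> \<le> B\<^sup>2 + B\<^sup>2" if "x \<in> space (PiM (insert w V) M)" for x
      using fv_bound[OF _ F FB that] v by auto
    have fm: "(\<lambda>x. fiber_variance (M v) (\<lambda>y. F (x(v := y)))) \<in> borel_measurable (PiM (insert w V) M)"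
      using fv_meas[OF _ F] v by auto
    from measurable_compose[OF up fm]
    have fm2: "(\<lambda>p. fiber_variance (M v) (\<lambda>y. F (((fst p)(w := snd p))(v := y)))) \<in> borel_measurable (PiM V M \<Otimes>\<^sub>M M w)" .
    have fm3: "(\<lambda>z. fiber_variance (M v) (\<lambda>y. F ((x(w := z))(v := y)))) \<in> borel_measurable (M w)" if "x \<in> space (PiM V M)" for x
      using measurable_compose[OF measurable_Pair1'[OF that] fm2] by simp
    have "(\<integral>x. fiber_variance (M v) (\<lambda>y. G' (x(v := y))) \<partial>PiM V M) \<le>
       (\<integral>x. (\<integral>z. fiber_variance (M v) (\<lambda>y. F ((x(w := z))(v := y))) \<partial>M w) \<partial>PiM V M)"
    proof (rule integral_mono_AE)
      show "integrable (PiM V M) (\<lambda>x. fiber_variance (M v) (\<lambda>y. G' (x(v := y))))"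
        by (rule V.integrable_const_bound[where B = "B\<^sup>2 + B\<^sup>2"])
          (use fv_bound[OF v Gm GB] fv_meas[OF v Gm] in auto)
      show "integrable (PiM V M) (\<lambda>x. \<integral>z. fiber_variance (M v) (\<lambda>y. F ((x(w := z))(v := y))) \<partial>M w)"
      proof (rule V.integrable_const_bound[where B = "B\<^sup>2 + B\<^sup>2"])
        show "(\<lambda>x. \<integral>z. fiber_variance (M v) (\<lambda>y. F ((x(w := z))(v := y))) \<partial>M w) \<in> borel_measurable (PiM V M)"
          using fm2 by (intro M.borel_measurable_lebesgue_integral) (simp add: split_def)
        show "AE x in PiM V M. norm (\<integral>z. fiber_variance (M v) (\<lambda>y. F ((x(w := z))(v := y))) \<partial>M w) \<le> B\<^sup>2 + B\<^sup>2"
        proof (intro AE_I2)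
          fix x assume x: "x \<in> space (PiM V M)"
          have "\<bar>\<integral>z. fiber_variance (M v) (\<lambda>y. F ((x(w := z))(v := y))) \<partial>M w\<bar>
              \<le> (\<integral>z. \<bar>fiber_variance (M v) (\<lambda>y. F ((x(w := z))(v := y)))\<bar> \<partial>M w)"
            by (rule integral_abs_bound)
          also have "\<dots> \<le> (\<integral>z. B\<^sup>2 + B\<^sup>2 \<partial>M w)"
            by (rule integral_mono_AE)
              (use fm3[OF x] fb[OF spw[OF x]] in \<open>auto intro!: M.integrable_const_bound[where B = "B\<^sup>2 + B\<^sup>2"] AE_I2\<close>)
          finally show "norm (\<integral>z. fiber_variance (M v) (\<lambda>y. F ((x(w := z))(v := y))) \<partial>M w) \<le> B\<^sup>2 + B\<^sup>2"
            by (simp add: M.prob_space)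
        qed
      qed
      show "AE x in PiM V M. fiber_variance (M v) (\<lambda>y. G' (x(v := y))) \<le>
         (\<integral>z. fiber_variance (M v) (\<lambda>y. F ((x(w := z))(v := y))) \<partial>M w)"
      proof (intro AE_I2)
        fix x assume x: "x \<in> space (PiM V M)"
        have "(\<lambda>p. (x(w := fst p))(v := snd p)) \<in> measurable (M w \<Otimes>\<^sub>M M v) (PiM (insert w V) M)"
        proof (rule measurable_fun_upd[where J = "insert w V"])
          show "(\<lambda>p. x(w := fst p)) \<in> measurable (M w \<Otimes>\<^sub>M M v) (PiM (insert w V) M)"
            by (rule measurable_fun_upd[where J = V]) (use x in auto)
        qed (use v in auto)
        from measurable_compose[OF this F]
        have hm: "(\<lambda>(z,y). F ((x(w := z))(v := y))) \<in> borel_measurable (M w \<Otimes>\<^sub>M M v)" by (simp add: split_def)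
        have "fiber_variance (M v) (\<lambda>y. G' (x(v := y))) = fiber_variance (M v) (\<lambda>y. \<integral>z. F ((x(w := z))(v := y)) \<partial>M w)"
          unfolding fiber_variance_def
          by (intro arg_cong2[where f = "(-)"] arg_cong[where f = "\<lambda>x. x\<^sup>2"] Bochner_Integration.integral_cong refl)
            (use vw sp[OF x v] in \<open>auto simp: G'_def G_def fun_upd_twist\<close>)
        also have "\<dots> \<le> (\<integral>z. fiber_variance (M v) (\<lambda>y. F ((x(w := z))(v := y))) \<partial>M w)"
          by (rule fiber_variance_mixture[OF M M hm FB])
        finally show "fiber_variance (M v) (\<lambda>y. G' (x(v := y))) \<le>
         (\<integral>z. fiber_variance (M v) (\<lambda>y. F ((x(w := z))(v := y))) \<partial>M w)" .
      qed
    qed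
    also have "\<dots> = (\<integral>x. fiber_variance (M v) (\<lambda>y. F (x(v := y))) \<partial>PiM (insert w V) M)"
      by (rule int_ins[OF fm fb, symmetric])
    finally show "(\<integral>x. fiber_variance (M v) (\<lambda>y. G' (x(v := y))) \<partial>PiM V M) \<le>
       (\<integral>x. fiber_variance (M v) (\<lambda>y. F (x(v := y))) \<partial>PiM (insert w V) M)" .
  qed
  finally show ?case
    unfolding split sum.insert[OF insert.hyps] by (rule add_left_mono)
qed


text \<open>Efron-Stein for \<open>F\<close> bounds the variance by \<open>c\<close>. Applied once
  more to g = (F - m)^2, it bounds the variance of \<open>g\<close> by 10 c^2, and the squared mean
  of \<open>g\<close> adds at most c^2. The bounds \<open>b v x\<close> may depend on the point;
  only their sum over \<open>v\<close> is controlled uniformly.\<close>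

theorem fourth_moment_bounded_differences:
  fixes M :: "'i \<Rightarrow> 'b measure" and F :: "('i \<Rightarrow> 'b) \<Rightarrow> real"
  assumes M: "\<And>i. prob_space (M i)" and V: "finite V"
    and F: "F \<in> borel_measurable (PiM V M)" and FB: "\<And>x. \<bar>F x\<bar> \<le> B"
    and b: "\<And>x v y. v \<in> V \<Longrightarrow> (F (x(v := y)) - F x)\<^sup>2 \<le> b v x"
    and c: "\<And>x. (\<Sum>v\<in>V. b v x) \<le> c"
  shows "(\<integral>x. (F x - (\<integral>x. F x \<partial>PiM V M)) ^ 4 \<partial>PiM V M) \<le> 11 * c\<^sup>2"
proof -
  interpret product_prob_space M by (intro product_prob_spaceI M)
  interpret V: prob_space "PiM V M" by (rule prob_space_PiM) (rule M)
  have meas: "(\<lambda>y. f (x(v := y))) \<in> borel_measurable (M v)"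
    if "v \<in> V" "x \<in> space (PiM V M)" "f \<in> borel_measurable (PiM V M)" for v x and f :: "_ \<Rightarrow> real"
  proof -
    have "(\<lambda>y. x(v := y)) \<in> measurable (M v) (PiM V M)"
      by (rule measurable_fun_upd[where J = V]) (use that in auto)
    from measurable_compose[OF this that(3)] show ?thesis .
  qed
  have b0: "0 \<le> b v x" if "v \<in> V" for v x
    using b[OF that, of x] by (meson order_trans zero_le_power2)
  have bc: "b v x \<le> c" if "v \<in> V" for v x
    using member_le_sum[OF that _ V, of "\<lambda>v. b v x"] b0 c[of x] by fastforce
  have c0: "0 \<le> c" using c[of undefined] sum_nonneg[of V "\<lambda>v. b v undefined"] b0 by fastforce
  have ES: "fiber_variance (PiM V M) f \<le> (\<integral>x. D x \<partial>PiM V M)"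
    if f: "f \<in> borel_measurable (PiM V M)" "\<And>x. \<bar>f x\<bar> \<le> C"
      and d: "\<And>x v y. v \<in> V \<Longrightarrow> (f (x(v := y)) - f x)\<^sup>2 \<le> d v x" and D: "\<And>x. (\<Sum>v\<in>V. d v x) \<le> D x"
      and Di: "integrable (PiM V M) D" for f d D C
  proof -
    have fl: "fiber_variance (M v) (\<lambda>y. f (x(v := y))) \<le> d v x" if "v \<in> V" "x \<in> space (PiM V M)" for v x
    proof -
      show ?thesis by (rule M.fiber_variance_le[OF meas[OF that f(1)] f(2) d[OF that(1)]])
    qed
    have fi: "integrable (PiM V M) (\<lambda>x. fiber_variance (M v) (\<lambda>y. f (x(v := y))))" if v: "v \<in> V" for v
    proof (rule V.integrable_const_bound[where B = "(2*C)\<^sup>2"])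
      have "(\<lambda>p. (fst p)(v := snd p)) \<in> measurable (PiM V M \<Otimes>\<^sub>M M v) (PiM V M)"
        by (rule measurable_fun_upd[where J = V]) (use v in auto)
      from measurable_compose[OF this f(1)]
      have [measurable]: "(\<lambda>(x,y). f (x(v := y))) \<in> borel_measurable (PiM V M \<Otimes>\<^sub>M M v)" by (simp add: split_def)
      show "(\<lambda>x. fiber_variance (M v) (\<lambda>y. f (x(v := y)))) \<in> borel_measurable (PiM V M)"
        unfolding fiber_variance_def by measurable
      show "AE x in PiM V M. norm (fiber_variance (M v) (\<lambda>y. f (x(v := y)))) \<le> (2*C)\<^sup>2"
      proof (intro AE_I2)
        fix x assume x: "x \<in> space (PiM V M)"
        have "(f y - f z)\<^sup>2 \<le> (2*C)\<^sup>2" for y z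
          using square_le_square_bound[of "f y - f z" "2*C"] f(2)[of y] f(2)[of z] by simp
        then have "fiber_variance (M v) (\<lambda>y. f (x(v := y))) \<le> (2*C)\<^sup>2"
          by (intro M.fiber_variance_le[OF meas[OF v x f(1)] f(2), where c = "f x"]) auto
        then show "norm (fiber_variance (M v) (\<lambda>y. f (x(v := y)))) \<le> (2*C)\<^sup>2"
          using M.fiber_variance_nonneg[OF meas[OF v x f(1)] f(2)] by simp
      qed
    qed
    have "fiber_variance (PiM V M) f \<le> (\<Sum>v\<in>V. \<integral>x. fiber_variance (M v) (\<lambda>y. f (x(v := y))) \<partial>PiM V M)"
      by (rule efron_stein[OF M V f])
    also have "\<dots> = (\<integral>x. (\<Sum>v\<in>V. fiber_variance (M v) (\<lambda>y. f (x(v := y)))) \<partial>PiM V M)"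
      by (rule Bochner_Integration.integral_sum[symmetric]) (rule fi)
    also have "\<dots> \<le> (\<integral>x. D x \<partial>PiM V M)"
    proof (rule integral_mono_AE)
      show "integrable (PiM V M) (\<lambda>x. \<Sum>v\<in>V. fiber_variance (M v) (\<lambda>y. f (x(v := y))))"
        by (intro Bochner_Integration.integrable_sum fi)
      show "AE x in PiM V M. (\<Sum>v\<in>V. fiber_variance (M v) (\<lambda>y. f (x(v := y)))) \<le> D x"
        using fl by (intro AE_I2 order_trans[OF sum_mono D])
    qed (rule Di)
    finally show ?thesis .
  qed
  define m where "m = (\<integral>x. F x \<partial>PiM V M)"
  define g where "g x = (F x - m)\<^sup>2" for x
  have gm: "g \<in> borel_measurable (PiM V M)" unfolding g_def using F by measurable
  have mB: "\<bar>m\<bar> \<le> B" unfolding m_def by (rule V.abs_integral_bounded[OF F FB])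
  have gB: "\<bar>g x\<bar> \<le> (2*B)\<^sup>2" for x
    unfolding g_def using square_le_square_bound[of "F x - m" "2*B"] FB[of x] mB by simp
  have gi: "integrable (PiM V M) g" by (rule V.integrable_bounded[OF gm gB])
  have "fiber_variance (PiM V M) F \<le> (\<integral>x. c \<partial>PiM V M)" by (rule ES[OF F FB b c]) auto
  then have intg: "(\<integral>x. g x \<partial>PiM V M) \<le> c"
    using V.fiber_variance_shift[OF F FB, of m] by (simp add: g_def m_def V.prob_space)
  have intg0: "0 \<le> (\<integral>x. g x \<partial>PiM V M)" by (rule integral_nonneg_AE) (simp add: g_def)
  have "fiber_variance (PiM V M) g \<le> (\<integral>x. 8 * c * g x + 2 * c\<^sup>2 \<partial>PiM V M)"
  proof (rule ES[of g "(2*B)\<^sup>2" "\<lambda>v x. b v x * (8 * g x + 2 * c)", OF gm gB])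
    fix x v y assume v: "v \<in> V"
    define p q where "p = F (x(v := y)) - F x" and "q = F x - m"
    have p2: "p\<^sup>2 \<le> b v x" unfolding p_def by (rule b[OF v])
    \<comment> \<open>An increment \<open>p\<close> of \<open>F\<close> moves the square of the
      deviation \<open>q\<close> by \<open>p * (p + 2 * q)\<close>. Since every single
      \<open>b v x\<close> is at most \<open>c\<close>, the second factor has square at most
      \<open>8 * q^2 + 2 * c\<close>, and the first supplies \<open>b v x\<close>.\<close>
    have "g (x(v := y)) - g x = p * (p + 2 * q)"
      by (simp add: g_def p_def q_def power2_eq_square algebra_simps)
    then have "(g (x(v := y)) - g x)\<^sup>2 = p\<^sup>2 * (p + 2 * q)\<^sup>2" by (simp add: power_mult_distrib)
    also have "\<dots> \<le> b v x * (8 * g x + 2 * c)"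
    proof (rule mult_mono[OF p2])
      have "(p + 2 * q)\<^sup>2 + (p - 2 * q)\<^sup>2 = 2 * p\<^sup>2 + 8 * q\<^sup>2" by (simp add: power2_eq_square algebra_simps)
      moreover have "p\<^sup>2 \<le> c" using p2 bc[OF v, of x] by simp
      moreover have "0 \<le> (p - 2 * q)\<^sup>2" by simp
      ultimately have "(p + 2 * q)\<^sup>2 \<le> 8 * q\<^sup>2 + 2 * c" by linarith
      then show "(p + 2 * q)\<^sup>2 \<le> 8 * g x + 2 * c" by (simp add: g_def q_def)
    qed (use b0[OF v] in auto)
    finally show "(g (x(v := y)) - g x)\<^sup>2 \<le> b v x * (8 * g x + 2 * c)" .
  next
    fix x
    have "(\<Sum>v\<in>V. b v x * (8 * g x + 2 * c)) = (\<Sum>v\<in>V. b v x) * (8 * g x + 2 * c)"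
      by (simp only: sum_distrib_right)
    also have "\<dots> \<le> c * (8 * g x + 2 * c)"
      using c c0 by (intro mult_right_mono) (auto simp: g_def)
    finally show "(\<Sum>v\<in>V. b v x * (8 * g x + 2 * c)) \<le> 8 * c * g x + 2 * c\<^sup>2"
      by (simp add: algebra_simps power2_eq_square)
  qed (use gi in auto)
  also have "\<dots> = 8 * c * (\<integral>x. g x \<partial>PiM V M) + 2 * c\<^sup>2" using gi by (simp add: V.prob_space)
  also have "\<dots> \<le> 8 * c * c + 2 * c\<^sup>2" using intg c0 by (intro add_right_mono mult_left_mono) auto
  finally have "(\<integral>x. (g x)\<^sup>2 \<partial>PiM V M) \<le> 10 * c\<^sup>2 + (\<integral>x. g x \<partial>PiM V M)\<^sup>2"
    by (simp add: fiber_variance_def power2_eq_square)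
  also have "(\<integral>x. g x \<partial>PiM V M)\<^sup>2 \<le> c\<^sup>2" using intg intg0 by (intro power_mono)
  finally have "(\<integral>x. (g x)\<^sup>2 \<partial>PiM V M) \<le> 11 * c\<^sup>2" by simp
  then show ?thesis by (simp add: g_def m_def flip: power_mult)
qed

section \<open>Matrices with cyclic link functions\<close>

definition cdist :: "nat \<Rightarrow> int \<Rightarrow> nat" where
  "cdist N d = nat (min (d mod int N) (int N - d mod int N))"

lemma cdist_eq_iff:
  assumes "N > 0"
  shows "cdist N d = cdist N e \<longleftrightarrow> int N dvd d - e \<or> int N dvd d + e"
proof -
  define a b where "a = d mod int N" and "b = e mod int N"
  have r: "0 \<le> a" "a < int N" "0 \<le> b" "b < int N" using assms by (auto simp: a_def b_def)
  have "cdist N d = cdist N e \<longleftrightarrow> min a (int N - a) = min b (int N - b)"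
    unfolding cdist_def a_def[symmetric] b_def[symmetric] using r by (auto simp: min_def)
  also have "\<dots> \<longleftrightarrow> a = b \<or> a + b = int N \<or> a + b = 0" using r by (auto simp: min_def)
  also have "a = b \<longleftrightarrow> int N dvd d - e" unfolding a_def b_def by (simp add: mod_eq_dvd_iff)
  also have "a + b = int N \<or> a + b = 0 \<longleftrightarrow> int N dvd a + b"
  proof
    assume "int N dvd a + b"
    then obtain k where k: "a + b = int N * k" by auto
    have "0 \<le> int N * k" "int N * k < int N * 2" using r k by linarith+
    then have "0 \<le> k" "k < 2" using assms by (simp_all add: zero_le_mult_iff)
    then have "k = 0 \<or> k = 1" by auto
    with k show "a + b = int N \<or> a + b = 0" by auto
  qed auto
  also have "int N dvd a + b \<longleftrightarrow> int N dvd d + e"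
    unfolding a_def b_def by (simp add: dvd_eq_mod_eq_0 mod_add_eq)
  finally show ?thesis by blast
qed

lemma cdist_minus: "N > 0 \<Longrightarrow> cdist N (- d) = cdist N d"
  by (simp add: cdist_eq_iff)

lemma cdist_commute: "N > 0 \<Longrightarrow> cdist N (a - b) = cdist N (b - a)"
  using cdist_minus[of N "a - b"] by simp

lemma cdist_le: "N > 0 \<Longrightarrow> 2 * cdist N d \<le> N"
  using pos_mod_bound[of "int N" d] pos_mod_sign[of "int N" d] by (auto simp: cdist_def min_def)

text \<open>Given one column \<open>j0\<close> with the right distance, any other must be congruent
  to \<open>j0\<close> or to its reflection \<open>2 * i - j0\<close>. So each input occurs at most
  twice in a row.\<close>

lemma card_cdist_row:
  assumes "n \<le> N" "N > 0"
  shows "card {j. j < n \<and> cdist N (int i - int j) = v} \<le> 2"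
proof (cases "{j. j < n \<and> cdist N (int i - int j) = v} = {}")
  case False
  then obtain j0 where j0: "j0 < n" "cdist N (int i - int j0) = v" by auto
  have "{j. j < n \<and> cdist N (int i - int j) = v} \<subseteq> {j0, nat ((2 * int i - int j0) mod int N)}"
  proof (rule subsetI)
    fix j assume "j \<in> {j. j < n \<and> cdist N (int i - int j) = v}"
    then have j: "j < n" "v = cdist N (int i - int j)" by auto
    have "int N dvd (int i - int j0) - (int i - int j) \<or> int N dvd (int i - int j0) + (int i - int j)"
      using j j0 assms by (subst cdist_eq_iff[symmetric]) auto
    then show "j \<in> {j0, nat ((2 * int i - int j0) mod int N)}"
    proof
      assume "int N dvd (int i - int j0) - (int i - int j)"
      then have "int j mod int N = int j0 mod int N" by (simp add: mod_eq_dvd_iff)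
      then show ?thesis using j j0 assms by simp
    next
      assume "int N dvd (int i - int j0) + (int i - int j)"
      then have "(2 * int i - int j0) mod int N = int j mod int N"
        by (simp add: mod_eq_dvd_iff algebra_simps)
      then have "(2 * int i - int j0) mod int N = int j" using j assms by simp
      then show ?thesis by simp
    qed
  qed
  from card_mono[OF _ this] have "card {j. j < n \<and> cdist N (int i - int j) = v} \<le> card {j0, nat ((2 * int i - int j0) mod int N)}"
    by simp
  also have "\<dots> \<le> 2" by (simp add: card_insert_if)
  finally show ?thesis .
qed (simp only: card.empty)

text \<open>Counting from 0 moves the antidiagonal to \<open>i + j = n - 1\<close>. The sign is
  formed over the integers because subtraction of naturals would lose the negative side.\<close>

definition mask :: "bool \<Rightarrow> nat \<Rightarrow> nat \<Rightarrow> nat \<Rightarrow> real" where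
  "mask hat n i j = (if hat then of_int (sgn (int n - 1 - int i - int j)) else 1)"

lemma abs_mask_le: "\<bar>mask hat n i j\<bar> \<le> 1"
  by (auto simp: mask_def sgn_if)

lemma mask_commute: "mask hat n i j = mask hat n j i"
  by (simp add: mask_def algebra_simps)

text \<open>The Toeplitz matrices correspond to \<open>r = 2\<close>, the symmetric circulants to \<open>r = 1\<close>. Rows and
  columns are counted from 0.\<close>

definition scaled :: "nat \<Rightarrow> bool \<Rightarrow> nat \<Rightarrow> (nat \<Rightarrow> real) \<Rightarrow> nat \<Rightarrow> nat \<Rightarrow> real" where
  "scaled r hat n x i j = real n powr (- 1 / 2) * (mask hat n i j * x (cdist (r * n) (int i - int j)))"

definition spec :: "nat \<Rightarrow> bool \<Rightarrow> nat \<Rightarrow> (nat \<Rightarrow> real) \<Rightarrow> nat \<Rightarrow> real" where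
  "spec r hat n x = eigenvalues_of n (scaled r hat n x)"

definition ecf :: "nat \<Rightarrow> bool \<Rightarrow> nat \<Rightarrow> (nat \<Rightarrow> real) \<Rightarrow> real \<Rightarrow> complex" where
  "ecf r hat n x t = (\<Sum>i<n. iexp (t * spec r hat n x i)) / of_nat n"

lemma scaled_commute:
  assumes "r > 0" "n > 0"
  shows "scaled r hat n x i j = scaled r hat n x j i"
  using assms by (simp add: scaled_def mask_commute[of hat n i j] cdist_commute[of "r*n" "int i"])

lemma spec_eigensystem:
  assumes "r > 0"
  shows "\<exists>u. eigensystem n (scaled r hat n x) (spec r hat n x) u"
  unfolding spec_def by (rule eigenvalues_of) (use assms scaled_commute in auto)

lemma eigenvalues_of_cong:
  assumes "\<And>i j. i < n \<Longrightarrow> j < n \<Longrightarrow> a i j = b i j"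
  shows "eigenvalues_of n a = eigenvalues_of n b"
proof -
  have "eigensystem n a = eigensystem n b"
    using assms by (intro ext) (simp add: eigensystem_def)
  moreover have "Matrix.mat n n (\<lambda>(i,j). a i j) = Matrix.mat n n (\<lambda>(i,j). b i j)"
    by (rule eq_matI) (auto simp: assms)
  ultimately show ?thesis unfolding eigenvalues_of_def by (simp only:)
qed

lemma cdist_le_n: "r \<in> {1, 2} \<Longrightarrow> n > 0 \<Longrightarrow> cdist (r * n) d \<le> n"
  using cdist_le[of "r * n" d] by auto

text \<open>Distances in a cyclic group of order at most \<open>2 * n\<close> never exceed
  \<open>n\<close>. Thus the inputs 0 to \<open>n\<close> determine the spectrum, and finite product
  spaces suffice for the concentration argument.\<close>

lemma ecf_cong:
  assumes "r \<in> {1, 2}" "\<And>v. v \<le> n \<Longrightarrow> x v = y v"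
  shows "ecf r hat n x t = ecf r hat n y t"
proof -
  have "spec r hat n x = spec r hat n y"
    unfolding spec_def by (rule eigenvalues_of_cong) (use assms cdist_le_n[of r n] in \<open>simp add: scaled_def\<close>)
  then show ?thesis by (simp add: ecf_def)
qed

lemma sum_link_rows:
  fixes d :: "nat \<Rightarrow> real"
  assumes r: "r \<in> {1, 2}" and d: "\<And>v. 0 \<le> d v"
  shows "(\<Sum>i<n. \<Sum>j<n. d (cdist (r * n) (int i - int j))) \<le> 2 * real n * (\<Sum>v\<le>n. d v)"
proof (cases "n = 0")
  case False
  have "(\<Sum>j<n. d (cdist (r * n) (int i - int j))) \<le> 2 * (\<Sum>v\<le>n. d v)" for i
  proof -
    have "(\<Sum>j<n. d (cdist (r * n) (int i - int j))) =
        (\<Sum>v\<le>n. \<Sum>j\<in>{j. j < n \<and> cdist (r * n) (int i - int j) = v}. d (cdist (r * n) (int i - int j)))"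
      using cdist_le_n[OF r, of n] False
      by (subst sum.group[symmetric, of _ "{..n}" "\<lambda>j. cdist (r * n) (int i - int j)"]) (auto intro!: sum.cong)
    also have "\<dots> = (\<Sum>v\<le>n. real (card {j. j < n \<and> cdist (r * n) (int i - int j) = v}) * d v)"
      by (intro sum.cong refl) simp
    also have "\<dots> \<le> (\<Sum>v\<le>n. 2 * d v)"
    proof (intro sum_mono mult_right_mono d)
      fix v
      have "card {j. j < n \<and> cdist (r * n) (int i - int j) = v} \<le> 2"
        by (rule card_cdist_row) (use r False in auto)
      then show "real (card {j. j < n \<and> cdist (r * n) (int i - int j) = v}) \<le> 2" by linarith
    qed
    finally show ?thesis by (simp add: sum_distrib_left)
  qed
  then have "(\<Sum>i<n. \<Sum>j<n. d (cdist (r * n) (int i - int j))) \<le> (\<Sum>i<n. 2 * (\<Sum>v\<le>n. d v))"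
    by (intro sum_mono)
  then show ?thesis by (simp add: mult_ac)
qed simp

lemma powr_half_sq: "n > 0 \<Longrightarrow> (real n powr (- 1 / 2))\<^sup>2 = 1 / real n"
proof -
  assume n: "n > 0"
  have "(real n powr (- 1 / 2))\<^sup>2 = real n powr (- 1 / 2 + - 1 / 2)"
    unfolding power2_eq_square by (rule powr_add[symmetric])
  also have "(- 1 / 2 + - 1 / 2 :: real) = - 1" by simp
  also have "real n powr (- 1) = 1 / real n" using n by (intro powr_neg_one) simp
  finally show ?thesis .
qed

lemma scaled_diff_sq_le:
  assumes "n > 0"
  shows "(scaled r hat n x i j - scaled r hat n y i j)\<^sup>2 \<le>
    (x (cdist (r * n) (int i - int j)) - y (cdist (r * n) (int i - int j)))\<^sup>2 / real n"
proof -
  let ?v = "cdist (r * n) (int i - int j)"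
  have "(scaled r hat n x i j - scaled r hat n y i j)\<^sup>2 =
     (1 / real n) * ((mask hat n i j)\<^sup>2 * (x ?v - y ?v)\<^sup>2)"
    unfolding scaled_def powr_half_sq[OF assms, symmetric]
    by (simp add: power2_eq_square algebra_simps)
  also have "\<dots> \<le> (1 / real n) * (1 * (x ?v - y ?v)\<^sup>2)"
    using abs_mask_le[of hat n i j] by (intro mult_left_mono mult_right_mono) (auto simp: abs_square_le_1)
  finally show ?thesis by simp
qed

text \<open>An input fills at most \<open>2 * n\<close> entries, each scaled by n^(-1/2) and damped
  by the mask; the factor 2 is what remains.\<close>

lemma scaled_diff_frobenius:
  assumes r: "r \<in> {1, 2}" and "n > 0"
  shows "(\<Sum>i<n. \<Sum>j<n. (scaled r hat n x i j - scaled r hat n y i j)\<^sup>2) \<le> 2 * (\<Sum>v\<le>n. (x v - y v)\<^sup>2)"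
proof -
  have "(\<Sum>i<n. \<Sum>j<n. (scaled r hat n x i j - scaled r hat n y i j)\<^sup>2) \<le>
      (\<Sum>i<n. \<Sum>j<n. (\<lambda>v. (x v - y v)\<^sup>2 / real n) (cdist (r * n) (int i - int j)))"
    by (intro sum_mono) (simp add: scaled_diff_sq_le[OF \<open>n > 0\<close>])
  also have "\<dots> \<le> 2 * real n * (\<Sum>v\<le>n. (x v - y v)\<^sup>2 / real n)"
    by (rule sum_link_rows[OF r]) simp
  also have "\<dots> = 2 * (\<Sum>v\<le>n. (x v - y v)\<^sup>2)"
    using \<open>n > 0\<close> by (simp flip: sum_divide_distrib)
  finally show ?thesis .
qed

lemma iexp_lipschitz: "cmod (iexp (t * x) - iexp (t * y)) \<le> \<bar>t\<bar> * \<bar>x - y\<bar>"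
proof -
  have "cmod (iexp (t * x - t * y) - (\<Sum>k\<le>0. (\<i> * complex_of_real (t * x - t * y)) ^ k / fact k)) \<le> \<bar>t * x - t * y\<bar> ^ Suc 0 / fact (Suc 0)"
    by (rule iexp_approx1)
  then have "cmod (iexp (t * x - t * y) - 1) \<le> \<bar>t * x - t * y\<bar>" by simp
  moreover have "iexp (t * x) - iexp (t * y) = iexp (t * y) * (iexp (t * x - t * y) - 1)"
    by (simp add: right_diff_distrib flip: exp_add)
  ultimately show ?thesis by (simp add: norm_mult flip: right_diff_distrib abs_mult)
qed

theorem ecf_lipschitz:
  assumes r: "r \<in> {1, 2}" and n: "n > 0"
  shows "cmod (ecf r hat n x t - ecf r hat n y t) \<le> \<bar>t\<bar> * sqrt (2 * (\<Sum>v\<le>n. (x v - y v)\<^sup>2) / real n)"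
proof -
  obtain u where u: "eigensystem n (scaled r hat n x) (spec r hat n x) u" using spec_eigensystem r by force
  obtain v where v: "eigensystem n (scaled r hat n y) (spec r hat n y) v" using spec_eigensystem r by force
  let ?D = "\<Sum>i<n. \<Sum>j<n. (scaled r hat n x i j - scaled r hat n y i j)\<^sup>2"
  have "cmod (ecf r hat n x t - ecf r hat n y t) =
     cmod ((\<Sum>i<n. iexp (t * spec r hat n x i)) - (\<Sum>i<n. iexp (t * spec r hat n y i))) / real n"
    by (simp add: ecf_def norm_divide flip: diff_divide_distrib)
  also have "\<dots> \<le> \<bar>t\<bar> * sqrt (real n * ?D) / real n"
    by (intro divide_right_mono spectral_sum_lipschitz[OF u v, where f = "\<lambda>s. iexp (t * s)"] iexp_lipschitz) auto
  also have "\<dots> = \<bar>t\<bar> * sqrt (?D / real n)"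
    using n by (simp add: real_sqrt_mult real_sqrt_divide field_simps)
  also have "\<dots> \<le> \<bar>t\<bar> * sqrt (2 * (\<Sum>v\<le>n. (x v - y v)\<^sup>2) / real n)"
    by (intro mult_left_mono real_sqrt_le_mono divide_right_mono scaled_diff_frobenius[OF r n]) auto
  finally show ?thesis .
qed

definition lin_stat :: "nat \<Rightarrow> bool \<Rightarrow> nat \<Rightarrow> (real \<Rightarrow> real) \<Rightarrow> (nat \<Rightarrow> real) \<Rightarrow> real" where
  "lin_stat r hat n f x = (\<Sum>i<n. f (spec r hat n x i)) / real n"

text \<open>Changing one input perturbs the matrix by a Frobenius norm of order 1, so the Lipschitz
  estimate would only give squared differences of order 1/n each. The first-order term is instead
  bounded by the gradient on the entries of that input; summed over all inputs these pieces give the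
  whole gradient, and the total is of order 1/n.\<close>

lemma lin_stat_bounded_difference:
  fixes f f' :: "real \<Rightarrow> real"
  assumes r: "r \<in> {1, 2}" and n: "n > 0" and C: "0 \<le> C" and L0: "0 \<le> L"
    and L: "\<And>x y. \<bar>f x - f y - f' x * (x - y)\<bar> \<le> L * (x - y)\<^sup>2" and L': "\<And>x. \<bar>f' x\<bar> \<le> L'"
    and x: "\<And>v. \<bar>x v\<bar> \<le> C"
  shows "\<exists>b. (\<forall>v y. \<bar>y\<bar> \<le> C \<longrightarrow> (lin_stat r hat n f (x(v := y)) - lin_stat r hat n f x)\<^sup>2 \<le> b v) \<and>
     (\<Sum>v\<le>n. b v) \<le> (16 * C\<^sup>2 * L'\<^sup>2 + 256 * C ^ 4 * L\<^sup>2) / real n"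
proof -
  let ?A = "scaled r hat n x" and ?l = "spec r hat n x" and ?c = "\<lambda>i j. cdist (r * n) (int i - int j)"
  obtain u where u: "eigensystem n ?A ?l u" using spec_eigensystem r by force
  define G where "G k k' = (\<Sum>i<n. f' (?l i) * u i k * u i k')" for k k'
  \<comment> \<open>Squared norm of the gradient on the entries that carry input \<open>v\<close>.
    Every entry carries exactly one input, so the sum over \<open>v\<close> is the full squared
    norm.\<close>
  define S where "S v = (\<Sum>i<n. \<Sum>j<n. if ?c i j = v then (G i j)\<^sup>2 else 0)" for v
  have first: "(\<Sum>k<n. \<Sum>k'<n. (G k k')\<^sup>2) \<le> real n * L'\<^sup>2 \<and>
      \<bar>(\<Sum>i<n. f (?l i)) - (\<Sum>j<n. f (spec r hat n y j)) - (\<Sum>k<n. \<Sum>k'<n. G k k' * (?A k k' - scaled r hat n y k k'))\<bar> \<le>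
      L * (\<Sum>k<n. \<Sum>k'<n. (?A k k' - scaled r hat n y k k')\<^sup>2)" for y
  proof -
    obtain v where v: "eigensystem n (scaled r hat n y) (spec r hat n y) v" using spec_eigensystem r by force
    from spectral_sum_first_order[OF u v L L'] show ?thesis unfolding G_def by blast
  qed
  have S0: "0 \<le> S v" for v unfolding S_def by (intro sum_nonneg) auto
  have "(\<Sum>v\<le>n. S v) = (\<Sum>i<n. \<Sum>v\<le>n. \<Sum>j<n. if ?c i j = v then (G i j)\<^sup>2 else 0)"
    unfolding S_def by (rule sum.swap)
  also have "\<dots> = (\<Sum>i<n. \<Sum>j<n. \<Sum>v\<le>n. if ?c i j = v then (G i j)\<^sup>2 else 0)"
    by (intro sum.cong refl sum.swap)
  also have "\<dots> = (\<Sum>i<n. \<Sum>j<n. (G i j)\<^sup>2)"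
    using cdist_le_n[OF r n] by simp
  finally have SS: "(\<Sum>v\<le>n. S v) \<le> real n * L'\<^sup>2" using first by simp
  \<comment> \<open>From \<open>P^2 <= 2 * T^2 + 2 * (P - T)^2\<close> with squared perturbation at
    most \<open>8 * C^2\<close>: the first part gives 2 * 8 = 16, the second 2 * 8^2 = 128.\<close>
  define b where "b v = 16 * C\<^sup>2 * S v / (real n)\<^sup>2 + 128 * C ^ 4 * L\<^sup>2 / (real n)\<^sup>2" for v
  have bb: "(lin_stat r hat n f (x(v := y)) - lin_stat r hat n f x)\<^sup>2 \<le> b v" if y: "\<bar>y\<bar> \<le> C" for v y
  proof -
    let ?x = "x(v := y)"
    let ?E = "\<lambda>k k'. ?A k k' - scaled r hat n ?x k k'"
    define D where "D = (\<Sum>k<n. \<Sum>k'<n. (?E k k')\<^sup>2)"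
    define T where "T = (\<Sum>k<n. \<Sum>k'<n. G k k' * ?E k k')"
    have d2: "(x v - y)\<^sup>2 \<le> 4 * C\<^sup>2"
      using square_le_square_bound[of "x v - y" "2*C"] x[of v] y by (simp add: power_mult_distrib)
    have "D \<le> 2 * (\<Sum>w\<le>n. (x w - ?x w)\<^sup>2)" unfolding D_def by (rule scaled_diff_frobenius[OF r n])
    also have "(\<Sum>w\<le>n. (x w - ?x w)\<^sup>2) \<le> (\<Sum>w\<le>n. if w = v then 4 * C\<^sup>2 else 0)"
      using d2 by (intro sum_mono) auto
    also have "\<dots> \<le> 4 * C\<^sup>2" by simp
    finally have D: "D \<le> 8 * C\<^sup>2" by simp
    have D0: "0 \<le> D" unfolding D_def by (intro sum_nonneg) auto
    have T2: "T\<^sup>2 \<le> S v * D"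
    proof -
      have E0: "?E k k' = 0" if "?c k k' \<noteq> v" for k k' using that by (simp add: scaled_def)
      have "T = (\<Sum>p\<in>{..<n} \<times> {..<n}. (if ?c (fst p) (snd p) = v then G (fst p) (snd p) else 0) * ?E (fst p) (snd p))"
        unfolding T_def sum.cartesian_product using E0 by (intro sum.cong refl) auto
      then have "T\<^sup>2 \<le> (\<Sum>p\<in>{..<n} \<times> {..<n}. (if ?c (fst p) (snd p) = v then G (fst p) (snd p) else 0)\<^sup>2) *
          (\<Sum>p\<in>{..<n} \<times> {..<n}. (?E (fst p) (snd p))\<^sup>2)"
        by (simp only: Cauchy_Schwarz_ineq_sum)
      also have "(\<Sum>p\<in>{..<n} \<times> {..<n}. (if ?c (fst p) (snd p) = v then G (fst p) (snd p) else 0)\<^sup>2) = S v"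
        unfolding S_def sum.cartesian_product by (intro sum.cong refl) auto
      also have "(\<Sum>p\<in>{..<n} \<times> {..<n}. (?E (fst p) (snd p))\<^sup>2) = D"
        unfolding D_def sum.cartesian_product by (intro sum.cong refl) auto
      finally show ?thesis .
    qed
    define P where "P = (\<Sum>i<n. f (?l i)) - (\<Sum>j<n. f (spec r hat n ?x j))"
    have PT: "\<bar>P - T\<bar> \<le> L * D" using first[of ?x] unfolding P_def T_def D_def by blast
    have "P\<^sup>2 + (2 * T - P)\<^sup>2 = 2 * T\<^sup>2 + 2 * (P - T)\<^sup>2" by (simp add: power2_eq_square algebra_simps)
    then have "P\<^sup>2 \<le> 2 * T\<^sup>2 + 2 * (P - T)\<^sup>2" using zero_le_power2[of "2 * T - P"] by linarith
    also have "(P - T)\<^sup>2 \<le> (L * D)\<^sup>2" using square_le_square_bound[OF PT] by simp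
    also have "\<dots> \<le> (L * (8 * C\<^sup>2))\<^sup>2" using D D0 L0 by (intro power_mono mult_left_mono) auto
    also have "T\<^sup>2 \<le> S v * (8 * C\<^sup>2)" using T2 D S0[of v] by (meson mult_left_mono order_trans)
    finally have "P\<^sup>2 \<le> 16 * C\<^sup>2 * S v + 128 * C ^ 4 * L\<^sup>2"
      by (simp add: power_mult_distrib algebra_simps flip: power_mult)
    moreover have "(lin_stat r hat n f ?x - lin_stat r hat n f x)\<^sup>2 = P\<^sup>2 / (real n)\<^sup>2"
      unfolding lin_stat_def P_def diff_divide_distrib[symmetric] power_divide by (simp add: power2_commute)
    ultimately show ?thesis by (simp add: b_def divide_right_mono flip: add_divide_distrib)
  qed
  have "(\<Sum>v\<le>n. b v) = 16 * C\<^sup>2 * (\<Sum>v\<le>n. S v) / (real n)\<^sup>2 + (real n + 1) * (128 * C ^ 4 * L\<^sup>2 / (real n)\<^sup>2)"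
    by (simp add: b_def sum.distrib sum_distrib_left sum_divide_distrib)
  \<comment> \<open>There are \<open>n + 1\<close> inputs, at most \<open>2 * n\<close>; this
    doubles 128 to 256.\<close>
  also have "\<dots> \<le> 16 * C\<^sup>2 * (real n * L'\<^sup>2) / (real n)\<^sup>2 + (2 * real n) * (128 * C ^ 4 * L\<^sup>2 / (real n)\<^sup>2)"
    using n by (intro add_mono divide_right_mono mult_left_mono mult_right_mono SS) auto
  also have "\<dots> = (16 * C\<^sup>2 * L'\<^sup>2 + 256 * C ^ 4 * L\<^sup>2) / real n"
    using n by (simp add: power2_eq_square field_simps)
  finally show ?thesis using bb by blast
qed

section \<open>Concentration of the empirical characteristic function\<close>

lemma sum_spec_power:
  assumes "r \<in> {1, 2}"
  shows "(\<Sum>i<n. spec r hat n x i ^ k) = (\<Sum>p<n. mpow n (scaled r hat n x) k p p)"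
proof -
  obtain u where u: "eigensystem n (scaled r hat n x) (spec r hat n x) u" using spec_eigensystem assms by force
  show ?thesis by (rule sum_eigenvalue_power[OF u])
qed

lemma measurable_mpow:
  assumes "\<And>i j. i < n \<Longrightarrow> j < n \<Longrightarrow> (\<lambda>\<omega>. a \<omega> i j) \<in> borel_measurable N" and "q < n"
  shows "(\<lambda>\<omega>. mpow n (a \<omega>) k p q) \<in> borel_measurable N"
  using \<open>q < n\<close>
proof (induction k arbitrary: q)
  case (Suc k)
  have "(\<lambda>\<omega>. \<Sum>h<n. mpow n (a \<omega>) k p h * a \<omega> h q) \<in> borel_measurable N"
    by (intro borel_measurable_sum borel_measurable_times Suc.IH assms(1) Suc.prems) auto
  then show ?case by simp
qed simp

lemma measurable_sum_spec_power:
  assumes r: "r \<in> {1, 2}" and X: "\<And>v. v \<le> n \<Longrightarrow> X v \<in> borel_measurable N"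
  shows "(\<lambda>\<omega>. \<Sum>i<n. spec r hat n (\<lambda>v. X v \<omega>) i ^ k) \<in> borel_measurable N"
  unfolding sum_spec_power[OF r]
proof (intro borel_measurable_sum measurable_mpow)
  fix i j p assume "i < n" "j < n"
  then show "(\<lambda>\<omega>. scaled r hat n (\<lambda>v. X v \<omega>) i j) \<in> borel_measurable N"
    unfolding scaled_def by (intro borel_measurable_times borel_measurable_const X cdist_le_n[OF r]) auto
qed auto

text \<open>The eigenvalues come from a choice operator, which gives no handle on their
  measurability. Their power sums, however, are traces of powers and thus polynomials in the inputs,
  and \<open>ecf\<close> is a pointwise limit of combinations of power sums by the exponential
  series.\<close>

lemma measurable_ecf:
  assumes r: "r \<in> {1, 2}" and X: "\<And>v. v \<le> n \<Longrightarrow> X v \<in> borel_measurable N"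
  shows "(\<lambda>\<omega>. ecf r hat n (\<lambda>v. X v \<omega>) t) \<in> borel_measurable N"
proof -
  let ?l = "\<lambda>\<omega> i. spec r hat n (\<lambda>v. X v \<omega>) i"
  have "(\<lambda>\<omega>. \<Sum>i<n. iexp (t * ?l \<omega> i)) \<in> borel_measurable N"
  proof (rule borel_measurable_LIMSEQ_metric)
    fix \<omega>
    have "(\<lambda>K. \<Sum>k<K. (\<i> * of_real (t * y)) ^ k /\<^sub>R fact k) \<longlonglongrightarrow> iexp (t * y)" for y
      using exp_converges[of "\<i> * of_real (t * y)"] by (simp add: sums_def)
    then have "(\<lambda>K. \<Sum>i<n. \<Sum>k<K. (\<i> * of_real (t * ?l \<omega> i)) ^ k /\<^sub>R fact k) \<longlonglongrightarrow> (\<Sum>i<n. iexp (t * ?l \<omega> i))"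
      by (intro tendsto_sum)
    also have "(\<lambda>K. \<Sum>i<n. \<Sum>k<K. (\<i> * of_real (t * ?l \<omega> i)) ^ k /\<^sub>R fact k) =
       (\<lambda>K. \<Sum>k<K. ((\<i> * of_real t) ^ k /\<^sub>R fact k) * of_real (\<Sum>i<n. ?l \<omega> i ^ k))"
      by (subst sum.swap) (simp add: sum_distrib_left power_mult_distrib mult.assoc)
    finally show "(\<lambda>K. \<Sum>k<K. ((\<i> * of_real t) ^ k /\<^sub>R fact k) * of_real (\<Sum>i<n. ?l \<omega> i ^ k))
       \<longlonglongrightarrow> (\<Sum>i<n. iexp (t * ?l \<omega> i))" .
  next
    fix K
    have [measurable]: "(\<lambda>\<omega>. \<Sum>i<n. ?l \<omega> i ^ k) \<in> borel_measurable N" for k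
      by (rule measurable_sum_spec_power[OF r X])
    show "(\<lambda>\<omega>. \<Sum>k<K. ((\<i> * of_real t) ^ k /\<^sub>R fact k) * of_real (\<Sum>i<n. ?l \<omega> i ^ k)) \<in> borel_measurable N"
      by measurable
  qed
  then show ?thesis unfolding ecf_def by measurable
qed

lemma cmod_ecf_le: "cmod (ecf r hat n x t) \<le> 1"
proof (cases "n = 0")
  case False
  have "cmod (\<Sum>i<n. iexp (t * spec r hat n x i)) \<le> (\<Sum>i<n. 1)"
    by (intro order_trans[OF norm_sum] sum_mono) simp
  then show ?thesis using False by (simp add: ecf_def norm_divide)
qed (simp add: ecf_def)

lemma abs_Re_ecf_le: "\<bar>Re (ecf r hat n x t)\<bar> \<le> 1"
  and abs_Im_ecf_le: "\<bar>Im (ecf r hat n x t)\<bar> \<le> 1"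
  using abs_Re_le_cmod[of "ecf r hat n x t"] abs_Im_le_cmod[of "ecf r hat n x t"] cmod_ecf_le[of r hat n x t]
  by linarith+

lemma Re_ecf: "Re (ecf r hat n x t) = lin_stat r hat n (\<lambda>s. cos (t * s)) x"
  and Im_ecf: "Im (ecf r hat n x t) = lin_stat r hat n (\<lambda>s. sin (t * s)) x"
  by (simp_all add: ecf_def lin_stat_def Re_exp Im_exp Re_divide_of_nat Im_divide_of_nat)

text \<open>The mean value theorem for \<open>f\<close> moves the question to \<open>f'\<close> at
  two points no further apart than \<open>x\<close> and \<open>y\<close>, where \<open>f'\<close> is
  Lipschitz with constant \<open>K\<close>; this costs a factor 2 against the sharp
  remainder.\<close>

lemma taylor_square_bound:
  fixes f f' f'' :: "real \<Rightarrow> real"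
  assumes f: "\<And>x. (f has_real_derivative f' x) (at x)" and f': "\<And>x. (f' has_real_derivative f'' x) (at x)"
    and K: "\<And>x. \<bar>f'' x\<bar> \<le> K"
  shows "\<bar>f x - f y - f' x * (x - y)\<bar> \<le> K * (x - y)\<^sup>2"
proof -
  have lip: "\<bar>f' a - f' b\<bar> \<le> K * \<bar>a - b\<bar>" for a b
    using field_differentiable_bound[of UNIV f' f'' K a b] f' K by (simp add: has_field_derivative_at_within)
  have mvt: "\<exists>z. \<bar>x - z\<bar> \<le> \<bar>x - y\<bar> \<and> f x - f y = (x - y) * f' z"
  proof (cases x y rule: linorder_cases)
    case less
    from MVT2[OF less f] obtain z where "x < z" "z < y" "f y - f x = (y - x) * f' z" by blast
    then show ?thesis by (intro exI[of _ z]) (auto simp: algebra_simps)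
  next
    case greater
    from MVT2[OF greater f] obtain z where "y < z" "z < x" "f x - f y = (x - y) * f' z" by blast
    then show ?thesis by (intro exI[of _ z]) auto
  qed auto
  then obtain z where z: "\<bar>x - z\<bar> \<le> \<bar>x - y\<bar>" "f x - f y = (x - y) * f' z" by blast
  have K0: "0 \<le> K" using K[of 0] by linarith
  have "\<bar>f x - f y - f' x * (x - y)\<bar> = \<bar>x - y\<bar> * \<bar>f' z - f' x\<bar>"
    unfolding z(2) by (simp add: abs_mult[symmetric] algebra_simps)
  also have "\<dots> \<le> \<bar>x - y\<bar> * (K * \<bar>x - y\<bar>)"
    using lip[of z x] z(1) K0 by (intro mult_left_mono) (auto intro: order_trans mult_left_mono simp: abs_minus_commute)
  finally show ?thesis by (simp add: power2_eq_square abs_mult[symmetric] mult_ac)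
qed

lemma cos_sin_taylor:
  fixes t :: real
  assumes "f \<in> {\<lambda>s. cos (t * s), \<lambda>s. sin (t * s)}"
  shows "\<exists>f'. (\<forall>x. \<bar>f' x\<bar> \<le> \<bar>t\<bar>) \<and> (\<forall>x y. \<bar>f x - f y - f' x * (x - y)\<bar> \<le> t\<^sup>2 * (x - y)\<^sup>2)"
proof -
  have tt: "\<bar>t * (t * c)\<bar> \<le> t\<^sup>2" if "\<bar>c\<bar> \<le> 1" for c
  proof -
    have "\<bar>t * (t * c)\<bar> = t\<^sup>2 * \<bar>c\<bar>" by (simp add: abs_mult power2_eq_square mult.assoc[symmetric])
    then show ?thesis using that by (simp add: mult_left_le)
  qed
  from assms show ?thesis
  proof (elim insertE emptyE)
    assume f: "f = (\<lambda>s. cos (t * s))"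
    have "\<bar>f x - f y - (- t * sin (t * x)) * (x - y)\<bar> \<le> t\<^sup>2 * (x - y)\<^sup>2" for x y
      by (rule taylor_square_bound[where f' = "\<lambda>x. - t * sin (t * x)" and f'' = "\<lambda>x. - t * (t * cos (t * x))"])
        (use tt in \<open>auto simp: f intro!: derivative_eq_intros\<close>)
    moreover have "\<bar>- t * sin (t * x)\<bar> \<le> \<bar>t\<bar>" for x by (simp add: abs_mult mult_left_le)
    ultimately show ?thesis by (intro exI[of _ "\<lambda>x. - t * sin (t * x)"]) blast
  next
    assume f: "f = (\<lambda>s. sin (t * s))"
    have "\<bar>f x - f y - (t * cos (t * x)) * (x - y)\<bar> \<le> t\<^sup>2 * (x - y)\<^sup>2" for x y
      by (rule taylor_square_bound[where f' = "\<lambda>x. t * cos (t * x)" and f'' = "\<lambda>x. t * (- t * sin (t * x))"])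
        (use tt in \<open>auto simp: f intro!: derivative_eq_intros\<close>)
    moreover have "\<bar>t * cos (t * x)\<bar> \<le> \<bar>t\<bar>" for x by (simp add: abs_mult mult_left_le)
    ultimately show ?thesis by (intro exI[of _ "\<lambda>x. t * cos (t * x)"]) blast
  qed
qed

definition clip :: "real \<Rightarrow> real \<Rightarrow> real" where
  "clip C y = max (- C) (min C y)"

lemma abs_clip_le: "0 \<le> C \<Longrightarrow> \<bar>clip C y\<bar> \<le> C"
  by (auto simp: clip_def)

lemma clip_id: "\<bar>y\<bar> \<le> C \<Longrightarrow> clip C y = y"
  by (auto simp: clip_def)

lemma measurable_clip [measurable]: "clip C \<in> borel_measurable borel"
  unfolding clip_def by measurable

context prob_space
begin

text \<open>The Efron-Stein bound lives on a product space, so the statistic is transported to the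
  joint law of the inputs 0 to \<open>n\<close>, a product by independence. The constants are those
  of \<open>lin_stat_bounded_difference\<close> with first derivative at most
  \<open>\<bar>t\<bar>\<close> and remainder constant \<open>t^2\<close>.\<close>

lemma lin_stat_fourth_moment:
  fixes hat :: bool and f :: "real \<Rightarrow> real"
  assumes ind: "indep_vars (\<lambda>_. borel) x UNIV" and C: "0 \<le> C" "\<And>i. AE \<omega> in M. \<bar>x i \<omega>\<bar> \<le> C"
    and r: "r \<in> {1, 2}" and n: "n > 0"
    and f: "f \<in> {\<lambda>s. cos (t * s), \<lambda>s. sin (t * s)}"
  defines "Z \<equiv> \<lambda>\<omega>. lin_stat r hat n f (\<lambda>v. x v \<omega>)"
  shows "expectation (\<lambda>\<omega>. (Z \<omega> - expectation Z) ^ 4) \<le> 11 * ((16 * C\<^sup>2 * t\<^sup>2 + 256 * C ^ 4 * t ^ 4) / real n)\<^sup>2"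
proof -
  have xm[measurable]: "x i \<in> borel_measurable M" for i
    using ind by (auto simp: indep_vars_def)
  define N where "N v = distr M borel (x v)" for v
  have pN: "prob_space (N v)" for v unfolding N_def by (rule prob_space_distr) simp
  have sN[simp, measurable_cong]: "sets (N v) = sets borel" for v by (simp add: N_def)
  \<comment> \<open>The differences are controlled for inputs within \<open>[-C, C]\<close> only,
    while \<open>fourth_moment_bounded_differences\<close> asks for bounds at every point. Clipping
    provides them and changes the statistic on a null set only.\<close>
  define F where "F y = lin_stat r hat n f (\<lambda>v. clip C (y v))" for y
  let ?P = "PiM {..n} N"
  \<comment> \<open>The trigonometric averages are the real or imaginary part of \<open>ecf\<close>,
    from which they inherit measurability and the bound 1.\<close>
  have lin: "\<exists>part. part \<in> {Re, Im} \<and> (\<forall>y. lin_stat r hat n f y = part (ecf r hat n y t))"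
    using f by (auto simp: Re_ecf[symmetric] Im_ecf[symmetric])
  then obtain part where part: "part \<in> {Re, Im}" "\<And>y. lin_stat r hat n f y = part (ecf r hat n y t)" by blast
  have pm[measurable]: "part \<in> borel_measurable borel" using part(1) by auto
  have Fm: "F \<in> borel_measurable ?P" unfolding F_def part(2)
    by (rule measurable_compose[OF measurable_ecf[OF r] pm]) measurable
  have FB: "\<bar>F y\<bar> \<le> 1" for y
    unfolding F_def part(2) using part(1) abs_Re_ecf_le abs_Im_ecf_le by auto
  obtain f' where f': "\<And>x. \<bar>f' x\<bar> \<le> \<bar>t\<bar>" "\<And>x y. \<bar>f x - f y - f' x * (x - y)\<bar> \<le> t\<^sup>2 * (x - y)\<^sup>2"
    using cos_sin_taylor[OF f] by blast
  have "\<exists>b. (\<forall>v y. \<bar>y\<bar> \<le> C \<longrightarrow> (lin_stat r hat n f ((\<lambda>v. clip C (z v))(v := y)) - lin_stat r hat n f (\<lambda>v. clip C (z v)))\<^sup>2 \<le> b v) \<and>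
     (\<Sum>v\<le>n. b v) \<le> (16 * C\<^sup>2 * \<bar>t\<bar>\<^sup>2 + 256 * C ^ 4 * (t\<^sup>2)\<^sup>2) / real n" for z
    by (rule lin_stat_bounded_difference[OF r n C(1) _ f'(2,1)]) (use C in \<open>auto simp: abs_clip_le\<close>)
  then obtain b where b: "\<And>z v y. \<bar>y\<bar> \<le> C \<Longrightarrow> (lin_stat r hat n f ((\<lambda>v. clip C (z v))(v := y)) - F z)\<^sup>2 \<le> b z v"
    and bs: "\<And>z. (\<Sum>v\<le>n. b z v) \<le> (16 * C\<^sup>2 * \<bar>t\<bar>\<^sup>2 + 256 * C ^ 4 * (t\<^sup>2)\<^sup>2) / real n"
    unfolding F_def by metis
  have main: "(\<integral>y. (F y - (\<integral>y. F y \<partial>?P)) ^ 4 \<partial>?P) \<le> 11 * ((16 * C\<^sup>2 * \<bar>t\<bar>\<^sup>2 + 256 * C ^ 4 * (t\<^sup>2)\<^sup>2) / real n)\<^sup>2"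
  proof (rule fourth_moment_bounded_differences[where b = "\<lambda>v z. b z v", OF pN _ Fm FB _ bs])
    fix z :: "nat \<Rightarrow> real" and v :: nat and y :: real
    have "(\<lambda>w. clip C ((z(v := y)) w)) = (\<lambda>w. clip C (z w))(v := clip C y)" by auto
    then show "(F (z(v := y)) - F z)\<^sup>2 \<le> b z v"
      using b[OF abs_clip_le[OF C(1), of y], of z v] by (simp add: F_def)
  qed simp
  have D: "distr M (PiM {..n} (\<lambda>_. borel)) (\<lambda>\<omega>. \<lambda>v\<in>{..n}. x v \<omega>) = ?P"
    unfolding N_def
    by (subst indep_vars_iff_distr_eq_PiM[symmetric]) (use indep_vars_subset[OF ind] in auto)
  have int: "(\<integral>y. h (F y) \<partial>?P) = expectation (\<lambda>\<omega>. h (Z \<omega>))" if h: "h \<in> borel_measurable borel" for h :: "real \<Rightarrow> real"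
  proof -
    have Fm': "F \<in> borel_measurable (PiM {..n} (\<lambda>_. borel))"
      using Fm by (simp cong: measurable_cong_sets sets_PiM_cong)
    have "(\<integral>y. h (F y) \<partial>?P) = (\<integral>\<omega>. h (F (\<lambda>v\<in>{..n}. x v \<omega>)) \<partial>M)"
      unfolding D[symmetric] by (rule integral_distr) (use measurable_compose[OF Fm' h] in measurable)
    also have "\<dots> = expectation (\<lambda>\<omega>. h (Z \<omega>))"
    proof (rule integral_cong_AE)
      show "(\<lambda>\<omega>. h (F (\<lambda>v\<in>{..n}. x v \<omega>))) \<in> borel_measurable M"
        by (rule measurable_compose[OF _ measurable_compose[OF Fm' h]]) measurable
      show "(\<lambda>\<omega>. h (Z \<omega>)) \<in> borel_measurable M"
        unfolding Z_def part(2)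
        by (rule measurable_compose[OF measurable_compose[OF measurable_ecf[OF r] pm] h]) simp
      have "AE \<omega> in M. \<forall>v. \<bar>x v \<omega>\<bar> \<le> C" using C by (simp add: AE_all_countable)
      then show "AE \<omega> in M. h (F (\<lambda>v\<in>{..n}. x v \<omega>)) = h (Z \<omega>)"
      proof eventually_elim
        fix \<omega> assume "\<forall>v. \<bar>x v \<omega>\<bar> \<le> C"
        then have "F (\<lambda>v\<in>{..n}. x v \<omega>) = Z \<omega>"
          unfolding F_def Z_def part(2) by (intro arg_cong[where f = part] ecf_cong r) (auto simp: clip_id)
        then show "h (F (\<lambda>v\<in>{..n}. x v \<omega>)) = h (Z \<omega>)" by simp
      qed
    qed
    finally show ?thesis .
  qed
  have "(\<integral>y. F y \<partial>?P) = expectation Z" using int[of "\<lambda>y. y"] by simp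
  with main int[of "\<lambda>y. (y - expectation Z) ^ 4"] show ?thesis by (simp flip: power_mult)
qed

text \<open>The fourth moments are summable, so the series of fourth powers has finite expectation
  and converges almost surely; its terms then vanish. No passage to subsequences is
  involved.\<close>

lemma AE_tendsto_zero_fourth_moment:
  fixes Y :: "nat \<Rightarrow> 'a \<Rightarrow> real"
  assumes Y[measurable]: "\<And>n. Y n \<in> borel_measurable M" and B: "\<And>n \<omega>. \<bar>Y n \<omega>\<bar> \<le> B"
    and K: "\<And>n. n > 0 \<Longrightarrow> expectation (\<lambda>\<omega>. Y n \<omega> ^ 4) \<le> K / (real n)\<^sup>2"
  shows "AE \<omega> in M. (\<lambda>n. Y n \<omega>) \<longlonglongrightarrow> 0"
proof -
  have i: "integrable M (\<lambda>\<omega>. Y n \<omega> ^ 4)" for n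
    by (rule integrable_bounded[where B = "B ^ 4"]) (use power_mono[OF B abs_ge_zero, of _ _ 4] in \<open>auto simp: power_abs\<close>)
  have sm: "summable (\<lambda>n. expectation (\<lambda>\<omega>. Y (Suc n) \<omega> ^ 4))"
  proof (rule summable_comparison_test')
    show "summable (\<lambda>n. K * (1 / (real (Suc n))\<^sup>2))"
      using inverse_squares_sums by (intro summable_mult) (auto simp: sums_iff add.commute)
    show "norm (expectation (\<lambda>\<omega>. Y (Suc n) \<omega> ^ 4)) \<le> K * (1 / (real (Suc n))\<^sup>2)" for n
      using K[of "Suc n"] Bochner_Integration.integral_nonneg[of M "\<lambda>\<omega>. Y (Suc n) \<omega> ^ 4"] by simp
  qed
  have "(\<integral>\<^sup>+\<omega>. (\<Sum>n. ennreal (Y (Suc n) \<omega> ^ 4)) \<partial>M) = (\<Sum>n. \<integral>\<^sup>+\<omega>. ennreal (Y (Suc n) \<omega> ^ 4) \<partial>M)"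
    by (rule nn_integral_suminf) measurable
  also have "\<dots> = (\<Sum>n. ennreal (expectation (\<lambda>\<omega>. Y (Suc n) \<omega> ^ 4)))"
    by (intro suminf_cong nn_integral_eq_integral i) auto
  also have "\<dots> = ennreal (\<Sum>n. expectation (\<lambda>\<omega>. Y (Suc n) \<omega> ^ 4))"
    by (rule suminf_ennreal2[OF _ sm]) (rule Bochner_Integration.integral_nonneg, simp)
  finally have fin: "(\<integral>\<^sup>+\<omega>. (\<Sum>n. ennreal (Y (Suc n) \<omega> ^ 4)) \<partial>M) \<noteq> \<infinity>"
    by (simp only: infinity_ennreal_def ennreal_neq_top not_False_eq_True)
  have "AE \<omega> in M. (\<Sum>n. ennreal (Y (Suc n) \<omega> ^ 4)) \<noteq> \<infinity>"
    by (rule nn_integral_PInf_AE[OF _ fin]) measurable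
  then show ?thesis
  proof eventually_elim
    fix \<omega> assume "(\<Sum>n. ennreal (Y (Suc n) \<omega> ^ 4)) \<noteq> \<infinity>"
    then have "summable (\<lambda>n. Y (Suc n) \<omega> ^ 4)" by (intro summable_suminf_not_top) auto
    then have "(\<lambda>n. Y (Suc n) \<omega> ^ 4) \<longlonglongrightarrow> 0" by (rule summable_LIMSEQ_zero)
    then have "(\<lambda>n. root 4 (Y (Suc n) \<omega> ^ 4)) \<longlonglongrightarrow> root 4 0" by (rule tendsto_real_root)
    moreover have "root 4 (y ^ 4) = \<bar>y\<bar>" for y :: real
      using real_root_power_cancel[of 4 "\<bar>y\<bar>"] by simp
    ultimately have "(\<lambda>n. \<bar>Y (Suc n) \<omega>\<bar>) \<longlonglongrightarrow> 0" by simp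
    then have "(\<lambda>n. Y (Suc n) \<omega>) \<longlonglongrightarrow> 0" by (rule tendsto_rabs_zero_cancel)
    then show "(\<lambda>n. Y n \<omega>) \<longlonglongrightarrow> 0" by (rule LIMSEQ_imp_Suc)
  qed
qed

theorem ecf_concentration:
  assumes ind: "indep_vars (\<lambda>_. borel) x UNIV" and C: "\<And>i. AE \<omega> in M. \<bar>x i \<omega>\<bar> \<le> C"
    and r: "r \<in> {1, 2}"
  shows "AE \<omega> in M. (\<lambda>n. ecf r hat n (\<lambda>v. x v \<omega>) t - expectation (\<lambda>\<omega>. ecf r hat n (\<lambda>v. x v \<omega>) t)) \<longlonglongrightarrow> 0"
proof -
  have C0: "0 \<le> max C 0" "AE \<omega> in M. \<bar>x i \<omega>\<bar> \<le> max C 0" for i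
    by (simp, rule eventually_mono[OF C[of i]]) simp
  have xm[measurable]: "x i \<in> borel_measurable M" for i
    using ind by (auto simp: indep_vars_def)
  have em: "(\<lambda>\<omega>. ecf r hat n (\<lambda>v. x v \<omega>) t) \<in> borel_measurable M" for n by (rule measurable_ecf[OF r]) simp
  have ei: "integrable M (\<lambda>\<omega>. ecf r hat n (\<lambda>v. x v \<omega>) t)" for n
    by (rule integrable_const_bound[where B = 1]) (use em cmod_ecf_le in auto)
  have conv: "AE \<omega> in M. (\<lambda>n. part (ecf r hat n (\<lambda>v. x v \<omega>) t) - part (expectation (\<lambda>\<omega>. ecf r hat n (\<lambda>v. x v \<omega>) t))) \<longlonglongrightarrow> 0"
    if p: "part = Re \<and> f = (\<lambda>s. cos (t * s)) \<or> part = Im \<and> f = (\<lambda>s. sin (t * s))" for part and f :: "real \<Rightarrow> real"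
  proof -
    have pe: "part (ecf r hat n y t) = lin_stat r hat n f y" for n y using p by (auto simp: Re_ecf Im_ecf)
    have pE: "part (expectation (\<lambda>\<omega>. ecf r hat n (\<lambda>v. x v \<omega>) t)) = expectation (\<lambda>\<omega>. lin_stat r hat n f (\<lambda>v. x v \<omega>))" for n
      using p ei[of n] by (auto simp: pe[symmetric])
    have lm[measurable]: "(\<lambda>\<omega>. lin_stat r hat n f (\<lambda>v. x v \<omega>)) \<in> borel_measurable M" for n
      unfolding pe[symmetric] using p em[of n] by auto
    have lB: "\<bar>lin_stat r hat n f y\<bar> \<le> 1" for n y
      unfolding pe[symmetric] using p abs_Re_ecf_le abs_Im_ecf_le by auto
    show ?thesis unfolding pe pE
    proof (rule AE_tendsto_zero_fourth_moment[where B = 2])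
      fix n \<omega>
      show "\<bar>lin_stat r hat n f (\<lambda>v. x v \<omega>) - expectation (\<lambda>\<omega>. lin_stat r hat n f (\<lambda>v. x v \<omega>))\<bar> \<le> 2"
        using lB[of n "\<lambda>v. x v \<omega>"] abs_integral_bounded[OF lm[of n] lB] by linarith
    next
      fix n :: nat assume n: "n > 0"
      have "f \<in> {\<lambda>s. cos (t * s), \<lambda>s. sin (t * s)}" using p by auto
      from lin_stat_fourth_moment[OF ind C0 r n this]
      show "expectation (\<lambda>\<omega>. (lin_stat r hat n f (\<lambda>v. x v \<omega>) - expectation (\<lambda>\<omega>. lin_stat r hat n f (\<lambda>v. x v \<omega>))) ^ 4)
          \<le> 11 * (16 * (max C 0)\<^sup>2 * t\<^sup>2 + 256 * (max C 0) ^ 4 * t ^ 4)\<^sup>2 / (real n)\<^sup>2"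
        by (simp add: power_divide)
    qed measurable
  qed
  have "AE \<omega> in M. (\<lambda>n. Re (ecf r hat n (\<lambda>v. x v \<omega>) t) - Re (expectation (\<lambda>\<omega>. ecf r hat n (\<lambda>v. x v \<omega>) t))) \<longlonglongrightarrow> 0"
    by (rule conv) auto
  moreover have "AE \<omega> in M. (\<lambda>n. Im (ecf r hat n (\<lambda>v. x v \<omega>) t) - Im (expectation (\<lambda>\<omega>. ecf r hat n (\<lambda>v. x v \<omega>) t))) \<longlonglongrightarrow> 0"
    by (rule conv) auto
  ultimately show ?thesis
    by eventually_elim (simp add: tendsto_complex_iff)
qed

end

section \<open>Closed walks and matchings\<close>

lemma sum_PiE_insert:
  assumes "a \<notin> A"
  shows "(\<Sum>f\<in>PiE (insert a A) B. g f) = (\<Sum>f\<in>PiE A B. \<Sum>b\<in>B a. g (f(a := b)))"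
proof -
  have "(\<Sum>f\<in>PiE (insert a A) B. g f) = (\<Sum>p\<in>B a \<times> PiE A B. g ((\<lambda>(y, f). f(a := y)) p))"
    unfolding PiE_insert_eq by (subst sum.reindex[OF inj_combinator[OF assms]]) simp
  also have "\<dots> = (\<Sum>b\<in>B a. \<Sum>f\<in>PiE A B. g (f(a := b)))"
    unfolding sum.cartesian_product by (intro sum.cong refl) auto
  also have "\<dots> = (\<Sum>f\<in>PiE A B. \<Sum>b\<in>B a. g (f(a := b)))" by (rule sum.swap)
  finally show ?thesis .
qed

definition steps :: "nat \<Rightarrow> nat \<Rightarrow> (nat \<Rightarrow> int) set" where
  "steps N k = PiE {..<k} (\<lambda>_. {0..<int N})"

definition walk :: "nat \<Rightarrow> int \<Rightarrow> (nat \<Rightarrow> int) \<Rightarrow> nat \<Rightarrow> int" where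
  "walk N p s j = (p + (\<Sum>i<j. s i)) mod int N"

text \<open>The value 0 outside the index range removes the walks on the larger group of order
  \<open>2 * n\<close> that leave the first \<open>n\<close> residues. Only upper limits are tested,
  as positions of a walk are nonnegative.\<close>

definition cell :: "bool \<Rightarrow> nat \<Rightarrow> int \<Rightarrow> int \<Rightarrow> real" where
  "cell hat n a b = (if a < int n \<and> b < int n then (if hat then of_int (sgn (int n - 1 - a - b)) else 1) else 0)"

definition walk_weight :: "nat \<Rightarrow> bool \<Rightarrow> nat \<Rightarrow> nat \<Rightarrow> int \<Rightarrow> (nat \<Rightarrow> int) \<Rightarrow> real" where
  "walk_weight r hat n k p s = (\<Prod>j<k. cell hat n (walk (r * n) p s j) (walk (r * n) p s (Suc j)))"

lemma finite_steps [simp]: "finite (steps N k)"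
  unfolding steps_def by (intro finite_PiE) auto

lemma abs_cell_le: "\<bar>cell hat n a b\<bar> \<le> 1"
  by (auto simp: cell_def sgn_if)

lemma abs_walk_weight_le: "\<bar>walk_weight r hat n k p s\<bar> \<le> 1"
  unfolding walk_weight_def abs_prod by (intro prod_le_1) (auto simp: abs_cell_le)

lemma walk_range: "N > 0 \<Longrightarrow> 0 \<le> walk N p s j \<and> walk N p s j < int N"
  by (simp add: walk_def)

lemma walk_Suc: "walk N p s (Suc j) = (walk N p s j + s j) mod int N"
  by (simp add: walk_def mod_add_left_eq add.assoc)

lemma walk_cong: "(\<And>i. i < j \<Longrightarrow> s i = s' i) \<Longrightarrow> walk N p s j = walk N p s' j"
  by (simp add: walk_def)

lemma walk_cong_mod:
  assumes "\<And>i. i < j \<Longrightarrow> s i mod int N = s' i mod int N"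
  shows "walk N p s j = walk N p s' j"
proof -
  have "(\<Sum>i<j. s i) mod int N = (\<Sum>i<j. s' i) mod int N"
    by (subst (1 2) mod_sum_eq[symmetric]) (use assms in simp)
  then show ?thesis unfolding walk_def by (metis mod_add_right_eq)
qed

text \<open>Each path of row indices in a matrix power is recorded by its differences in the cyclic
  group. In the inductive step the sum over the last intermediate index is traded for a sum over the
  last step.\<close>

lemma mpow_walk_expansion:
  assumes r: "r > 0" and n: "n > 0" and p: "p < n" and q: "q < n"
  shows "mpow n (scaled r hat n x) k p q = (real n powr (- 1 / 2)) ^ k *
    (\<Sum>s\<in>steps (r * n) k. if walk (r * n) (int p) s k = int q
       then walk_weight r hat n k (int p) s * (\<Prod>j<k. x (cdist (r * n) (s j))) else 0)"
  using q
proof (induction k arbitrary: q)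
  case 0
  have "p < r * n" using p r by (metis less_le_trans mult_le_mono1 nat_mult_1 Suc_leI One_nat_def)
  then have w: "walk (r * n) (int p) s 0 = int p" for s
    by (simp add: walk_def del: of_nat_mult)
  have st: "steps (r * n) 0 = {\<lambda>_. undefined}" by (simp add: steps_def)
  show ?case unfolding st by (simp add: w walk_weight_def)
next
  case (Suc k)
  let ?N = "r * n" and ?c = "real n powr (- 1 / 2)" and ?P = "int p"
  let ?W = "\<lambda>s. walk_weight r hat n k ?P s * (\<Prod>j<k. x (cdist ?N (s j)))"
  have N: "?N > 0" using r n by simp
  have qN: "int q < int ?N"
    using Suc.prems r by (metis less_le_trans mult_le_mono1 nat_mult_1 Suc_leI One_nat_def of_nat_less_iff)
  have cellh: "?c * (cell hat n (int h) (int q) * x (cdist ?N (int q - int h))) = scaled r hat n x h q" if "h < n" for h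
    using that Suc.prems cdist_commute[OF N, of "int q" "int h"] by (simp add: cell_def scaled_def mask_def)
  \<comment> \<open>Exactly one residue leads from \<open>w\<close> to \<open>q\<close>, so the sum
    over all steps has a single nonzero term.\<close>
  have inner: "(\<Sum>t\<in>{0..<int ?N}. if (w + t) mod int ?N = int q then cell hat n w ((w + t) mod int ?N) * x (cdist ?N t) else 0)
       = cell hat n w (int q) * x (cdist ?N (int q - w))" for w
  proof -
    let ?t = "(int q - w) mod int ?N"
    have t: "(w + t) mod int ?N = int q \<longleftrightarrow> t = ?t" if "t \<in> {0..<int ?N}" for t
    proof
      assume "(w + t) mod int ?N = int q"
      then have "?t = ((w + t) - w) mod int ?N" by (metis mod_diff_left_eq)
      then show "t = ?t" using that by simp
    next
      assume "t = ?t"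
      then have "(w + t) mod int ?N = int q mod int ?N" by (simp add: mod_add_right_eq)
      then show "(w + t) mod int ?N = int q" using qN by simp
    qed
    have cd: "cdist ?N ?t = cdist ?N (int q - w)"
      by (simp add: cdist_def)
    have "(\<Sum>t\<in>{0..<int ?N}. if (w + t) mod int ?N = int q then cell hat n w ((w + t) mod int ?N) * x (cdist ?N t) else 0)
       = (\<Sum>t\<in>{0..<int ?N}. if t = ?t then cell hat n w (int q) * x (cdist ?N ?t) else 0)"
    proof (intro sum.cong refl)
      fix t' assume t': "t' \<in> {0..<int ?N}"
      show "(if (w + t') mod int ?N = int q then cell hat n w ((w + t') mod int ?N) * x (cdist ?N t') else 0) =
          (if t' = ?t then cell hat n w (int q) * x (cdist ?N ?t) else 0)"
      proof (cases "t' = ?t")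
        case True
        then have "(w + ?t) mod int ?N = int q" using t[OF t'] by blast
        then show ?thesis by (simp only: True if_True refl)
      next
        case False
        then show ?thesis using t[OF t'] by (simp only: if_False)
      qed
    qed
    also have "\<dots> = cell hat n w (int q) * x (cdist ?N ?t)"
      using N by (subst sum.delta) auto
    finally show ?thesis unfolding cd .
  qed
  have "mpow n (scaled r hat n x) (Suc k) p q = (\<Sum>h<n. mpow n (scaled r hat n x) k p h * scaled r hat n x h q)"
    by simp
  also have "\<dots> = (\<Sum>h<n. \<Sum>s\<in>steps ?N k. if walk ?N ?P s k = int h then ?c ^ k * ?W s * (?c * (cell hat n (walk ?N ?P s k) (int q) * x (cdist ?N (int q - walk ?N ?P s k)))) else 0)"
  proof (intro sum.cong refl)
    fix h assume "h \<in> {..<n}"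
    then have h: "h < n" by simp
    show "mpow n (scaled r hat n x) k p h * scaled r hat n x h q =
      (\<Sum>s\<in>steps ?N k. if walk ?N ?P s k = int h then ?c ^ k * ?W s * (?c * (cell hat n (walk ?N ?P s k) (int q) * x (cdist ?N (int q - walk ?N ?P s k)))) else 0)"
      unfolding Suc.IH[OF h] sum_distrib_left sum_distrib_right
    proof (intro sum.cong refl)
      fix s
      show "?c ^ k * (if walk ?N ?P s k = int h then ?W s else 0) * scaled r hat n x h q =
        (if walk ?N ?P s k = int h then ?c ^ k * ?W s * (?c * (cell hat n (walk ?N ?P s k) (int q) * x (cdist ?N (int q - walk ?N ?P s k)))) else 0)"
      proof (cases "walk ?N ?P s k = int h")
        case True
        then show ?thesis by (simp only: True if_True cellh[OF h])
      qed simp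
    qed
  qed
  also have "\<dots> = (\<Sum>s\<in>steps ?N k. \<Sum>h<n. if walk ?N ?P s k = int h then ?c ^ k * ?W s * (?c * (cell hat n (walk ?N ?P s k) (int q) * x (cdist ?N (int q - walk ?N ?P s k)))) else 0)"
    by (rule sum.swap)
  also have "\<dots> = (\<Sum>s\<in>steps ?N k. ?c ^ Suc k * (?W s * (cell hat n (walk ?N ?P s k) (int q) * x (cdist ?N (int q - walk ?N ?P s k)))))"
  proof (intro sum.cong refl)
    fix s
    let ?w = "walk ?N ?P s k"
    have w0: "0 \<le> ?w" using walk_range[OF N] by simp
    have "(\<Sum>h<n. if ?w = int h then ?c ^ k * ?W s * (?c * (cell hat n ?w (int q) * x (cdist ?N (int q - ?w)))) else 0)
       = (\<Sum>h<n. if h = nat ?w then ?c ^ k * ?W s * (?c * (cell hat n ?w (int q) * x (cdist ?N (int q - ?w)))) else 0)"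
      using w0 by (intro sum.cong refl if_cong) auto
    also have "\<dots> = (if nat ?w < n then ?c ^ k * ?W s * (?c * (cell hat n ?w (int q) * x (cdist ?N (int q - ?w)))) else 0)"
      by (subst sum.delta) auto
    \<comment> \<open>The cell vanishes outside the index range, so the test on \<open>?w\<close> is
      absorbed by it.\<close>
    also have "\<dots> = ?c ^ Suc k * (?W s * (cell hat n ?w (int q) * x (cdist ?N (int q - ?w))))"
      using w0 by (auto simp: cell_def)
    finally show "(\<Sum>h<n. if ?w = int h then ?c ^ k * ?W s * (?c * (cell hat n ?w (int q) * x (cdist ?N (int q - ?w)))) else 0)
       = ?c ^ Suc k * (?W s * (cell hat n ?w (int q) * x (cdist ?N (int q - ?w))))" .
  qed
  also have "\<dots> = ?c ^ Suc k * (\<Sum>s\<in>steps ?N k. ?W s * (\<Sum>t\<in>{0..<int ?N}. if (walk ?N ?P s k + t) mod int ?N = int q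
      then cell hat n (walk ?N ?P s k) ((walk ?N ?P s k + t) mod int ?N) * x (cdist ?N t) else 0))"
    unfolding inner sum_distrib_left ..
  also have "(\<Sum>s\<in>steps ?N k. ?W s * (\<Sum>t\<in>{0..<int ?N}. if (walk ?N ?P s k + t) mod int ?N = int q
      then cell hat n (walk ?N ?P s k) ((walk ?N ?P s k + t) mod int ?N) * x (cdist ?N t) else 0)) =
    (\<Sum>s\<in>steps ?N k. \<Sum>t\<in>{0..<int ?N}. (\<lambda>s. if walk ?N ?P s (Suc k) = int q
       then walk_weight r hat n (Suc k) ?P s * (\<Prod>j<Suc k. x (cdist ?N (s j))) else 0) (s(k := t)))"
  proof (intro sum.cong refl, unfold sum_distrib_left, intro sum.cong refl)
    fix s t
    have w: "walk ?N ?P (s(k := t)) j = walk ?N ?P s j" if "j \<le> k" for j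
      by (rule walk_cong) (use that in auto)
    have 1: "walk ?N ?P (s(k := t)) (Suc k) = (walk ?N ?P s k + t) mod int ?N"
      unfolding walk_Suc w[OF order_refl] by simp
    have "walk_weight r hat n k ?P (s(k := t)) = walk_weight r hat n k ?P s"
      unfolding walk_weight_def by (intro prod.cong refl arg_cong2[where f = "cell hat n"] w) auto
    then have 2: "walk_weight r hat n (Suc k) ?P (s(k := t)) =
        walk_weight r hat n k ?P s * cell hat n (walk ?N ?P s k) ((walk ?N ?P s k + t) mod int ?N)"
      using w[OF order_refl] by (simp only: walk_weight_def prod.lessThan_Suc 1)
    have 3: "(\<Prod>j<Suc k. x (cdist ?N ((s(k := t)) j))) = (\<Prod>j<k. x (cdist ?N (s j))) * x (cdist ?N t)" by simp
    show "?W s * (if (walk ?N ?P s k + t) mod int ?N = int q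
        then cell hat n (walk ?N ?P s k) ((walk ?N ?P s k + t) mod int ?N) * x (cdist ?N t) else 0) =
      (\<lambda>s. if walk ?N ?P s (Suc k) = int q
       then walk_weight r hat n (Suc k) ?P s * (\<Prod>j<Suc k. x (cdist ?N (s j))) else 0) (s(k := t))"
      unfolding 1 2 3 by simp
  qed
  also have "\<dots> = (\<Sum>s\<in>steps ?N (Suc k). if walk ?N ?P s (Suc k) = int q
       then walk_weight r hat n (Suc k) ?P s * (\<Prod>j<Suc k. x (cdist ?N (s j))) else 0)"
    unfolding steps_def lessThan_Suc by (rule sum_PiE_insert[symmetric]) simp
  finally show ?case .
qed

definition closed_steps :: "nat \<Rightarrow> nat \<Rightarrow> (nat \<Rightarrow> int) set" where
  "closed_steps N k = {s \<in> steps N k. int N dvd (\<Sum>i<k. s i)}"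

lemma finite_closed_steps [simp]: "finite (closed_steps N k)"
  by (simp add: closed_steps_def)

text \<open>Whether a walk closes depends on the sum of its steps and not on its start. Start and
  steps therefore separate: the inputs see only the steps, the start enters only the weight.\<close>

lemma trace_walk_expansion:
  assumes r: "r \<in> {1, 2}" and n: "n > 0"
  shows "(\<Sum>i<n. spec r hat n x i ^ k) = (real n powr (- 1 / 2)) ^ k *
    (\<Sum>p<n. \<Sum>s\<in>closed_steps (r * n) k. walk_weight r hat n k (int p) s * (\<Prod>j<k. x (cdist (r * n) (s j))))"
proof -
  have r0: "r > 0" using r by auto
  have "mpow n (scaled r hat n x) k p p = (real n powr (- 1 / 2)) ^ k *
     (\<Sum>s\<in>closed_steps (r * n) k. walk_weight r hat n k (int p) s * (\<Prod>j<k. x (cdist (r * n) (s j))))" if p: "p < n" for p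
  proof -
    have "int p < int (r * n)" using p r by auto
    then have wd: "walk (r * n) (int p) s k = int p \<longleftrightarrow> int (r * n) dvd (\<Sum>i<k. s i)" for s
    proof -
      have "walk (r * n) (int p) s k = int p \<longleftrightarrow> (int p + (\<Sum>i<k. s i)) mod int (r * n) = int p mod int (r * n)"
        using \<open>int p < int (r * n)\<close> by (simp add: walk_def)
      then show ?thesis by (simp add: mod_eq_dvd_iff)
    qed
    show ?thesis
      unfolding mpow_walk_expansion[OF r0 n p p] closed_steps_def wd
      by (simp only: sum.inter_filter[OF finite_steps])
  qed
  then show ?thesis unfolding sum_spec_power[OF r] by (simp add: sum_distrib_left)
qed

text \<open>Pair partitions of the \<open>k\<close> steps, encoded as involutions without fixed
  points so that the partner of a step is a function value; extensionality makes the encoding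
  unique.\<close>

definition matchings :: "nat \<Rightarrow> (nat \<Rightarrow> nat) set" where
  "matchings k = {\<sigma> \<in> PiE {..<k} (\<lambda>_. {..<k}). \<forall>i<k. \<sigma> i \<noteq> i \<and> \<sigma> (\<sigma> i) = i}"

lemma finite_matchings [simp]: "finite (matchings k)"
  unfolding matchings_def by (rule finite_subset[of _ "PiE {..<k} (\<lambda>_. {..<k})"]) (auto intro: finite_PiE)

definition opposite :: "nat \<Rightarrow> nat \<Rightarrow> (nat \<Rightarrow> nat) \<Rightarrow> (nat \<Rightarrow> int) \<Rightarrow> bool" where
  "opposite N k \<sigma> s \<longleftrightarrow> (\<forall>i<k. int N dvd s i + s (\<sigma> i))"

definition step_class :: "nat \<Rightarrow> nat \<Rightarrow> (nat \<Rightarrow> int) \<Rightarrow> nat \<Rightarrow> nat set" where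
  "step_class N k s i = {j. j < k \<and> cdist N (s j) = cdist N (s i)}"

text \<open>Steps whose contribution to the expected trace may differ from the number of matchings
  with opposite steps.\<close>

definition bad_steps :: "nat \<Rightarrow> nat \<Rightarrow> (nat \<Rightarrow> int) set" where
  "bad_steps N k = {s \<in> steps N k. 2 * card ((\<lambda>i. cdist N (s i)) ` {..<k}) < k} \<union>
     {s \<in> closed_steps N k. (\<forall>i<k. card (step_class N k s i) = 2) \<and> (\<exists>i<k. \<forall>j\<in>step_class N k s i. s j = s i)}"

lemma card_steps_determined:
  assumes A: "A \<subseteq> steps N k" and J: "J \<subseteq> {..<k}"
    and det: "\<And>s s'. s \<in> A \<Longrightarrow> s' \<in> A \<Longrightarrow> (\<And>j. j \<in> J \<Longrightarrow> s j = s' j) \<Longrightarrow> s = s'"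
  shows "card A \<le> N ^ card J"
proof -
  have fJ: "finite J" using J finite_subset by blast
  have "inj_on (\<lambda>s. restrict s J) A"
  proof (rule inj_onI)
    fix s s' assume s: "s \<in> A" "s' \<in> A" "restrict s J = restrict s' J"
    show "s = s'" by (rule det[OF s(1,2)]) (metis s(3) restrict_apply')
  qed
  moreover have "(\<lambda>s. restrict s J) ` A \<subseteq> PiE J (\<lambda>_. {0..<int N})"
  proof (rule image_subsetI)
    fix s assume "s \<in> A"
    then have "s \<in> PiE {..<k} (\<lambda>_. {0..<int N})" using A by (auto simp: steps_def)
    then show "restrict s J \<in> PiE J (\<lambda>_. {0..<int N})"
      using J by (intro restrict_PiE_iff[THEN iffD2] ballI) (auto simp: PiE_iff)
  qed
  ultimately have "card A \<le> card (PiE J (\<lambda>_. {0..<int N}))"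
    by (rule card_inj_on_le) (use fJ in \<open>auto intro: finite_PiE\<close>)
  then show ?thesis using fJ by (simp add: card_PiE)
qed

lemma steps_eqI:
  assumes "s \<in> steps N k" "s' \<in> steps N k" "\<And>i. i < k \<Longrightarrow> s i = s' i" shows "s = s'"
  by (rule PiE_ext[of _ "{..<k}" "\<lambda>_. {0..<int N}"]) (use assms in \<open>auto simp: steps_def\<close>)

text \<open>Within a class of equal distances all steps agree up to sign with the step at one
  representative, here the least index. The representatives and signs form a code with boundedly
  many values for given \<open>k\<close>; once it is fixed, only the steps at representatives are
  free.\<close>

lemma step_code:
  assumes s: "s \<in> steps N k" and N: "N > 0"
  shows "\<exists>\<tau>\<in>PiE {..<k} (\<lambda>_. {..<k}). \<exists>\<epsilon>\<in>PiE {..<k} (\<lambda>_. UNIV :: bool set).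
    (\<forall>i<k. s i = (if \<epsilon> i then s (\<tau> i) else (- s (\<tau> i)) mod int N) \<and> cdist N (s (\<tau> i)) = cdist N (s i)) \<and>
    (\<forall>i<k. \<forall>j<k. cdist N (s i) = cdist N (s j) \<longrightarrow> \<tau> i = \<tau> j)"
proof -
  define \<tau> where "\<tau> = (\<lambda>i\<in>{..<k}. LEAST j. j < k \<and> cdist N (s j) = cdist N (s i))"
  define \<epsilon> where "\<epsilon> = (\<lambda>i\<in>{..<k}. s i = s (\<tau> i))"
  have L: "\<tau> i < k \<and> cdist N (s (\<tau> i)) = cdist N (s i)" if "i < k" for i
    unfolding \<tau>_def using that by simp (rule LeastI[of _ i], simp)
  have eq: "s i = (- s (\<tau> i)) mod int N" if i: "i < k" and ne: "s i \<noteq> s (\<tau> i)" for i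
  proof -
    have r: "0 \<le> s i" "s i < int N" "0 \<le> s (\<tau> i)" "s (\<tau> i) < int N"
      using s i L[OF i] by (auto simp: steps_def PiE_iff)
    have "int N dvd s i - s (\<tau> i) \<or> int N dvd s i + s (\<tau> i)"
      using L[OF i] cdist_eq_iff[OF N] by metis
    moreover have "\<not> int N dvd s i - s (\<tau> i)"
    proof
      assume "int N dvd s i - s (\<tau> i)"
      then have "s i mod int N = s (\<tau> i) mod int N" by (simp add: mod_eq_dvd_iff)
      then show False using r ne by simp
    qed
    ultimately have "int N dvd s i - (- s (\<tau> i))" by simp
    then have "s i mod int N = (- s (\<tau> i)) mod int N" by (simp only: mod_eq_dvd_iff)
    then show ?thesis using r by simp
  qed
  show ?thesis
  proof (intro bexI[of _ \<tau>] bexI[of _ \<epsilon>] conjI)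
    show "\<forall>i<k. s i = (if \<epsilon> i then s (\<tau> i) else (- s (\<tau> i)) mod int N) \<and> cdist N (s (\<tau> i)) = cdist N (s i)"
      using L eq by (auto simp: \<epsilon>_def)
    show "\<forall>i<k. \<forall>j<k. cdist N (s i) = cdist N (s j) \<longrightarrow> \<tau> i = \<tau> j" by (simp add: \<tau>_def)
    show "\<epsilon> \<in> PiE {..<k} (\<lambda>_. UNIV)" by (simp add: \<epsilon>_def)
    show "\<tau> \<in> PiE {..<k} (\<lambda>_. {..<k})" using L by (auto simp: PiE_iff \<tau>_def)
  qed
qed

text \<open>Doubling modulo \<open>N\<close> need not be injective, but it is on each half of the
  residues: there \<open>2 * a\<close> and \<open>2 * b\<close> differ by less than
  \<open>N\<close>.\<close>

lemma doubled_residue_eqI: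
  fixes a b :: int
  assumes "int N dvd 2 * a - 2 * b" "(2 * a < int N) = (2 * b < int N)"
    and "0 \<le> a" "a < int N" "0 \<le> b" "b < int N"
  shows "a = b"
proof (rule ccontr)
  assume "a \<noteq> b"
  then have "\<bar>int N\<bar> \<le> \<bar>2 * a - 2 * b\<bar>" using assms(1) by (intro dvd_imp_le_int) auto
  then show False using assms(2-) by (cases "2 * a < int N") auto
qed

text \<open>Too few distances leave fewer than k/2 free steps. In the other case there are k/2
  pairs, but one pair consists of equal instead of opposite steps; then the closing condition
  determines twice its step modulo \<open>N\<close>, which again costs one degree of freedom. The
  exponent is the largest integer below k/2 for positive \<open>k\<close>.\<close>

lemma card_bad_steps:
  "\<exists>K. \<forall>N>0. real (card (bad_steps N k)) \<le> K * real N ^ ((k - 1) div 2)"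
proof -
  define T where "T = PiE {..<k} (\<lambda>_. {..<k})"
  define E where "E = PiE {..<k} (\<lambda>_. UNIV :: bool set)"
  define m where "m = (k - 1) div 2"
  have fin: "finite T" "finite E" unfolding T_def E_def by (auto intro: finite_PiE)
  have bound: "card (bad_steps N k) \<le> (card T * card E + card T * card E * k * 2) * N ^ m" if N: "N > 0" for N
  proof -
    define Q where "Q \<tau> \<epsilon> s \<longleftrightarrow> s \<in> steps N k \<and> (\<forall>i<k. s i = (if \<epsilon> i then s (\<tau> i) else (- s (\<tau> i)) mod int N))"
      for \<tau> :: "nat \<Rightarrow> nat" and \<epsilon> s
    define A1 where "A1 = (\<lambda>(\<tau>, \<epsilon>). {s. Q \<tau> \<epsilon> s \<and> card (\<tau> ` {..<k}) \<le> m})"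
    \<comment> \<open>Here \<open>b\<close> points to the pair of equal steps, and the bit
      \<open>z\<close> tells in which half of the residues the step lies, so that it can be
      recovered from its double.\<close>
    define A2 where "A2 = (\<lambda>(\<tau>, \<epsilon>, b, z). {s. Q \<tau> \<epsilon> s \<and> int N dvd (\<Sum>i<k. s i) \<and> 2 * card (\<tau> ` {..<k}) \<le> k \<and> \<tau> b \<in> \<tau> ` {..<k} \<and>
        card {i. i < k \<and> \<tau> i = \<tau> b} = 2 \<and> (\<forall>i<k. \<tau> i = \<tau> b \<longrightarrow> s i = s b) \<and> b < k \<and> \<tau> b < k \<and> \<tau> (\<tau> b) = \<tau> b \<and> z = (2 * s b < int N)})"
    have c1: "card (A1 c) \<le> N ^ m" if cT: "c \<in> T \<times> E" for c
    proof -
      obtain \<tau> \<epsilon> where c: "c = (\<tau>, \<epsilon>)" "\<tau> \<in> T" using cT by auto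
      show ?thesis
      proof (cases "card (\<tau> ` {..<k}) \<le> m")
        case True
        have "card (A1 c) \<le> N ^ card (\<tau> ` {..<k})"
        proof (rule card_steps_determined)
          show "A1 c \<subseteq> steps N k" by (auto simp: A1_def c Q_def)
          show "\<tau> ` {..<k} \<subseteq> {..<k}" using c by (auto simp: T_def PiE_iff)
        next
          fix s s' assume s: "s \<in> A1 c" "s' \<in> A1 c" and eq: "\<And>j. j \<in> \<tau> ` {..<k} \<Longrightarrow> s j = s' j"
          have Q: "Q \<tau> \<epsilon> s" "Q \<tau> \<epsilon> s'" using s by (auto simp: A1_def c)
          show "s = s'"
          proof (rule steps_eqI)
            show "s \<in> steps N k" "s' \<in> steps N k" using Q unfolding Q_def by blast+
            fix i assume i: "i < k"
            have "s i = (if \<epsilon> i then s (\<tau> i) else (- s (\<tau> i)) mod int N)"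
              "s' i = (if \<epsilon> i then s' (\<tau> i) else (- s' (\<tau> i)) mod int N)" using Q i unfolding Q_def by blast+
            moreover have "s (\<tau> i) = s' (\<tau> i)" using eq i by blast
            ultimately show "s i = s' i" by metis
          qed
        qed
        also have "\<dots> \<le> N ^ m" using True N by (intro power_increasing) auto
        finally show ?thesis .
      next
        case False
        then have "A1 c = {}" by (auto simp: A1_def c)
        then show ?thesis by simp
      qed
    qed
    have c2: "card (A2 c) \<le> N ^ m" if cT: "c \<in> T \<times> E \<times> {..<k} \<times> UNIV" for c
    proof -
      obtain \<tau> \<epsilon> b z where c: "c = (\<tau>, \<epsilon>, b, z)" "\<tau> \<in> T" using cT by auto
      show ?thesis
      proof (cases "A2 c = {}")
        case False
        then have h: "2 * card (\<tau> ` {..<k}) \<le> k" "\<tau> b \<in> \<tau> ` {..<k}" "card {i. i < k \<and> \<tau> i = \<tau> b} = 2" "b < k" "\<tau> b < k" "\<tau> (\<tau> b) = \<tau> b"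
          by (auto simp: A2_def c)
        have A2D: "Q \<tau> \<epsilon> w" "int N dvd (\<Sum>i<k. w i)" "\<And>i. i < k \<Longrightarrow> \<tau> i = \<tau> b \<Longrightarrow> w i = w b" "z \<longleftrightarrow> 2 * w b < int N"
          if "w \<in> A2 c" for w
          using that unfolding A2_def c prod.case mem_Collect_eq by blast+
        define J where "J = \<tau> ` {..<k} - {\<tau> b}"
        have "card (A2 c) \<le> N ^ card J"
        proof (rule card_steps_determined)
          show "A2 c \<subseteq> steps N k" by (auto simp: A2_def c Q_def)
          show "J \<subseteq> {..<k}" using c by (auto simp: T_def PiE_iff J_def)
        next
          fix s s' assume s: "s \<in> A2 c" "s' \<in> A2 c" and eq: "\<And>j. j \<in> J \<Longrightarrow> s j = s' j"
          have Q: "Q \<tau> \<epsilon> s" "Q \<tau> \<epsilon> s'" using s A2D by blast+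
          have other: "s i = s' i" if i: "i < k" "\<tau> i \<noteq> \<tau> b" for i
          proof -
            have "s i = (if \<epsilon> i then s (\<tau> i) else (- s (\<tau> i)) mod int N)"
              "s' i = (if \<epsilon> i then s' (\<tau> i) else (- s' (\<tau> i)) mod int N)" using Q i unfolding Q_def by blast+
            moreover have "s (\<tau> i) = s' (\<tau> i)" using eq i by (simp add: J_def)
            ultimately show ?thesis by metis
          qed
          \<comment> \<open>The distinguished pair enters the closing condition with twice its step;
            everything else is fixed by the code and the remaining representatives.\<close>
          have sum: "(\<Sum>i<k. w i) = 2 * w b + (\<Sum>i\<in>{i. i < k \<and> \<tau> i \<noteq> \<tau> b}. w i)" if "w \<in> A2 c" for w
          proof -
            have "(\<Sum>i<k. w i) = (\<Sum>i\<in>{i. i < k \<and> \<tau> i = \<tau> b} \<union> {i. i < k \<and> \<tau> i \<noteq> \<tau> b}. w i)"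
              by (intro sum.cong) auto
            also have "\<dots> = (\<Sum>i\<in>{i. i < k \<and> \<tau> i = \<tau> b}. w i) + (\<Sum>i\<in>{i. i < k \<and> \<tau> i \<noteq> \<tau> b}. w i)"
              by (rule sum.union_disjoint) auto
            also have "(\<Sum>i\<in>{i. i < k \<and> \<tau> i = \<tau> b}. w i) = (\<Sum>i\<in>{i. i < k \<and> \<tau> i = \<tau> b}. w b)"
              by (intro sum.cong refl) (use A2D(3)[OF that] in blast)
            also have "\<dots> = 2 * w b" using h by simp
            finally show ?thesis .
          qed
          have "(\<Sum>i\<in>{i. i < k \<and> \<tau> i \<noteq> \<tau> b}. s i) = (\<Sum>i\<in>{i. i < k \<and> \<tau> i \<noteq> \<tau> b}. s' i)"
            using other by (intro sum.cong) auto
          moreover have "int N dvd (\<Sum>i<k. s i) - (\<Sum>i<k. s' i)"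
            by (intro dvd_diff A2D(2) s)
          ultimately have "int N dvd 2 * s b - 2 * s' b" using sum[OF s(1)] sum[OF s(2)] by simp
          moreover have "(2 * s b < int N) = (2 * s' b < int N)" using A2D(4)[OF s(1)] A2D(4)[OF s(2)] by blast
          moreover have "0 \<le> s b" "s b < int N" "0 \<le> s' b" "s' b < int N"
          proof -
            have "s \<in> steps N k" "s' \<in> steps N k" using Q unfolding Q_def by blast+
            then have "s b \<in> {0..<int N}" "s' b \<in> {0..<int N}"
              using h(4) unfolding steps_def by (blast dest: PiE_mem)+
            then show "0 \<le> s b" "s b < int N" "0 \<le> s' b" "s' b < int N" by simp_all
          qed
          ultimately have sb: "s b = s' b" by (rule doubled_residue_eqI)
          show "s = s'"
          proof (rule steps_eqI)
            show "s \<in> steps N k" "s' \<in> steps N k" using Q unfolding Q_def by blast+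
            fix i assume i: "i < k"
            show "s i = s' i"
            proof (cases "\<tau> i = \<tau> b")
              case True
              then show ?thesis using A2D(3)[OF s(1) i] A2D(3)[OF s(2) i] sb by simp
            qed (use other i in auto)
          qed
        qed
        also have "card J = card (\<tau> ` {..<k}) - 1" using h by (simp add: J_def)
        also have "N ^ (card (\<tau> ` {..<k}) - 1) \<le> N ^ m"
          using N h(1) unfolding m_def by (intro power_increasing) auto
        finally show ?thesis .
      qed simp
    qed
    have sub: "bad_steps N k \<subseteq> (\<Union>c\<in>T \<times> E. A1 c) \<union> (\<Union>c\<in>T \<times> E \<times> {..<k} \<times> UNIV. A2 c)"
    proof
      fix s assume sb: "s \<in> bad_steps N k"
      then have s: "s \<in> steps N k" by (auto simp: bad_steps_def closed_steps_def)
      obtain \<tau> \<epsilon> where te: "\<tau> \<in> T" "\<epsilon> \<in> E"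
        and code': "\<forall>i<k. s i = (if \<epsilon> i then s (\<tau> i) else (- s (\<tau> i)) mod int N) \<and> cdist N (s (\<tau> i)) = cdist N (s i)"
        and tau': "\<forall>i<k. \<forall>j<k. cdist N (s i) = cdist N (s j) \<longrightarrow> \<tau> i = \<tau> j"
        using step_code[OF s N, folded T_def E_def] by (elim bexE conjE) (rule that; assumption)
      have code: "s i = (if \<epsilon> i then s (\<tau> i) else (- s (\<tau> i)) mod int N)"
        and same: "cdist N (s (\<tau> i)) = cdist N (s i)" if "i < k" for i
        using code' that by blast+
      have tau: "\<tau> i = \<tau> j" if "i < k" "j < k" "cdist N (s i) = cdist N (s j)" for i j
        using tau' that by blast
      have tk: "\<tau> i < k" if "i < k" for i using te that by (auto simp: T_def PiE_iff)
      have Q: "Q \<tau> \<epsilon> s" unfolding Q_def using s code by blast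
      have cd: "card (\<tau> ` {..<k}) = card ((\<lambda>i. cdist N (s i)) ` {..<k})"
      proof (rule bij_betw_same_card[of "\<lambda>j. cdist N (s j)"])
        show "bij_betw (\<lambda>j. cdist N (s j)) (\<tau> ` {..<k}) ((\<lambda>i. cdist N (s i)) ` {..<k})"
          unfolding bij_betw_def
        proof
          show "inj_on (\<lambda>j. cdist N (s j)) (\<tau> ` {..<k})"
          proof (rule inj_onI)
            fix a b assume "a \<in> \<tau> ` {..<k}" "b \<in> \<tau> ` {..<k}" and eq: "cdist N (s a) = cdist N (s b)"
            then obtain i j where ij: "i < k" "a = \<tau> i" "j < k" "b = \<tau> j" by blast
            then have "cdist N (s i) = cdist N (s j)" using eq same[OF ij(1)] same[OF ij(3)] by metis
            then show "a = b" using tau[OF ij(1,3)] ij by blast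
          qed
          show "(\<lambda>j. cdist N (s j)) ` \<tau> ` {..<k} = (\<lambda>i. cdist N (s i)) ` {..<k}"
            unfolding image_image by (intro image_cong refl, rule same) simp
        qed
      qed
      from sb consider "2 * card ((\<lambda>i. cdist N (s i)) ` {..<k}) < k"
        | "int N dvd (\<Sum>i<k. s i)" "\<forall>i<k. card (step_class N k s i) = 2" "\<exists>i<k. \<forall>j\<in>step_class N k s i. s j = s i"
        unfolding bad_steps_def closed_steps_def by blast
      then show "s \<in> (\<Union>c\<in>T \<times> E. A1 c) \<union> (\<Union>c\<in>T \<times> E \<times> {..<k} \<times> UNIV. A2 c)"
      proof cases
        case 1
        then have "card (\<tau> ` {..<k}) \<le> m" using cd by (simp add: m_def)
        then have "s \<in> A1 (\<tau>, \<epsilon>)" using Q unfolding A1_def prod.case mem_Collect_eq by blast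
        then show ?thesis using te by blast
      next
        case 2
        then obtain b where b: "b < k" "\<forall>j\<in>step_class N k s b. s j = s b" by blast
        have cls: "{i. i < k \<and> \<tau> i = \<tau> b'} = step_class N k s b'" if "b' < k" for b'
        proof -
          have "\<tau> i = \<tau> b' \<longleftrightarrow> cdist N (s i) = cdist N (s b')" if "i < k" for i
            using tau[OF that \<open>b' < k\<close>] same[OF that] same[OF \<open>b' < k\<close>] by metis
          then show ?thesis unfolding step_class_def by blast
        qed
        have fib: "card {i \<in> {..<k}. cdist N (s i) = v} = 2" if "v \<in> (\<lambda>i. cdist N (s i)) ` {..<k}" for v
        proof -
          from that obtain i where "i < k" "v = cdist N (s i)" by auto
          then show ?thesis using 2(2)[rule_format, of i] by (simp add: step_class_def)
        qed
        have "k = (\<Sum>v\<in>(\<lambda>i. cdist N (s i)) ` {..<k}. card {i \<in> {..<k}. cdist N (s i) = v})"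
          using sum.image_gen[of "{..<k}" "\<lambda>_. 1::nat" "\<lambda>i. cdist N (s i)"] by simp
        also have "\<dots> = 2 * card ((\<lambda>i. cdist N (s i)) ` {..<k})" using fib by simp
        finally have "2 * card (\<tau> ` {..<k}) \<le> k" using cd by simp
        moreover have "\<tau> (\<tau> b) = \<tau> b" using tau[OF tk[OF b(1)] b(1)] same[OF b(1)] by simp
        moreover have "card {i. i < k \<and> \<tau> i = \<tau> b} = 2" unfolding cls[OF b(1)] using 2(2) b(1) by blast
        moreover have "\<forall>i<k. \<tau> i = \<tau> b \<longrightarrow> s i = s b" using b cls[OF b(1)] by blast
        ultimately have "s \<in> A2 (\<tau>, \<epsilon>, b, 2 * s b < int N)"
          using Q 2(1) b(1) tk[OF b(1)] unfolding A2_def prod.case mem_Collect_eq by blast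
        then show ?thesis using te b by blast
      qed
    qed
    have fA: "finite (A1 c)" "finite (A2 c')" for c c'
      by (rule finite_subset[OF _ finite_steps[of N k]], auto simp: A1_def A2_def Q_def split: prod.splits)+
    have "card (bad_steps N k) \<le> card ((\<Union>c\<in>T \<times> E. A1 c) \<union> (\<Union>c\<in>T \<times> E \<times> {..<k} \<times> UNIV. A2 c))"
      by (rule card_mono[OF _ sub]) (use fin fA in auto)
    also have "\<dots> \<le> card (\<Union>c\<in>T \<times> E. A1 c) + card (\<Union>c\<in>T \<times> E \<times> {..<k} \<times> UNIV. A2 c)"
      by (rule card_Un_le)
    also have "\<dots> \<le> (\<Sum>c\<in>T \<times> E. card (A1 c)) + (\<Sum>c\<in>T \<times> E \<times> {..<k} \<times> UNIV. card (A2 c))"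
      by (intro add_mono card_UN_le) (use fin in auto)
    also have "\<dots> \<le> (\<Sum>c\<in>T \<times> E. N ^ m) + (\<Sum>c\<in>T \<times> E \<times> {..<k} \<times> (UNIV :: bool set). N ^ m)"
      by (intro add_mono sum_mono c1 c2)
    also have "\<dots> = (card T * card E + card T * card E * k * 2) * N ^ m"
      by (simp add: card_cartesian_product algebra_simps)
    finally show ?thesis .
  qed
  show ?thesis
  proof (intro exI[of _ "real (card T * card E + card T * card E * k * 2)"] allI impI)
    fix N :: nat assume "N > 0"
    from bound[OF this] have "real (card (bad_steps N k)) \<le> real ((card T * card E + card T * card E * k * 2) * N ^ m)"
      by (simp only: of_nat_le_iff)
    then show "real (card (bad_steps N k)) \<le> real (card T * card E + card T * card E * k * 2) * real N ^ ((k - 1) div 2)"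
      by (simp only: of_nat_mult of_nat_power m_def)
  qed
qed

section \<open>Expected moments\<close>

lemma closed_class_eqD:
  assumes s: "s \<in> steps N k" and N: "N > 0" and ij: "i < k" "j < k"
    and c: "cdist N (s j) = cdist N (s i)" and ne: "s j \<noteq> s i"
  shows "int N dvd s i + s j"
proof -
  have r: "s i \<in> {0..<int N}" "s j \<in> {0..<int N}" using s ij unfolding steps_def by (blast dest: PiE_mem)+
  have "\<not> int N dvd s i - s j"
  proof
    assume "int N dvd s i - s j"
    then have "s i mod int N = s j mod int N" by (simp only: mod_eq_dvd_iff)
    then show False using r ne by simp
  qed
  then show ?thesis using c[symmetric] cdist_eq_iff[OF N] by blast
qed

lemma opposite_in_class:
  assumes N: "N > 0" and \<sigma>: "\<sigma> \<in> matchings k" "opposite N k \<sigma> s" and i: "i < k"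
  shows "\<sigma> i \<in> step_class N k s i - {i}"
proof -
  have 1: "\<sigma> i < k" "\<sigma> i \<noteq> i" using \<sigma>(1) i by (auto simp: matchings_def PiE_iff)
  have "int N dvd s (\<sigma> i) + s i" using \<sigma>(2) i by (simp add: opposite_def add.commute)
  then have "cdist N (s (\<sigma> i)) = cdist N (s i)" unfolding cdist_eq_iff[OF N] by blast
  then show ?thesis using 1 by (simp add: step_class_def)
qed

lemma finite_step_class [simp]: "finite (step_class N k s i)"
  by (simp add: step_class_def)

text \<open>With classes of size two the partner of a step can only be the other member of its
  class. Outside \<open>bad_steps\<close> the two members differ while having equal distance, hence
  they are opposite and the forced matching is admissible.\<close>

lemma card_opposite_matchings:
  assumes N: "N > 0" and s: "s \<in> closed_steps N k" and two: "\<And>i. i < k \<Longrightarrow> card (step_class N k s i) = 2"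
    and nb: "s \<notin> bad_steps N k"
  shows "card {\<sigma> \<in> matchings k. opposite N k \<sigma> s} = 1"
proof -
  have st: "s \<in> steps N k" using s by (simp add: closed_steps_def)
  have ex: "\<exists>j\<in>step_class N k s i. s j \<noteq> s i" if "i < k" for i
  proof (rule ccontr)
    assume "\<not> ?thesis"
    then have "\<exists>i<k. \<forall>j\<in>step_class N k s i. s j = s i" using that by blast
    moreover have "\<forall>i<k. card (step_class N k s i) = 2" using two by blast
    ultimately have "s \<in> bad_steps N k" using s unfolding bad_steps_def by blast
    with nb show False by blast
  qed
  define \<sigma>0 where "\<sigma>0 = (\<lambda>i\<in>{..<k}. SOME j. j \<in> step_class N k s i \<and> s j \<noteq> s i)"
  have s0: "\<sigma>0 i \<in> step_class N k s i \<and> s (\<sigma>0 i) \<noteq> s i" if i: "i < k" for i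
  proof -
    have "\<sigma>0 i = (SOME j. j \<in> step_class N k s i \<and> s j \<noteq> s i)" using i by (simp add: \<sigma>0_def)
    moreover have "\<exists>j. j \<in> step_class N k s i \<and> s j \<noteq> s i" using ex[OF i] by blast
    ultimately show ?thesis by (metis (mono_tags, lifting) someI_ex)
  qed
  have lt: "\<sigma>0 i < k" if "i < k" for i using s0[OF that] by (simp add: step_class_def)
  have cls: "step_class N k s i - {i} = {\<sigma>0 i}" if i: "i < k" for i
  proof -
    have ii: "i \<in> step_class N k s i" using i by (simp add: step_class_def)
    then have "card (step_class N k s i - {i}) = 1" using two[OF i] by simp
    then obtain a where a: "step_class N k s i - {i} = {a}" by (auto simp: card_1_singleton_iff)
    moreover have "\<sigma>0 i \<in> step_class N k s i - {i}" using s0[OF i] by auto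
    ultimately show ?thesis by (metis singletonD)
  qed
  have inv: "\<sigma>0 (\<sigma>0 i) = i" if i: "i < k" for i
  proof -
    have "step_class N k s (\<sigma>0 i) = step_class N k s i"
      using s0[OF i] by (simp add: step_class_def)
    moreover have "i \<in> step_class N k s i" using i by (simp add: step_class_def)
    moreover have "i \<noteq> \<sigma>0 i" using s0[OF i] by metis
    ultimately have "i \<in> step_class N k s (\<sigma>0 i) - {\<sigma>0 i}" by blast
    then show ?thesis unfolding cls[OF lt[OF i]] by simp
  qed
  have m0: "\<sigma>0 \<in> matchings k"
  proof -
    have "\<sigma>0 \<in> PiE {..<k} (\<lambda>_. {..<k})" using lt by (auto simp: PiE_iff \<sigma>0_def)
    moreover have "\<forall>i<k. \<sigma>0 i \<noteq> i \<and> \<sigma>0 (\<sigma>0 i) = i" using inv s0 by metis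
    ultimately show ?thesis by (simp add: matchings_def)
  qed
  have o0: "opposite N k \<sigma>0 s"
    unfolding opposite_def
  proof (intro allI impI)
    fix i assume i: "i < k"
    show "int N dvd s i + s (\<sigma>0 i)"
      by (rule closed_class_eqD[OF st N i lt[OF i]]) (use s0[OF i] in \<open>auto simp: step_class_def\<close>)
  qed
  have "{\<sigma> \<in> matchings k. opposite N k \<sigma> s} = {\<sigma>0}"
  proof (intro equalityI subsetI)
    fix \<sigma> assume "\<sigma> \<in> {\<sigma> \<in> matchings k. opposite N k \<sigma> s}"
    then have \<sigma>: "\<sigma> \<in> matchings k" "opposite N k \<sigma> s" by auto
    have "\<sigma> i = \<sigma>0 i" if "i < k" for i
      using opposite_in_class[OF N \<sigma> that] cls[OF that] by blast
    then have "\<sigma> = \<sigma>0"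
      by (intro PiE_ext[of \<sigma> "{..<k}" "\<lambda>_. {..<k}" \<sigma>0]) (use \<sigma>(1) m0 in \<open>auto simp: matchings_def\<close>)
    then show "\<sigma> \<in> {\<sigma>0}" by simp
  qed (use m0 o0 in auto)
  then show ?thesis by simp
qed

context prob_space
begin

lemma integrable_power_bounded:
  assumes "x \<in> borel_measurable M" "AE \<omega> in M. \<bar>x \<omega>\<bar> \<le> C"
  shows "integrable M (\<lambda>\<omega>. x \<omega> ^ m :: real)"
proof (rule integrable_const_bound)
  show "AE \<omega> in M. norm (x \<omega> ^ m) \<le> C ^ m"
    using assms(2) by eventually_elim (simp add: power_abs power_mono)
qed (use assms(1) in measurable)

text \<open>A class of size one makes the expectation vanish by mean zero, and it excludes every
  matching. Otherwise all classes have at least two members and, outside \<open>bad_steps\<close>,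
  counting forces exactly two; the expectation is then a product of variances, equal to 1, and the
  matching is unique.\<close>

lemma expectation_step_product:
  assumes ind: "indep_vars (\<lambda>_. borel) x UNIV" and std: "standardized x" and C: "\<And>i. AE \<omega> in M. \<bar>x i \<omega>\<bar> \<le> C"
    and N: "N > 0" and s: "s \<in> closed_steps N k" and nb: "s \<notin> bad_steps N k"
  shows "expectation (\<lambda>\<omega>. \<Prod>j<k. x (cdist N (s j)) \<omega>) = real (card {\<sigma> \<in> matchings k. opposite N k \<sigma> s})"
proof -
  have xm[measurable]: "x i \<in> borel_measurable M" for i
    using ind by (auto simp: indep_vars_def)
  define c where "c j = cdist N (s j)" for j
  define V where "V = c ` {..<k}"
  define m where "m v = card {j \<in> {..<k}. c j = v}" for v
  have m_class: "m (c i) = card (step_class N k s i)" for i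
    by (simp add: m_def step_class_def c_def)
  have E: "expectation (\<lambda>\<omega>. \<Prod>j<k. x (c j) \<omega>) = (\<Prod>v\<in>V. expectation (\<lambda>\<omega>. x v \<omega> ^ m v))"
  proof -
    have "(\<lambda>\<omega>. \<Prod>j<k. x (c j) \<omega>) = (\<lambda>\<omega>. \<Prod>v\<in>V. x v \<omega> ^ m v)"
    proof
      fix \<omega>
      have "(\<Prod>j<k. x (c j) \<omega>) = (\<Prod>v\<in>V. \<Prod>j\<in>{j \<in> {..<k}. c j = v}. x (c j) \<omega>)"
        unfolding V_def by (rule prod.image_gen) simp
      also have "\<dots> = (\<Prod>v\<in>V. x v \<omega> ^ m v)"
        by (intro prod.cong refl) (simp add: m_def)
      finally show "(\<Prod>j<k. x (c j) \<omega>) = (\<Prod>v\<in>V. x v \<omega> ^ m v)" .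
    qed
    moreover have "expectation (\<lambda>\<omega>. \<Prod>v\<in>V. x v \<omega> ^ m v) = (\<Prod>v\<in>V. expectation (\<lambda>\<omega>. x v \<omega> ^ m v))"
    proof (rule indep_vars_lebesgue_integral)
      show "finite V" by (simp add: V_def)
      show "indep_vars (\<lambda>_. borel) (\<lambda>v \<omega>. x v \<omega> ^ m v) V"
        by (rule indep_vars_compose2[OF indep_vars_subset[OF ind subset_UNIV]]) simp
      show "integrable M (\<lambda>\<omega>. x v \<omega> ^ m v)" for v
        by (rule integrable_power_bounded[OF xm C])
    qed
    ultimately show ?thesis by simp
  qed
  have e1: "expectation (\<lambda>\<omega>. x v \<omega> ^ 1) = 0" for v using std by (simp add: standardized_def)
  have e2: "expectation (\<lambda>\<omega>. x v \<omega> ^ 2) = 1" for v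
  proof -
    have "expectation (x v) = 0" using std by (simp add: standardized_def)
    moreover have "variance (x v) = 1" using std unfolding standardized_def by blast
    ultimately show ?thesis by simp
  qed
  show ?thesis
  proof (cases "\<exists>i<k. card (step_class N k s i) = 1")
    case True
    then obtain i where i: "i < k" "card (step_class N k s i) = 1" by blast
    have "expectation (\<lambda>\<omega>. x (c i) \<omega> ^ m (c i)) = 0" unfolding m_class i(2) by (rule e1)
    then have "(\<Prod>v\<in>V. expectation (\<lambda>\<omega>. x v \<omega> ^ m v)) = 0"
      by (intro prod_zero) (use i in \<open>auto simp: V_def\<close>)
    moreover have "{\<sigma> \<in> matchings k. opposite N k \<sigma> s} = {}"
    proof (rule ccontr)
      assume "\<not> ?thesis"
      then obtain \<sigma> where \<sigma>: "\<sigma> \<in> matchings k" "opposite N k \<sigma> s" by blast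
      have "i \<in> step_class N k s i" using i by (simp add: step_class_def)
      moreover obtain a where "step_class N k s i = {a}" using i(2) by (auto simp: card_1_singleton_iff)
      ultimately show False using opposite_in_class[OF N \<sigma> i(1)] by auto
    qed
    ultimately show ?thesis using E by (simp add: c_def)
  next
    case False
    have ge: "2 \<le> m v" if vV: "v \<in> V" for v
    proof -
      obtain i where i: "i < k" "v = c i" using vV by (auto simp: V_def)
      have "i \<in> step_class N k s i" using i by (simp add: step_class_def)
      then have "card (step_class N k s i) \<noteq> 0" by (auto simp: card_eq_0_iff)
      moreover have "card (step_class N k s i) \<noteq> 1" using False i(1) by blast
      ultimately show ?thesis unfolding i(2) m_class by linarith
    qed
    have k: "k = (\<Sum>v\<in>V. m v)"
      using sum.image_gen[of "{..<k}" "\<lambda>_. 1::nat" c] by (simp add: V_def m_def)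
    \<comment> \<open>Fewer classes would put \<open>s\<close> into \<open>bad_steps\<close>;
      together with the sizes being at least two this pins every size to two.\<close>
    have V2: "k \<le> 2 * card V"
    proof (rule ccontr)
      assume "\<not> ?thesis"
      then have "2 * card ((\<lambda>i. cdist N (s i)) ` {..<k}) < k" by (simp add: V_def c_def)
      moreover have "s \<in> steps N k" using s by (simp add: closed_steps_def)
      ultimately have "s \<in> bad_steps N k" unfolding bad_steps_def by blast
      with nb show False by blast
    qed
    have m2: "m v = 2" if v: "v \<in> V" for v
    proof (rule ccontr)
      assume "m v \<noteq> 2"
      then have "2 < m v" using ge[OF v] by simp
      then have "(\<Sum>v\<in>V. 2) < (\<Sum>v\<in>V. m v)"
        by (intro sum_strict_mono_ex1) (use ge v in \<open>auto simp: V_def\<close>)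
      then show False using k V2 by simp
    qed
    have "card (step_class N k s i) = 2" if "i < k" for i
      using m2[of "c i"] that by (simp add: V_def m_class)
    from card_opposite_matchings[OF N s this nb]
    have "card {\<sigma> \<in> matchings k. opposite N k \<sigma> s} = 1" by blast
    moreover have "(\<Prod>v\<in>V. expectation (\<lambda>\<omega>. x v \<omega> ^ m v)) = (\<Prod>v\<in>V. 1)"
      by (intro prod.cong refl) (simp only: m2 e2)
    ultimately show ?thesis using E by (simp add: c_def)
  qed
qed

end

definition opposite_steps :: "nat \<Rightarrow> nat \<Rightarrow> (nat \<Rightarrow> nat) \<Rightarrow> (nat \<Rightarrow> int) set" where
  "opposite_steps N k \<sigma> = {s \<in> steps N k. opposite N k \<sigma> s}"

text \<open>The share of one matching in the expected moment of order \<open>k\<close>. A step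
  sequence may be opposite for several matchings and is then counted repeatedly, but only for
  sequences in \<open>bad_steps\<close>, where this is negligible.\<close>

definition match_term :: "nat \<Rightarrow> bool \<Rightarrow> nat \<Rightarrow> nat \<Rightarrow> (nat \<Rightarrow> nat) \<Rightarrow> real" where
  "match_term r hat n k \<sigma> = (real n powr (- 1 / 2)) ^ k / real n *
     (\<Sum>p<n. \<Sum>s\<in>opposite_steps (r * n) k \<sigma>. walk_weight r hat n k (int p) s)"

text \<open>An involution without fixed points splits the indices into those smaller than their
  partners and the partners of these.\<close>

lemma sum_matching_split:
  fixes f :: "nat \<Rightarrow> 'b::comm_monoid_add"
  assumes \<sigma>: "\<sigma> \<in> matchings k"
  shows "(\<Sum>i<k. f i) = (\<Sum>i\<in>{i. i < k \<and> i < \<sigma> i}. f i + f (\<sigma> i))"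
proof -
  let ?A = "{i. i < k \<and> i < \<sigma> i}"
  have \<sigma>': "\<sigma> i < k" "\<sigma> i \<noteq> i" "\<sigma> (\<sigma> i) = i" if "i < k" for i
    using \<sigma> that by (auto simp: matchings_def PiE_iff)
  have inj: "inj_on \<sigma> ?A" by (rule inj_onI) (metis \<sigma>'(3) mem_Collect_eq)
  have U: "{..<k} = ?A \<union> \<sigma> ` ?A"
  proof (intro equalityI subsetI)
    fix i assume "i \<in> {..<k}"
    then have i: "i < k" by simp
    show "i \<in> ?A \<union> \<sigma> ` ?A"
    proof (cases "i < \<sigma> i")
      case False
      then have "\<sigma> i < i" using \<sigma>'(2)[OF i] by simp
      then have "\<sigma> i \<in> ?A" using \<sigma>'[OF i] by simp
      then have "\<sigma> (\<sigma> i) \<in> \<sigma> ` ?A" by (rule imageI)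
      then show ?thesis unfolding \<sigma>'(3)[OF i] by (rule UnI2)
    qed (use i in simp)
  qed (use \<sigma>' in auto)
  have D: "?A \<inter> \<sigma> ` ?A = {}"
  proof (rule ccontr)
    assume "\<not> ?thesis"
    then obtain j where "j < k" "j < \<sigma> j" "\<sigma> j < \<sigma> (\<sigma> j)" by auto
    then show False using \<sigma>'(3)[of j] by simp
  qed
  have "(\<Sum>i<k. f i) = (\<Sum>i\<in>?A. f i) + (\<Sum>i\<in>\<sigma> ` ?A. f i)"
    unfolding U by (rule sum.union_disjoint) (use D in auto)
  also have "(\<Sum>i\<in>\<sigma> ` ?A. f i) = (\<Sum>i\<in>?A. f (\<sigma> i))" by (subst sum.reindex[OF inj]) simp
  finally show ?thesis by (simp add: sum.distrib)
qed

text \<open>Opposite steps cancel in pairs, so the closing condition is automatic and costs no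
  degree of freedom; this is why matched walks have the leading order.\<close>

lemma opposite_steps_closed:
  assumes "\<sigma> \<in> matchings k" "s \<in> opposite_steps N k \<sigma>"
  shows "s \<in> closed_steps N k"
proof -
  have "int N dvd (\<Sum>i<k. s i)"
    unfolding sum_matching_split[OF assms(1)]
    by (rule dvd_sum) (use assms(2) in \<open>auto simp: opposite_steps_def opposite_def\<close>)
  then show ?thesis using assms(2) by (simp add: closed_steps_def opposite_steps_def)
qed

context prob_space
begin

text \<open>Expectation and matching count agree outside \<open>bad_steps\<close>. The error is a
  bounded multiple of the number of bad sequences times n^(-k/2), the average over starts being
  harmless, and for positive \<open>k\<close> this is of order n^(-1/2) at most.\<close>

theorem expected_moment:
  assumes ind: "indep_vars (\<lambda>_. borel) x UNIV" and std: "standardized x" and C: "\<And>i. AE \<omega> in M. \<bar>x i \<omega>\<bar> \<le> C"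
    and r: "r \<in> {1, 2}"
  shows "(\<lambda>n. expectation (\<lambda>\<omega>. (\<Sum>i<n. spec r hat n (\<lambda>v. x v \<omega>) i ^ k) / real n) -
     (\<Sum>\<sigma>\<in>matchings k. match_term r hat n k \<sigma>)) \<longlonglongrightarrow> 0"
proof -
  have xm[measurable]: "x i \<in> borel_measurable M" for i
    using ind by (auto simp: indep_vars_def)
  obtain K where K: "\<And>N. N > 0 \<Longrightarrow> real (card (bad_steps N k)) \<le> K * real N ^ ((k - 1) div 2)"
    using card_bad_steps by blast
  define e where "e N s = expectation (\<lambda>\<omega>. \<Prod>j<k. x (cdist N (s j)) \<omega>)" for N s
  define W where "W N s = real (card {\<sigma> \<in> matchings k. opposite N k \<sigma> s})" for N s
  \<comment> \<open>Bounds the error of a single sequence: an expectation of at most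
    \<open>C ^ k\<close> against at most all matchings.\<close>
  define D where "D = C ^ k + real (card (matchings k))"
  have ae: "AE \<omega> in M. \<forall>i. \<bar>x i \<omega>\<bar> \<le> C" using C by (simp add: AE_all_countable)
  have prodB: "AE \<omega> in M. \<bar>\<Prod>j<k. x (f j) \<omega>\<bar> \<le> C ^ k" for f :: "nat \<Rightarrow> nat"
    using ae
  proof eventually_elim
    fix \<omega> assume B: "\<forall>i. \<bar>x i \<omega>\<bar> \<le> C"
    have "(\<Prod>j<k. \<bar>x (f j) \<omega>\<bar>) \<le> (\<Prod>j<k. C)" by (rule prod_mono) (use B in auto)
    then show "\<bar>\<Prod>j<k. x (f j) \<omega>\<bar> \<le> C ^ k" by (simp add: abs_prod)
  qed
  have intp: "integrable M (\<lambda>\<omega>. \<Prod>j<k. x (f j) \<omega>)" for f :: "nat \<Rightarrow> nat"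
    by (rule integrable_const_bound[where B = "C ^ k"]) (use prodB in auto)
  have eB: "\<bar>e N s\<bar> \<le> C ^ k" for N s
  proof -
    have "\<bar>e N s\<bar> \<le> expectation (\<lambda>\<omega>. \<bar>\<Prod>j<k. x (cdist N (s j)) \<omega>\<bar>)"
      unfolding e_def by (rule integral_abs_bound)
    also have "\<dots> \<le> expectation (\<lambda>\<omega>. C ^ k)"
      by (rule integral_mono_AE) (use intp prodB in auto)
    finally show ?thesis by (simp add: prob_space)
  qed
  have WB: "\<bar>W N s\<bar> \<le> real (card (matchings k))" for N s
    unfolding W_def by (simp add: card_mono)
  have bd: "\<bar>expectation (\<lambda>\<omega>. (\<Sum>i<n. spec r hat n (\<lambda>v. x v \<omega>) i ^ k) / real n) -
     (\<Sum>\<sigma>\<in>matchings k. match_term r hat n k \<sigma>)\<bar> \<le> (real n powr (- 1 / 2)) ^ k * (K * real (r * n) ^ ((k - 1) div 2) * D)" if n: "n > 0" for n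
  proof -
    let ?N = "r * n" and ?c = "(real n powr (- 1 / 2)) ^ k"
    let ?H = "\<lambda>p s. walk_weight r hat n k (int p) s"
    have N: "?N > 0" using n r by auto
    have 1: "expectation (\<lambda>\<omega>. (\<Sum>i<n. spec r hat n (\<lambda>v. x v \<omega>) i ^ k) / real n) =
       ?c / real n * (\<Sum>p<n. \<Sum>s\<in>closed_steps ?N k. ?H p s * e ?N s)"
    proof -
      have "expectation (\<lambda>\<omega>. (\<Sum>i<n. spec r hat n (\<lambda>v. x v \<omega>) i ^ k) / real n) =
         expectation (\<lambda>\<omega>. ?c / real n * (\<Sum>p<n. \<Sum>s\<in>closed_steps ?N k. ?H p s * (\<Prod>j<k. x (cdist ?N (s j)) \<omega>)))"
        unfolding trace_walk_expansion[OF r n] by simp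
      also have "\<dots> = ?c / real n * (\<Sum>p<n. \<Sum>s\<in>closed_steps ?N k. ?H p s * e ?N s)"
        unfolding e_def by (simp add: intp)
      finally show ?thesis .
    qed
    have 2: "(\<Sum>\<sigma>\<in>matchings k. match_term r hat n k \<sigma>) = ?c / real n * (\<Sum>p<n. \<Sum>s\<in>closed_steps ?N k. ?H p s * W ?N s)"
    proof -
      have "(\<Sum>s\<in>closed_steps ?N k. ?H p s * W ?N s) = (\<Sum>\<sigma>\<in>matchings k. \<Sum>s\<in>opposite_steps ?N k \<sigma>. ?H p s)" for p
      proof -
        have "(\<Sum>s\<in>closed_steps ?N k. ?H p s * W ?N s) =
            (\<Sum>s\<in>closed_steps ?N k. \<Sum>\<sigma>\<in>{\<sigma> \<in> matchings k. opposite ?N k \<sigma> s}. ?H p s)"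
          by (simp add: W_def mult.commute)
        \<comment> \<open>Double counting of the pairs of a closed step sequence and a matching for
          which it is opposite.\<close>
        also have "\<dots> = (\<Sum>\<sigma>\<in>matchings k. \<Sum>s\<in>{s \<in> closed_steps ?N k. opposite ?N k \<sigma> s}. ?H p s)"
          by (rule sum.swap_restrict) auto
        also have "\<dots> = (\<Sum>\<sigma>\<in>matchings k. \<Sum>s\<in>opposite_steps ?N k \<sigma>. ?H p s)"
        proof (intro sum.cong refl)
          fix \<sigma> assume "\<sigma> \<in> matchings k"
          then show "{s \<in> closed_steps ?N k. opposite ?N k \<sigma> s} = opposite_steps ?N k \<sigma>"
            using opposite_steps_closed[of \<sigma> k _ ?N] unfolding opposite_steps_def closed_steps_def by blast
        qed
        finally show ?thesis .
      qed
      then have "(\<Sum>p<n. \<Sum>s\<in>closed_steps ?N k. ?H p s * W ?N s) =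
         (\<Sum>\<sigma>\<in>matchings k. \<Sum>p<n. \<Sum>s\<in>opposite_steps ?N k \<sigma>. ?H p s)"
        by (simp only: sum.swap[of _ "matchings k"])
      then show ?thesis unfolding match_term_def by (simp only: sum_distrib_left[symmetric])
    qed
    have "\<bar>\<Sum>p<n. \<Sum>s\<in>closed_steps ?N k. ?H p s * (e ?N s - W ?N s)\<bar>
        \<le> (\<Sum>p<n. \<Sum>s\<in>closed_steps ?N k. if s \<in> bad_steps ?N k then D else 0)"
    proof (intro order_trans[OF sum_abs] sum_mono)
      fix p s assume s: "s \<in> closed_steps ?N k"
      show "\<bar>?H p s * (e ?N s - W ?N s)\<bar> \<le> (if s \<in> bad_steps ?N k then D else 0)"
      proof (cases "s \<in> bad_steps ?N k")
        case True
        have "\<bar>?H p s\<bar> * \<bar>e ?N s - W ?N s\<bar> \<le> 1 * D"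
          using eB[of ?N s] WB[of ?N s] by (intro mult_mono abs_walk_weight_le) (auto simp: D_def)
        then show ?thesis using True by (simp add: abs_mult)
      next
        case False
        then have "e ?N s = W ?N s"
          unfolding e_def W_def using expectation_step_product[OF ind std C N s] by blast
        then show ?thesis using False by simp
      qed
    qed
    also have "\<dots> = real n * (real (card (closed_steps ?N k \<inter> bad_steps ?N k)) * D)"
      by (simp add: sum.If_cases)
    also have "\<dots> \<le> real n * (K * real ?N ^ ((k - 1) div 2) * D)"
    proof (intro mult_left_mono mult_right_mono)
      have "card (closed_steps ?N k \<inter> bad_steps ?N k) \<le> card (bad_steps ?N k)"
        by (rule card_mono) (auto simp: bad_steps_def)
      then show "real (card (closed_steps ?N k \<inter> bad_steps ?N k)) \<le> K * real ?N ^ ((k - 1) div 2)"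
        using K[OF N] by linarith
      show "0 \<le> D" using eB[of 0 undefined] by (simp add: D_def)
    qed simp
    finally have *: "\<bar>\<Sum>p<n. \<Sum>s\<in>closed_steps ?N k. ?H p s * (e ?N s - W ?N s)\<bar> \<le> real n * (K * real ?N ^ ((k - 1) div 2) * D)" .
    have "expectation (\<lambda>\<omega>. (\<Sum>i<n. spec r hat n (\<lambda>v. x v \<omega>) i ^ k) / real n) -
      (\<Sum>\<sigma>\<in>matchings k. match_term r hat n k \<sigma>) = ?c / real n * (\<Sum>p<n. \<Sum>s\<in>closed_steps ?N k. ?H p s * (e ?N s - W ?N s))"
      unfolding 1 2 by (simp add: right_diff_distrib sum_subtractf)
    then have "\<bar>expectation (\<lambda>\<omega>. (\<Sum>i<n. spec r hat n (\<lambda>v. x v \<omega>) i ^ k) / real n) -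
      (\<Sum>\<sigma>\<in>matchings k. match_term r hat n k \<sigma>)\<bar> = ?c / real n * \<bar>\<Sum>p<n. \<Sum>s\<in>closed_steps ?N k. ?H p s * (e ?N s - W ?N s)\<bar>"
      by (simp add: abs_mult)
    also have "\<dots> \<le> ?c / real n * (real n * (K * real ?N ^ ((k - 1) div 2) * D))"
      by (intro mult_left_mono *) simp
    also have "\<dots> = ?c * (K * real ?N ^ ((k - 1) div 2) * D)" using n by simp
    finally show ?thesis .
  qed
  show ?thesis
  \<comment> \<open>For \<open>k = 0\<close> the bound does not decay, because the exponent is 0 and
    no power of \<open>n\<close> is gained; but then there are no bad sequences and the two sides
    agree.\<close>
  proof (cases "k = 0")
    case True
    have b0: "bad_steps N 0 = {}" for N by (simp add: bad_steps_def)
    have "expectation (\<lambda>\<omega>. (\<Sum>i<n. spec r hat n (\<lambda>v. x v \<omega>) i ^ k) / real n) - (\<Sum>\<sigma>\<in>matchings k. match_term r hat n k \<sigma>) = 0" if n: "n > 0" for n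
    proof -
      have "matchings 0 = {\<lambda>_. undefined}" by (auto simp: matchings_def)
      moreover have "opposite_steps (r * n) 0 (\<lambda>_. undefined) = {\<lambda>_. undefined}"
        by (simp add: opposite_steps_def steps_def opposite_def)
      ultimately show ?thesis using n unfolding True match_term_def by (simp add: walk_weight_def prob_space)
    qed
    then show ?thesis by (intro tendsto_eventually eventually_sequentiallyI[of 1]) auto
  next
    case False
    define q where "q = (k - 1) div 2"
    have q: "2 * q < k" using False by (auto simp: q_def)
    have lim: "(\<lambda>n. (K * real r ^ q * D) * (real n powr (- 1 / 2))) \<longlonglongrightarrow> (K * real r ^ q * D) * 0"
      by (intro tendsto_mult_left tendsto_neg_powr filterlim_real_sequentially) simp
    have le: "\<bar>expectation (\<lambda>\<omega>. (\<Sum>i<n. spec r hat n (\<lambda>v. x v \<omega>) i ^ k) / real n) -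
     (\<Sum>\<sigma>\<in>matchings k. match_term r hat n k \<sigma>)\<bar> \<le> (K * real r ^ q * D) * (real n powr (- 1 / 2))" if n: "n > 0" for n
    proof -
      let ?y = "real n powr (- 1 / 2)"
      have y: "0 \<le> ?y" "?y \<le> 1"
        by (simp, rule power2_le_imp_le[OF _ zero_le_one], unfold powr_half_sq[OF n]) (use n in simp)
      have K0: "0 \<le> K * real r ^ q * D"
      proof -
        have "0 \<le> K * real r ^ q" using K[of r] r by (auto simp: q_def)
        moreover have "0 \<le> D" using eB[of 0 undefined] by (simp add: D_def)
        ultimately show ?thesis by simp
      qed
      have "?y ^ k * (K * real (r * n) ^ q * D) = (K * real r ^ q * D) * (?y ^ k * real n ^ q)"
        by (simp add: power_mult_distrib)
      \<comment> \<open>Each factor \<open>n\<close> is absorbed by two factors \<open>?y\<close>;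
        since \<open>2 * q < k\<close> at least one \<open>?y\<close> is left over.\<close>
      also have "?y ^ k * real n ^ q = ?y ^ (k - 2 * q) * ((?y\<^sup>2) ^ q * real n ^ q)"
        using q by (simp flip: power_mult power_add mult.assoc)
      also have "(?y\<^sup>2) ^ q * real n ^ q = 1"
        unfolding powr_half_sq[OF n] using n by (simp add: power_divide)
      also have "(K * real r ^ q * D) * (?y ^ (k - 2 * q) * 1) \<le> (K * real r ^ q * D) * ?y"
      proof (intro mult_left_mono K0)
        show "?y ^ (k - 2 * q) * 1 \<le> ?y" using power_decreasing[of 1 "k - 2 * q" ?y] y q by simp
      qed
      finally show ?thesis using bd[OF n] unfolding q_def by linarith
    qed
    show ?thesis
      by (rule Lim_null_comparison[OF _ lim[unfolded mult_zero_right]])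
        (use le in \<open>auto intro!: eventually_sequentiallyI[of 1]\<close>)
  qed
qed

end

section \<open>Limits of the moments\<close>

text \<open>Dominated convergence with an unidentified limit function: the limit moments have to
  exist, and no closed form for them enters the argument.\<close>

lemma (in prob_space) convergent_integral:
  fixes f :: "nat \<Rightarrow> 'a \<Rightarrow> real"
  assumes f[measurable]: "\<And>n. f n \<in> borel_measurable M" and B: "\<And>n. AE x in M. \<bar>f n x\<bar> \<le> B"
    and c: "AE x in M. convergent (\<lambda>n. f n x)"
  shows "convergent (\<lambda>n. \<integral>x. f n x \<partial>M)"
proof (rule convergentI, rule integral_dominated_convergence)
  show "(\<lambda>x. lim (\<lambda>n. f n x)) \<in> borel_measurable M" by (rule borel_measurable_lim_metric) (rule f)
  show "AE x in M. (\<lambda>n. f n x) \<longlonglongrightarrow> lim (\<lambda>n. f n x)"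
    using c by eventually_elim (simp add: convergent_LIMSEQ_iff)
  show "integrable M (\<lambda>_. B)" by simp
  show "AE x in M. norm (f n x) \<le> B" for n using B by simp
qed (rule f)

section \<open>Grid averages as integrals over the unit cube\<close>

abbreviation unif :: "real measure" where
  "unif \<equiv> uniform_measure lborel {0..<1}"

lemma prob_space_unif: "prob_space unif"
  by (rule prob_space_uniform_measure) auto

lemma AE_unif_range: "AE u in unif. 0 \<le> u \<and> u < 1"
  by (rule AE_uniform_measureI) auto

lemma AE_unif_countable:
  assumes "countable B" shows "AE u in unif. u \<notin> B"
proof (rule AE_uniform_measureI)
  have "AE u in lborel. u \<notin> B" by (rule AE_not_in[OF countable_imp_null_set_lborel[OF assms]])
  then show "AE u in lborel. u \<in> {0..<1} \<longrightarrow> u \<notin> B" by eventually_elim simp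
qed simp

lemma integral_unif_cell:
  assumes N: "N > 0" and j: "j \<in> {0..<int N}"
  shows "(\<integral>u. (if \<lfloor>real N * u\<rfloor> = j then 1 else 0) \<partial>unif) = 1 / real N"
proof -
  interpret prob_space unif by (rule prob_space_unif)
  let ?B = "{real_of_int j / real N ..< (real_of_int j + 1) / real N}"
  have cell: "\<lfloor>real N * u\<rfloor> = j \<longleftrightarrow> u \<in> ?B" for u
    using N by (auto simp: floor_eq_iff field_simps)
  have "(\<integral>u. (if \<lfloor>real N * u\<rfloor> = j then 1 else 0) \<partial>unif) = (\<integral>u. indicator ?B u \<partial>unif)"
    unfolding cell by (intro Bochner_Integration.integral_cong refl) (simp add: indicator_def)
  also have "\<dots> = measure unif ?B" by simp
  also have "\<dots> = measure lborel ({0..<1} \<inter> ?B) / measure lborel {0..<1::real}"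
    by (rule measure_uniform_measure) auto
  also have "{0..<1} \<inter> ?B = ?B"
  proof -
    have "0 \<le> real_of_int j / real N" using j by simp
    moreover have "(real_of_int j + 1) / real N \<le> 1" using j N by (simp add: field_simps)
    ultimately show ?thesis by auto
  qed
  finally show ?thesis using N by (simp add: divide_right_mono field_simps)
qed

lemma sum_as_integral_unif:
  assumes N: "N > 0"
  shows "(\<Sum>p<N. f (int p)) / real N = (\<integral>u. f \<lfloor>real N * u\<rfloor> \<partial>unif)"
    and "(\<lambda>u. f \<lfloor>real N * u\<rfloor>) \<in> borel_measurable unif"
proof -
  interpret prob_space unif by (rule prob_space_unif)
  have m: "(\<lambda>u. real N * u) \<in> borel_measurable unif" by simp
  have fl: "(\<lambda>u. \<lfloor>real N * u\<rfloor>) \<in> measurable unif (count_space UNIV)" using m by measurable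
  show fm: "(\<lambda>u. f \<lfloor>real N * u\<rfloor>) \<in> borel_measurable unif"
    by (rule measurable_compose[OF fl]) simp
  have ind: "(\<lambda>u. if \<lfloor>real N * u\<rfloor> = int p then 1 else 0 :: real) \<in> borel_measurable unif" for p
    by (rule measurable_compose[OF fl, of "\<lambda>z. if z = int p then 1 else 0"]) simp
  have "(\<integral>u. f \<lfloor>real N * u\<rfloor> \<partial>unif) = (\<integral>u. (\<Sum>p<N. f (int p) * (if \<lfloor>real N * u\<rfloor> = int p then 1 else 0)) \<partial>unif)"
  proof (rule integral_cong_AE[OF fm])
    show "(\<lambda>u. \<Sum>p<N. f (int p) * (if \<lfloor>real N * u\<rfloor> = int p then 1 else 0)) \<in> borel_measurable unif"
      by (intro borel_measurable_sum borel_measurable_times borel_measurable_const ind)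
    show "AE u in unif. f \<lfloor>real N * u\<rfloor> = (\<Sum>p<N. f (int p) * (if \<lfloor>real N * u\<rfloor> = int p then 1 else 0))"
      using AE_unif_range
    proof eventually_elim
      fix u :: real assume u: "0 \<le> u \<and> u < 1"
      let ?q = "nat \<lfloor>real N * u\<rfloor>"
      have q0: "0 \<le> \<lfloor>real N * u\<rfloor>" using u by simp
      have "real N * u < real N" using u N by simp
      then have "?q < N" using u by (simp add: floor_less_iff nat_less_iff)
      have "(\<Sum>p<N. f (int p) * (if \<lfloor>real N * u\<rfloor> = int p then 1 else 0)) = (\<Sum>p<N. if p = ?q then f \<lfloor>real N * u\<rfloor> else 0)"
        using q0 by (intro sum.cong refl) auto
      then show "f \<lfloor>real N * u\<rfloor> = (\<Sum>p<N. f (int p) * (if \<lfloor>real N * u\<rfloor> = int p then 1 else 0))"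
        using \<open>?q < N\<close> by simp
    qed
  qed
  also have "\<dots> = (\<Sum>p<N. f (int p) * (\<integral>u. (if \<lfloor>real N * u\<rfloor> = int p then 1 else 0) \<partial>unif))"
  proof (subst Bochner_Integration.integral_sum)
    show "integrable unif (\<lambda>u. f (int p) * (if \<lfloor>real N * u\<rfloor> = int p then 1 else 0))" for p
      by (intro integrable_mult_right integrable_bounded[where B = 1] ind) auto
  qed simp
  also have "\<dots> = (\<Sum>p<N. f (int p) * (1 / real N))"
    by (intro sum.cong refl, subst integral_unif_cell[OF N]) auto
  finally show "(\<Sum>p<N. f (int p)) / real N = (\<integral>u. f \<lfloor>real N * u\<rfloor> \<partial>unif)"
    by (simp add: sum_divide_distrib)
qed

text \<open>The integrand is spelled out as a sum over grid cells because its measurability is then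
  evident for arbitrary \<open>F\<close>. On the cube it coincides with \<open>F\<close> at the
  integer parts, which is the form in which limits are taken.\<close>

lemma sum_as_integral_cube:
  fixes F :: "('i \<Rightarrow> int) \<Rightarrow> real"
  assumes N: "N > 0" and A: "finite A"
  defines "h \<equiv> \<lambda>V. \<Sum>v\<in>PiE A (\<lambda>_. {0..<int N}). F v * (\<Prod>i\<in>A. if \<lfloor>real N * V i\<rfloor> = v i then 1 else 0 :: real)"
  shows "(\<Sum>v\<in>PiE A (\<lambda>_. {0..<int N}). F v) / real N ^ card A = (\<integral>V. h V \<partial>PiM A (\<lambda>_. unif))"
    and "h \<in> borel_measurable (PiM A (\<lambda>_. unif))"
    and "(\<And>i. i \<in> A \<Longrightarrow> 0 \<le> V i \<and> V i < 1) \<Longrightarrow> h V = F (\<lambda>i\<in>A. \<lfloor>real N * V i\<rfloor>)"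
proof -
  interpret u: prob_space unif by (rule prob_space_unif)
  interpret product_sigma_finite "\<lambda>_. unif" by (intro product_sigma_finite.intro) (rule u.sigma_finite_measure_axioms)
  interpret P: prob_space "PiM A (\<lambda>_. unif)" by (rule prob_space_PiM) (rule prob_space_unif)
  let ?S = "PiE A (\<lambda>_. {0..<int N})"
  have fS: "finite ?S" using A by (intro finite_PiE) auto
  have m: "(\<lambda>u. real N * u) \<in> borel_measurable unif" by simp
  have fl: "(\<lambda>u. \<lfloor>real N * u\<rfloor>) \<in> measurable unif (count_space UNIV)" using m by measurable
  have ind: "(\<lambda>u. if \<lfloor>real N * u\<rfloor> = z then 1 else 0 :: real) \<in> borel_measurable unif" for z
    by (rule measurable_compose[OF fl, of "\<lambda>y. if y = z then 1 else 0"]) simp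
  have pm: "(\<lambda>V. \<Prod>i\<in>A. if \<lfloor>real N * V i\<rfloor> = v i then 1 else 0 :: real) \<in> borel_measurable (PiM A (\<lambda>_. unif))" for v
  proof (rule borel_measurable_prod)
    fix i assume "i \<in> A"
    then have "(\<lambda>V. V i) \<in> measurable (PiM A (\<lambda>_. unif)) unif" by (rule measurable_component_singleton)
    from measurable_compose[OF this ind[of "v i"]]
    show "(\<lambda>V. if \<lfloor>real N * V i\<rfloor> = v i then 1 else 0 :: real) \<in> borel_measurable (PiM A (\<lambda>_. unif))" .
  qed
  show hm: "h \<in> borel_measurable (PiM A (\<lambda>_. unif))"
    unfolding h_def by (intro borel_measurable_sum borel_measurable_times borel_measurable_const pm)
  have one: "(\<integral>V. (\<Prod>i\<in>A. if \<lfloor>real N * V i\<rfloor> = v i then 1 else 0 :: real) \<partial>PiM A (\<lambda>_. unif)) = 1 / real N ^ card A"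
    if v: "v \<in> ?S" for v
  proof -
    have "(\<integral>V. (\<Prod>i\<in>A. (\<lambda>i u. if \<lfloor>real N * u\<rfloor> = v i then 1 else 0 :: real) i (V i)) \<partial>PiM A (\<lambda>_. unif)) =
        (\<Prod>i\<in>A. \<integral>u. (if \<lfloor>real N * u\<rfloor> = v i then 1 else 0) \<partial>unif)"
      by (rule product_integral_prod[OF A]) (rule u.integrable_bounded[OF ind, of _ 1], auto)
    also have "\<dots> = (\<Prod>i\<in>A. 1 / real N)"
      by (intro prod.cong refl integral_unif_cell[OF N]) (use v in \<open>auto simp: PiE_iff\<close>)
    finally show ?thesis by (simp add: power_divide)
  qed
  have "(\<integral>V. h V \<partial>PiM A (\<lambda>_. unif)) = (\<Sum>v\<in>?S. F v * (\<integral>V. (\<Prod>i\<in>A. if \<lfloor>real N * V i\<rfloor> = v i then 1 else 0 :: real) \<partial>PiM A (\<lambda>_. unif)))"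
    unfolding h_def
  proof (subst Bochner_Integration.integral_sum)
    show "integrable (PiM A (\<lambda>_. unif)) (\<lambda>V. F v * (\<Prod>i\<in>A. if \<lfloor>real N * V i\<rfloor> = v i then 1 else 0 :: real))" for v
      by (intro integrable_mult_right P.integrable_bounded[where B = 1] pm)
        (auto simp: abs_prod intro!: prod_le_1)
  qed simp
  also have "\<dots> = (\<Sum>v\<in>?S. F v * (1 / real N ^ card A))" by (intro sum.cong refl, subst one) auto
  finally show "(\<Sum>v\<in>?S. F v) / real N ^ card A = (\<integral>V. h V \<partial>PiM A (\<lambda>_. unif))"
    by (simp add: sum_divide_distrib)
  assume V: "\<And>i. i \<in> A \<Longrightarrow> 0 \<le> V i \<and> V i < 1"
  define w where "w = (\<lambda>i\<in>A. \<lfloor>real N * V i\<rfloor>)"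
  have wS: "w \<in> ?S"
  proof -
    have "\<lfloor>real N * V i\<rfloor> \<in> {0..<int N}" if "i \<in> A" for i
    proof -
      have "real N * V i < real N" using V[OF that] N by simp
      then show ?thesis using V[OF that] by (simp add: floor_less_iff)
    qed
    then show ?thesis by (simp add: w_def)
  qed
  have "h V = (\<Sum>v\<in>?S. if v = w then F w else 0)"
    unfolding h_def
  proof (intro sum.cong refl)
    fix v assume v: "v \<in> ?S"
    show "F v * (\<Prod>i\<in>A. if \<lfloor>real N * V i\<rfloor> = v i then 1 else 0 :: real) = (if v = w then F w else 0)"
    proof (cases "v = w")
      case True
      then show ?thesis by (simp add: w_def)
    next
      case False
      then obtain i where "i \<in> A" "v i \<noteq> w i" using v wS by (metis PiE_ext)
      then have "(\<Prod>i\<in>A. if \<lfloor>real N * V i\<rfloor> = v i then 1 else 0 :: real) = 0"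
        by (intro prod_zero[OF A] bexI[of _ i]) (auto simp: w_def)
      then show ?thesis using False by simp
    qed
  qed
  then show "h V = F (\<lambda>i\<in>A. \<lfloor>real N * V i\<rfloor>)" using fS wS by (simp add: w_def)
qed

definition openers :: "nat \<Rightarrow> (nat \<Rightarrow> nat) \<Rightarrow> nat set" where
  "openers k \<sigma> = {i. i < k \<and> i < \<sigma> i}"

text \<open>The smaller index of each pair carries a free value and its partner the negative. The
  polymorphic type covers the integer steps as well as their real limits after scaling.\<close>

definition signed_ext :: "nat \<Rightarrow> (nat \<Rightarrow> nat) \<Rightarrow> (nat \<Rightarrow> 'b::ab_group_add) \<Rightarrow> nat \<Rightarrow> 'b" where
  "signed_ext k \<sigma> v i = (if i \<in> openers k \<sigma> then v i else - v (\<sigma> i))"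

lemma finite_openers [simp]: "finite (openers k \<sigma>)"
  by (simp add: openers_def)

lemma card_openers: "\<sigma> \<in> matchings k \<Longrightarrow> k = 2 * card (openers k \<sigma>)"
  using sum_matching_split[of \<sigma> k "\<lambda>_. 1::nat"] by (simp add: openers_def)

lemma matching_not_opener:
  assumes "\<sigma> \<in> matchings k" "i < k" "i \<notin> openers k \<sigma>"
  shows "\<sigma> i \<in> openers k \<sigma>"
proof -
  have "\<sigma> i < k" "\<sigma> i \<noteq> i" "\<sigma> (\<sigma> i) = i" using assms(1,2) by (auto simp: matchings_def PiE_iff)
  then show ?thesis using assms(2,3) by (simp add: openers_def)
qed

text \<open>A matched sequence is given freely by its steps at the openers. The extension produces
  negative integers rather than residues, so \<open>f\<close> is required to depend on residues
  only.\<close>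

lemma sum_opposite_steps:
  assumes \<sigma>: "\<sigma> \<in> matchings k" and N: "N > 0"
    and f: "\<And>s s'. (\<And>i. i < k \<Longrightarrow> s i mod int N = s' i mod int N) \<Longrightarrow> f s = f s'"
  shows "(\<Sum>s\<in>opposite_steps N k \<sigma>. f s) = (\<Sum>v\<in>PiE (openers k \<sigma>) (\<lambda>_. {0..<int N}). f (signed_ext k \<sigma> v))"
proof -
  let ?A = "openers k \<sigma>"
  define g where "g v = (\<lambda>i\<in>{..<k}. signed_ext k \<sigma> v i mod int N)" for v :: "nat \<Rightarrow> int"
  have \<sigma>': "\<sigma> i < k" "\<sigma> i \<noteq> i" "\<sigma> (\<sigma> i) = i" if "i < k" for i
    using \<sigma> that by (auto simp: matchings_def PiE_iff)
  have gA: "g v i = v i" if "v \<in> PiE ?A (\<lambda>_. {0..<int N})" "i \<in> ?A" for v i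
  proof -
    have "v i \<in> {0..<int N}" using that by (blast dest: PiE_mem)
    then show ?thesis using that(2) by (simp add: g_def signed_ext_def openers_def)
  qed
  show ?thesis
  proof (rule sum.reindex_bij_witness[of _ g "\<lambda>s. restrict s ?A"])
    fix s assume s: "s \<in> opposite_steps N k \<sigma>"
    then have st: "s \<in> PiE {..<k} (\<lambda>_. {0..<int N})" and op: "\<And>i. i < k \<Longrightarrow> int N dvd s i + s (\<sigma> i)"
      by (auto simp: opposite_steps_def steps_def opposite_def)
    have r: "s i \<in> {0..<int N}" if "i < k" for i using st that by (blast dest: PiE_mem)
    have ext: "signed_ext k \<sigma> (restrict s ?A) i mod int N = s i" if i: "i < k" for i
    proof (cases "i \<in> ?A")
      case True
      then show ?thesis using r[OF i] by (simp add: signed_ext_def)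
    next
      case False
      have "int N dvd (- s (\<sigma> i)) - s i" using op[OF i] by (metis add.commute dvd_minus_iff minus_add_distrib uminus_add_conv_diff diff_minus_eq_add minus_diff_eq)
      then have "(- s (\<sigma> i)) mod int N = s i mod int N" by (simp only: mod_eq_dvd_iff)
      then show ?thesis using False matching_not_opener[OF \<sigma> i False] r[OF i] by (simp add: signed_ext_def)
    qed
    show "g (restrict s ?A) = s"
      by (rule PiE_ext[of _ "{..<k}" "\<lambda>_. {0..<int N}"]) (use ext st N in \<open>auto simp: g_def\<close>)
    show "restrict s ?A \<in> PiE ?A (\<lambda>_. {0..<int N})"
      using r by (auto simp: openers_def)
    show "f (signed_ext k \<sigma> (restrict s ?A)) = f s"
      by (rule f) (use ext r in auto)
  next
    fix v assume v: "v \<in> PiE ?A (\<lambda>_. {0..<int N})"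
    show "restrict (g v) ?A = v"
      by (rule PiE_ext[OF _ v]) (use gA[OF v] v in auto)
    show "g v \<in> opposite_steps N k \<sigma>"
      unfolding opposite_steps_def steps_def opposite_def mem_Collect_eq
    proof (intro conjI allI impI)
      show "g v \<in> PiE {..<k} (\<lambda>_. {0..<int N})" using N by (auto simp: g_def)
      fix i assume i: "i < k"
      have "signed_ext k \<sigma> v i + signed_ext k \<sigma> v (\<sigma> i) = 0"
      proof (cases "i \<in> ?A")
        case True
        then have "\<sigma> i \<notin> ?A" using \<sigma>'[OF i] by (simp add: openers_def)
        then show ?thesis using True \<sigma>'[OF i] by (simp add: signed_ext_def)
      next
        case False
        then show ?thesis using matching_not_opener[OF \<sigma> i False] by (simp add: signed_ext_def)
      qed
      then have "(g v i + g v (\<sigma> i)) mod int N = 0"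
        using i \<sigma>'[OF i] by (simp add: g_def mod_add_eq)
      then show "int N dvd g v i + g v (\<sigma> i)" by (simp add: dvd_eq_mod_eq_0)
    qed
  qed
qed

lemma eventually_floor_eq:
  fixes y :: "nat \<Rightarrow> real"
  assumes "y \<longlonglongrightarrow> \<theta>" "\<theta> \<notin> \<int>"
  shows "eventually (\<lambda>n. \<lfloor>y n\<rfloor> = \<lfloor>\<theta>\<rfloor>) sequentially"
proof -
  have "real_of_int \<lfloor>\<theta>\<rfloor> < \<theta>" using assms(2) by (metis Ints_of_int floor_correct order_le_less)
  then have "eventually (\<lambda>n. real_of_int \<lfloor>\<theta>\<rfloor> < y n) sequentially" by (rule order_tendstoD(1)[OF assms(1)])
  moreover have "eventually (\<lambda>n. y n < real_of_int \<lfloor>\<theta>\<rfloor> + 1) sequentially"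
    by (rule order_tendstoD(2)[OF assms(1)]) linarith
  ultimately show ?thesis by eventually_elim linarith
qed

text \<open>In the scaling limit a cell jumps only where a position hits the border of the index
  range or where two consecutive positions hit the antidiagonal. Off these three lines all tests are
  eventually constant.\<close>

lemma convergent_cell:
  fixes a b :: "nat \<Rightarrow> int"
  assumes a: "(\<lambda>n. real_of_int (a n) / real n) \<longlonglongrightarrow> \<alpha>" and b: "(\<lambda>n. real_of_int (b n) / real n) \<longlonglongrightarrow> \<beta>"
    and ne: "\<alpha> \<noteq> 1" "\<beta> \<noteq> 1" "\<alpha> + \<beta> \<noteq> 1"
  shows "convergent (\<lambda>n. cell hat n (a n) (b n))"
proof -
  have pos: "eventually (\<lambda>n::nat. n > 0) sequentially" by (rule eventually_gt_at_top)
  have lt: "\<exists>v. eventually (\<lambda>n. (c n < int n) = v) sequentially"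
    if c: "(\<lambda>n. real_of_int (c n) / real n) \<longlonglongrightarrow> \<gamma>" and g: "\<gamma> \<noteq> 1" for c \<gamma>
  proof (cases "\<gamma> < 1")
    case True
    have "eventually (\<lambda>n. (c n < int n) = True) sequentially"
      using order_tendstoD(2)[OF c True] pos by eventually_elim (simp add: divide_less_eq)
    then show ?thesis by blast
  next
    case False
    then have g1: "1 < \<gamma>" using g by simp
    have "eventually (\<lambda>n. (c n < int n) = False) sequentially"
      using order_tendstoD(1)[OF c g1] pos by eventually_elim (simp add: less_divide_eq)
    then show ?thesis by blast
  qed
  obtain va where va: "eventually (\<lambda>n. (a n < int n) = va) sequentially" using lt[OF a ne(1)] by blast
  obtain vb where vb: "eventually (\<lambda>n. (b n < int n) = vb) sequentially" using lt[OF b ne(2)] by blast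
  have "(\<lambda>n. 1 - 1 / real n - real_of_int (a n) / real n - real_of_int (b n) / real n) \<longlonglongrightarrow> 1 - 0 - \<alpha> - \<beta>"
    by (intro tendsto_diff a b tendsto_const lim_1_over_n)
  then have l: "(\<lambda>n. 1 - 1 / real n - real_of_int (a n) / real n - real_of_int (b n) / real n) \<longlonglongrightarrow> 1 - \<alpha> - \<beta>" by simp
  have sg: "real_of_int (int n - 1 - a n - b n) = real n * (1 - 1 / real n - real_of_int (a n) / real n - real_of_int (b n) / real n)"
    if "n > 0" for n using that by (simp add: field_simps)
  have "\<exists>z. eventually (\<lambda>n. sgn (int n - 1 - a n - b n) = z) sequentially"
  proof (cases "\<alpha> + \<beta> < 1")
    case True
    then have "0 < 1 - \<alpha> - \<beta>" by simp
    from order_tendstoD(1)[OF l this] pos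
    have "eventually (\<lambda>n. sgn (int n - 1 - a n - b n) = 1) sequentially"
    proof eventually_elim
      fix n :: nat assume "0 < 1 - 1 / real n - real_of_int (a n) / real n - real_of_int (b n) / real n" "0 < n"
      then have "0 < real_of_int (int n - 1 - a n - b n)" unfolding sg[OF \<open>0 < n\<close>] by simp
      then have "0 < int n - 1 - a n - b n" by (simp only: of_int_0_less_iff)
      then show "sgn (int n - 1 - a n - b n) = 1" by (simp only: sgn_1_pos)
    qed
    then show ?thesis by blast
  next
    case False
    then have "1 - \<alpha> - \<beta> < 0" using ne by simp
    from order_tendstoD(2)[OF l this] pos
    have "eventually (\<lambda>n. sgn (int n - 1 - a n - b n) = - 1) sequentially"
    proof eventually_elim
      fix n :: nat assume "1 - 1 / real n - real_of_int (a n) / real n - real_of_int (b n) / real n < 0" "0 < n"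
      then have "real_of_int (int n - 1 - a n - b n) < 0" unfolding sg[OF \<open>0 < n\<close>] by (simp add: mult_pos_neg)
      then have "int n - 1 - a n - b n < 0" by (simp only: of_int_less_0_iff)
      then show "sgn (int n - 1 - a n - b n) = - 1" by (simp only: sgn_1_neg)
    qed
    then show ?thesis by blast
  qed
  then obtain z where z: "eventually (\<lambda>n. sgn (int n - 1 - a n - b n) = z) sequentially" by blast
  have "eventually (\<lambda>n. cell hat n (a n) (b n) = (if va \<and> vb then (if hat then of_int z else 1) else 0)) sequentially"
    using va vb z by eventually_elim (simp add: cell_def)
  then have "(\<lambda>n. cell hat n (a n) (b n)) \<longlonglongrightarrow> (if va \<and> vb then (if hat then of_int z else 1) else 0)"
    by (rule tendsto_eventually)
  then show ?thesis by (rule convergentI)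
qed

lemma floor_scaled_limit: "(\<lambda>n. real_of_int \<lfloor>real n * u\<rfloor> / real n) \<longlonglongrightarrow> u"
proof (rule real_tendsto_sandwich)
  show "eventually (\<lambda>n. u - 1 / real n \<le> real_of_int \<lfloor>real n * u\<rfloor> / real n) sequentially"
    using eventually_gt_at_top[of 0]
  proof eventually_elim
    fix n :: nat assume "n > 0"
    moreover have "(real n * u - 1) / real n \<le> real_of_int \<lfloor>real n * u\<rfloor> / real n"
      by (rule divide_right_mono) (linarith, simp)
    ultimately show "u - 1 / real n \<le> real_of_int \<lfloor>real n * u\<rfloor> / real n" by (simp add: diff_divide_distrib)
  qed
  show "eventually (\<lambda>n. real_of_int \<lfloor>real n * u\<rfloor> / real n \<le> u) sequentially"
    using eventually_gt_at_top[of 0]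
  proof eventually_elim
    fix n :: nat assume "n > 0"
    moreover have "real_of_int \<lfloor>real n * u\<rfloor> / real n \<le> real n * u / real n"
      by (rule divide_right_mono) (linarith, simp)
    ultimately show "real_of_int \<lfloor>real n * u\<rfloor> / real n \<le> u" by simp
  qed
  show "(\<lambda>n. u - 1 / real n) \<longlonglongrightarrow> u" using tendsto_diff[OF tendsto_const lim_1_over_n, of u] by simp
qed simp

text \<open>Positions are measured in units of \<open>n\<close> and steps in units of the
  circumference \<open>r * n\<close>; hence the start enters as \<open>u / r\<close> and the
  fractional part is multiplied by \<open>r\<close>. Reduction modulo the circumference passes to
  the limit away from integers.\<close>

lemma walk_limit:
  assumes r: "r > 0" and th: "u / real r + (\<Sum>i<j. signed_ext k \<sigma> V i) \<notin> \<int>"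
  shows "(\<lambda>n. real_of_int (walk (r * n) \<lfloor>real n * u\<rfloor> (signed_ext k \<sigma> (\<lambda>i. \<lfloor>real (r * n) * V i\<rfloor>)) j) / real n)
    \<longlonglongrightarrow> real r * frac (u / real r + (\<Sum>i<j. signed_ext k \<sigma> V i))"
proof -
  let ?th = "u / real r + (\<Sum>i<j. signed_ext k \<sigma> V i)"
  define X where "X n = \<lfloor>real n * u\<rfloor> + (\<Sum>i<j. signed_ext k \<sigma> (\<lambda>i. \<lfloor>real (r * n) * V i\<rfloor>) i)" for n
  have V: "(\<lambda>n. real_of_int \<lfloor>real (r * n) * y\<rfloor> / real (r * n)) \<longlonglongrightarrow> y" for y
    using LIMSEQ_subseq_LIMSEQ[OF floor_scaled_limit[of y], of "\<lambda>n. r * n"] r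
    by (auto simp: comp_def strict_mono_def)
  have "(\<lambda>n. real_of_int \<lfloor>real n * u\<rfloor> / real n / real r + (\<Sum>i<j. real_of_int (signed_ext k \<sigma> (\<lambda>i. \<lfloor>real (r * n) * V i\<rfloor>) i) / real (r * n))) \<longlonglongrightarrow> ?th"
  proof (intro tendsto_add tendsto_divide floor_scaled_limit tendsto_const tendsto_sum)
    fix i
    show "(\<lambda>n. real_of_int (signed_ext k \<sigma> (\<lambda>i. \<lfloor>real (r * n) * V i\<rfloor>) i) / real (r * n)) \<longlonglongrightarrow> signed_ext k \<sigma> V i"
      using V[of "V i"] tendsto_minus[OF V[of "V (\<sigma> i)"]] by (simp add: signed_ext_def)
  qed (use r in simp)
  also have "(\<lambda>n. real_of_int \<lfloor>real n * u\<rfloor> / real n / real r + (\<Sum>i<j. real_of_int (signed_ext k \<sigma> (\<lambda>i. \<lfloor>real (r * n) * V i\<rfloor>) i) / real (r * n)))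
     = (\<lambda>n. real_of_int (X n) / real (r * n))"
    by (rule ext) (simp add: X_def add_divide_distrib sum_divide_distrib mult.commute)
  finally have Xl: "(\<lambda>n. real_of_int (X n) / real (r * n)) \<longlonglongrightarrow> ?th" .
  have fl: "eventually (\<lambda>n. \<lfloor>real_of_int (X n) / real (r * n)\<rfloor> = \<lfloor>?th\<rfloor>) sequentially"
    by (rule eventually_floor_eq[OF Xl th])
  have "eventually (\<lambda>n. real r * (real_of_int (X n) / real (r * n) - real_of_int \<lfloor>?th\<rfloor>) =
      real_of_int (walk (r * n) \<lfloor>real n * u\<rfloor> (signed_ext k \<sigma> (\<lambda>i. \<lfloor>real (r * n) * V i\<rfloor>)) j) / real n) sequentially"
    using fl eventually_gt_at_top[of 0]
  proof eventually_elim
    fix n :: nat assume f: "\<lfloor>real_of_int (X n) / real (r * n)\<rfloor> = \<lfloor>?th\<rfloor>" and n: "0 < n"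
    have "X n div int (r * n) = \<lfloor>?th\<rfloor>" unfolding f[symmetric] by (metis floor_divide_of_int_eq of_int_of_nat_eq)
    then have w: "walk (r * n) \<lfloor>real n * u\<rfloor> (signed_ext k \<sigma> (\<lambda>i. \<lfloor>real (r * n) * V i\<rfloor>)) j = X n - int (r * n) * \<lfloor>?th\<rfloor>"
      unfolding walk_def X_def[symmetric] by (simp add: minus_div_mult_eq_mod[symmetric] mult.commute)
    have "real r * (a / real (r * n) - b) = (a - real (r * n) * b) / real n" for a b
      using n r by (simp add: field_simps)
    then show "real r * (real_of_int (X n) / real (r * n) - real_of_int \<lfloor>?th\<rfloor>) =
      real_of_int (walk (r * n) \<lfloor>real n * u\<rfloor> (signed_ext k \<sigma> (\<lambda>i. \<lfloor>real (r * n) * V i\<rfloor>)) j) / real n"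
      by (simp only: w of_int_diff of_int_mult of_int_of_nat_eq)
  qed
  moreover have "(\<lambda>n. real r * (real_of_int (X n) / real (r * n) - real_of_int \<lfloor>?th\<rfloor>)) \<longlonglongrightarrow> real r * frac ?th"
    unfolding frac_def by (intro tendsto_intros Xl)
  ultimately show ?thesis by (rule Lim_transform_eventually[rotated])
qed

lemma convergent_finite_prod:
  fixes f :: "'i \<Rightarrow> nat \<Rightarrow> real"
  assumes "\<And>i. i \<in> I \<Longrightarrow> convergent (f i)"
  shows "convergent (\<lambda>n. \<Prod>i\<in>I. f i n)"
  by (rule convergentI[of _ "\<Prod>i\<in>I. lim (f i)"], rule tendsto_prod)
    (use assms in \<open>simp add: convergent_LIMSEQ_iff\<close>)

text \<open>For any fixed \<open>V\<close> each degenerate position determines the start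
  \<open>u\<close> up to an integer, so the exceptional starts are countable. Averaging over the
  start thus spares any study of null sets in the cube of steps.\<close>

lemma AE_convergent_walk_weight:
  assumes r: "r > 0"
  shows "AE u in unif. convergent (\<lambda>n. walk_weight r hat n k \<lfloor>real n * u\<rfloor> (signed_ext k \<sigma> (\<lambda>i. \<lfloor>real (r * n) * V i\<rfloor>)))"
proof -
  define a where "a j = (\<Sum>i<j. signed_ext k \<sigma> V i)" for j
  \<comment> \<open>The three families collect the starts for which a position is 0, for which it is
    1 in units of \<open>n\<close>, and for which two consecutive positions add up to 1.\<close>
  define B where "B = (\<Union>j\<le>k. range (\<lambda>z::int. real r * (real_of_int z - a j)) \<union>
     range (\<lambda>z::int. real r * (real_of_int z + 1 / real r - a j)) \<union>
     range (\<lambda>z::int. real r * (real_of_int z + 1 / real r - a j - a (Suc j)) / 2))"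
  have "countable B" unfolding B_def by (intro countable_UN countable_Un countable_image) auto
  from AE_unif_countable[OF this] show ?thesis
  proof eventually_elim
    fix u assume u: "u \<notin> B"
    let ?th = "\<lambda>j. u / real r + a j"
    have th: "?th j \<notin> \<int>" if "j \<le> k" for j
    proof
      assume "?th j \<in> \<int>"
      then obtain z :: int where "?th j = real_of_int z" by (auto elim: Ints_cases)
      then have "u = real r * (real_of_int z - a j)" using r by (simp add: field_simps)
      then show False using u that unfolding B_def by blast
    qed
    have ne1: "real r * frac (?th j) \<noteq> 1" if "j \<le> k" for j
    proof
      assume "real r * frac (?th j) = 1"
      then have "frac (?th j) = 1 / real r" using r by (simp add: field_simps)
      then have "u = real r * (real_of_int \<lfloor>?th j\<rfloor> + 1 / real r - a j)" using r by (simp add: frac_def field_simps)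
      then show False using u that unfolding B_def by blast
    qed
    have ne2: "real r * frac (?th j) + real r * frac (?th (Suc j)) \<noteq> 1" if "j \<le> k" for j
    proof
      assume "real r * frac (?th j) + real r * frac (?th (Suc j)) = 1"
      then have "?th j + ?th (Suc j) = real_of_int (\<lfloor>?th j\<rfloor> + \<lfloor>?th (Suc j)\<rfloor>) + 1 / real r"
        using r by (simp add: frac_def field_simps)
      then have "2 * (u / real r) = real_of_int (\<lfloor>?th j\<rfloor> + \<lfloor>?th (Suc j)\<rfloor>) + 1 / real r - a j - a (Suc j)"
        by linarith
      moreover have "u = real r * (2 * (u / real r)) / 2" using r by simp
      ultimately have "u = real r * (real_of_int (\<lfloor>?th j\<rfloor> + \<lfloor>?th (Suc j)\<rfloor>) + 1 / real r - a j - a (Suc j)) / 2"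
        by (simp only:)
      then show False using u that unfolding B_def by blast
    qed
    show "convergent (\<lambda>n. walk_weight r hat n k \<lfloor>real n * u\<rfloor> (signed_ext k \<sigma> (\<lambda>i. \<lfloor>real (r * n) * V i\<rfloor>)))"
      unfolding walk_weight_def
    proof (rule convergent_finite_prod)
      fix j assume "j \<in> {..<k}"
      then have j: "j < k" by simp
      show "convergent (\<lambda>n. cell hat n (walk (r * n) \<lfloor>real n * u\<rfloor> (signed_ext k \<sigma> (\<lambda>i. \<lfloor>real (r * n) * V i\<rfloor>)) j)
          (walk (r * n) \<lfloor>real n * u\<rfloor> (signed_ext k \<sigma> (\<lambda>i. \<lfloor>real (r * n) * V i\<rfloor>)) (Suc j)))"
        by (rule convergent_cell[OF walk_limit[OF r th[unfolded a_def]] walk_limit[OF r th[unfolded a_def]]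
              ne1[unfolded a_def] ne1[unfolded a_def] ne2[unfolded a_def]])
          (use j in simp_all)
    qed
  qed
qed

lemma walk_weight_cong_mod:
  assumes "\<And>i. i < k \<Longrightarrow> s i mod int (r * n) = s' i mod int (r * n)"
  shows "walk_weight r hat n k p s = walk_weight r hat n k p s'"
proof -
  have w: "walk (r * n) p s j = walk (r * n) p s' j" if "j \<le> k" for j
    by (rule walk_cong_mod) (use assms that in auto)
  show ?thesis
    unfolding walk_weight_def by (intro prod.cong refl arg_cong2[where f = "cell hat n"] w) auto
qed

lemma walk_weight_cong: 
  assumes "\<And>i. i < k \<Longrightarrow> s i = s' i"
  shows "walk_weight r hat n k p s = walk_weight r hat n k p s'"
  by (rule walk_weight_cong_mod) (simp add: assms)

text \<open>The walk has one free step per pair, each ranging over \<open>r * n\<close> residues,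
  whereas the scaling divides by \<open>n\<close> per pair only; the power of \<open>r\<close>
  compensates.\<close>

lemma match_term_average:
  assumes \<sigma>: "\<sigma> \<in> matchings k" and r: "r > 0" and n: "n > 0"
  shows "match_term r hat n k \<sigma> = real r ^ card (openers k \<sigma>) *
    ((\<Sum>v\<in>PiE (openers k \<sigma>) (\<lambda>_. {0..<int (r * n)}).
        (\<Sum>p<n. walk_weight r hat n k (int p) (signed_ext k \<sigma> v)) / real n) / real (r * n) ^ card (openers k \<sigma>))"
proof -
  let ?c = "real n powr (- 1 / 2)" and ?m = "card (openers k \<sigma>)"
  let ?S = "\<Sum>v\<in>PiE (openers k \<sigma>) (\<lambda>_. {0..<int (r * n)}). \<Sum>p<n. walk_weight r hat n k (int p) (signed_ext k \<sigma> v)"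
  have "(\<Sum>p<n. \<Sum>s\<in>opposite_steps (r * n) k \<sigma>. walk_weight r hat n k (int p) s) =
     (\<Sum>p<n. \<Sum>v\<in>PiE (openers k \<sigma>) (\<lambda>_. {0..<int (r * n)}). walk_weight r hat n k (int p) (signed_ext k \<sigma> v))"
  proof (rule sum.cong[OF refl], rule sum_opposite_steps[OF \<sigma>])
    show "0 < r * n" using r n by simp
    fix p and s s' :: "nat \<Rightarrow> int" assume "\<And>i. i < k \<Longrightarrow> s i mod int (r * n) = s' i mod int (r * n)"
    then show "walk_weight r hat n k (int p) s = walk_weight r hat n k (int p) s'"
      by (rule walk_weight_cong_mod)
  qed
  also have "\<dots> = ?S" by (rule sum.swap)
  finally have 1: "match_term r hat n k \<sigma> = ?c ^ k / real n * ?S" by (simp only: match_term_def)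
  have "?c ^ k = (?c\<^sup>2) ^ ?m" by (subst card_openers[OF \<sigma>]) (simp only: power_mult)
  also have "\<dots> = 1 / real n ^ ?m" unfolding powr_half_sq[OF n] by (simp add: power_divide)
  finally have 2: "?c ^ k = real r ^ ?m / real (r * n) ^ ?m" using r n by (simp add: power_mult_distrib)
  show ?thesis unfolding 1 2 sum_divide_distrib[symmetric] by simp
qed

lemma match_term_le:
  assumes r: "r > 0" and \<sigma>: "\<sigma> \<in> matchings k" and n: "n > 0"
  shows "\<bar>match_term r hat n k \<sigma>\<bar> \<le> real r ^ card (openers k \<sigma>)"
proof -
  let ?P = "PiE (openers k \<sigma>) (\<lambda>_. {0..<int (r * n)})"
  let ?f = "\<lambda>v. (\<Sum>p<n. walk_weight r hat n k (int p) (signed_ext k \<sigma> v)) / real n"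
  have "\<bar>?f v\<bar> \<le> 1" for v
  proof -
    have "\<bar>\<Sum>p<n. walk_weight r hat n k (int p) (signed_ext k \<sigma> v)\<bar> \<le> (\<Sum>p<n. 1)"
      by (intro order_trans[OF sum_abs] sum_mono abs_walk_weight_le)
    then show ?thesis using n by (simp add: divide_le_eq)
  qed
  then have "\<bar>\<Sum>v\<in>?P. ?f v\<bar> \<le> (\<Sum>v\<in>?P. 1)"
    by (intro order_trans[OF sum_abs] sum_mono)
  also have "\<dots> = real (r * n) ^ card (openers k \<sigma>)" by (simp add: card_PiE)
  finally have "\<bar>(\<Sum>v\<in>?P. ?f v) / real (r * n) ^ card (openers k \<sigma>)\<bar> \<le> 1"
    using r n by (simp add: divide_le_eq del: of_nat_mult)
  from mult_left_mono[OF this, of "real r ^ card (openers k \<sigma>)"]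
  show ?thesis unfolding match_term_average[OF \<sigma> r n] abs_mult power_abs[symmetric] abs_of_nat
    by (simp only: mult_1_right zero_le_power of_nat_0_le_iff power_abs abs_of_nat)
qed

text \<open>Dominated convergence is applied twice: over the start \<open>u\<close> for fixed steps
  \<open>V\<close>, where almost every \<open>u\<close> is regular, and then over \<open>V\<close>.
  All integrands are bounded by 1.\<close>

theorem match_term_convergent:
  assumes r: "r > 0" and \<sigma>: "\<sigma> \<in> matchings k"
  shows "convergent (\<lambda>n. match_term r hat n k \<sigma>)"
proof -
  interpret u: prob_space unif by (rule prob_space_unif)
  let ?A = "openers k \<sigma>"
  let ?P = "PiM ?A (\<lambda>_. unif)"
  interpret P: prob_space ?P by (rule prob_space_PiM) (rule prob_space_unif)
  define J where "J n v = (\<Sum>p<n. walk_weight r hat n k (int p) (signed_ext k \<sigma> v)) / real n" for n and v :: "nat \<Rightarrow> int"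
  define h where "h n V = (\<Sum>v\<in>PiE ?A (\<lambda>_. {0..<int (r * n)}). J n v * (\<Prod>i\<in>?A. if \<lfloor>real (r * n) * V i\<rfloor> = v i then 1 else 0 :: real))"
    for n and V :: "nat \<Rightarrow> real"
  have J1: "\<bar>J n v\<bar> \<le> 1" for n v
  proof (cases "n = 0")
    case False
    have "\<bar>\<Sum>p<n. walk_weight r hat n k (int p) (signed_ext k \<sigma> v)\<bar> \<le> (\<Sum>p<n. 1)"
      by (intro order_trans[OF sum_abs] sum_mono abs_walk_weight_le)
    then show ?thesis using False by (simp add: J_def divide_le_eq)
  qed (simp add: J_def)
  have J_integral: "J n v = (\<integral>u. walk_weight r hat n k \<lfloor>real n * u\<rfloor> (signed_ext k \<sigma> v) \<partial>unif)" if "n > 0" for n v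
    unfolding J_def by (rule sum_as_integral_unif(1)[OF that])
  have AEV: "AE V in ?P. \<forall>i\<in>?A. 0 \<le> V i \<and> V i < 1"
    by (intro AE_finite_allI finite_openers AE_PiM_component prob_space_unif AE_unif_range) auto
  have hJ: "h n V = J n (\<lambda>i\<in>?A. \<lfloor>real (r * n) * V i\<rfloor>)" if "n > 0" "\<forall>i\<in>?A. 0 \<le> V i \<and> V i < 1" for n V
    unfolding h_def by (rule sum_as_integral_cube(3)) (use r that in auto)
  \<comment> \<open>The grid formulas require \<open>n > 0\<close>; the shift leaves convergence
    unaffected.\<close>
  have "convergent (\<lambda>n. \<integral>V. h (Suc n) V \<partial>?P)"
  proof (rule P.convergent_integral[where B = 1])
    show "h (Suc n) \<in> borel_measurable ?P" for n
      unfolding h_def by (rule sum_as_integral_cube(2)) (use r in auto)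
    show "AE V in ?P. \<bar>h (Suc n) V\<bar> \<le> 1" for n
      using AEV by eventually_elim (simp add: hJ J1)
    show "AE V in ?P. convergent (\<lambda>n. h (Suc n) V)"
      using AEV
    proof eventually_elim
      fix V :: "nat \<Rightarrow> real" assume V: "\<forall>i\<in>?A. 0 \<le> V i \<and> V i < 1"
      have "convergent (\<lambda>n. \<integral>u. walk_weight r hat (Suc n) k \<lfloor>real (Suc n) * u\<rfloor> (signed_ext k \<sigma> (\<lambda>i. \<lfloor>real (r * Suc n) * V i\<rfloor>)) \<partial>unif)"
      proof (rule u.convergent_integral[where B = 1])
        show "(\<lambda>u. walk_weight r hat (Suc n) k \<lfloor>real (Suc n) * u\<rfloor> (signed_ext k \<sigma> (\<lambda>i. \<lfloor>real (r * Suc n) * V i\<rfloor>))) \<in> borel_measurable unif" for n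
          by (rule sum_as_integral_unif(2)) simp
        show "AE u in unif. convergent (\<lambda>n. walk_weight r hat (Suc n) k \<lfloor>real (Suc n) * u\<rfloor> (signed_ext k \<sigma> (\<lambda>i. \<lfloor>real (r * Suc n) * V i\<rfloor>)))"
          using AE_convergent_walk_weight[OF r, of hat k \<sigma> V]
          by eventually_elim (rule convergent_Suc_iff[THEN iffD2])
      qed (simp add: abs_walk_weight_le)
      moreover have "h (Suc n) V = (\<integral>u. walk_weight r hat (Suc n) k \<lfloor>real (Suc n) * u\<rfloor> (signed_ext k \<sigma> (\<lambda>i. \<lfloor>real (r * Suc n) * V i\<rfloor>)) \<partial>unif)" for n
      proof -
        have "walk_weight r hat (Suc n) k p (signed_ext k \<sigma> (\<lambda>i\<in>?A. \<lfloor>real (r * Suc n) * V i\<rfloor>)) =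
            walk_weight r hat (Suc n) k p (signed_ext k \<sigma> (\<lambda>i. \<lfloor>real (r * Suc n) * V i\<rfloor>))" for p
          by (rule walk_weight_cong) (use matching_not_opener[OF \<sigma>] in \<open>simp add: signed_ext_def\<close>)
        then show ?thesis by (simp only: hJ[OF zero_less_Suc V] J_integral[OF zero_less_Suc])
      qed
      ultimately show "convergent (\<lambda>n. h (Suc n) V)" by (simp only:)
    qed
  qed
  then have c: "convergent (\<lambda>n. real r ^ card ?A * (\<integral>V. h (Suc n) V \<partial>?P))"
    by (intro convergent_mult convergent_const)
  have "match_term r hat (Suc n) k \<sigma> = real r ^ card ?A * (\<integral>V. h (Suc n) V \<partial>?P)" for n
    unfolding match_term_average[OF \<sigma> r zero_less_Suc] h_def
    by (subst sum_as_integral_cube(1)[symmetric]) (use r in \<open>auto simp: J_def\<close>)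
  then have "convergent (\<lambda>n. match_term r hat (Suc n) k \<sigma>)" using c by simp
  then show ?thesis by (rule convergent_Suc_iff[THEN iffD1])
qed

text \<open>Every \<open>lim\<close> here is an actual limit when \<open>r > 0\<close>, by
  \<open>match_term_convergent\<close>.\<close>

definition limit_moment :: "nat \<Rightarrow> bool \<Rightarrow> nat \<Rightarrow> real" where
  "limit_moment r hat k = (\<Sum>\<sigma>\<in>matchings k. lim (\<lambda>n. match_term r hat n k \<sigma>))"

lemma sum_match_term_tendsto:
  assumes "r > 0"
  shows "(\<lambda>n. \<Sum>\<sigma>\<in>matchings k. match_term r hat n k \<sigma>) \<longlonglongrightarrow> limit_moment r hat k"
  unfolding limit_moment_def
  by (intro tendsto_sum) (use match_term_convergent[OF assms] in \<open>simp add: convergent_LIMSEQ_iff\<close>)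

lemma matchings_odd: "odd k \<Longrightarrow> matchings k = {}"
  using card_openers[of _ k] by (metis dvd_triv_left equals0I)

lemma limit_moment_odd: "odd k \<Longrightarrow> limit_moment r hat k = 0"
  by (simp add: limit_moment_def matchings_odd)

text \<open>Matchings of an arbitrary finite set: removing a pair from an initial segment need not
  leave an initial segment, so the counting induction needs this generality.\<close>

definition set_matchings :: "nat set \<Rightarrow> (nat \<Rightarrow> nat) set" where
  "set_matchings S = {\<sigma> \<in> PiE S (\<lambda>_. S). \<forall>i\<in>S. \<sigma> i \<noteq> i \<and> \<sigma> (\<sigma> i) = i}"

lemma finite_set_matchings: "finite S \<Longrightarrow> finite (set_matchings S)"
  unfolding set_matchings_def by (rule finite_subset[of _ "PiE S (\<lambda>_. S)"]) (auto intro: finite_PiE)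

text \<open>A chosen element has one partner less than the size of the set, and the rest is matched
  independently. This gives the double factorial (2m)! / (2^m m!), written without division.\<close>

lemma card_set_matchings:
  assumes "finite S" "card S = 2 * m"
  shows "card (set_matchings S) * (2 ^ m * fact m) \<le> fact (2 * m)"
  using assms
proof (induction m arbitrary: S)
  case 0
  then show ?case by (simp add: set_matchings_def)
next
  case (Suc m)
  then obtain x where x: "x \<in> S" by fastforce
  let ?D = "SIGMA y:S - {x}. set_matchings (S - {x, y})"
  define \<Phi> where "\<Phi> \<sigma> = (\<sigma> x, restrict \<sigma> (S - {x, \<sigma> x}))" for \<sigma> :: "nat \<Rightarrow> nat"
  have "inj_on \<Phi> (set_matchings S)"
  proof (rule inj_onI)
    fix \<sigma> \<tau> assume s: "\<sigma> \<in> set_matchings S" and t: "\<tau> \<in> set_matchings S" and eq: "\<Phi> \<sigma> = \<Phi> \<tau>"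
    have e1: "\<sigma> x = \<tau> x" and e2: "restrict \<sigma> (S - {x, \<sigma> x}) = restrict \<tau> (S - {x, \<sigma> x})"
      using eq by (auto simp: \<Phi>_def)
    show "\<sigma> = \<tau>"
    proof (rule PiE_ext[of \<sigma> S "\<lambda>_. S" \<tau>])
      show "\<sigma> \<in> PiE S (\<lambda>_. S)" "\<tau> \<in> PiE S (\<lambda>_. S)" using s t by (auto simp: set_matchings_def)
      fix i assume i: "i \<in> S"
      have "\<sigma> (\<sigma> x) = x" "\<tau> (\<tau> x) = x" using s t x by (auto simp: set_matchings_def)
      then show "\<sigma> i = \<tau> i"
        using e1 fun_cong[OF e2, of i] i by (cases "i = x \<or> i = \<sigma> x") auto
    qed
  qed
  moreover have "\<Phi> ` set_matchings S \<subseteq> ?D"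
  proof (rule image_subsetI)
    fix \<sigma> assume s: "\<sigma> \<in> set_matchings S"
    have h: "\<sigma> i \<in> S" "\<sigma> i \<noteq> i" "\<sigma> (\<sigma> i) = i" if "i \<in> S" for i
      using s that by (auto simp: set_matchings_def PiE_iff)
    have "\<sigma> i \<noteq> x \<and> \<sigma> i \<noteq> \<sigma> x" if "i \<in> S - {x, \<sigma> x}" for i
      using h(3)[of i] h(3)[of x] x that by auto
    then show "\<Phi> \<sigma> \<in> ?D" using h x by (auto simp: \<Phi>_def set_matchings_def)
  qed
  moreover have "finite ?D" using Suc.prems by (auto intro: finite_set_matchings)
  ultimately have "card (set_matchings S) \<le> card ?D" by (rule card_inj_on_le)
  also have "card ?D = (\<Sum>y\<in>S - {x}. card (set_matchings (S - {x, y})))"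
    using Suc.prems by (intro card_SigmaI) (auto intro: finite_set_matchings)
  finally have "card (set_matchings S) * (2 ^ m * fact m) \<le> (\<Sum>y\<in>S - {x}. card (set_matchings (S - {x, y})) * (2 ^ m * fact m))"
    by (metis mult_le_mono1 sum_distrib_right)
  also have "\<dots> \<le> (\<Sum>y\<in>S - {x}. fact (2 * m))"
  proof (rule sum_mono)
    fix y assume y: "y \<in> S - {x}"
    have "card (S - {x, y}) = card S - card {x, y}" by (rule card_Diff_subset) (use x y in auto)
    then have "card (S - {x, y}) = 2 * m" using Suc.prems y by simp
    then show "card (set_matchings (S - {x, y})) * (2 ^ m * fact m) \<le> fact (2 * m)"
      using Suc.prems by (intro Suc.IH) auto
  qed
  also have "\<dots> = (2 * m + 1) * fact (2 * m)" using Suc.prems x by simp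
  \<comment> \<open>The factor \<open>2 * m + 2\<close> supplies the missing
    \<open>2 * (m + 1)\<close> on the left and completes the factorial on the right.\<close>
  finally have "(2 * m + 2) * (card (set_matchings S) * (2 ^ m * fact m)) \<le> (2 * m + 2) * ((2 * m + 1) * fact (2 * m))"
    by (rule mult_le_mono2)
  then show ?case by (simp add: algebra_simps)
qed

text \<open>The bound is the moment of order \<open>2 * m\<close> of a centred normal law with
  variance \<open>r\<close>: a double factorial of matchings, each contributing at most
  \<open>r ^ m\<close>.\<close>

lemma limit_moment_le:
  assumes r: "r > 0"
  shows "\<bar>limit_moment r hat (2 * m)\<bar> \<le> real r ^ m * fact (2 * m) / (2 ^ m * fact m)"
proof -
  have M: "matchings (2 * m) = set_matchings {..<2 * m}"
    by (auto simp: matchings_def set_matchings_def)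
  have c: "real (card (matchings (2 * m))) \<le> fact (2 * m) / (2 ^ m * fact m)"
  proof -
    have "card (matchings (2 * m)) * (2 ^ m * fact m) \<le> fact (2 * m)"
      unfolding M by (rule card_set_matchings) auto
    then have "real (card (matchings (2 * m)) * (2 ^ m * fact m)) \<le> real (fact (2 * m))"
      by (simp only: of_nat_le_iff)
    then show ?thesis by (simp add: field_simps)
  qed
  have "\<bar>lim (\<lambda>n. match_term r hat n (2 * m) \<sigma>)\<bar> \<le> real r ^ m" if \<sigma>: "\<sigma> \<in> matchings (2 * m)" for \<sigma>
  proof -
    have "(\<lambda>n. match_term r hat n (2 * m) \<sigma>) \<longlonglongrightarrow> lim (\<lambda>n. match_term r hat n (2 * m) \<sigma>)"
      using match_term_convergent[OF r \<sigma>] by (simp add: convergent_LIMSEQ_iff)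
    then have "(\<lambda>n. \<bar>match_term r hat n (2 * m) \<sigma>\<bar>) \<longlonglongrightarrow> \<bar>lim (\<lambda>n. match_term r hat n (2 * m) \<sigma>)\<bar>"
      by (rule tendsto_rabs)
    moreover have "card (openers (2 * m) \<sigma>) = m" using card_openers[OF \<sigma>] by simp
    ultimately show ?thesis
      using match_term_le[OF r \<sigma>] by (intro LIMSEQ_le_const2[of _ _ "real r ^ m"]) (auto intro!: exI[of _ 1])
  qed
  then have "\<bar>limit_moment r hat (2 * m)\<bar> \<le> (\<Sum>\<sigma>\<in>matchings (2 * m). real r ^ m)"
    unfolding limit_moment_def by (intro order_trans[OF sum_abs] sum_mono)
  also have "\<dots> = real (card (matchings (2 * m))) * real r ^ m" by simp
  also have "\<dots> \<le> fact (2 * m) / (2 ^ m * fact m) * real r ^ m" by (intro mult_right_mono c) simp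
  finally show ?thesis by (simp add: mult.commute)
qed

section \<open>Bounded inputs\<close>

definition moment_coeff :: "nat \<Rightarrow> bool \<Rightarrow> nat \<Rightarrow> real" where
  "moment_coeff r hat m = (- 1) ^ m * limit_moment r hat (2 * m) / fact (2 * m)"

text \<open>The characteristic function that the limit moments would generate; the odd ones vanish,
  so it is a series in \<open>t^2\<close>. That some law has it is settled only in
  \<open>limit_law_exists\<close>.\<close>

definition limit_char :: "nat \<Rightarrow> bool \<Rightarrow> real \<Rightarrow> real" where
  "limit_char r hat t = (\<Sum>m. moment_coeff r hat m * (t\<^sup>2) ^ m)"

lemma abs_moment_coeff_le:
  assumes "r > 0"
  shows "\<bar>moment_coeff r hat m\<bar> \<le> (real r / 2) ^ m / fact m"
proof -
  have "\<bar>moment_coeff r hat m\<bar> = \<bar>limit_moment r hat (2 * m)\<bar> / fact (2 * m)"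
    by (simp add: moment_coeff_def abs_mult power_abs)
  also have "\<dots> \<le> (real r ^ m * fact (2 * m) / (2 ^ m * fact m)) / fact (2 * m)"
    by (intro divide_right_mono limit_moment_le assms) simp
  also have "\<dots> = (real r / 2) ^ m / fact m" by (simp add: power_divide)
  finally show ?thesis .
qed

lemma summable_moment_coeff:
  assumes "r > 0" shows "summable (\<lambda>m. moment_coeff r hat m * y ^ m)"
proof (rule summable_comparison_test')
  show "summable (\<lambda>m. inverse (fact m) * (real r / 2 * \<bar>y\<bar>) ^ m)" by (rule summable_exp)
  fix m
  have "\<bar>moment_coeff r hat m\<bar> * \<bar>y\<bar> ^ m \<le> (real r / 2) ^ m / fact m * \<bar>y\<bar> ^ m"
    by (intro mult_right_mono abs_moment_coeff_le assms) simp
  moreover have "inverse (fact m) * (real r / 2 * \<bar>y\<bar>) ^ m = (real r / 2) ^ m / fact m * \<bar>y\<bar> ^ m"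
    by (simp only: power_mult_distrib divide_inverse mult_ac)
  ultimately show "norm (moment_coeff r hat m * y ^ m) \<le> inverse (fact m) * (real r / 2 * \<bar>y\<bar>) ^ m"
    by (simp only: real_norm_def abs_mult power_abs)
qed

lemma isCont_limit_char:
  assumes "r > 0" shows "isCont (limit_char r hat) t"
proof -
  have "isCont (\<lambda>y. \<Sum>m. moment_coeff r hat m * y ^ m) (t\<^sup>2)"
    by (rule isCont_powser_converges_everywhere) (rule summable_moment_coeff[OF assms])
  then have "isCont (\<lambda>t. \<Sum>m. moment_coeff r hat m * (t\<^sup>2) ^ m) t"
    by (rule isCont_o2[rotated]) (intro continuous_intros)
  then show ?thesis by (simp add: limit_char_def[abs_def])
qed

lemma taylor_moment_sum:
  "(\<Sum>j<2 * m. (\<i> * of_real t) ^ j / fact j * of_real (limit_moment r hat j)) =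
     complex_of_real (\<Sum>j<m. moment_coeff r hat j * (t\<^sup>2) ^ j)"
proof (induction m)
  case (Suc m)
  have e: "(\<i> * complex_of_real t) ^ (2 * m) = of_real ((- 1) ^ m * (t\<^sup>2) ^ m)"
    by (simp add: power_mult power_mult_distrib power_minus[of "(complex_of_real t)\<^sup>2"])
  have "2 * Suc m = Suc (Suc (2 * m))" by simp
  then show ?case using Suc.IH limit_moment_odd[of "Suc (2 * m)" r hat] e
    by (simp add: moment_coeff_def mult_ac)
qed simp

text \<open>The sum of squared eigenvalues is the squared Frobenius norm, that is, the distance to
  the matrix with zero input.\<close>

lemma spec_second_moment:
  assumes r: "r \<in> {1, 2}" and n: "n > 0"
  shows "(\<Sum>i<n. (spec r hat n x i)\<^sup>2) \<le> 2 * (\<Sum>v\<le>n. (x v)\<^sup>2)"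
proof -
  have r0: "r > 0" using r by auto
  have "(\<Sum>i<n. (spec r hat n x i)\<^sup>2) = (\<Sum>p<n. mpow n (scaled r hat n x) 2 p p)"
    by (rule sum_spec_power[OF r])
  also have "\<dots> = (\<Sum>p<n. \<Sum>h<n. (scaled r hat n x p h)\<^sup>2)"
  proof (intro sum.cong refl)
    fix p assume "p \<in> {..<n}"
    then have p: "p < n" by simp
    have "mpow n (scaled r hat n x) 2 p p = (\<Sum>h<n. mpow n (scaled r hat n x) 1 p h * scaled r hat n x h p)"
      by (simp add: numeral_2_eq_2)
    also have "\<dots> = (\<Sum>h<n. (scaled r hat n x p h)\<^sup>2)"
    proof (intro sum.cong refl)
      fix h
      have "mpow n (scaled r hat n x) 1 p h = (\<Sum>g<n. if g = p then scaled r hat n x g h else 0)"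
        unfolding One_nat_def mpow.simps by (intro sum.cong refl) auto
      also have "\<dots> = scaled r hat n x p h" using p by simp
      finally show "mpow n (scaled r hat n x) 1 p h * scaled r hat n x h p = (scaled r hat n x p h)\<^sup>2"
        using scaled_commute[OF r0 n, of hat x h p] by (simp add: power2_eq_square)
    qed
    finally show "mpow n (scaled r hat n x) 2 p p = (\<Sum>h<n. (scaled r hat n x p h)\<^sup>2)" .
  qed
  also have "\<dots> = (\<Sum>p<n. \<Sum>h<n. (scaled r hat n x p h - scaled r hat n (\<lambda>_. 0) p h)\<^sup>2)"
    by (simp add: scaled_def)
  also have "\<dots> \<le> 2 * (\<Sum>v\<le>n. (x v - 0)\<^sup>2)" by (rule scaled_diff_frobenius[OF r n])
  finally show ?thesis by simp
qed

context prob_space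
begin

text \<open>The exponential is expanded to a fixed order, whose moments converge as \<open>n\<close>
  grows; the order is chosen beforehand so that the limiting remainder is small. The two limits need
  not be exchanged.\<close>

theorem expected_ecf_tendsto:
  assumes ind: "indep_vars (\<lambda>_. borel) x UNIV" and std: "standardized x" and C: "\<And>i. AE \<omega> in M. \<bar>x i \<omega>\<bar> \<le> C"
    and r: "r \<in> {1, 2}"
  shows "(\<lambda>n. expectation (\<lambda>\<omega>. ecf r hat n (\<lambda>v. x v \<omega>) t)) \<longlonglongrightarrow> complex_of_real (limit_char r hat t)"
proof -
  have r0: "r > 0" using r by auto
  have xm[measurable]: "x i \<in> borel_measurable M" for i
    using ind by (auto simp: indep_vars_def)
  define mom where "mom n k = expectation (\<lambda>\<omega>. (\<Sum>i<n. spec r hat n (\<lambda>v. x v \<omega>) i ^ k) / real n)" for n k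
  have mom: "(\<lambda>n. mom n k) \<longlonglongrightarrow> limit_moment r hat k" for k
    using tendsto_add[OF expected_moment[OF ind std C r, of hat k] sum_match_term_tendsto[OF r0, of hat k]]
    by (simp add: mom_def)
  have ae: "AE \<omega> in M. \<forall>i. \<bar>x i \<omega>\<bar> \<le> C" using C by (simp add: AE_all_countable)
  have mi: "integrable M (\<lambda>\<omega>. \<Sum>i<n. spec r hat n (\<lambda>v. x v \<omega>) i ^ k)" for n k
  proof (cases "n = 0")
    case False
    have "integrable M (\<lambda>\<omega>. \<Prod>j<k. x (f j) \<omega>)" for f :: "nat \<Rightarrow> nat"
    proof (rule integrable_const_bound[where B = "C ^ k"])
      show "AE \<omega> in M. norm (\<Prod>j<k. x (f j) \<omega>) \<le> C ^ k" using ae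
      proof eventually_elim
        fix \<omega> assume B: "\<forall>i. \<bar>x i \<omega>\<bar> \<le> C"
        have "(\<Prod>j<k. \<bar>x (f j) \<omega>\<bar>) \<le> (\<Prod>j<k. C)" by (rule prod_mono) (use B in auto)
        then show "norm (\<Prod>j<k. x (f j) \<omega>) \<le> C ^ k" by (simp add: abs_prod)
      qed
    qed measurable
    then show ?thesis using False by (subst trace_walk_expansion[OF r]) auto
  qed simp
  have ei: "integrable M (\<lambda>\<omega>. ecf r hat n (\<lambda>v. x v \<omega>) t)" for n
    by (rule integrable_const_bound[where B = 1]) (use measurable_ecf[OF r, of n x M] cmod_ecf_le in auto)
  \<comment> \<open>The remainder has even order, so the absolute value disappears and the remainder
    is itself a moment with known limit.\<close>
  have taylor: "cmod (expectation (\<lambda>\<omega>. ecf r hat n (\<lambda>v. x v \<omega>) t) - (\<Sum>j<2 * Suc m. (\<i> * of_real t) ^ j / fact j * of_real (mom n j)))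
      \<le> \<bar>t\<bar> ^ (2 * Suc m) / fact (2 * Suc m) * mom n (2 * Suc m)" if n: "n > 0" for n m
  proof -
    let ?K = "2 * Suc m"
    let ?l = "\<lambda>\<omega> i. spec r hat n (\<lambda>v. x v \<omega>) i"
    let ?T = "\<lambda>\<omega>. \<Sum>j<?K. (\<i> * of_real t) ^ j / fact j * of_real ((\<Sum>i<n. ?l \<omega> i ^ j) / real n)"
    have Ti: "integrable M ?T"
      by (intro Bochner_Integration.integrable_sum integrable_mult_right integrable_of_real integrable_divide_zero mi)
    have ET: "expectation ?T = (\<Sum>j<?K. (\<i> * of_real t) ^ j / fact j * of_real (mom n j))"
    proof (subst Bochner_Integration.integral_sum)
      show "integrable M (\<lambda>\<omega>. (\<i> * of_real t) ^ j / fact j * of_real ((\<Sum>i<n. ?l \<omega> i ^ j) / real n))" for j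
        by (intro integrable_mult_right integrable_of_real integrable_divide_zero mi)
      have "expectation (\<lambda>\<omega>. (\<i> * of_real t) ^ j / fact j * of_real ((\<Sum>i<n. ?l \<omega> i ^ j) / real n)) =
         (\<i> * of_real t) ^ j / fact j * of_real (mom n j)" for j
      proof -
        have "expectation (\<lambda>\<omega>. (\<i> * of_real t) ^ j / fact j * complex_of_real ((\<Sum>i<n. ?l \<omega> i ^ j) / real n)) =
           (\<i> * of_real t) ^ j / fact j * expectation (\<lambda>\<omega>. complex_of_real ((\<Sum>i<n. ?l \<omega> i ^ j) / real n))"
          by (rule integral_mult_right_zero)
        then show ?thesis unfolding mom_def integral_complex_of_real .
      qed
      then show "(\<Sum>j<?K. expectation (\<lambda>\<omega>. (\<i> * of_real t) ^ j / fact j * of_real ((\<Sum>i<n. ?l \<omega> i ^ j) / real n))) =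
         (\<Sum>j<?K. (\<i> * of_real t) ^ j / fact j * of_real (mom n j))" by simp
    qed
    have pt: "cmod (ecf r hat n (\<lambda>v. x v \<omega>) t - ?T \<omega>) \<le> \<bar>t\<bar> ^ ?K / fact ?K * ((\<Sum>i<n. ?l \<omega> i ^ ?K) / real n)" for \<omega>
    proof -
      have T: "?T \<omega> = (\<Sum>i<n. \<Sum>j\<le>Suc (2 * m). (\<i> * of_real (t * ?l \<omega> i)) ^ j / fact j) / of_nat n"
      proof -
        have "?T \<omega> = (\<Sum>j<?K. \<Sum>i<n. (\<i> * of_real (t * ?l \<omega> i)) ^ j / fact j) / of_nat n"
        proof -
          have "(\<i> * of_real t) ^ j / fact j * complex_of_real ((\<Sum>i<n. ?l \<omega> i ^ j) / real n) =
              (\<Sum>i<n. (\<i> * of_real (t * ?l \<omega> i)) ^ j / fact j) / of_nat n" for j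
            by (simp add: sum_distrib_left sum_divide_distrib power_mult_distrib mult_ac)
          then show ?thesis by (simp only: sum_divide_distrib[of _ "{..<2 * Suc m}"])
        qed
        also have "\<dots> = (\<Sum>i<n. \<Sum>j<?K. (\<i> * of_real (t * ?l \<omega> i)) ^ j / fact j) / of_nat n"
          by (subst sum.swap) simp
        also have "\<dots> = (\<Sum>i<n. \<Sum>j\<le>Suc (2 * m). (\<i> * of_real (t * ?l \<omega> i)) ^ j / fact j) / of_nat n"
        proof -
          have "{..<?K} = {..Suc (2 * m)}" by auto
          then show ?thesis by (simp only:)
        qed
        finally show ?thesis .
      qed
      have "ecf r hat n (\<lambda>v. x v \<omega>) t - ?T \<omega> =
        (\<Sum>i<n. iexp (t * ?l \<omega> i) - (\<Sum>j\<le>Suc (2 * m). (\<i> * of_real (t * ?l \<omega> i)) ^ j / fact j)) / of_nat n"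
        unfolding T ecf_def by (simp only: sum_subtractf diff_divide_distrib)
      then have "cmod (ecf r hat n (\<lambda>v. x v \<omega>) t - ?T \<omega>) \<le>
        (\<Sum>i<n. cmod (iexp (t * ?l \<omega> i) - (\<Sum>j\<le>Suc (2 * m). (\<i> * of_real (t * ?l \<omega> i)) ^ j / fact j))) / real n"
        by (simp only: norm_divide norm_of_nat) (intro divide_right_mono norm_sum, simp)
      also have "\<dots> \<le> (\<Sum>i<n. \<bar>t * ?l \<omega> i\<bar> ^ ?K / fact ?K) / real n"
      proof (intro divide_right_mono sum_mono)
        fix i
        have "?K = Suc (Suc (2 * m))" by simp
        then show "cmod (iexp (t * ?l \<omega> i) - (\<Sum>j\<le>Suc (2 * m). (\<i> * of_real (t * ?l \<omega> i)) ^ j / fact j)) \<le> \<bar>t * ?l \<omega> i\<bar> ^ ?K / fact ?K"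
          using iexp_approx1[of "t * ?l \<omega> i" "Suc (2 * m)"] by (simp only:)
      qed simp
      also have "\<dots> = (\<Sum>i<n. \<bar>t\<bar> ^ ?K / fact ?K * ?l \<omega> i ^ ?K) / real n"
      proof -
        have "\<bar>t * y\<bar> ^ ?K / fact ?K = \<bar>t\<bar> ^ ?K / fact ?K * y ^ ?K" for y
          unfolding abs_mult power_mult_distrib power_even_abs[OF dvd_triv_left, of y] by simp
        then show ?thesis by (simp only:)
      qed
      also have "\<dots> = \<bar>t\<bar> ^ ?K / fact ?K * ((\<Sum>i<n. ?l \<omega> i ^ ?K) / real n)"
        by (simp only: sum_distrib_left[symmetric] times_divide_eq_right)
      finally show ?thesis .
    qed
    have "cmod (expectation (\<lambda>\<omega>. ecf r hat n (\<lambda>v. x v \<omega>) t) - expectation ?T) =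
       cmod (expectation (\<lambda>\<omega>. ecf r hat n (\<lambda>v. x v \<omega>) t - ?T \<omega>))"
      by (subst Bochner_Integration.integral_diff[OF ei Ti]) simp
    also have "\<dots> \<le> expectation (\<lambda>\<omega>. cmod (ecf r hat n (\<lambda>v. x v \<omega>) t - ?T \<omega>))"
      by (rule integral_norm_bound)
    also have "\<dots> \<le> expectation (\<lambda>\<omega>. \<bar>t\<bar> ^ ?K / fact ?K * ((\<Sum>i<n. ?l \<omega> i ^ ?K) / real n))"
      by (intro integral_mono_AE AE_I2 pt integrable_norm Bochner_Integration.integrable_diff ei Ti
          integrable_mult_right integrable_divide_zero mi)
    also have "\<dots> = \<bar>t\<bar> ^ ?K / fact ?K * mom n ?K" unfolding mom_def by (rule integral_mult_right_zero)
    finally show ?thesis unfolding ET .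
  qed
  define S where "S m = (\<Sum>j<m. moment_coeff r hat j * (t\<^sup>2) ^ j)" for m
  have Slim: "S \<longlonglongrightarrow> limit_char r hat t"
    unfolding S_def limit_char_def by (rule summable_LIMSEQ[OF summable_moment_coeff[OF r0]])
  define e where "e m = \<bar>t\<bar> ^ (2 * Suc m) / fact (2 * Suc m) * limit_moment r hat (2 * Suc m)" for m
  \<comment> \<open>Up to sign \<open>e m\<close> is the term of index \<open>Suc m\<close> of the
    convergent series defining \<open>limit_char\<close>.\<close>
  have elim: "e \<longlonglongrightarrow> 0"
  proof -
    have "(\<lambda>m. \<bar>moment_coeff r hat m * (t\<^sup>2) ^ m\<bar>) \<longlonglongrightarrow> 0"
      by (rule tendsto_rabs_zero[OF summable_LIMSEQ_zero[OF summable_moment_coeff[OF r0]]])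
    then have "(\<lambda>m. \<bar>moment_coeff r hat (Suc m) * (t\<^sup>2) ^ Suc m\<bar>) \<longlonglongrightarrow> 0" by (rule LIMSEQ_Suc)
    then have "(\<lambda>m. \<bar>e m\<bar>) \<longlonglongrightarrow> 0"
    proof (rule Lim_transform_eventually, intro always_eventually allI)
      fix m
      have "\<bar>t\<bar> ^ (2 * Suc m) = (t\<^sup>2) ^ Suc m" by (simp only: power_mult power2_abs)
      then have "moment_coeff r hat (Suc m) * (t\<^sup>2) ^ Suc m = (- 1) ^ Suc m * e m"
        unfolding e_def moment_coeff_def by (simp only: times_divide_eq_left times_divide_eq_right mult_ac)
      then show "\<bar>moment_coeff r hat (Suc m) * (t\<^sup>2) ^ Suc m\<bar> = \<bar>e m\<bar>"
        by (simp only: abs_mult power_abs abs_minus_cancel abs_one power_one mult_1_left)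
    qed
    then show ?thesis by (rule tendsto_rabs_zero_cancel)
  qed
  have tl: "(\<lambda>n. (\<Sum>j<2 * Suc m. (\<i> * of_real t) ^ j / fact j * complex_of_real (mom n j))) \<longlonglongrightarrow> complex_of_real (S (Suc m))" for m
    unfolding S_def taylor_moment_sum[symmetric] by (intro tendsto_sum tendsto_mult tendsto_const tendsto_of_real mom)
  show ?thesis
  proof (rule LIMSEQ_I)
    \<comment> \<open>The budget is half for the Taylor remainder and a quarter each for the
      convergence of the moments and for the tail of the series.\<close>
    fix \<epsilon> :: real assume \<epsilon>: "0 < \<epsilon>"
    have "eventually (\<lambda>m. dist (S (Suc m)) (limit_char r hat t) < \<epsilon> / 4) sequentially"
      using LIMSEQ_Suc[OF Slim] \<epsilon> by (intro tendstoD) auto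
    moreover have "eventually (\<lambda>m. dist (e m) 0 < \<epsilon> / 4) sequentially" using elim \<epsilon> by (intro tendstoD) auto
    ultimately have "eventually (\<lambda>m. dist (S (Suc m)) (limit_char r hat t) < \<epsilon> / 4 \<and> dist (e m) 0 < \<epsilon> / 4) sequentially"
      by (rule eventually_conj)
    then obtain m where m: "dist (S (Suc m)) (limit_char r hat t) < \<epsilon> / 4" "dist (e m) 0 < \<epsilon> / 4"
      by (auto dest: eventually_happens)
    have "(\<lambda>n. \<bar>t\<bar> ^ (2 * Suc m) / fact (2 * Suc m) * mom n (2 * Suc m)) \<longlonglongrightarrow> e m"
      unfolding e_def by (intro tendsto_mult tendsto_const mom)
    then have "eventually (\<lambda>n. \<bar>t\<bar> ^ (2 * Suc m) / fact (2 * Suc m) * mom n (2 * Suc m) < \<epsilon> / 2) sequentially"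
      by (rule order_tendstoD(2)) (use m \<epsilon> in \<open>auto simp: dist_real_def\<close>)
    moreover have "eventually (\<lambda>n. dist (\<Sum>j<2 * Suc m. (\<i> * of_real t) ^ j / fact j * complex_of_real (mom n j)) (complex_of_real (S (Suc m))) < \<epsilon> / 4) sequentially"
      using tl[of m] \<epsilon> by (intro tendstoD) auto
    moreover have "eventually (\<lambda>n::nat. n > 0) sequentially" by (rule eventually_gt_at_top)
    ultimately have "eventually (\<lambda>n. norm (expectation (\<lambda>\<omega>. ecf r hat n (\<lambda>v. x v \<omega>) t) - complex_of_real (limit_char r hat t)) < \<epsilon>) sequentially"
    proof eventually_elim
      fix n :: nat
      let ?E = "expectation (\<lambda>\<omega>. ecf r hat n (\<lambda>v. x v \<omega>) t)"
      let ?P = "\<Sum>j<2 * Suc m. (\<i> * of_real t) ^ j / fact j * complex_of_real (mom n j)"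
      assume 1: "\<bar>t\<bar> ^ (2 * Suc m) / fact (2 * Suc m) * mom n (2 * Suc m) < \<epsilon> / 2"
        and 2: "dist ?P (complex_of_real (S (Suc m))) < \<epsilon> / 4" and n: "0 < n"
      have "dist ?E ?P < \<epsilon> / 2" unfolding dist_norm using taylor[OF n, of m] 1 by (rule order_le_less_trans)
      moreover have "dist (complex_of_real (S (Suc m))) (complex_of_real (limit_char r hat t)) < \<epsilon> / 4"
        using m(1) by simp
      ultimately have "dist ?E (complex_of_real (limit_char r hat t)) < \<epsilon>"
        using dist_triangle[of ?E "complex_of_real (limit_char r hat t)" ?P]
          dist_triangle[of ?P "complex_of_real (limit_char r hat t)" "complex_of_real (S (Suc m))"] 2 by linarith
      then show "norm (?E - complex_of_real (limit_char r hat t)) < \<epsilon>" by (simp only: dist_norm)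
    qed
    then show "\<exists>no. \<forall>n\<ge>no. norm (expectation (\<lambda>\<omega>. ecf r hat n (\<lambda>v. x v \<omega>) t) - complex_of_real (limit_char r hat t)) < \<epsilon>"
      by (simp only: eventually_sequentially)
  qed
qed

corollary ecf_tendsto_bounded:
  assumes ind: "indep_vars (\<lambda>_. borel) x UNIV" and std: "standardized x" and C: "\<And>i. AE \<omega> in M. \<bar>x i \<omega>\<bar> \<le> C"
    and r: "r \<in> {1, 2}"
  shows "AE \<omega> in M. (\<lambda>n. ecf r hat n (\<lambda>v. x v \<omega>) t) \<longlonglongrightarrow> complex_of_real (limit_char r hat t)"
  using ecf_concentration[OF ind C r, where hat = hat and t = t]
proof eventually_elim
  fix \<omega> assume "(\<lambda>n. ecf r hat n (\<lambda>v. x v \<omega>) t - expectation (\<lambda>\<omega>. ecf r hat n (\<lambda>v. x v \<omega>) t)) \<longlonglongrightarrow> 0"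
  from tendsto_add[OF this expected_ecf_tendsto[OF ind std C r, where hat = hat and t = t]]
  show "(\<lambda>n. ecf r hat n (\<lambda>v. x v \<omega>) t) \<longlonglongrightarrow> complex_of_real (limit_char r hat t)" by simp
qed

end

lemma ecf_lipschitz_argument:
  assumes r: "r \<in> {1, 2}" and n: "n > 0"
  shows "cmod (ecf r hat n x t - ecf r hat n x s) \<le> \<bar>t - s\<bar> * sqrt (2 * (\<Sum>v\<le>n. (x v)\<^sup>2) / real n)"
proof -
  let ?l = "spec r hat n x"
  have "cmod (ecf r hat n x t - ecf r hat n x s) = cmod (\<Sum>i<n. iexp (t * ?l i) - iexp (s * ?l i)) / real n"
    by (simp add: ecf_def sum_subtractf norm_divide flip: diff_divide_distrib)
  also have "\<dots> \<le> (\<Sum>i<n. \<bar>t - s\<bar> * \<bar>?l i\<bar>) / real n"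
  proof (intro divide_right_mono order_trans[OF norm_sum] sum_mono)
    fix i
    show "cmod (iexp (t * ?l i) - iexp (s * ?l i)) \<le> \<bar>t - s\<bar> * \<bar>?l i\<bar>"
      using iexp_lipschitz[of "?l i" t s] by (simp only: mult.commute)
  qed simp
  also have "\<dots> = \<bar>t - s\<bar> * ((\<Sum>i<n. \<bar>?l i\<bar>) / real n)"
    by (simp add: sum_distrib_left)
  also have "\<dots> \<le> \<bar>t - s\<bar> * sqrt (2 * (\<Sum>v\<le>n. (x v)\<^sup>2) / real n)"
  proof (intro mult_left_mono real_le_rsqrt)
    have "(\<Sum>i<n. 1 * \<bar>?l i\<bar>)\<^sup>2 \<le> (\<Sum>i<n. 1\<^sup>2) * (\<Sum>i<n. \<bar>?l i\<bar>\<^sup>2)" by (rule Cauchy_Schwarz_ineq_sum)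
    then have "(\<Sum>i<n. \<bar>?l i\<bar>)\<^sup>2 \<le> real n * (\<Sum>i<n. (?l i)\<^sup>2)" by simp
    also have "\<dots> \<le> real n * (2 * (\<Sum>v\<le>n. (x v)\<^sup>2))" by (intro mult_left_mono spec_second_moment[OF r n]) simp
    finally show "((\<Sum>i<n. \<bar>?l i\<bar>) / real n)\<^sup>2 \<le> 2 * (\<Sum>v\<le>n. (x v)\<^sup>2) / real n"
      using n by (simp add: power_divide power2_eq_square field_simps)
  qed simp
  finally show ?thesis .
qed

text \<open>Null sets depend on the argument, so almost sure convergence is at first available for
  countably many arguments only. Bounded mean squares of the input make the functions
  \<open>ecf\<close> uniformly Lipschitz in the argument, and rational arguments suffice.\<close>

lemma ecf_tendsto_all_arguments:
  assumes r: "r \<in> {1, 2}" and B: "\<And>n. n > 0 \<Longrightarrow> (\<Sum>v\<le>n. (x v)\<^sup>2) / real n \<le> B"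
    and rat: "\<And>q. (\<lambda>n. ecf r hat n x (real_of_rat q)) \<longlonglongrightarrow> complex_of_real (limit_char r hat (real_of_rat q))"
  shows "(\<lambda>n. ecf r hat n x t) \<longlonglongrightarrow> complex_of_real (limit_char r hat t)"
proof (rule LIMSEQ_I)
  fix \<epsilon> :: real assume \<epsilon>: "0 < \<epsilon>"
  have r0: "r > 0" using r by auto
  \<comment> \<open>The added 1 keeps the Lipschitz constant positive, as it appears in a
    denominator below.\<close>
  define D where "D = sqrt (2 * B) + 1"
  have B0: "0 \<le> B" using B[of 1] by (rule order_trans[rotated]) (auto intro!: sum_nonneg)
  have D: "D > 0" using B0 by (simp add: D_def add_nonneg_pos)
  from isCont_limit_char[OF r0, where hat = hat and t = t] \<epsilon> obtain d where d: "d > 0"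
    and dd: "\<And>s. dist s t < d \<Longrightarrow> dist (limit_char r hat s) (limit_char r hat t) < \<epsilon> / 3"
    unfolding continuous_at_eps_delta by (metis divide_pos_pos zero_less_numeral)
  define \<delta> where "\<delta> = min d (\<epsilon> / (3 * D))"
  have \<delta>: "\<delta> > 0" using d \<epsilon> D by (simp add: \<delta>_def)
  obtain q :: rat where q: "t < real_of_rat q" "real_of_rat q < t + \<delta>" using of_rat_dense[of t "t + \<delta>"] \<delta> by auto
  let ?s = "real_of_rat q"
  have lc: "dist (limit_char r hat ?s) (limit_char r hat t) < \<epsilon> / 3" by (rule dd) (use q in \<open>auto simp: dist_real_def \<delta>_def\<close>)
  obtain N where N: "\<And>n. n \<ge> N \<Longrightarrow> cmod (ecf r hat n x ?s - complex_of_real (limit_char r hat ?s)) < \<epsilon> / 3"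
    using LIMSEQ_D[OF rat[of q], of "\<epsilon> / 3"] \<epsilon> by auto
  have "cmod (ecf r hat n x t - complex_of_real (limit_char r hat t)) < \<epsilon>" if "n \<ge> max 1 N" for n
  proof -
    have n: "n > 0" using that by simp
    have "cmod (ecf r hat n x t - ecf r hat n x ?s) \<le> \<bar>t - ?s\<bar> * sqrt (2 * ((\<Sum>v\<le>n. (x v)\<^sup>2) / real n))"
      using ecf_lipschitz_argument[OF r n, of hat x t ?s] by simp
    also have "\<dots> \<le> \<bar>t - ?s\<bar> * D"
      using B[OF n] unfolding D_def by (intro mult_left_mono) (auto intro!: add_increasing2 real_sqrt_le_mono)
    also have "\<dots> \<le> \<epsilon> / 3"
    proof -
      have "\<bar>t - ?s\<bar> \<le> \<epsilon> / (3 * D)" using q by (auto simp: \<delta>_def)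
      then have "\<bar>t - ?s\<bar> * D \<le> \<epsilon> / (3 * D) * D" using D by (intro mult_right_mono) auto
      also have "\<dots> = \<epsilon> / 3" using D by simp
      finally show ?thesis .
    qed
    finally have 1: "cmod (ecf r hat n x t - ecf r hat n x ?s) \<le> \<epsilon> / 3" .
    have 2: "cmod (ecf r hat n x ?s - complex_of_real (limit_char r hat ?s)) < \<epsilon> / 3" using N that by simp
    have 3: "cmod (complex_of_real (limit_char r hat ?s) - complex_of_real (limit_char r hat t)) < \<epsilon> / 3"
      using lc by (simp add: dist_real_def flip: of_real_diff)
    show ?thesis
      using norm_triangle_ineq[of "ecf r hat n x t - ecf r hat n x ?s" "ecf r hat n x ?s - complex_of_real (limit_char r hat t)"]
        norm_triangle_ineq[of "ecf r hat n x ?s - complex_of_real (limit_char r hat ?s)" "complex_of_real (limit_char r hat ?s) - complex_of_real (limit_char r hat t)"]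
        1 2 3 by simp
  qed
  then show "\<exists>no. \<forall>n\<ge>no. norm (ecf r hat n x t - complex_of_real (limit_char r hat t)) < \<epsilon>" by blast
qed

section \<open>Strong laws along dyadic blocks\<close>

text \<open>The powers of two below \<open>w\<close> sum to at most twice the largest one. Taken in
  expectation, this converts a first moment into summable tail probabilities along dyadic
  blocks.\<close>

lemma dyadic_tail_sum_le:
  fixes w :: real
  assumes "0 \<le> w"
  shows "(\<Sum>j<J. 2 ^ j * (if 2 ^ j < w then 1 else 0)) \<le> 2 * w"
proof (induction J)
  case (Suc J)
  show ?case
  proof (cases "2 ^ J < w")
    case True
    have "(\<Sum>j<J. 2 ^ j * (if 2 ^ j < w then 1 else 0 :: real)) \<le> (\<Sum>j<J. 2 ^ j)"
      by (intro sum_mono) auto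
    also have "\<dots> \<le> 2 ^ J" by (induction J) auto
    finally show ?thesis using True by simp
  qed (use Suc in simp)
qed (use assms in simp)

text \<open>The reciprocals of the powers of two from \<open>w\<close> on sum to at most
  \<open>2 / w\<close>. In expectation this makes the Chebyshev bounds of truncated block sums
  summable.\<close>

lemma dyadic_truncated_sum_le:
  fixes w :: real
  assumes "0 \<le> w"
  shows "(\<Sum>j<J. w\<^sup>2 * (if w \<le> 2 ^ j then 1 else 0) / 2 ^ j) \<le> 2 * w"
proof (cases "w = 0")
  case False
  then have w: "0 < w" using assms by simp
  define U :: "nat \<Rightarrow> real" where "U J = (\<Sum>j<J. (if w \<le> 2 ^ j then 1 else 0) / 2 ^ j)" for J
  \<comment> \<open>The subtracted tail of the geometric series makes the bound inductive; the first
    alternative covers the range before any power of two reaches \<open>w\<close>.\<close>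
  have inv: "U J = 0 \<or> U J \<le> 2 / w - 2 / 2 ^ J" for J
  proof (induction J)
    case (Suc J)
    show ?case
    proof (cases "w \<le> 2 ^ J")
      case True
      then have "1 / 2 ^ J \<le> 1 / w" using w by (intro divide_left_mono) auto
      moreover have "U (Suc J) = U J + 1 / 2 ^ J" using True by (simp add: U_def)
      moreover have "2 / 2 ^ Suc J = (1 / 2 ^ J :: real)" "2 / 2 ^ J = 2 * (1 / 2 ^ J :: real)" "2 / w = 2 * (1 / w)" by simp_all
      ultimately show ?thesis using Suc by linarith
    next
      case False
      moreover have "2 / 2 ^ Suc J \<le> 2 / (2 ^ J :: real)" by (intro divide_left_mono) auto
      ultimately show ?thesis using Suc by (auto simp: U_def)
    qed
  qed (simp add: U_def)
  have "U J \<le> 2 / w" using inv[of J] w by (smt (verit) divide_nonneg_nonneg zero_le_power)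
  then have "w\<^sup>2 * U J \<le> w\<^sup>2 * (2 / w)" by (intro mult_left_mono) auto
  also have "\<dots> = 2 * w" using w by (simp add: power2_eq_square)
  finally show ?thesis by (simp add: U_def sum_distrib_left)
qed simp

context prob_space
begin

text \<open>Independence removes the mixed terms after centring, and centring only lowers each
  second moment.\<close>

lemma indep_centered_sum_square:
  fixes Y :: "nat \<Rightarrow> 'a \<Rightarrow> real"
  assumes ind: "indep_vars (\<lambda>_. borel) Y UNIV" and B: "\<And>i \<omega>. \<bar>Y i \<omega>\<bar> \<le> B"
  shows "variance (\<lambda>\<omega>. \<Sum>i<n. Y i \<omega>) \<le> (\<Sum>i<n. expectation (\<lambda>\<omega>. (Y i \<omega>)\<^sup>2))"
proof -
  have Ym[measurable]: "Y i \<in> borel_measurable M" for i using ind by (auto simp: indep_vars_def)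
  have Yi: "integrable M (Y i)" for i by (rule integrable_bounded[OF Ym B])
  define m where "m i = expectation (Y i)" for i
  define Z where "Z i \<omega> = Y i \<omega> - m i" for i \<omega>
  have mB: "\<bar>m i\<bar> \<le> B" for i unfolding m_def by (rule abs_integral_bounded[OF Ym B])
  have Zm[measurable]: "Z i \<in> borel_measurable M" for i unfolding Z_def by measurable
  have ZB: "\<bar>Z i \<omega>\<bar> \<le> 2 * B" for i \<omega> using B[of i \<omega>] mB[of i] by (simp add: Z_def)
  have Zi: "integrable M (Z i)" for i by (rule integrable_bounded[OF Zm ZB])
  have EZ: "expectation (Z i) = 0" for i unfolding Z_def using Yi by (simp add: m_def prob_space)
  have indZ: "indep_vars (\<lambda>_. borel) Z UNIV"
    unfolding Z_def by (rule indep_vars_compose2[OF ind]) simp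
  have ZZ: "integrable M (\<lambda>\<omega>. Z i \<omega> * Z j \<omega>)" for i j
  proof (rule integrable_bounded[where B = "2 * B * (2 * B)"])
    show "\<bar>Z i \<omega> * Z j \<omega>\<bar> \<le> 2 * B * (2 * B)" for \<omega>
      unfolding abs_mult by (intro mult_mono ZB) (use ZB[of i \<omega>] in auto)
  qed measurable
  have EZZ: "expectation (\<lambda>\<omega>. Z i \<omega> * Z j \<omega>) = 0" if "i \<noteq> j" for i j
  proof -
    have "expectation (\<lambda>\<omega>. \<Prod>v\<in>{i, j}. Z v \<omega>) = (\<Prod>v\<in>{i, j}. expectation (Z v))"
      by (rule indep_vars_lebesgue_integral) (auto intro: indep_vars_subset[OF indZ] Zi)
    then show ?thesis using that by (simp add: EZ)
  qed
  have ES: "expectation (\<lambda>\<omega>. \<Sum>i<n. Y i \<omega>) = (\<Sum>i<n. m i)" unfolding m_def by (simp add: Yi)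
  have "variance (\<lambda>\<omega>. \<Sum>i<n. Y i \<omega>) = expectation (\<lambda>\<omega>. \<Sum>i<n. \<Sum>j<n. Z i \<omega> * Z j \<omega>)"
    unfolding ES by (simp add: Z_def power2_eq_square sum_product[symmetric] sum_subtractf)
  also have "\<dots> = (\<Sum>i<n. \<Sum>j<n. expectation (\<lambda>\<omega>. Z i \<omega> * Z j \<omega>))" by (simp add: ZZ)
  also have "\<dots> = (\<Sum>i<n. \<Sum>j<n. if j = i then expectation (\<lambda>\<omega>. Z i \<omega> * Z i \<omega>) else 0)"
    by (intro sum.cong refl) (use EZZ in auto)
  also have "\<dots> = (\<Sum>i<n. expectation (\<lambda>\<omega>. Z i \<omega> * Z i \<omega>))" by simp
  also have "\<dots> \<le> (\<Sum>i<n. expectation (\<lambda>\<omega>. (Y i \<omega>)\<^sup>2))"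
  proof (rule sum_mono)
    fix i
    have "expectation (\<lambda>\<omega>. (Y i \<omega> - 0)\<^sup>2) = fiber_variance M (Y i) + (m i - 0)\<^sup>2"
      unfolding m_def by (rule fiber_variance_shift[OF Ym B])
    moreover have "expectation (\<lambda>\<omega>. (Y i \<omega> - m i)\<^sup>2) = fiber_variance M (Y i) + (m i - m i)\<^sup>2"
      unfolding m_def by (rule fiber_variance_shift[OF Ym B])
    ultimately show "expectation (\<lambda>\<omega>. Z i \<omega> * Z i \<omega>) \<le> expectation (\<lambda>\<omega>. (Y i \<omega>)\<^sup>2)"
      by (simp add: Z_def power2_eq_square)
  qed
  finally show ?thesis .
qed

text \<open>What a strong law along blocks of length 2^j consumes: \<open>P\<close> feeds the union
  bound over a block that nothing exceeds the truncation level, \<open>Q\<close> feeds Chebyshev's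
  inequality for the truncated block sum. Identically distributed integrable sequences and sequences
  with bounded second moments both qualify, which unites the cases of the input.\<close>

definition dyadic_tame :: "(nat \<Rightarrow> 'a \<Rightarrow> real) \<Rightarrow> bool" where
  "dyadic_tame W \<longleftrightarrow> (\<exists>P Q. summable (\<lambda>j. 2 ^ j * P j) \<and> summable (\<lambda>j. Q j / 2 ^ j) \<and>
     (\<forall>i j. prob {\<omega> \<in> space M. 2 ^ j < W i \<omega>} \<le> P j) \<and>
     (\<forall>i j. expectation (\<lambda>\<omega>. (W i \<omega>)\<^sup>2 * (if W i \<omega> \<le> 2 ^ j then 1 else 0)) \<le> Q j))"

text \<open>Etemadi's argument along the blocks of length a power of two; the resulting bound on the
  averages is off by a constant factor, which is harmless here.\<close>

lemma AE_dyadic_average: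
  assumes ind: "indep_vars (\<lambda>_. borel) W UNIV" and W0: "\<And>i \<omega>. 0 \<le> W i \<omega>"
    and Wi: "\<And>i. integrable M (W i)" and E: "\<And>i. expectation (W i) \<le> \<epsilon>" and \<epsilon>: "0 < \<epsilon>"
    and tame: "dyadic_tame W"
  shows "AE \<omega> in M. eventually (\<lambda>n. (\<Sum>v\<le>n. W v \<omega>) / real n \<le> 4 * \<epsilon>) sequentially"
proof -
  obtain P Q where sP: "summable (\<lambda>j. 2 ^ j * P j)" and sQ: "summable (\<lambda>j. Q j / 2 ^ j)"
    and P: "\<And>i j. prob {\<omega> \<in> space M. 2 ^ j < W i \<omega>} \<le> P j"
    and Q: "\<And>i j. expectation (\<lambda>\<omega>. (W i \<omega>)\<^sup>2 * (if W i \<omega> \<le> 2 ^ j then 1 else 0)) \<le> Q j"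
    using tame unfolding dyadic_tame_def by blast
  have Wm[measurable]: "W i \<in> borel_measurable M" for i using ind by (auto simp: indep_vars_def)
  define Y where "Y j i \<omega> = (if W i \<omega> \<le> 2 ^ j then W i \<omega> else 0)" for j i \<omega>
  define S where "S j \<omega> = (\<Sum>i<2 ^ j. Y j i \<omega>)" for j :: nat and \<omega>
  have YB: "\<bar>Y j i \<omega>\<bar> \<le> 2 ^ j" for j i \<omega> using W0 by (simp add: Y_def)
  have indY: "indep_vars (\<lambda>_. borel) (Y j) UNIV" for j
    unfolding Y_def by (rule indep_vars_compose2[OF ind]) simp
  have Ym[measurable]: "Y j i \<in> borel_measurable M" for j i unfolding Y_def by measurable
  have Sm[measurable]: "S j \<in> borel_measurable M" for j unfolding S_def by measurable
  have Yi: "integrable M (Y j i)" for j i by (rule integrable_bounded[OF Ym YB])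
  have ES: "expectation (S j) \<le> 2 ^ j * \<epsilon>" for j
  proof -
    have "expectation (Y j i) \<le> \<epsilon>" for i
      by (rule order_trans[OF integral_mono[OF Yi Wi] E]) (use W0 in \<open>auto simp: Y_def\<close>)
    then have "(\<Sum>i<2 ^ j. expectation (Y j i)) \<le> (\<Sum>i<(2::nat) ^ j. \<epsilon>)" by (intro sum_mono)
    then show ?thesis unfolding S_def by (simp add: Yi)
  qed
  have S2: "integrable M (\<lambda>\<omega>. (S j \<omega>)\<^sup>2)" for j
  proof (rule integrable_bounded[where B = "(2 ^ j * 2 ^ j)\<^sup>2"])
    have "\<bar>S j \<omega>\<bar> \<le> (\<Sum>i<(2::nat) ^ j. 2 ^ j)" for \<omega>
      unfolding S_def by (intro order_trans[OF sum_abs] sum_mono YB)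
    then show "\<bar>(S j \<omega>)\<^sup>2\<bar> \<le> (2 ^ j * 2 ^ j)\<^sup>2" for \<omega> by (intro square_le_square_bound) simp
  qed measurable
  have VS: "variance (S j) \<le> 2 ^ j * Q j" for j
  proof -
    have "variance (S j) \<le> (\<Sum>i<2 ^ j. expectation (\<lambda>\<omega>. (Y j i \<omega>)\<^sup>2))"
      unfolding S_def by (rule indep_centered_sum_square[OF indY YB])
    also have "\<dots> \<le> (\<Sum>i<(2::nat) ^ j. Q j)"
    proof (rule sum_mono)
      fix i
      have "(\<lambda>\<omega>. (Y j i \<omega>)\<^sup>2) = (\<lambda>\<omega>. (W i \<omega>)\<^sup>2 * (if W i \<omega> \<le> 2 ^ j then 1 else 0))"
        by (auto simp: Y_def)
      then show "expectation (\<lambda>\<omega>. (Y j i \<omega>)\<^sup>2) \<le> Q j" using Q[of i j] by simp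
    qed
    finally show ?thesis by simp
  qed
  \<comment> \<open>Off \<open>A j\<close> truncation is invisible in the block, and off
    \<open>D j\<close> its sum is within \<open>2 ^ j * \<epsilon>\<close> of a mean that is itself
    at most \<open>2 ^ j * \<epsilon>\<close>. Both events have summable probabilities.\<close>
  define A where "A j = {\<omega> \<in> space M. \<exists>i<2 ^ j. 2 ^ j < W i \<omega>}" for j :: nat
  define D where "D j = {\<omega> \<in> space M. 2 ^ j * \<epsilon> \<le> \<bar>S j \<omega> - expectation (S j)\<bar>}" for j :: nat
  have Am[measurable]: "A j \<in> sets M" for j unfolding A_def by measurable
  have Dm[measurable]: "D j \<in> sets M" for j unfolding D_def by measurable
  have pA: "prob (A j) \<le> 2 ^ j * P j" for j
  proof -
    have "A j = (\<Union>i<2 ^ j. {\<omega> \<in> space M. 2 ^ j < W i \<omega>})" by (auto simp: A_def)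
    then have "prob (A j) \<le> (\<Sum>i<2 ^ j. prob {\<omega> \<in> space M. 2 ^ j < W i \<omega>})"
      by (simp only:) (rule finite_measure_subadditive_finite, auto)
    also have "\<dots> \<le> (\<Sum>i<(2::nat) ^ j. P j)" by (intro sum_mono P)
    finally show ?thesis by simp
  qed
  have pD: "prob (D j) \<le> Q j / 2 ^ j / \<epsilon>\<^sup>2" for j
  proof -
    have "prob (D j) \<le> variance (S j) / (2 ^ j * \<epsilon>)\<^sup>2"
      unfolding D_def by (rule Chebyshev_inequality[OF Sm S2]) (use \<epsilon> in simp)
    also have "\<dots> \<le> (2 ^ j * Q j) / (2 ^ j * \<epsilon>)\<^sup>2" by (intro divide_right_mono VS) simp
    also have "\<dots> = Q j / 2 ^ j / \<epsilon>\<^sup>2" by (simp add: power_mult_distrib power2_eq_square)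
    finally show ?thesis .
  qed
  have AEA: "AE \<omega> in M. eventually (\<lambda>j. \<omega> \<in> space M - A j) sequentially"
  proof (rule borel_cantelli_AE1[OF Am])
    show "summable (\<lambda>j. prob (A j))" by (rule summable_comparison_test'[OF sP]) (use pA in auto)
  qed (simp add: less_top[symmetric])
  have AED: "AE \<omega> in M. eventually (\<lambda>j. \<omega> \<in> space M - D j) sequentially"
  proof (rule borel_cantelli_AE1[OF Dm])
    show "summable (\<lambda>j. prob (D j))"
      by (rule summable_comparison_test'[OF summable_divide[OF sQ, of "\<epsilon>\<^sup>2"]]) (use pD in auto)
  qed (simp add: less_top[symmetric])
  show ?thesis using AEA AED
  proof eventually_elim
    fix \<omega> assume "eventually (\<lambda>j. \<omega> \<in> space M - A j) sequentially" "eventually (\<lambda>j. \<omega> \<in> space M - D j) sequentially"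
    then have "eventually (\<lambda>j. \<omega> \<in> space M - A j \<and> \<omega> \<in> space M - D j) sequentially" by (rule eventually_conj)
    then obtain j0 where j0: "\<And>j. j \<ge> j0 \<Longrightarrow> \<omega> \<in> space M - A j \<and> \<omega> \<in> space M - D j"
      by (auto simp: eventually_sequentially)
    have block: "(\<Sum>i<2 ^ j. W i \<omega>) \<le> 2 * 2 ^ j * \<epsilon>" if "j \<ge> j0" for j
    proof -
      have nA: "\<omega> \<in> space M" "\<omega> \<notin> A j" "\<omega> \<notin> D j" using j0[OF that] by auto
      have "W i \<omega> \<le> 2 ^ j" if "i < 2 ^ j" for i
      proof (rule ccontr)
        assume "\<not> W i \<omega> \<le> 2 ^ j"
        then have "\<omega> \<in> A j" using nA(1) that by (auto simp: A_def not_le)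
        with nA(2) show False by blast
      qed
      then have "(\<Sum>i<2 ^ j. W i \<omega>) = S j \<omega>"
        unfolding S_def Y_def by (intro sum.cong refl) simp
      moreover have "\<bar>S j \<omega> - expectation (S j)\<bar> < 2 ^ j * \<epsilon>" using nA by (auto simp: D_def not_le)
      ultimately show ?thesis using ES[of j] by linarith
    qed
    show "eventually (\<lambda>n. (\<Sum>v\<le>n. W v \<omega>) / real n \<le> 4 * \<epsilon>) sequentially"
    proof (rule eventually_sequentiallyI[of "2 ^ j0"])
      \<comment> \<open>Passing to the next power of two at most doubles the length of the sum,
        which raises the block bound of twice \<epsilon> to four times.\<close>
      fix n :: nat assume n: "2 ^ j0 \<le> n"
      have "n \<ge> 1" using n by (meson one_le_numeral one_le_power order_trans)
      then obtain k where k: "2 ^ k \<le> n" "n < 2 ^ Suc k"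
        using ex_power_ivl1[of 2 n] by auto
      have "j0 \<le> Suc k"
      proof (rule ccontr)
        assume "\<not> j0 \<le> Suc k"
        then have "(2::nat) ^ Suc k \<le> 2 ^ j0" by (intro power_increasing) auto
        then show False using k n by simp
      qed
      have "(\<Sum>v\<le>n. W v \<omega>) \<le> (\<Sum>i<2 ^ Suc k. W i \<omega>)"
        by (rule sum_mono2) (use k W0 in auto)
      also have "\<dots> \<le> 2 * 2 ^ Suc k * \<epsilon>" by (rule block[OF \<open>j0 \<le> Suc k\<close>])
      also have "\<dots> = 4 * \<epsilon> * real (2 ^ k)" by simp
      also have "\<dots> \<le> 4 * \<epsilon> * real n" using k \<epsilon> by (intro mult_left_mono) (auto simp del: of_nat_power)
      finally show "(\<Sum>v\<le>n. W v \<omega>) / real n \<le> 4 * \<epsilon>" using \<open>n \<ge> 1\<close> by (simp add: divide_le_eq)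
    qed
  qed
qed

text \<open>Chebyshev's inequality gives tails of order 4^(-j), against which the block length 2^j
  is summable; the truncated second moments are bounded outright.\<close>

lemma dyadic_tame_second_moment:
  assumes Wm[measurable]: "\<And>i. W i \<in> borel_measurable M" and W0: "\<And>i \<omega>. 0 \<le> W i \<omega>"
    and W2: "\<And>i. integrable M (\<lambda>\<omega>. (W i \<omega>)\<^sup>2)" and C: "\<And>i. expectation (\<lambda>\<omega>. (W i \<omega>)\<^sup>2) \<le> C"
  shows "dyadic_tame W"
  unfolding dyadic_tame_def
proof (intro exI conjI allI)
  have g: "summable (\<lambda>j. C * (1 / 2) ^ j)" by (intro summable_mult summable_geometric) simp
  have "(\<lambda>j. 2 ^ j * (C / (2 ^ j)\<^sup>2)) = (\<lambda>j. C * (1 / 2) ^ j)" by (auto simp: power2_eq_square power_divide)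
  then show "summable (\<lambda>j. 2 ^ j * (C / (2 ^ j)\<^sup>2))" using g by simp
  have "(\<lambda>j. C / 2 ^ j) = (\<lambda>j. C * (1 / 2) ^ j)" by (auto simp: power_divide)
  then show "summable (\<lambda>j. C / 2 ^ j)" using g by simp
  fix i j
  let ?A = "{\<omega> \<in> space M. 2 ^ j < W i \<omega>}"
  have "(2 ^ j)\<^sup>2 * prob ?A = expectation (\<lambda>\<omega>. (2 ^ j)\<^sup>2 * indicator ?A \<omega>)" by simp
  also have "\<dots> \<le> expectation (\<lambda>\<omega>. (W i \<omega>)\<^sup>2)"
  proof (rule integral_mono[OF _ W2])
    show "integrable M (\<lambda>\<omega>. (2 ^ j)\<^sup>2 * indicator ?A \<omega> :: real)"
      by (intro integrable_mult_right integrable_bounded[where B = 1]) (auto simp: indicator_def)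
    show "(2 ^ j)\<^sup>2 * indicator ?A \<omega> \<le> (W i \<omega>)\<^sup>2" for \<omega>
      using power_mono[of "2 ^ j" "W i \<omega>" 2] by (auto simp: indicator_def)
  qed
  finally have "prob ?A \<le> expectation (\<lambda>\<omega>. (W i \<omega>)\<^sup>2) / (2 ^ j)\<^sup>2"
    by (simp add: le_divide_eq mult.commute)
  also have "\<dots> \<le> C / (2 ^ j)\<^sup>2" by (intro divide_right_mono C) simp
  finally show "prob {\<omega> \<in> space M. 2 ^ j < W i \<omega>} \<le> C / (2 ^ j)\<^sup>2" .
  have "expectation (\<lambda>\<omega>. (W i \<omega>)\<^sup>2 * (if W i \<omega> \<le> 2 ^ j then 1 else 0)) \<le> expectation (\<lambda>\<omega>. (W i \<omega>)\<^sup>2)"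
  proof (rule integral_mono)
    show "integrable M (\<lambda>\<omega>. (W i \<omega>)\<^sup>2 * (if W i \<omega> \<le> 2 ^ j then 1 else 0))"
    proof (rule Bochner_Integration.integrable_bound[OF W2[of i]])
      have "(\<lambda>\<omega>. if W i \<omega> \<le> 2 ^ j then 1 else 0 :: real) \<in> borel_measurable M"
        by (rule measurable_compose[OF Wm[of i], of "\<lambda>w. if w \<le> 2 ^ j then 1 else 0"]) simp
      then show "(\<lambda>\<omega>. (W i \<omega>)\<^sup>2 * (if W i \<omega> \<le> 2 ^ j then 1 else 0)) \<in> borel_measurable M"
        by (intro borel_measurable_times borel_measurable_power Wm)
    qed auto
  qed (auto simp: W2)
  then show "expectation (\<lambda>\<omega>. (W i \<omega>)\<^sup>2 * (if W i \<omega> \<le> 2 ^ j then 1 else 0)) \<le> C" using C[of i] by linarith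
qed

text \<open>A first moment is enough here: the pointwise dyadic inequalities are integrated, so that
  all partial sums of both series stay below twice the mean of \<open>W 0\<close>.\<close>

lemma dyadic_tame_identical:
  assumes Wm[measurable]: "\<And>i. W i \<in> borel_measurable M" and W0: "\<And>i \<omega>. 0 \<le> W i \<omega>"
    and Wi: "integrable M (W 0)" and id: "\<And>i. distr M borel (W i) = distr M borel (W 0)"
  shows "dyadic_tame W"
  unfolding dyadic_tame_def
proof (intro exI conjI allI)
  let ?P = "\<lambda>j. prob {\<omega> \<in> space M. 2 ^ j < W 0 \<omega>}"
  let ?q = "\<lambda>j w :: real. w\<^sup>2 * (if w \<le> 2 ^ j then 1 else 0)"
  let ?Q = "\<lambda>j. expectation (\<lambda>\<omega>. ?q j (W 0 \<omega>))"
  have qi: "integrable M (\<lambda>\<omega>. ?q j (W 0 \<omega>))" for j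
  proof (rule integrable_bounded[where B = "(2 ^ j)\<^sup>2"])
    show "\<bar>?q j (W 0 \<omega>)\<bar> \<le> (2 ^ j)\<^sup>2" for \<omega> using power_mono[of "W 0 \<omega>" "2 ^ j" 2] W0[of 0 \<omega>] by auto
  qed measurable
  show "summable (\<lambda>j. 2 ^ j * ?P j)"
  proof (rule summableI_nonneg_bounded)
    fix J
    have pe: "?P j = expectation (\<lambda>\<omega>. if 2 ^ j < W 0 \<omega> then 1 else 0)" for j
    proof -
      have "?P j = expectation (indicator {\<omega> \<in> space M. 2 ^ j < W 0 \<omega>})" by simp
      also have "\<dots> = expectation (\<lambda>\<omega>. if 2 ^ j < W 0 \<omega> then 1 else 0)"
        by (intro Bochner_Integration.integral_cong refl) (simp add: indicator_def)
      finally show ?thesis .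
    qed
    have ii: "integrable M (\<lambda>\<omega>. 2 ^ j * (if 2 ^ j < W 0 \<omega> then 1 else 0 :: real))" for j
      by (intro integrable_mult_right integrable_bounded[where B = 1]) auto
    have "(\<Sum>j<J. 2 ^ j * ?P j) = expectation (\<lambda>\<omega>. \<Sum>j<J. 2 ^ j * (if 2 ^ j < W 0 \<omega> then 1 else 0))"
      unfolding pe by (subst Bochner_Integration.integral_sum[OF ii]) simp
    also have "\<dots> \<le> expectation (\<lambda>\<omega>. 2 * W 0 \<omega>)"
      by (intro integral_mono Bochner_Integration.integrable_sum ii integrable_mult_right Wi dyadic_tail_sum_le W0)
    finally show "(\<Sum>j<J. 2 ^ j * ?P j) \<le> expectation (\<lambda>\<omega>. 2 * W 0 \<omega>)" .
  qed simp
  show "summable (\<lambda>j. ?Q j / 2 ^ j)"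
  proof (rule summableI_nonneg_bounded)
    fix J
    have "(\<Sum>j<J. ?Q j / 2 ^ j) = expectation (\<lambda>\<omega>. \<Sum>j<J. ?q j (W 0 \<omega>) / 2 ^ j)"
      by (subst Bochner_Integration.integral_sum) (auto intro: qi)
    also have "\<dots> \<le> expectation (\<lambda>\<omega>. 2 * W 0 \<omega>)"
      by (intro integral_mono Bochner_Integration.integrable_sum integrable_divide_zero qi integrable_mult_right Wi dyadic_truncated_sum_le W0)
    finally show "(\<Sum>j<J. ?Q j / 2 ^ j) \<le> expectation (\<lambda>\<omega>. 2 * W 0 \<omega>)" .
  qed (auto intro!: divide_nonneg_nonneg Bochner_Integration.integral_nonneg)
  fix i j
  have "prob {\<omega> \<in> space M. 2 ^ j < W i \<omega>} = measure (distr M borel (W i)) {2 ^ j<..}" for i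
    by (subst measure_distr) (auto intro!: arg_cong[where f = prob])
  then show "prob {\<omega> \<in> space M. 2 ^ j < W i \<omega>} \<le> ?P j" using id[of i] by simp
  have "expectation (\<lambda>\<omega>. ?q j (W i \<omega>)) = (\<integral>w. ?q j w \<partial>distr M borel (W i))" for i
    by (subst integral_distr) auto
  then show "expectation (\<lambda>\<omega>. ?q j (W i \<omega>)) \<le> ?Q j" using id[of i] by simp
qed

end

section \<open>Truncation\<close>

text \<open>Large values are replaced by 0, not by the threshold as in \<open>clip\<close>. Kept and
  discarded part are then never nonzero together, and their squares add up to the square of the
  variable.\<close>

definition cut :: "real \<Rightarrow> real \<Rightarrow> real" where
  "cut K u = (if \<bar>u\<bar> \<le> K then u else 0)"

lemma measurable_cut [measurable]: "cut K \<in> borel_measurable borel"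
  unfolding cut_def by measurable

lemma abs_cut_le: "0 \<le> K \<Longrightarrow> \<bar>cut K u\<bar> \<le> K"
  by (simp add: cut_def)

context prob_space
begin

text \<open>Truncation disturbs mean and variance; recentring and rescaling make the truncated
  sequence \<open>standardized\<close> again, so that the result for bounded inputs applies.\<close>

definition standard_cut :: "real \<Rightarrow> ('a \<Rightarrow> real) \<Rightarrow> real \<Rightarrow> real" where
  "standard_cut K X u = (cut K u - expectation (\<lambda>\<omega>. cut K (X \<omega>))) / sqrt (fiber_variance M (\<lambda>\<omega>. cut K (X \<omega>)))"

definition tail_square :: "real \<Rightarrow> ('a \<Rightarrow> real) \<Rightarrow> real" where
  "tail_square K X = expectation (\<lambda>\<omega>. (X \<omega> - cut K (X \<omega>))\<^sup>2)"

lemma measurable_standard_cut [measurable]: "standard_cut K X \<in> borel_measurable borel"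
  unfolding standard_cut_def by measurable

text \<open>The discarded part has second moment at most \<eta> and mean opposite to that of the
  kept part, so the standard deviation \<open>b\<close> of the kept part is at least 1/2; hence the
  bound \<open>2 * K / (1 / 2)\<close>. The error splits into discarded part, shift and rescaling,
  each of mean square at most \<eta>, and squaring a sum of three terms costs a factor 3.\<close>

lemma standard_cut_properties:
  assumes X[measurable]: "X \<in> borel_measurable M" and X1: "integrable M X" and X2: "integrable M (\<lambda>\<omega>. (X \<omega>)\<^sup>2)"
    and E1: "expectation X = 0" and E2: "expectation (\<lambda>\<omega>. (X \<omega>)\<^sup>2) = 1"
    and K: "1 \<le> K" and tail: "tail_square K X \<le> \<eta>" and \<eta>: "\<eta> \<le> 1 / 4"
  shows "\<bar>standard_cut K X u\<bar> \<le> 4 * K"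
    and "expectation (\<lambda>\<omega>. standard_cut K X (X \<omega>)) = 0"
    and "expectation (\<lambda>\<omega>. (standard_cut K X (X \<omega>))\<^sup>2) = 1"
    and "expectation (\<lambda>\<omega>. (X \<omega> - standard_cut K X (X \<omega>))\<^sup>2) \<le> 9 * \<eta>"
proof -
  define z where "z \<omega> = cut K (X \<omega>)" for \<omega>
  define w where "w \<omega> = X \<omega> - z \<omega>" for \<omega>
  define a where "a = expectation z"
  define b where "b = sqrt (fiber_variance M z)"
  have zm[measurable]: "z \<in> borel_measurable M" unfolding z_def by measurable
  have wm[measurable]: "w \<in> borel_measurable M" unfolding w_def by measurable
  have zB: "\<bar>z \<omega>\<bar> \<le> K" for \<omega> unfolding z_def by (rule abs_cut_le) (use K in simp)
  have zi: "integrable M z" by (rule integrable_bounded[OF zm zB])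
  have z2i: "integrable M (\<lambda>\<omega>. (z \<omega>)\<^sup>2)"
    by (rule integrable_bounded[where B = "K\<^sup>2"]) (use square_le_square_bound[OF zB] in auto)
  have w2i: "integrable M (\<lambda>\<omega>. (w \<omega>)\<^sup>2)"
  proof (rule Bochner_Integration.integrable_bound[OF X2])
    show "AE \<omega> in M. norm ((w \<omega>)\<^sup>2) \<le> norm ((X \<omega>)\<^sup>2)" by (simp add: w_def z_def cut_def)
  qed measurable
  have wi: "integrable M w" unfolding w_def using X1 zi by simp
  define h where "h = expectation (\<lambda>\<omega>. (w \<omega>)\<^sup>2)"
  have h: "h \<le> \<eta>" "0 \<le> h" using tail by (auto simp: h_def w_def z_def tail_square_def intro!: Bochner_Integration.integral_nonneg)
  have wa: "expectation w = - a" unfolding w_def a_def using X1 zi E1 by simp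
  have a2: "a\<^sup>2 \<le> h"
  proof -
    have "0 \<le> expectation (\<lambda>\<omega>. (w \<omega> - expectation w)\<^sup>2)" by (intro Bochner_Integration.integral_nonneg) simp
    also have "\<dots> = h - (expectation w)\<^sup>2" unfolding h_def by (rule variance_eq[OF wi w2i])
    finally show ?thesis by (simp add: wa)
  qed
  have Ez2: "expectation (\<lambda>\<omega>. (z \<omega>)\<^sup>2) = 1 - h"
  proof -
    \<comment> \<open>At every point one of \<open>z\<close> and \<open>w\<close> is 0, so there is
      no mixed term.\<close>
    have "(\<lambda>\<omega>. (X \<omega>)\<^sup>2) = (\<lambda>\<omega>. (z \<omega>)\<^sup>2 + (w \<omega>)\<^sup>2)" by (auto simp: w_def z_def cut_def)
    then have "1 = expectation (\<lambda>\<omega>. (z \<omega>)\<^sup>2 + (w \<omega>)\<^sup>2)" using E2 by simp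
    also have "\<dots> = expectation (\<lambda>\<omega>. (z \<omega>)\<^sup>2) + h" unfolding h_def by (rule Bochner_Integration.integral_add[OF z2i w2i])
    finally show ?thesis by simp
  qed
  have fv: "fiber_variance M z = 1 - h - a\<^sup>2" by (simp add: fiber_variance_def Ez2 a_def)
  have fv0: "1 / 2 \<le> fiber_variance M z" using fv a2 h \<eta> by linarith
  have b2: "b\<^sup>2 = 1 - h - a\<^sup>2" unfolding b_def fv[symmetric] using fv0 by simp
  have b_half: "1 / 2 \<le> b"
  proof -
    have "(1 / 2)\<^sup>2 \<le> fiber_variance M z" using fv0 by (simp add: power2_eq_square)
    then show ?thesis unfolding b_def by (rule real_le_rsqrt)
  qed
  have "b\<^sup>2 \<le> 1" using b2 h zero_le_power2[of a] by linarith
  then have b1: "b \<le> 1" using power2_le_imp_le[of b 1] by simp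
  have sc: "standard_cut K X u = (cut K u - a) / b" for u
    by (simp add: standard_cut_def a_def b_def z_def[abs_def])
  have aK: "\<bar>a\<bar> \<le> K" unfolding a_def by (rule abs_integral_bounded[OF zm zB])
  show "\<bar>standard_cut K X u\<bar> \<le> 4 * K"
  proof -
    have "\<bar>cut K u - a\<bar> \<le> 2 * K" using abs_cut_le[of K u] aK K by linarith
    also have "\<dots> \<le> 4 * K * b" using mult_left_mono[OF b_half, of "4 * K"] K by simp
    finally show ?thesis unfolding sc using b_half by (simp add: abs_divide divide_le_eq)
  qed
  show "expectation (\<lambda>\<omega>. standard_cut K X (X \<omega>)) = 0"
    unfolding sc z_def[symmetric] using zi by (simp add: a_def prob_space)
  have "expectation (\<lambda>\<omega>. (z \<omega> - a)\<^sup>2) = fiber_variance M z"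
    unfolding a_def using fiber_variance_shift[OF zm zB, of "expectation z"] by simp
  then have Eza: "expectation (\<lambda>\<omega>. (z \<omega> - a)\<^sup>2) = b\<^sup>2" using b2 fv by simp
  show "expectation (\<lambda>\<omega>. (standard_cut K X (X \<omega>))\<^sup>2) = 1"
    unfolding sc z_def[symmetric] power_divide using Eza b_half by simp
  have za2i: "integrable M (\<lambda>\<omega>. (z \<omega> - a)\<^sup>2)"
  proof (rule integrable_bounded[where B = "(2 * K)\<^sup>2"])
    have "\<bar>z \<omega> - a\<bar> \<le> 2 * K" for \<omega> using zB[of \<omega>] aK by linarith
    then show "\<bar>(z \<omega> - a)\<^sup>2\<bar> \<le> (2 * K)\<^sup>2" for \<omega> by (rule square_le_square_bound)
  qed measurable
  \<comment> \<open>Rescaling costs (1 - b)^2 in mean square. One factor is at most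
    \<open>1 - b^2\<close>, hence at most \<open>2 * \<eta>\<close>, and the other at most
    1/2.\<close>
  define c where "c = (1 - 1 / b)\<^sup>2"
  have c: "c * b\<^sup>2 \<le> \<eta>"
  proof -
    have "c * b\<^sup>2 = (1 - b)\<^sup>2" using b_half by (simp add: c_def power2_eq_square field_simps)
    also have "\<dots> \<le> (1 - b) * (2 * \<eta>)"
    proof -
      have "1 - b \<le> (1 - b) * (1 + b)" using b1 b_half mult_left_mono[of 1 "1 + b" "1 - b"] by simp
      also have "\<dots> = 1 - b\<^sup>2" by (simp add: power2_eq_square algebra_simps)
      also have "\<dots> \<le> 2 * \<eta>" using b2 a2 h by linarith
      finally show ?thesis unfolding power2_eq_square using b1 by (intro mult_left_mono) auto
    qed
    also have "\<dots> \<le> 1 / 2 * (2 * \<eta>)" using b_half h by (intro mult_right_mono) auto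
    finally show ?thesis by simp
  qed
  have pt: "(X \<omega> - standard_cut K X (X \<omega>))\<^sup>2 \<le> 3 * (w \<omega>)\<^sup>2 + 3 * a\<^sup>2 + 3 * (c * (z \<omega> - a)\<^sup>2)" for \<omega>
  proof -
    have e: "X \<omega> - standard_cut K X (X \<omega>) = w \<omega> + a + (1 - 1 / b) * (z \<omega> - a)"
      unfolding sc z_def[symmetric] w_def by (simp add: algebra_simps diff_divide_distrib)
    have "(p + q + s)\<^sup>2 \<le> 3 * p\<^sup>2 + 3 * q\<^sup>2 + 3 * s\<^sup>2" for p q s :: real
    proof -
      have "3 * p\<^sup>2 + 3 * q\<^sup>2 + 3 * s\<^sup>2 - (p + q + s)\<^sup>2 = (p - q)\<^sup>2 + (q - s)\<^sup>2 + (p - s)\<^sup>2"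
        by (simp add: power2_eq_square algebra_simps)
      moreover have "0 \<le> (p - q)\<^sup>2 + (q - s)\<^sup>2 + (p - s)\<^sup>2" by simp
      ultimately show ?thesis by linarith
    qed
    from this[of "w \<omega>" a "(1 - 1 / b) * (z \<omega> - a)"] show ?thesis
      unfolding e c_def by (simp only: power_mult_distrib)
  qed
  have "expectation (\<lambda>\<omega>. (X \<omega> - standard_cut K X (X \<omega>))\<^sup>2) \<le> expectation (\<lambda>\<omega>. 3 * (w \<omega>)\<^sup>2 + 3 * a\<^sup>2 + 3 * (c * (z \<omega> - a)\<^sup>2))"
  proof (rule integral_mono[OF _ _ pt])
    show ri: "integrable M (\<lambda>\<omega>. 3 * (w \<omega>)\<^sup>2 + 3 * a\<^sup>2 + 3 * (c * (z \<omega> - a)\<^sup>2))"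
      using w2i za2i by simp
    show "integrable M (\<lambda>\<omega>. (X \<omega> - standard_cut K X (X \<omega>))\<^sup>2)"
    proof (rule Bochner_Integration.integrable_bound[OF ri])
      show "AE \<omega> in M. norm ((X \<omega> - standard_cut K X (X \<omega>))\<^sup>2) \<le> norm (3 * (w \<omega>)\<^sup>2 + 3 * a\<^sup>2 + 3 * (c * (z \<omega> - a)\<^sup>2))"
      proof (intro AE_I2)
        fix \<omega>
        have "0 \<le> (X \<omega> - standard_cut K X (X \<omega>))\<^sup>2" by simp
        then show "norm ((X \<omega> - standard_cut K X (X \<omega>))\<^sup>2) \<le> norm (3 * (w \<omega>)\<^sup>2 + 3 * a\<^sup>2 + 3 * (c * (z \<omega> - a)\<^sup>2))"
          using pt[of \<omega>] unfolding real_norm_def by linarith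
      qed
    qed measurable
  qed
  also have "\<dots> = 3 * h + 3 * a\<^sup>2 + 3 * (c * b\<^sup>2)"
    using w2i za2i by (simp add: h_def[symmetric] Eza prob_space)
  also have "\<dots> \<le> 9 * \<eta>" using h a2 c by linarith
  finally show "expectation (\<lambda>\<omega>. (X \<omega> - standard_cut K X (X \<omega>))\<^sup>2) \<le> 9 * \<eta>" .
qed

definition cut_error :: "real \<Rightarrow> (nat \<Rightarrow> 'a \<Rightarrow> real) \<Rightarrow> nat \<Rightarrow> 'a \<Rightarrow> real" where
  "cut_error K x i \<omega> = (x i \<omega> - standard_cut K (x i) (x i \<omega>))\<^sup>2"

lemma eventually_bounded_imp_bounded:
  fixes f :: "nat \<Rightarrow> real"
  assumes "eventually (\<lambda>n. f n \<le> B) sequentially"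
  shows "\<exists>B'. \<forall>n. f n \<le> B'"
proof -
  obtain N where N: "\<And>n. n \<ge> N \<Longrightarrow> f n \<le> B" using assms by (auto simp: eventually_sequentially)
  have "f n \<le> max B (Max (f ` {..N}))" for n
  proof (cases "n \<ge> N")
    case False
    then have "f n \<le> Max (f ` {..N})" by (intro Max_ge) auto
    then show ?thesis by simp
  qed (use N in \<open>simp add: le_max_iff_disj\<close>)
  then show ?thesis by blast
qed

text \<open>The truncated inputs are covered by the bounded case at every level. The Lipschitz bound
  for \<open>ecf\<close> compares them with the original ones through the average cut error, which
  the dyadic strong law keeps small; \<open>ui\<close> provides the levels and \<open>tame\<close>
  the law. What \<open>tame\<close> may assume are the facts available at the point of its
  use.\<close>

theorem ecf_tendsto_truncation:
  assumes ind: "indep_vars (\<lambda>_. borel) x UNIV" and std: "standardized x" and r: "r \<in> {1, 2}"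
    and ui: "\<And>\<eta>. 0 < \<eta> \<Longrightarrow> \<exists>K\<ge>1. \<forall>i. tail_square K (x i) \<le> \<eta>"
    and tame: "\<And>K. 1 \<le> K \<Longrightarrow> (\<And>i u. \<bar>standard_cut K (x i) u\<bar> \<le> 4 * K) \<Longrightarrow> (\<And>i. integrable M (cut_error K x i)) \<Longrightarrow> dyadic_tame (cut_error K x)"
  shows "AE \<omega> in M. \<forall>t. (\<lambda>n. ecf r hat n (\<lambda>v. x v \<omega>) t) \<longlonglongrightarrow> complex_of_real (limit_char r hat t)"
proof -
  have xm[measurable]: "x i \<in> borel_measurable M" for i using ind by (auto simp: indep_vars_def)
  have x1: "integrable M (x i)" and x2: "integrable M (\<lambda>\<omega>. (x i \<omega>)\<^sup>2)" and e1: "expectation (x i) = 0" for i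
    using std by (auto simp: standardized_def)
  have e2: "expectation (\<lambda>\<omega>. (x i \<omega>)\<^sup>2) = 1" for i
  proof -
    have "variance (x i) = 1" using std unfolding standardized_def by blast
    then show ?thesis using e1[of i] by simp
  qed
  \<comment> \<open>A null sequence starting at 1/4, the largest tail that
    \<open>standard_cut_properties\<close> admits.\<close>
  define \<eta> where "\<eta> m = 1 / (real m + 4)" for m :: nat
  have \<eta>: "0 < \<eta> m" "\<eta> m \<le> 1 / 4" for m by (auto simp: \<eta>_def field_simps)
  obtain K where K: "\<And>m. 1 \<le> K m" and tail: "\<And>m i. tail_square (K m) (x i) \<le> \<eta> m"
    using ui[OF \<eta>(1)] by metis
  note sc = standard_cut_properties[OF xm x1 x2 e1 e2 K tail \<eta>(2)]
  define y where "y m i \<omega> = standard_cut (K m) (x i) (x i \<omega>)" for m i \<omega>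
  have ym[measurable]: "y m i \<in> borel_measurable M" for m i unfolding y_def by measurable
  have yB: "\<bar>y m i \<omega>\<bar> \<le> 4 * K m" for m i \<omega> unfolding y_def by (rule sc(1))
  have indy: "indep_vars (\<lambda>_. borel) (y m) UNIV" for m
    unfolding y_def by (rule indep_vars_compose2[OF ind]) simp
  have stdy: "standardized (y m)" for m
    unfolding standardized_def
  proof (intro allI conjI)
    fix i
    show "integrable M (y m i)" by (rule integrable_bounded[OF ym yB])
    show "integrable M (\<lambda>\<omega>. (y m i \<omega>)\<^sup>2)"
      by (rule integrable_bounded[where B = "(4 * K m)\<^sup>2"]) (use square_le_square_bound[OF yB] in auto)
    show e: "expectation (y m i) = 0" unfolding y_def by (rule sc(2))
    show "variance (y m i) = 1" unfolding e using sc(3)[of m i] by (simp add: y_def)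
  qed
  have W: "cut_error (K m) x i \<omega> = (x i \<omega> - y m i \<omega>)\<^sup>2" for m i \<omega> by (simp add: cut_error_def y_def)
  have Wi: "integrable M (cut_error (K m) x i)" for m i
  proof (rule Bochner_Integration.integrable_bound)
    show "integrable M (\<lambda>\<omega>. 2 * (x i \<omega>)\<^sup>2 + 2 * (4 * K m)\<^sup>2)" using x2[of i] by simp
    show "AE \<omega> in M. norm (cut_error (K m) x i \<omega>) \<le> norm (2 * (x i \<omega>)\<^sup>2 + 2 * (4 * K m)\<^sup>2)"
    proof (intro AE_I2)
      fix \<omega>
      have "(x i \<omega> - y m i \<omega>)\<^sup>2 + (x i \<omega> + y m i \<omega>)\<^sup>2 = 2 * (x i \<omega>)\<^sup>2 + 2 * (y m i \<omega>)\<^sup>2"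
        by (simp add: power2_eq_square algebra_simps)
      moreover have "(y m i \<omega>)\<^sup>2 \<le> (4 * K m)\<^sup>2" using square_le_square_bound[OF yB[of m i \<omega>]] by simp
      moreover have "0 \<le> (x i \<omega> + y m i \<omega>)\<^sup>2" "0 \<le> (x i \<omega> - y m i \<omega>)\<^sup>2" by simp_all
      ultimately show "norm (cut_error (K m) x i \<omega>) \<le> norm (2 * (x i \<omega>)\<^sup>2 + 2 * (4 * K m)\<^sup>2)"
        unfolding W real_norm_def by linarith
    qed
    show "cut_error (K m) x i \<in> borel_measurable M" unfolding cut_error_def[abs_def] by measurable
  qed
  have AE_W: "AE \<omega> in M. eventually (\<lambda>n. (\<Sum>v\<le>n. cut_error (K m) x v \<omega>) / real n \<le> 4 * (9 * \<eta> m)) sequentially" for m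
  proof (rule AE_dyadic_average)
    show "indep_vars (\<lambda>_. borel) (cut_error (K m) x) UNIV"
      unfolding cut_error_def[abs_def] by (rule indep_vars_compose2[OF ind, of "\<lambda>i u. (u - standard_cut (K m) (x i) u)\<^sup>2"]) simp
    show "0 \<le> cut_error (K m) x i \<omega>" for i \<omega> by (simp add: cut_error_def)
    show "expectation (cut_error (K m) x i) \<le> 9 * \<eta> m" for i
      unfolding cut_error_def[abs_def] by (rule sc(4))
    show "0 < 9 * \<eta> m" using \<eta> by simp
    show "dyadic_tame (cut_error (K m) x)" by (rule tame[OF K sc(1) Wi])
  qed (rule Wi)
  \<comment> \<open>One null set for all truncation levels and all rational arguments.\<close>
  have AE_y: "AE \<omega> in M. \<forall>m q. (\<lambda>n. ecf r hat n (\<lambda>v. y m v \<omega>) (real_of_rat q)) \<longlonglongrightarrow> complex_of_real (limit_char r hat (real_of_rat q))"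
    unfolding AE_all_countable by (intro allI ecf_tendsto_bounded[OF indy stdy _ r]) (use yB in auto)
  have "AE \<omega> in M. \<forall>m. eventually (\<lambda>n. (\<Sum>v\<le>n. cut_error (K m) x v \<omega>) / real n \<le> 4 * (9 * \<eta> m)) sequentially"
    unfolding AE_all_countable by (intro allI AE_W)
  with AE_y show ?thesis
  proof eventually_elim
    fix \<omega>
    assume y: "\<forall>m q. (\<lambda>n. ecf r hat n (\<lambda>v. y m v \<omega>) (real_of_rat q)) \<longlonglongrightarrow> complex_of_real (limit_char r hat (real_of_rat q))"
      and w: "\<forall>m. eventually (\<lambda>n. (\<Sum>v\<le>n. cut_error (K m) x v \<omega>) / real n \<le> 4 * (9 * \<eta> m)) sequentially"
    let ?x = "\<lambda>v. x v \<omega>"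
    have rat: "(\<lambda>n. ecf r hat n ?x (real_of_rat q)) \<longlonglongrightarrow> complex_of_real (limit_char r hat (real_of_rat q))" for q
    proof (rule LIMSEQ_I)
      fix \<epsilon> :: real assume \<epsilon>: "0 < \<epsilon>"
      let ?t = "real_of_rat q"
      \<comment> \<open>72 is the product of 2 from \<open>ecf_lipschitz\<close>, 4 from the dyadic
        average and 9 from the mean-square cut error.\<close>
      have "(\<lambda>m. \<bar>?t\<bar> * sqrt (72 * \<eta> m)) \<longlonglongrightarrow> \<bar>?t\<bar> * sqrt (72 * 0)"
      proof (intro tendsto_mult tendsto_const tendsto_real_sqrt)
        show "\<eta> \<longlonglongrightarrow> 0" unfolding \<eta>_def[abs_def]
          using LIMSEQ_ignore_initial_segment[OF lim_1_over_n[where 'a = real], of 4] by simp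
      qed
      then have "eventually (\<lambda>m. \<bar>?t\<bar> * sqrt (72 * \<eta> m) < \<epsilon> / 2) sequentially"
        by (rule order_tendstoD(2)) (use \<epsilon> in simp)
      then obtain m where m: "\<bar>?t\<bar> * sqrt (72 * \<eta> m) < \<epsilon> / 2" by (auto dest: eventually_happens)
      have "eventually (\<lambda>n. dist (ecf r hat n (\<lambda>v. y m v \<omega>) ?t) (complex_of_real (limit_char r hat ?t)) < \<epsilon> / 2) sequentially"
        using y \<epsilon> by (intro tendstoD) auto
      moreover have "eventually (\<lambda>n::nat. n > 0) sequentially" by (rule eventually_gt_at_top)
      ultimately have "eventually (\<lambda>n. norm (ecf r hat n ?x ?t - complex_of_real (limit_char r hat ?t)) < \<epsilon>) sequentially"
        using w[rule_format, of m]
      proof eventually_elim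
        fix n :: nat
        assume 1: "dist (ecf r hat n (\<lambda>v. y m v \<omega>) ?t) (complex_of_real (limit_char r hat ?t)) < \<epsilon> / 2" and n: "0 < n"
          and 2: "(\<Sum>v\<le>n. cut_error (K m) x v \<omega>) / real n \<le> 4 * (9 * \<eta> m)"
        have "dist (ecf r hat n ?x ?t) (ecf r hat n (\<lambda>v. y m v \<omega>) ?t) \<le> \<bar>?t\<bar> * sqrt (2 * (\<Sum>v\<le>n. (x v \<omega> - y m v \<omega>)\<^sup>2) / real n)"
          unfolding dist_norm by (rule ecf_lipschitz[OF r n])
        also have "\<dots> \<le> \<bar>?t\<bar> * sqrt (72 * \<eta> m)"
          using 2 unfolding W by (intro mult_left_mono real_sqrt_le_mono) auto
        finally have "dist (ecf r hat n ?x ?t) (ecf r hat n (\<lambda>v. y m v \<omega>) ?t) < \<epsilon> / 2" using m by linarith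
        then show "norm (ecf r hat n ?x ?t - complex_of_real (limit_char r hat ?t)) < \<epsilon>"
          using 1 dist_triangle[of "ecf r hat n ?x ?t" "complex_of_real (limit_char r hat ?t)" "ecf r hat n (\<lambda>v. y m v \<omega>) ?t"]
          unfolding dist_norm by linarith
      qed
      then show "\<exists>no. \<forall>n\<ge>no. norm (ecf r hat n ?x ?t - complex_of_real (limit_char r hat ?t)) < \<epsilon>"
        by (simp only: eventually_sequentially)
    qed
    \<comment> \<open>A single truncation level already bounds the mean squares of the original
      inputs, which is what the passage from rational to real arguments needs.\<close>
    have "eventually (\<lambda>n. (\<Sum>v\<le>n. (x v \<omega>)\<^sup>2) / real n \<le> 72 * \<eta> 0 + 64 * (K 0)\<^sup>2) sequentially"
      using w[rule_format, of 0] eventually_gt_at_top[of 0]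
    proof eventually_elim
      fix n :: nat assume 1: "(\<Sum>v\<le>n. cut_error (K 0) x v \<omega>) / real n \<le> 4 * (9 * \<eta> 0)" and n: "0 < n"
      have pt: "(x v \<omega>)\<^sup>2 \<le> 2 * cut_error (K 0) x v \<omega> + 32 * (K 0)\<^sup>2" for v
      proof -
        define p q where "p = x v \<omega>" and "q = y 0 v \<omega>"
        have "2 * (p - q)\<^sup>2 + 2 * q\<^sup>2 - p\<^sup>2 = (p - 2 * q)\<^sup>2" by (simp add: power2_eq_square algebra_simps)
        moreover have "0 \<le> (p - 2 * q)\<^sup>2" by simp
        moreover have "q\<^sup>2 \<le> (4 * K 0)\<^sup>2" using square_le_square_bound[OF yB[of 0 v \<omega>]] by (simp add: q_def)
        moreover have "(4 * K 0)\<^sup>2 = 16 * (K 0)\<^sup>2" by (simp add: power_mult_distrib)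
        ultimately have "p\<^sup>2 \<le> 2 * (p - q)\<^sup>2 + 32 * (K 0)\<^sup>2" by linarith
        then show ?thesis unfolding W p_def q_def .
      qed
      have "(\<Sum>v\<le>n. (x v \<omega>)\<^sup>2) \<le> (\<Sum>v\<le>n. 2 * cut_error (K 0) x v \<omega> + 32 * (K 0)\<^sup>2)" by (intro sum_mono pt)
      also have "\<dots> = 2 * (\<Sum>v\<le>n. cut_error (K 0) x v \<omega>) + (real n + 1) * (32 * (K 0)\<^sup>2)"
        by (simp add: sum.distrib sum_distrib_left)
      also have "\<dots> \<le> 2 * (36 * \<eta> 0 * real n) + (2 * real n) * (32 * (K 0)\<^sup>2)"
        using 1 n by (intro add_mono mult_left_mono mult_right_mono) (auto simp: divide_le_eq)
      finally show "(\<Sum>v\<le>n. (x v \<omega>)\<^sup>2) / real n \<le> 72 * \<eta> 0 + 64 * (K 0)\<^sup>2"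
        using n by (simp add: divide_le_eq algebra_simps)
    qed
    from eventually_bounded_imp_bounded[OF this] obtain B where B: "\<And>n. (\<Sum>v\<le>n. (x v \<omega>)\<^sup>2) / real n \<le> B" by blast
    show "\<forall>t. (\<lambda>n. ecf r hat n ?x t) \<longlonglongrightarrow> complex_of_real (limit_char r hat t)"
      by (intro allI ecf_tendsto_all_arguments[OF r B rat])
  qed
qed

lemma tail_square_le_fourth_moment:
  assumes X[measurable]: "X \<in> borel_measurable M" and X4: "integrable M (\<lambda>\<omega>. \<bar>X \<omega>\<bar> ^ 4)"
    and C: "expectation (\<lambda>\<omega>. \<bar>X \<omega>\<bar> ^ 4) \<le> C" and K: "1 \<le> K"
  shows "tail_square K X \<le> C / K\<^sup>2"
proof -
  have pt: "(u - cut K u)\<^sup>2 \<le> \<bar>u\<bar> ^ 4 / K\<^sup>2" for u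
  proof (cases "\<bar>u\<bar> \<le> K")
    case False
    then have "K\<^sup>2 \<le> \<bar>u\<bar>\<^sup>2" using K by (intro power_mono) auto
    then have "u\<^sup>2 * K\<^sup>2 \<le> u\<^sup>2 * \<bar>u\<bar>\<^sup>2" by (intro mult_left_mono) auto
    also have "u\<^sup>2 * \<bar>u\<bar>\<^sup>2 = \<bar>u\<bar> ^ 4" by (simp add: power2_eq_square power4_eq_xxxx)
    finally show ?thesis using False K by (simp add: cut_def le_divide_eq)
  qed (simp add: cut_def)
  have i4: "integrable M (\<lambda>\<omega>. \<bar>X \<omega>\<bar> ^ 4 / K\<^sup>2)" using X4 by simp
  have "tail_square K X \<le> expectation (\<lambda>\<omega>. \<bar>X \<omega>\<bar> ^ 4 / K\<^sup>2)"
    unfolding tail_square_def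
  proof (rule integral_mono[OF _ i4 pt])
    show "integrable M (\<lambda>\<omega>. (X \<omega> - cut K (X \<omega>))\<^sup>2)"
      by (rule Bochner_Integration.integrable_bound[OF i4]) (use pt in auto)
  qed
  also have "\<dots> \<le> C / K\<^sup>2" using C by (simp add: divide_right_mono)
  finally show ?thesis .
qed

lemma input_A1_imp_A3: "input_A1 x \<Longrightarrow> input_A3 x"
proof -
  assume A1: "input_A1 x"
  then obtain C where C: "\<And>i. AE \<omega> in M. \<bar>x i \<omega>\<bar> \<le> C" and ind: "indep_vars (\<lambda>_. borel) x UNIV"
    by (auto simp: input_A1_def)
  have xm[measurable]: "x i \<in> borel_measurable M" for i using ind by (auto simp: indep_vars_def)
  have "integrable M (\<lambda>\<omega>. \<bar>x i \<omega>\<bar> ^ k) \<and> expectation (\<lambda>\<omega>. \<bar>x i \<omega>\<bar> ^ k) \<le> C ^ k" for i k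
  proof
    have b: "AE \<omega> in M. \<bar>x i \<omega>\<bar> ^ k \<le> C ^ k" using C[of i] by eventually_elim (simp add: power_mono)
    show int: "integrable M (\<lambda>\<omega>. \<bar>x i \<omega>\<bar> ^ k)"
      by (rule integrable_const_bound[where B = "C ^ k"]) (use b in auto)
    have "expectation (\<lambda>\<omega>. \<bar>x i \<omega>\<bar> ^ k) \<le> expectation (\<lambda>\<omega>. C ^ k)"
      by (rule integral_mono_AE[OF int _ b]) simp
    then show "expectation (\<lambda>\<omega>. \<bar>x i \<omega>\<bar> ^ k) \<le> C ^ k" by (simp add: prob_space)
  qed
  then show "input_A3 x" using A1 unfolding input_A1_def input_A3_def by blast
qed

text \<open>Bounded fourth moments serve twice: they make the tails uniformly small by a Markov
  bound, and they bound the second moments of the cut errors.\<close>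

lemma input_A3_ecf_tendsto:
  assumes A3: "input_A3 x" and r: "r \<in> {1, 2}"
  shows "AE \<omega> in M. \<forall>t. (\<lambda>n. ecf r hat n (\<lambda>v. x v \<omega>) t) \<longlonglongrightarrow> complex_of_real (limit_char r hat t)"
proof -
  have ind: "indep_vars (\<lambda>_. borel) x UNIV" and std: "standardized x" using A3 by (auto simp: input_A3_def)
  have xm[measurable]: "x i \<in> borel_measurable M" for i using ind by (auto simp: indep_vars_def)
  obtain C where C: "\<And>i. integrable M (\<lambda>\<omega>. \<bar>x i \<omega>\<bar> ^ 4)" "\<And>i. expectation (\<lambda>\<omega>. \<bar>x i \<omega>\<bar> ^ 4) \<le> C"
    using A3 unfolding input_A3_def by meson
  show ?thesis
  proof (rule ecf_tendsto_truncation[OF ind std r])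
    fix \<eta> :: real assume \<eta>: "0 < \<eta>"
    define K where "K = max 1 (\<bar>C\<bar> / \<eta>)"
    have K: "1 \<le> K" "\<bar>C\<bar> / \<eta> \<le> K" by (auto simp: K_def)
    have "C / K\<^sup>2 \<le> \<eta>"
    proof -
      have "C \<le> \<eta> * K" using K(2) \<eta> by (simp add: divide_le_eq mult.commute)
      also have "\<dots> \<le> \<eta> * K\<^sup>2" using K(1) \<eta> by (intro mult_left_mono) (auto simp: power2_eq_square)
      finally show ?thesis using K(1) by (simp add: divide_le_eq)
    qed
    then show "\<exists>K\<ge>1. \<forall>i. tail_square K (x i) \<le> \<eta>"
      using tail_square_le_fourth_moment[OF xm C K(1)] K(1) by (meson order_trans)
  next
    fix K :: real assume K: "1 \<le> K" and B: "\<And>i u. \<bar>standard_cut K (x i) u\<bar> \<le> 4 * K"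
    have Wm: "cut_error K x i \<in> borel_measurable M" for i unfolding cut_error_def[abs_def] by measurable
    have pt: "(cut_error K x i \<omega>)\<^sup>2 \<le> 8 * \<bar>x i \<omega>\<bar> ^ 4 + 8 * (4 * K) ^ 4" for i \<omega>
    proof -
      define p q where "p = x i \<omega>" and "q = standard_cut K (x i) (x i \<omega>)"
      have 1: "(p - q)\<^sup>2 \<le> 2 * p\<^sup>2 + 2 * q\<^sup>2"
      proof -
        have "2 * p\<^sup>2 + 2 * q\<^sup>2 - (p - q)\<^sup>2 = (p + q)\<^sup>2" by (simp add: power2_eq_square algebra_simps)
        moreover have "0 \<le> (p + q)\<^sup>2" by simp
        ultimately show ?thesis by linarith
      qed
      have "((p - q)\<^sup>2)\<^sup>2 \<le> (2 * p\<^sup>2 + 2 * q\<^sup>2)\<^sup>2" by (rule power_mono[OF 1]) simp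
      also have "\<dots> \<le> 8 * (p\<^sup>2)\<^sup>2 + 8 * (q\<^sup>2)\<^sup>2"
      proof -
        have "8 * (p\<^sup>2)\<^sup>2 + 8 * (q\<^sup>2)\<^sup>2 - (2 * p\<^sup>2 + 2 * q\<^sup>2)\<^sup>2 = (2 * p\<^sup>2 - 2 * q\<^sup>2)\<^sup>2" by (simp add: power2_eq_square algebra_simps)
        moreover have "0 \<le> (2 * p\<^sup>2 - 2 * q\<^sup>2)\<^sup>2" by simp
        ultimately show ?thesis by linarith
      qed
      also have "(q\<^sup>2)\<^sup>2 \<le> (4 * K) ^ 4"
        using power_mono[OF B[of i "x i \<omega>"] abs_ge_zero, of 4] by (simp add: q_def flip: power_mult)
      also have "(p\<^sup>2)\<^sup>2 = \<bar>p\<bar> ^ 4" by (simp flip: power_mult)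
      finally show ?thesis by (simp add: cut_error_def p_def q_def)
    qed
    have bi: "integrable M (\<lambda>\<omega>. 8 * \<bar>x i \<omega>\<bar> ^ 4 + 8 * (4 * K) ^ 4)" for i using C(1)[of i] by simp
    have W2: "integrable M (\<lambda>\<omega>. (cut_error K x i \<omega>)\<^sup>2)" for i
    proof (rule Bochner_Integration.integrable_bound[OF bi[of i]])
      show "AE \<omega> in M. norm ((cut_error K x i \<omega>)\<^sup>2) \<le> norm (8 * \<bar>x i \<omega>\<bar> ^ 4 + 8 * (4 * K) ^ 4)"
      proof (intro AE_I2)
        fix \<omega>
        have "0 \<le> (cut_error K x i \<omega>)\<^sup>2" by simp
        then show "norm ((cut_error K x i \<omega>)\<^sup>2) \<le> norm (8 * \<bar>x i \<omega>\<bar> ^ 4 + 8 * (4 * K) ^ 4)"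
          using pt[of i \<omega>] unfolding real_norm_def by linarith
      qed
    qed (use Wm[of i] in measurable)
    show "dyadic_tame (cut_error K x)"
    proof (rule dyadic_tame_second_moment[OF Wm _ W2])
      show "0 \<le> cut_error K x i \<omega>" for i \<omega> by (simp add: cut_error_def)
      fix i
      have "expectation (\<lambda>\<omega>. (cut_error K x i \<omega>)\<^sup>2) \<le> expectation (\<lambda>\<omega>. 8 * \<bar>x i \<omega>\<bar> ^ 4 + 8 * (4 * K) ^ 4)"
        by (rule integral_mono[OF W2 bi pt])
      also have "\<dots> = 8 * expectation (\<lambda>\<omega>. \<bar>x i \<omega>\<bar> ^ 4) + 8 * (4 * K) ^ 4" using C(1)[of i] by (simp add: prob_space)
      also have "\<dots> \<le> 8 * C + 8 * (4 * K) ^ 4" using C(2)[of i] by simp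
      finally show "expectation (\<lambda>\<omega>. (cut_error K x i \<omega>)\<^sup>2) \<le> 8 * C + 8 * (4 * K) ^ 4" .
    qed
  qed
qed

lemma tail_square_tendsto_zero:
  assumes X[measurable]: "X \<in> borel_measurable M" and X2: "integrable M (\<lambda>\<omega>. (X \<omega>)\<^sup>2)"
  shows "(\<lambda>n. tail_square (real n) X) \<longlonglongrightarrow> 0"
proof -
  have "(\<lambda>n. expectation (\<lambda>\<omega>. (X \<omega> - cut (real n) (X \<omega>))\<^sup>2)) \<longlonglongrightarrow> expectation (\<lambda>\<omega>. 0)"
  proof (rule integral_dominated_convergence[OF _ _ X2])
    show "AE \<omega> in M. (\<lambda>n. (X \<omega> - cut (real n) (X \<omega>))\<^sup>2) \<longlonglongrightarrow> 0"
    proof (intro AE_I2 tendsto_eventually)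
      fix \<omega>
      show "eventually (\<lambda>n. (X \<omega> - cut (real n) (X \<omega>))\<^sup>2 = 0) sequentially"
        using eventually_ge_at_top[of "nat \<lceil>\<bar>X \<omega>\<bar>\<rceil>"]
      proof eventually_elim
        fix n assume "nat \<lceil>\<bar>X \<omega>\<bar>\<rceil> \<le> n"
        then have "\<bar>X \<omega>\<bar> \<le> real n" by linarith
        then show "(X \<omega> - cut (real n) (X \<omega>))\<^sup>2 = 0" by (simp add: cut_def)
      qed
    qed
    show "AE \<omega> in M. norm ((X \<omega> - cut (real n) (X \<omega>))\<^sup>2) \<le> (X \<omega>)\<^sup>2" for n
      by (intro AE_I2) (simp add: cut_def)
  qed measurable
  then show ?thesis by (simp add: tail_square_def)
qed

text \<open>Under identical distribution one truncation function serves all indices, so the cut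
  errors are again identically distributed, and the tail condition reduces to a single
  square-integrable variable.\<close>

lemma input_A2_ecf_tendsto:
  assumes A2: "input_A2 x" and r: "r \<in> {1, 2}"
  shows "AE \<omega> in M. \<forall>t. (\<lambda>n. ecf r hat n (\<lambda>v. x v \<omega>) t) \<longlonglongrightarrow> complex_of_real (limit_char r hat t)"
proof -
  have ind: "indep_vars (\<lambda>_. borel) x UNIV" and std: "standardized x"
    and id: "\<And>i. distr M borel (x i) = distr M borel (x 0)" using A2 unfolding input_A2_def by blast+
  have xm[measurable]: "x i \<in> borel_measurable M" for i using ind by (auto simp: indep_vars_def)
  have same: "expectation (\<lambda>\<omega>. h (x i \<omega>)) = expectation (\<lambda>\<omega>. h (x 0 \<omega>))"
    if h: "h \<in> borel_measurable borel" for h :: "real \<Rightarrow> real" and i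
  proof -
    have "expectation (\<lambda>\<omega>. h (x i \<omega>)) = (\<integral>u. h u \<partial>distr M borel (x i))" for i
      by (rule integral_distr[symmetric]) (use h in auto)
    then show ?thesis using id[of i] by simp
  qed
  show ?thesis
  proof (rule ecf_tendsto_truncation[OF ind std r])
    fix \<eta> :: real assume \<eta>: "0 < \<eta>"
    have "integrable M (\<lambda>\<omega>. (x 0 \<omega>)\<^sup>2)" using std by (simp add: standardized_def)
    from order_tendstoD(2)[OF tail_square_tendsto_zero[OF xm this] \<eta>] eventually_ge_at_top[of 1]
    have "eventually (\<lambda>n. tail_square (real n) (x 0) < \<eta> \<and> 1 \<le> n) sequentially" by (rule eventually_conj)
    then obtain n where n: "tail_square (real n) (x 0) < \<eta>" "1 \<le> n" by (auto dest: eventually_happens)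
    have "tail_square (real n) (x i) = tail_square (real n) (x 0)" for i
      unfolding tail_square_def by (rule same[of "\<lambda>u. (u - cut (real n) u)\<^sup>2"]) measurable
    then have "tail_square (real n) (x i) \<le> \<eta>" for i using n(1) by (metis less_imp_le)
    then show "\<exists>K\<ge>1. \<forall>i. tail_square K (x i) \<le> \<eta>" using n(2) by (intro exI[of _ "real n"]) auto
  next
    fix K :: real assume K: "1 \<le> K" and Wi: "\<And>i. integrable M (cut_error K x i)"
    have sc: "standard_cut K (x i) = standard_cut K (x 0)" for i
    proof -
      have "expectation (\<lambda>\<omega>. cut K (x i \<omega>)) = expectation (\<lambda>\<omega>. cut K (x 0 \<omega>))"
        by (rule same) measurable
      moreover have "expectation (\<lambda>\<omega>. (cut K (x i \<omega>))\<^sup>2) = expectation (\<lambda>\<omega>. (cut K (x 0 \<omega>))\<^sup>2)"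
        by (rule same[of "\<lambda>u. (cut K u)\<^sup>2"]) measurable
      ultimately show ?thesis unfolding standard_cut_def[abs_def] fiber_variance_def by (simp only:)
    qed
    show "dyadic_tame (cut_error K x)"
    proof (rule dyadic_tame_identical)
      show "cut_error K x i \<in> borel_measurable M" for i unfolding cut_error_def[abs_def] by measurable
      show "0 \<le> cut_error K x i \<omega>" for i \<omega> by (simp add: cut_error_def)
      let ?h = "\<lambda>u. (u - standard_cut K (x 0) u)\<^sup>2"
      have "distr M borel (cut_error K x i) = distr (distr M borel (x i)) borel ?h" for i
        by (subst distr_distr) (auto simp: comp_def cut_error_def[abs_def] sc[of i])
      then show "distr M borel (cut_error K x i) = distr M borel (cut_error K x 0)" for i
        using id[of i] by simp
    qed (rule Wi)
  qed
qed

theorem admissible_ecf_tendsto: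
  assumes "admissible_input x" "r \<in> {1, 2}"
  shows "AE \<omega> in M. \<forall>t. (\<lambda>n. ecf r hat n (\<lambda>v. x v \<omega>) t) \<longlonglongrightarrow> complex_of_real (limit_char r hat t)"
  using assms input_A1_imp_A3 input_A2_ecf_tendsto input_A3_ecf_tendsto unfolding admissible_input_def by blast

end

section \<open>The limit laws\<close>

text \<open>The spectral distribution as the law of a uniformly chosen eigenvalue. The uniform law
  on the empty index set is unspecified, so computations assume \<open>n > 0\<close> or are indexed
  by \<open>Suc n\<close>.\<close>

definition empirical :: "nat \<Rightarrow> bool \<Rightarrow> nat \<Rightarrow> (nat \<Rightarrow> real) \<Rightarrow> real measure" where
  "empirical r hat n x = distr (measure_pmf (pmf_of_set {..<n})) borel (spec r hat n x)"

lemma real_distribution_empirical: "real_distribution (empirical r hat n x)"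
  unfolding empirical_def by (rule prob_space.real_distribution_distr[OF prob_space_measure_pmf]) simp

lemma measure_empirical:
  assumes n: "n > 0" and S: "S \<in> sets borel"
  shows "measure (empirical r hat n x) S = real (card {i. i < n \<and> spec r hat n x i \<in> S}) / real n"
proof -
  have "measure (empirical r hat n x) S = measure (measure_pmf (pmf_of_set {..<n})) (spec r hat n x -` S)"
    unfolding empirical_def using S by (subst measure_distr) auto
  also have "\<dots> = real (card ({..<n} \<inter> spec r hat n x -` S)) / real (card {..<n})"
    by (rule measure_pmf_of_set) (use n in auto)
  also have "{..<n} \<inter> spec r hat n x -` S = {i. i < n \<and> spec r hat n x i \<in> S}" by auto
  finally show ?thesis by simp
qed

lemma char_empirical:
  assumes n: "n > 0"
  shows "char (empirical r hat n x) t = ecf r hat n x t"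
proof -
  have "char (empirical r hat n x) t = (\<integral>i. iexp (t * spec r hat n x i) \<partial>measure_pmf (pmf_of_set {..<n}))"
    unfolding char_def empirical_def by (subst integral_distr) auto
  also have "\<dots> = (\<Sum>i<n. pmf (pmf_of_set {..<n}) i *\<^sub>R iexp (t * spec r hat n x i))"
    by (rule integral_measure_pmf) (use n in \<open>simp_all add: set_pmf_of_set lessThan_empty_iff\<close>)
  also have "\<dots> = (\<Sum>i<n. iexp (t * spec r hat n x i) / of_nat n)"
    using n by (intro sum.cong refl) (auto simp: scaleR_conv_of_real divide_inverse mult.commute lessThan_empty_iff)
  finally show ?thesis by (simp add: ecf_def sum_divide_distrib)
qed

lemma cdf_empirical:
  assumes r: "r \<in> {1, 2}" and n: "n > 0"
  shows "cdf (empirical r hat n x) = esd (Matrix.mat n n (\<lambda>(i, j). scaled r hat n x i j))"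
proof
  fix s
  let ?A = "Matrix.mat n n (\<lambda>(i, j). scaled r hat n x i j)"
  have r0: "r > 0" using r by auto
  have "proots (char_poly ?A) = mset (map (spec r hat n x) [0..<n])"
    unfolding spec_def by (rule eigenvalues_of(2)) (rule scaled_commute[OF r0 n])
  then have "size {#l \<in># proots (char_poly ?A). l \<le> s#} = length (filter (\<lambda>l. l \<le> s) (map (spec r hat n x) [0..<n]))"
    by (simp only: mset_filter[symmetric] size_mset)
  also have "\<dots> = card {i. i < n \<and> spec r hat n x i \<le> s}"
    by (subst length_filter_conv_card) (auto intro!: arg_cong[where f = card])
  finally have "esd ?A s = real (card {i. i < n \<and> spec r hat n x i \<le> s}) / real n"
    by (simp add: esd_def)
  then show "cdf (empirical r hat n x) s = esd ?A s"
    unfolding cdf_def measure_empirical[OF n atMost_borel] by simp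
qed

text \<open>Levy's theorem is applied from \<open>n = 1\<close> on, where \<open>esd\<close> is the
  distribution function of a law; a shift of the index transfers the limit back.\<close>

lemma weak_conv_esd:
  assumes r: "r \<in> {1, 2}" and \<mu>: "real_distribution \<mu>"
    and char: "\<And>t. char \<mu> t = complex_of_real (limit_char r hat t)"
    and lim: "\<And>t. (\<lambda>n. ecf r hat n x t) \<longlonglongrightarrow> complex_of_real (limit_char r hat t)"
  shows "weak_conv (\<lambda>n. esd (Matrix.mat n n (\<lambda>(i, j). scaled r hat n x i j))) (cdf \<mu>)"
proof -
  have "weak_conv_m (\<lambda>n. empirical r hat (Suc n) x) \<mu>"
  proof (rule levy_continuity[OF real_distribution_empirical \<mu>])
    fix t
    show "(\<lambda>n. char (empirical r hat (Suc n) x) t) \<longlonglongrightarrow> char \<mu> t"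
      unfolding char char_empirical[OF zero_less_Suc] by (rule LIMSEQ_Suc[OF lim])
  qed
  then have "weak_conv (\<lambda>n. esd (Matrix.mat (Suc n) (Suc n) (\<lambda>(i, j). scaled r hat (Suc n) x i j))) (cdf \<mu>)"
    unfolding weak_conv_m_def cdf_empirical[OF r zero_less_Suc] .
  then have "(\<lambda>n. esd (Matrix.mat (Suc n) (Suc n) (\<lambda>(i, j). scaled r hat (Suc n) x i j)) s) \<longlonglongrightarrow> cdf \<mu> s"
    if "isCont (cdf \<mu>) s" for s using that by (simp add: weak_conv_def)
  then show ?thesis unfolding weak_conv_def
    using LIMSEQ_imp_Suc[of "\<lambda>n. esd (Matrix.mat n n (\<lambda>(i, j). scaled r hat n x i j)) s" for s] by blast
qed

section \<open>A fair coin input that produces the limit law\<close>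

definition coin :: "real measure" where
  "coin = distr (measure_pmf (pmf_of_set {- 1, 1})) borel (\<lambda>u. u)"

definition coins :: "(nat \<Rightarrow> real) measure" where
  "coins = PiM UNIV (\<lambda>_. coin)"

lemma prob_space_coin: "prob_space coin"
  unfolding coin_def by (rule prob_space.prob_space_distr[OF prob_space_measure_pmf]) simp

lemma sets_coin [simp, measurable_cong]: "sets coin = sets borel"
  by (simp add: coin_def)

lemma integral_coin:
  fixes h :: "real \<Rightarrow> real"
  assumes "h \<in> borel_measurable borel"
  shows "(\<integral>u. h u \<partial>coin) = (h (- 1) + h 1) / 2"
proof -
  have "(\<integral>u. h u \<partial>coin) = (\<integral>u. h u \<partial>measure_pmf (pmf_of_set {- 1, 1}))"
    unfolding coin_def by (rule integral_distr) (use assms in auto)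
  also have "\<dots> = sum h {- 1, 1} / real (card {- 1, 1 :: real})" by (rule integral_pmf_of_set) auto
  finally show ?thesis by simp
qed

lemma AE_coin: "AE u in coin. \<bar>u\<bar> \<le> 1"
  unfolding coin_def by (subst AE_distr_iff) (auto simp: AE_measure_pmf_iff)

lemma prob_space_coins: "prob_space coins"
  unfolding coins_def by (rule prob_space_PiM) (rule prob_space_coin)

lemma AE_coins: "AE \<omega> in coins. \<bar>\<omega> i\<bar> \<le> 1"
  unfolding coins_def by (rule AE_PiM_component[OF prob_space_coin UNIV_I AE_coin])

lemma input_A1_coins: "prob_space.input_A1 coins (\<lambda>i \<omega>. \<omega> i)"
proof -
  interpret prob_space coins by (rule prob_space_coins)
  have m[measurable]: "(\<lambda>\<omega>. \<omega> i) \<in> measurable coins coin" for i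
    unfolding coins_def by (rule measurable_component_singleton) simp
  have m'[measurable]: "(\<lambda>\<omega>. \<omega> i) \<in> borel_measurable coins" for i
    using m[of i] by (simp cong: measurable_cong_sets)
  have d: "distr coins coin (\<lambda>\<omega>. \<omega> i) = coin" for i
    unfolding coins_def by (rule distr_PiM_component) (auto intro: prob_space_coin)
  have E: "expectation (\<lambda>\<omega>. h (\<omega> i)) = (h (- 1) + h 1) / 2" if h: "h \<in> borel_measurable borel" for h :: "real \<Rightarrow> real" and i
  proof -
    have "expectation (\<lambda>\<omega>. h (\<omega> i)) = (\<integral>u. h u \<partial>distr coins coin (\<lambda>\<omega>. \<omega> i))"
      by (rule integral_distr[symmetric]) (use h in \<open>auto cong: measurable_cong_sets\<close>)
    then show ?thesis by (simp add: d integral_coin[OF h])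
  qed
  have "indep_vars (\<lambda>_. coin) (\<lambda>i \<omega>. \<omega> i) UNIV"
  proof (subst indep_vars_iff_distr_eq_PiM)
    have "distr coins (PiM UNIV (\<lambda>_. coin)) (\<lambda>\<omega>. \<lambda>i\<in>UNIV. \<omega> i) = coins"
      unfolding coins_def by (simp add: restrict_def distr_id)
    then show "distr coins (PiM UNIV (\<lambda>_. coin)) (\<lambda>\<omega>. \<lambda>i\<in>UNIV. \<omega> i) = PiM UNIV (\<lambda>i. distr coins coin (\<lambda>\<omega>. \<omega> i))"
      unfolding d by (simp add: coins_def)
  qed auto
  then have ind: "indep_vars (\<lambda>_. borel) (\<lambda>i \<omega>. \<omega> i) UNIV"
    by (rule indep_vars_compose2[where Y = "\<lambda>_ u. u"]) (simp cong: measurable_cong_sets)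
  have e1: "expectation (\<lambda>\<omega>. \<omega> i) = 0" for i using E[of "\<lambda>u. u" i] by simp
  have e2: "expectation (\<lambda>\<omega>. (\<omega> i)\<^sup>2) = 1" for i using E[of "\<lambda>u. u\<^sup>2" i] by simp
  have i2: "integrable coins (\<lambda>\<omega>. (\<omega> i) ^ k)" for i k
    by (rule integrable_power_bounded[OF m' AE_coins])
  have "standardized (\<lambda>i \<omega>. \<omega> i)"
    unfolding standardized_def using i2[of _ 1] i2[of _ 2] by (simp add: e1 e2)
  then show ?thesis unfolding input_A1_def using ind AE_coins by blast
qed

lemma tight_empirical:
  assumes r: "r \<in> {1, 2}" and x: "\<And>v. \<bar>x v\<bar> \<le> 1"
  shows "tight (\<lambda>n. empirical r hat (Suc n) x)"
  unfolding tight_def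
proof (intro conjI allI impI real_distribution_empirical)
  fix \<epsilon> :: real assume \<epsilon>: "0 < \<epsilon>"
  \<comment> \<open>Chebyshev's inequality: the mean squared eigenvalue is at most 4, as 2 (n + 2)
    is at most 4 (n + 1). So \<open>R^2 > 4 / \<epsilon>\<close> is wanted, and this follows from
    \<open>R >= 1\<close> and \<open>R > 4 / \<epsilon>\<close>.\<close>
  define R where "R = 1 + 4 / \<epsilon>"
  have R: "1 \<le> R" "4 / \<epsilon> < R" using \<epsilon> by (auto simp: R_def)
  have "4 / \<epsilon> < R\<^sup>2" using R mult_left_mono[OF R(1), of R] unfolding power2_eq_square by linarith
  then have R2: "4 < \<epsilon> * R\<^sup>2" using \<epsilon> by (simp add: divide_less_eq mult.commute)
  have "1 - \<epsilon> < measure (empirical r hat (Suc n) x) {- R<..R}" for n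
  proof -
    interpret e: real_distribution "empirical r hat (Suc n) x" by (rule real_distribution_empirical)
    let ?l = "spec r hat (Suc n) x"
    let ?B = "{i. i < Suc n \<and> ?l i \<in> - {- R<..R}}"
    have "real (card ?B) * R\<^sup>2 = (\<Sum>i\<in>?B. R\<^sup>2)" by simp
    also have "\<dots> \<le> (\<Sum>i\<in>?B. (?l i)\<^sup>2)"
    proof (rule sum_mono)
      fix i assume "i \<in> ?B"
      then have "R \<le> \<bar>?l i\<bar>" by auto
      then show "R\<^sup>2 \<le> (?l i)\<^sup>2" using R power_mono[of R "\<bar>?l i\<bar>" 2] by simp
    qed
    also have "\<dots> \<le> (\<Sum>i<Suc n. (?l i)\<^sup>2)" by (rule sum_mono2) auto
    also have "\<dots> \<le> 2 * (\<Sum>v\<le>Suc n. (x v)\<^sup>2)" by (rule spec_second_moment[OF r]) simp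
    also have "(\<Sum>v\<le>Suc n. (x v)\<^sup>2) \<le> (\<Sum>v\<le>Suc n. 1)"
      using x by (intro sum_mono) (simp add: abs_square_le_1)
    also have "2 * (\<Sum>v\<le>Suc n. 1 :: real) \<le> 4 * real (Suc n)" by simp
    finally have "real (card ?B) * R\<^sup>2 \<le> 4 * real (Suc n)" by simp
    also have "\<dots> < \<epsilon> * R\<^sup>2 * real (Suc n)" using R2 by (intro mult_strict_right_mono) auto
    finally have "real (card ?B) * R\<^sup>2 < (\<epsilon> * real (Suc n)) * R\<^sup>2" by (simp only: mult_ac)
    then have "real (card ?B) < \<epsilon> * real (Suc n)" using R by (simp add: mult_less_cancel_right)
    then have "measure (empirical r hat (Suc n) x) (- {- R<..R}) < \<epsilon>"
      by (subst measure_empirical) (auto simp: divide_less_eq)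
    moreover have "measure (empirical r hat (Suc n) x) (- {- R<..R}) = 1 - measure (empirical r hat (Suc n) x) {- R<..R}"
      using e.prob_compl[of "{- R<..R}"] by (simp add: Compl_eq_Diff_UNIV e.space_eq_univ)
    ultimately show ?thesis by linarith
  qed
  then show "\<exists>a b. a < b \<and> (\<forall>n. 1 - \<epsilon> < measure (empirical r hat (Suc n) x) {a<..b})"
    using R by (intro exI[of _ "- R"] exI[of _ R]) auto
qed

text \<open>A power series need not be a characteristic function. Along one good realization of fair
  coins the spectral laws are tight, and any law that is a limit along a subsequence has the
  required characteristic function.\<close>

theorem limit_law_exists:
  assumes r: "r \<in> {1, 2}"
  shows "\<exists>\<mu>. real_distribution \<mu> \<and> (\<forall>t. char \<mu> t = complex_of_real (limit_char r hat t))"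
proof -
  interpret prob_space coins by (rule prob_space_coins)
  have "AE \<omega> in coins. \<forall>t. (\<lambda>n. ecf r hat n (\<lambda>v. \<omega> v) t) \<longlonglongrightarrow> complex_of_real (limit_char r hat t)"
    by (rule admissible_ecf_tendsto[OF _ r]) (simp add: admissible_input_def input_A1_coins)
  moreover have "AE \<omega> in coins. \<forall>v. \<bar>\<omega> v\<bar> \<le> 1" using AE_coins by (simp add: AE_all_countable)
  ultimately have "AE \<omega> in coins. (\<forall>t. (\<lambda>n. ecf r hat n (\<lambda>v. \<omega> v) t) \<longlonglongrightarrow> complex_of_real (limit_char r hat t)) \<and> (\<forall>v. \<bar>\<omega> v\<bar> \<le> 1)"
    by (rule AE_conjI)
  \<comment> \<open>A property that holds almost surely in a probability space holds at some point;
    from here on the argument is deterministic.\<close>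
  from eventually_happens'[OF ae_filter_bot this]
  obtain x where x: "\<And>t. (\<lambda>n. ecf r hat n x t) \<longlonglongrightarrow> complex_of_real (limit_char r hat t)" "\<And>v. \<bar>x v\<bar> \<le> 1"
    by blast
  let ?\<mu> = "\<lambda>n. empirical r hat (Suc n) x"
  obtain s M where s: "strict_mono (s :: nat \<Rightarrow> nat)" and M: "real_distribution M" and w: "weak_conv_m (?\<mu> \<circ> id \<circ> s) M"
    using tight_imp_convergent_subsubsequence[OF tight_empirical[of r x hat, OF r x(2)], of id] by (auto simp: strict_mono_id)
  have "char M t = complex_of_real (limit_char r hat t)" for t
  proof (rule LIMSEQ_unique)
    have "(\<lambda>n. char ((?\<mu> \<circ> id \<circ> s) n) t) \<longlonglongrightarrow> char M t"
      by (rule levy_continuity1[OF _ M w]) (simp add: real_distribution_empirical)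
    then show "(\<lambda>n. ecf r hat (Suc (s n)) x t) \<longlonglongrightarrow> char M t"
      by (simp add: char_empirical)
    show "(\<lambda>n. ecf r hat (Suc (s n)) x t) \<longlonglongrightarrow> complex_of_real (limit_char r hat t)"
      using LIMSEQ_subseq_LIMSEQ[OF LIMSEQ_Suc[OF x(1)] s] by (simp add: comp_def)
  qed
  then show ?thesis using M by blast
qed

text \<open>A law is determined by its characteristic function, so the choice is forced once a law
  exists. No input and no sample space enters, which is where universality comes from.\<close>

definition limit_cdf :: "nat \<Rightarrow> bool \<Rightarrow> real \<Rightarrow> real" where
  "limit_cdf r hat = cdf (SOME \<mu>. real_distribution \<mu> \<and> (\<forall>t. char \<mu> t = complex_of_real (limit_char r hat t)))"

lemma limit_cdf:
  assumes "r \<in> {1, 2}"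
  shows "\<exists>\<mu>. real_distribution \<mu> \<and> (\<forall>t. char \<mu> t = complex_of_real (limit_char r hat t)) \<and> limit_cdf r hat = cdf \<mu>"
  using someI_ex[OF limit_law_exists[OF assms, of hat]] unfolding limit_cdf_def by blast

theorem universal_lsd_scaled:
  assumes r: "r \<in> {1, 2}"
    and A: "\<And>n x. real n powr (- 1 / 2) \<cdot>\<^sub>m A n x = Matrix.mat n n (\<lambda>(i, j). scaled r hat n x i j)"
  shows "universal_lsd TYPE('a) A (limit_cdf r hat)"
  unfolding universal_lsd_def is_lsd_def A
proof (intro allI impI conjI)
  fix M :: "'a measure" and x
  assume M: "prob_space M" and x: "prob_space.admissible_input M x"
  obtain \<mu> where \<mu>: "real_distribution \<mu>" "\<And>t. char \<mu> t = complex_of_real (limit_char r hat t)" "limit_cdf r hat = cdf \<mu>"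
    using limit_cdf[OF r] by blast
  show "distribution_function (limit_cdf r hat)" unfolding distribution_function_def using \<mu> by blast
  show "AE \<omega> in M. weak_conv (\<lambda>n. esd (Matrix.mat n n (\<lambda>(i, j). scaled r hat n (\<lambda>i. x i \<omega>) i j))) (limit_cdf r hat)"
    using prob_space.admissible_ecf_tendsto[OF M x r, of hat]
  proof eventually_elim
    fix \<omega> assume "\<forall>t. (\<lambda>n. ecf r hat n (\<lambda>v. x v \<omega>) t) \<longlonglongrightarrow> complex_of_real (limit_char r hat t)"
    then show "weak_conv (\<lambda>n. esd (Matrix.mat n n (\<lambda>(i, j). scaled r hat n (\<lambda>i. x i \<omega>) i j))) (limit_cdf r hat)"
      unfolding \<mu>(3) by (intro weak_conv_esd[OF r \<mu>(1,2)]) blast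
  qed
qed

text \<open>The variable stands for \<open>t^2\<close>, so vanishing is known on the positive
  half-line only. Continuity at 0 from the right kills the constant coefficient, and division by
  \<open>y\<close> shifts the series.\<close>

lemma powser_eq_zero_imp_coeff_zero:
  fixes d :: "nat \<Rightarrow> real"
  assumes "\<And>y. summable (\<lambda>m. d m * y ^ m)" and "\<And>y. 0 < y \<Longrightarrow> (\<Sum>m. d m * y ^ m) = 0"
  shows "d k = 0"
  using assms
proof (induction k arbitrary: d)
  case (0 d)
  have "isCont (\<lambda>y. \<Sum>m. d m * y ^ m) 0" by (rule isCont_powser_converges_everywhere) (rule 0)
  then have "((\<lambda>y. \<Sum>m. d m * y ^ m) \<longlongrightarrow> (\<Sum>m. d m * 0 ^ m)) (at_right 0)"
    by (simp add: isCont_def filterlim_at_split)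
  moreover have "((\<lambda>y. \<Sum>m. d m * y ^ m) \<longlongrightarrow> 0) (at_right 0)"
    by (rule tendsto_eventually) (use 0 in \<open>auto simp: eventually_at_filter\<close>)
  ultimately have "(\<Sum>m. d m * 0 ^ m) = 0" by (rule tendsto_unique[rotated]) simp
  then show ?case by (simp add: powser_zero)
next
  case (Suc k d)
  have d0: "d 0 = 0"
  proof -
    have "isCont (\<lambda>y. \<Sum>m. d m * y ^ m) 0" by (rule isCont_powser_converges_everywhere) (rule Suc)
    then have "((\<lambda>y. \<Sum>m. d m * y ^ m) \<longlongrightarrow> (\<Sum>m. d m * 0 ^ m)) (at_right 0)"
      by (simp add: isCont_def filterlim_at_split)
    moreover have "((\<lambda>y. \<Sum>m. d m * y ^ m) \<longlongrightarrow> 0) (at_right 0)"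
      by (rule tendsto_eventually) (use Suc in \<open>auto simp: eventually_at_filter\<close>)
    ultimately have "(\<Sum>m. d m * 0 ^ m) = 0" by (rule tendsto_unique[rotated]) simp
    then show ?thesis by (simp add: powser_zero)
  qed
  show ?case
  proof (rule Suc.IH)
    show s: "summable (\<lambda>m. d (Suc m) * y ^ m)" for y using Suc.prems(1)[of y] by (simp add: summable_powser_split_head)
    fix y :: real assume y: "0 < y"
    have "(\<Sum>m. d m * y ^ m) = d 0 + (\<Sum>m. d (Suc m) * y ^ m) * y" by (rule powser_split_head(1)[OF Suc.prems(1)])
    then show "(\<Sum>m. d (Suc m) * y ^ m) = 0" using Suc.prems(2)[OF y] d0 y by simp
  qed
qed

text \<open>The limit laws determine their characteristic functions and these the coefficients of
  the series, so the limit moments can be compared without proving convergence of moments to those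
  of the limit law.\<close>

lemma limit_cdf_eq_imp_moment_eq:
  assumes r: "r \<in> {1, 2}" and eq: "limit_cdf r hat = limit_cdf r hat'"
  shows "limit_moment r hat (2 * m) = limit_moment r hat' (2 * m)"
proof -
  have r0: "r > 0" using r by auto
  obtain \<mu> where \<mu>: "real_distribution \<mu>" "\<And>t. char \<mu> t = complex_of_real (limit_char r hat t)" "limit_cdf r hat = cdf \<mu>"
    using limit_cdf[OF r] by blast
  obtain \<nu> where \<nu>: "real_distribution \<nu>" "\<And>t. char \<nu> t = complex_of_real (limit_char r hat' t)" "limit_cdf r hat' = cdf \<nu>"
    using limit_cdf[OF r] by blast
  have "\<mu> = \<nu>" by (rule cdf_unique[OF \<mu>(1) \<nu>(1)]) (use eq \<mu>(3) \<nu>(3) in simp)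
  then have lc: "limit_char r hat t = limit_char r hat' t" for t using \<mu>(2)[of t] \<nu>(2)[of t] by simp
  have "moment_coeff r hat m - moment_coeff r hat' m = 0"
  proof (rule powser_eq_zero_imp_coeff_zero)
    show "summable (\<lambda>m. (moment_coeff r hat m - moment_coeff r hat' m) * y ^ m)" for y
      unfolding left_diff_distrib by (intro summable_diff summable_moment_coeff r0)
    fix y :: real assume "0 < y"
    then have y: "(sqrt y)\<^sup>2 = y" by simp
    have "(\<Sum>m. (moment_coeff r hat m - moment_coeff r hat' m) * y ^ m) = limit_char r hat (sqrt y) - limit_char r hat' (sqrt y)"
      unfolding limit_char_def y left_diff_distrib by (rule suminf_diff[symmetric]) (rule summable_moment_coeff[OF r0])+
    then show "(\<Sum>m. (moment_coeff r hat m - moment_coeff r hat' m) * y ^ m) = 0" by (simp add: lc)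
  qed
  then show ?thesis by (simp add: moment_coeff_def)
qed

section \<open>Masked against unmasked fourth moments\<close>

lemma abs_cell_le_unmasked: "\<bar>cell hat n a b\<bar> \<le> cell False n a b"
  by (auto simp: cell_def sgn_if)

lemma walk_weight_le_unmasked: "walk_weight r hat n k p s \<le> walk_weight r False n k p s"
proof -
  have "walk_weight r hat n k p s \<le> \<bar>walk_weight r hat n k p s\<bar>" by simp
  also have "\<dots> \<le> walk_weight r False n k p s"
    unfolding walk_weight_def abs_prod by (intro prod_mono conjI abs_cell_le_unmasked) simp
  finally show ?thesis .
qed

text \<open>The comparison holds matching by matching, so a strict gap in one of them cannot be
  compensated by the others.\<close>

lemma match_term_le_unmasked: "match_term r hat n k \<sigma> \<le> match_term r False n k \<sigma>"
  unfolding match_term_def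
  by (intro mult_left_mono sum_mono walk_weight_le_unmasked) simp

text \<open>The pair partition {0,2}, {1,3}. In the non-crossing matchings of four steps, and in the
  only matching of two, every edge is traversed back and forth and the mask enters squared; the
  crossing one is the first place where signs survive.\<close>

definition crossing :: "nat \<Rightarrow> nat" where
  "crossing = (\<lambda>i\<in>{..<4}. if i < 2 then i + 2 else i - 2)"

lemma crossing_matching: "crossing \<in> matchings 4"
  by (auto simp: matchings_def crossing_def)

lemma openers_crossing: "openers 4 crossing = {0, 1}"
  by (auto simp: openers_def crossing_def)

text \<open>A box of closed walks of length four along which the mask has sign \<open>-1\<close>: the walk starts near
  \<open>0.4 n\<close>, hardly moves in its first step and then makes a step of length about \<open>0.4 n\<close>. Only its
  first edge lies above the antidiagonal.\<close>

lemma walk_weight_crossing_box: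
  assumes r: "r > 0" and m: "m > 0" and p: "7 * int m \<le> p" "p < 8 * int m"
    and v0: "0 \<le> v 0" "v 0 < int m" and v1: "8 * int m \<le> v 1" "v 1 < 9 * int m"
  shows "walk_weight r False (20 * m) 4 p (signed_ext 4 crossing v) = 1"
    and "walk_weight r True (20 * m) 4 p (signed_ext 4 crossing v) = - 1"
proof -
  let ?N = "r * (20 * m)" and ?s = "signed_ext 4 crossing v"
  have "20 * m \<le> ?N" using r by (cases r) auto
  then have "int (20 * m) \<le> int ?N" by (simp only: of_nat_le_iff)
  then have N: "20 * int m \<le> int ?N" by (simp only: of_nat_mult of_nat_numeral)
  have s: "?s 0 = v 0" "?s 1 = v 1" "?s 2 = - v 0" "?s 3 = - v 1"
    by (simp_all add: signed_ext_def openers_crossing, simp_all add: crossing_def)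
  have md: "y mod int ?N = y" if "0 \<le> y" "y < 20 * int m" for y
    by (rule mod_pos_pos_trivial[OF that(1) less_le_trans[OF that(2) N]])
  have sums: "(\<Sum>i<0. ?s i) = 0" "(\<Sum>i<1. ?s i) = v 0" "(\<Sum>i<2. ?s i) = v 0 + v 1" "(\<Sum>i<3. ?s i) = v 1" "(\<Sum>i<4. ?s i) = 0"
    using s by (simp_all add: eval_nat_numeral)
  have w: "walk ?N p ?s 0 = p" "walk ?N p ?s 1 = p + v 0" "walk ?N p ?s 2 = p + v 0 + v 1"
    "walk ?N p ?s 3 = p + v 1" "walk ?N p ?s 4 = p"
    unfolding walk_def sums using p v0 v1 by (simp_all only: add_0_right add.assoc[symmetric], (subst md; linarith)+)
  have "walk_weight r hat (20 * m) 4 p ?s = cell hat (20 * m) p (p + v 0) * cell hat (20 * m) (p + v 0) (p + v 0 + v 1)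
      * cell hat (20 * m) (p + v 0 + v 1) (p + v 1) * cell hat (20 * m) (p + v 1) p" for hat
  proof -
    have "{..<4::nat} = {0, 1, 2, 3}" by auto
    then have "walk_weight r hat (20 * m) 4 p ?s = cell hat (20 * m) (walk ?N p ?s 0) (walk ?N p ?s (Suc 0)) *
      (cell hat (20 * m) (walk ?N p ?s 1) (walk ?N p ?s (Suc 1)) * (cell hat (20 * m) (walk ?N p ?s 2) (walk ?N p ?s (Suc 2)) *
       cell hat (20 * m) (walk ?N p ?s 3) (walk ?N p ?s (Suc 3))))"
      unfolding walk_weight_def by simp
    moreover have "Suc 0 = 1" "Suc 1 = 2" "Suc 2 = 3" "Suc 3 = (4::nat)" by simp_all
    ultimately show ?thesis by (simp only: w mult.assoc)
  qed
  then show "walk_weight r False (20 * m) 4 p ?s = 1" "walk_weight r True (20 * m) 4 p ?s = - 1"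
    using p v0 v1 m by (simp_all add: cell_def sgn_if)
qed

text \<open>The box of walks with sign -1 has a fixed proportion of size, so its gap survives the
  limit. The bound does not depend on \<open>r\<close>, because the normalisation is by powers of
  \<open>n\<close> and not of the circumference.\<close>

lemma match_term_crossing_gap:
  assumes r: "r > 0" and m: "m > 0"
  shows "match_term r False (20 * m) 4 crossing - match_term r True (20 * m) 4 crossing \<ge> 1 / 4000"
proof -
  let ?n = "20 * m" and ?N = "r * (20 * m)"
  let ?f = "\<lambda>p s. walk_weight r False ?n 4 (int p) s - walk_weight r True ?n 4 (int p) s"
  let ?P = "PiE (openers 4 crossing) (\<lambda>_. {0..<int ?N})"
  let ?Q = "PiE {0, 1} (\<lambda>i::nat. if i = 0 then {0..<int m} else {8 * int m..<9 * int m})"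
  have n: "?n > 0" using m by simp
  have f0: "0 \<le> ?f p s" for p s using walk_weight_le_unmasked[of r True ?n 4 "int p" s] by simp
  have fP: "finite ?P" by (intro finite_PiE) auto
  have N: "9 * int m \<le> int ?N"
  proof -
    have "9 * m \<le> ?N" using r by (cases r) auto
    then show ?thesis by linarith
  qed
  have QP: "?Q \<subseteq> ?P" unfolding openers_crossing by (rule PiE_mono) (use N in auto)
  have cQ: "card ?Q = m * m" by (simp add: card_PiE)
  have inner: "(\<Sum>s\<in>opposite_steps ?N 4 crossing. ?f p s) \<ge> (if 7 * m \<le> p \<and> p < 8 * m then 2 * real (m * m) else 0)" for p
  proof -
    have "(\<Sum>s\<in>opposite_steps ?N 4 crossing. ?f p s) = (\<Sum>v\<in>?P. ?f p (signed_ext 4 crossing v))"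
    proof (rule sum_opposite_steps[OF crossing_matching])
      show "0 < ?N" using r m by simp
      fix s s' :: "nat \<Rightarrow> int" assume a: "\<And>i. i < 4 \<Longrightarrow> s i mod int ?N = s' i mod int ?N"
      show "?f p s = ?f p s'"
        by (intro arg_cong2[where f = "(-)"] walk_weight_cong_mod a)
    qed
    moreover have "(\<Sum>v\<in>?P. ?f p (signed_ext 4 crossing v)) \<ge> 0" by (intro sum_nonneg f0)
    moreover have "(\<Sum>v\<in>?P. ?f p (signed_ext 4 crossing v)) \<ge> 2 * real (m * m)" if p: "7 * m \<le> p" "p < 8 * m"
    proof -
      have "2 * real (m * m) = (\<Sum>v\<in>?Q. 2)" using cQ by simp
      also have "\<dots> = (\<Sum>v\<in>?Q. ?f p (signed_ext 4 crossing v))"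
      proof (intro sum.cong refl)
        fix v assume v: "v \<in> ?Q"
        have "v 0 \<in> {0..<int m}" "v 1 \<in> {8 * int m..<9 * int m}" using PiE_mem[OF v, of 0] PiE_mem[OF v, of 1] by auto
        then show "2 = ?f p (signed_ext 4 crossing v)"
          using walk_weight_crossing_box[OF r m, of "int p" v] p by simp
      qed
      also have "\<dots> \<le> (\<Sum>v\<in>?P. ?f p (signed_ext 4 crossing v))" by (rule sum_mono2[OF fP QP f0])
      finally show ?thesis .
    qed
    ultimately show ?thesis by simp
  qed
  \<comment> \<open>\<open>m\<close> starts, \<open>m * m\<close> pairs of steps and a gap of 2 for
    each; division by (20 m)^3 leaves 2 / 8000.\<close>
  have "2 * real m ^ 3 = (\<Sum>p\<in>{7 * m..<8 * m}. 2 * real (m * m))" by (simp add: power3_eq_cube)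
  also have "\<dots> = (\<Sum>p\<in>{7 * m..<8 * m}. if 7 * m \<le> p \<and> p < 8 * m then 2 * real (m * m) else 0)" by (intro sum.cong) auto
  also have "\<dots> \<le> (\<Sum>p<?n. if 7 * m \<le> p \<and> p < 8 * m then 2 * real (m * m) else 0)" by (rule sum_mono2) auto
  also have "\<dots> \<le> (\<Sum>p<?n. \<Sum>s\<in>opposite_steps ?N 4 crossing. ?f p s)" by (intro sum_mono inner)
  finally have S: "2 * real m ^ 3 \<le> (\<Sum>p<?n. \<Sum>s\<in>opposite_steps ?N 4 crossing. ?f p s)" .
  have c: "(real ?n powr (- 1 / 2)) ^ 4 = 1 / (real ?n)\<^sup>2"
  proof -
    have "(real ?n powr (- 1 / 2)) ^ 4 = ((real ?n powr (- 1 / 2))\<^sup>2)\<^sup>2" by (simp only: power_mult[symmetric]) simp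
    then show ?thesis unfolding powr_half_sq[OF n] by (simp only: power_divide power_one)
  qed
  have "match_term r False ?n 4 crossing - match_term r True ?n 4 crossing =
      (1 / (real ?n)\<^sup>2 / real ?n) * (\<Sum>p<?n. \<Sum>s\<in>opposite_steps ?N 4 crossing. ?f p s)"
    unfolding match_term_def c by (simp only: sum_subtractf right_diff_distrib)
  also have "\<dots> \<ge> (1 / (real ?n)\<^sup>2 / real ?n) * (2 * real m ^ 3)"
    by (intro mult_left_mono S) simp
  also have "(1 / (real ?n)\<^sup>2 / real ?n) * (2 * real m ^ 3) = 1 / 4000"
    using m by (simp add: power2_eq_square power3_eq_cube field_simps)
  finally show ?thesis .
qed

text \<open>The box has integer end points for multiples of 20 only; as the full sequence of moments
  converges, this subsequence decides.\<close>

theorem limit_cdf_neq: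
  assumes r: "r \<in> {1, 2}"
  shows "limit_cdf r True \<noteq> limit_cdf r False"
proof
  assume "limit_cdf r True = limit_cdf r False"
  from limit_cdf_eq_imp_moment_eq[OF r this, of 2] have eq: "limit_moment r True 4 = limit_moment r False 4" by simp
  have r0: "r > 0" using r by auto
  let ?S = "\<lambda>hat n. \<Sum>\<sigma>\<in>matchings 4. match_term r hat n 4 \<sigma>"
  have "(\<lambda>n. ?S False n - ?S True n) \<longlonglongrightarrow> limit_moment r False 4 - limit_moment r True 4"
    by (intro tendsto_diff sum_match_term_tendsto r0)
  then have "((\<lambda>n. ?S False n - ?S True n) \<circ> (\<lambda>m. 20 * m)) \<longlonglongrightarrow> limit_moment r False 4 - limit_moment r True 4"
    by (rule LIMSEQ_subseq_LIMSEQ) (simp add: strict_mono_def)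
  moreover have "1 / 4000 \<le> ?S False (20 * m) - ?S True (20 * m)" if m: "m > 0" for m
  proof -
    have "1 / 4000 \<le> match_term r False (20 * m) 4 crossing - match_term r True (20 * m) 4 crossing"
      by (rule match_term_crossing_gap[OF r0 m])
    also have "\<dots> \<le> (\<Sum>\<sigma>\<in>matchings 4. match_term r False (20 * m) 4 \<sigma> - match_term r True (20 * m) 4 \<sigma>)"
      by (rule member_le_sum[OF crossing_matching]) (auto simp: match_term_le_unmasked)
    finally show ?thesis by (simp add: sum_subtractf)
  qed
  ultimately have "1 / 4000 \<le> limit_moment r False 4 - limit_moment r True 4"
    by (intro LIMSEQ_le_const[where a = "1 / 4000"]) (auto intro!: exI[of _ 1])
  then show False using eq by simp
qed

section \<open>The four matrix models as instances of \<open>scaled\<close>\<close>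

lemma toeplitz_link:
  assumes "i < n" "j < n"
  shows "nat \<bar>int (i + 1) - int (j + 1)\<bar> = cdist (2 * n) (int i - int j)"
proof (cases "j \<le> i")
  case True
  \<comment> \<open>The difference stays below \<open>n\<close>, half of the circumference, so the
    cyclic distance is the ordinary one.\<close>
  then have "(int i - int j) mod int (2 * n) = int i - int j" using assms by (intro mod_pos_pos_trivial) auto
  then show ?thesis using True assms by (simp add: cdist_def)
next
  case False
  have n: "2 * n > 0" using assms by simp
  have "(int j - int i) mod int (2 * n) = int j - int i" using False assms by (intro mod_pos_pos_trivial) auto
  then have "cdist (2 * n) (int j - int i) = nat (int j - int i)" using False assms by (simp add: cdist_def)
  then show ?thesis using False cdist_commute[OF n, of "int i" "int j"] by simp
qed

text \<open>The halves cancel, so the floor in \<open>sc_link\<close> is taken of an integer, namely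
  the shorter of the two arcs between the indices.\<close>

lemma circulant_link:
  assumes "i < n" "j < n"
  shows "sc_link n (i + 1) (j + 1) = cdist n (int i - int j)"
proof -
  have n: "n > 0" using assms by simp
  have aux: "sc_link n (a + 1) (b + 1) = cdist n (int a - int b)" if ab: "b \<le> a" "a < n" for a b
  proof -
    let ?d = "int a - int b"
    have "?d mod int n = ?d" using ab by (intro mod_pos_pos_trivial) auto
    then have c: "cdist n ?d = nat (min ?d (int n - ?d))" by (simp add: cdist_def)
    have "real n / 2 - \<bar>real n / 2 - \<bar>real (a + 1) - real (b + 1)\<bar>\<bar> = real_of_int (min ?d (int n - ?d))"
      using ab by (simp add: min_def abs_if field_simps)
    then show ?thesis unfolding sc_link_def c by (simp only: floor_of_int)
  qed
  show ?thesis
  proof (cases "j \<le> i")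
    case False
    have "sc_link n (i + 1) (j + 1) = sc_link n (j + 1) (i + 1)" by (simp add: sc_link_def abs_minus_commute)
    then show ?thesis using aux[of i j] False assms cdist_commute[OF n, of "int i" "int j"] by simp
  qed (use aux assms in simp)
qed

lemma mask_entry:
  assumes "i < n" "j < n"
  shows "(if (i + 1) + (j + 1) < n + 1 then 1 else if (i + 1) + (j + 1) = n + 1 then 0 else - 1) = mask True n i j"
  using assms by (auto simp: mask_def sgn_if)

lemma scaled_toeplitz:
  "real n powr (- 1 / 2) \<cdot>\<^sub>m toeplitz n x = Matrix.mat n n (\<lambda>(i, j). scaled 2 False n x i j)"
  by (rule eq_matI) (auto simp: toeplitz_def matrix1_def scaled_def mask_def toeplitz_link[simplified])

lemma scaled_toeplitz_hat:
  "real n powr (- 1 / 2) \<cdot>\<^sub>m toeplitz_hat n x = Matrix.mat n n (\<lambda>(i, j). scaled 2 True n x i j)"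
  by (rule eq_matI)
    (auto simp: toeplitz_hat_def hadamard_def M_matrix_def toeplitz_def matrix1_def scaled_def
      mask_entry[symmetric] toeplitz_link[simplified])

lemma scaled_symmetric_circulant:
  "real n powr (- 1 / 2) \<cdot>\<^sub>m symmetric_circulant n x = Matrix.mat n n (\<lambda>(i, j). scaled 1 False n x i j)"
  by (rule eq_matI) (auto simp: symmetric_circulant_def matrix1_def scaled_def mask_def circulant_link[simplified])

lemma scaled_symmetric_circulant_hat:
  "real n powr (- 1 / 2) \<cdot>\<^sub>m symmetric_circulant_hat n x = Matrix.mat n n (\<lambda>(i, j). scaled 1 True n x i j)"
  by (rule eq_matI)
    (auto simp: symmetric_circulant_hat_def hadamard_def M_matrix_def symmetric_circulant_def matrix1_def scaled_def
      mask_entry[symmetric] circulant_link[simplified])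

theorem theorem5p2:
  shows "\<exists>F_That F_SChat F_T F_SC.
    universal_lsd TYPE('a) toeplitz_hat F_That \<and>
    universal_lsd TYPE('b) toeplitz_hat F_That \<and>
    universal_lsd TYPE('a) symmetric_circulant_hat F_SChat \<and>
    universal_lsd TYPE('b) symmetric_circulant_hat F_SChat \<and>
    universal_lsd TYPE('a) toeplitz F_T \<and>
    universal_lsd TYPE('b) toeplitz F_T \<and>
    universal_lsd TYPE('a) symmetric_circulant F_SC \<and>
    universal_lsd TYPE('b) symmetric_circulant F_SC \<and>
    F_That \<noteq> F_T \<and> F_SChat \<noteq> F_SC"
  by (intro exI[of _ "limit_cdf 2 True"] exI[of _ "limit_cdf 1 True"]
      exI[of _ "limit_cdf 2 False"] exI[of _ "limit_cdf 1 False"] conjI limit_cdf_neq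
      universal_lsd_scaled[OF _ scaled_toeplitz_hat] universal_lsd_scaled[OF _ scaled_toeplitz]
      universal_lsd_scaled[OF _ scaled_symmetric_circulant_hat] universal_lsd_scaled[OF _ scaled_symmetric_circulant])
    simp_all

end
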